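(* Let $F'/F$ be a separable quadratic extension of nonarchimedean local fields, $(V,h)$ a finite dimensional nondegenerate Hermitian space over $F'$, $d\ge1$, and $C\subset V^d$ a nonempty compact open subset. The representation density $\mathrm{Den}_T(C)$ is locally constant as a function of the nonsingular Hermitian matrix $T\in\mathrm{Herm}_d(F')$. Moreover, for any nonsingular $T$ and all sufficiently small compact open neighborhoods $U$ of $T$ in the set of nonsingular matrices in $\mathrm{Herm}_d(F')$, $$\mathrm{Den}_T(C)=\frac{\mathrm{Vol}(\{x\in C:\tau(x)\in U\})}{\mathrm{Vol}(C)}\cdot\frac{\mathrm{Vol}(\mathrm{Herm}_d(\mathcal{O}_{F'})^\vee)}{\mathrm{Vol}(U)},$$ where the first quotient of volumes is taken in $V^d$ and the second in $\mathrm{Herm}_d(F')$, both with respect to (any) translation-invariant Haar measures on these $F$-vector spaces.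
   Context: Hermitian forms are linear in the first variable and $\sigma$-linear in the second, $\langle\sigma\rangle=\mathrm{Gal}(F'/F)$. $\mathrm{Herm}_d(\cdot)$ denotes $d\times d$ Hermitian matrices, $\tau(x)=(h(x_i,x_j))_{1\le i,j\le d}$ is the moment matrix of $x\in V^d$, and $\mathrm{Herm}_d(\mathcal{O}_{F'})^\vee=\{t\in\mathrm{Herm}_d(F'):\mathrm{Tr}(ts)\in\mathcal{O}_F\ \forall s\in\mathrm{Herm}_d(\mathcal{O}_{F'})\}$. Definition of $\mathrm{Den}_T(C)$. Regard $X=V^d$ and $Y=\mathrm{Herm}_d(F')$ as $F$-schemes (affine spaces over $F$): $X(R)=(V\otimes_FR)^d$, $Y(R)=\mathrm{Herm}_d(R\otimes_FF')$ for $F$-algebras $R$; then $\tau:X\to Y$ is a morphism of $F$-schemes. Let $Y^{\mathrm{ns}}\subset Y$ be the open subscheme of matrices with invertible determinant, $X^{\mathrm{ns}}=\tau^{-1}(Y^{\mathrm{ns}})$; the restriction $\tau:X^{\mathrm{ns}}\to Y^{\mathrm{ns}}$ is smooth. Choose nonzero translation-invariant top-degree differential forms $\mu_X$ on $X$ and $\mu_Y$ on $Y$. Smoothness gives a canonical isomorphism $\Omega^{\mathrm{top}}_{X^{\mathrm{ns}}}\cong\Omega^{\mathrm{top}}_{X^{\mathrm{ns}}/Y^{\mathrm{ns}}}\otimes\tau^*\Omega^{\mathrm{top}}_{Y^{\mathrm{ns}}}$, and hence a nowhere vanishing relative form $\mu_X/\tau^*\mu_Y$ determined by $\mu_X=(\mu_X/\tau^*\mu_Y)\otimes\tau^*\mu_Y$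 on $X^{\mathrm{ns}}$. For nonsingular $T$, let $X_T=\tau^{-1}(T)$, a smooth $F$-scheme with $X_T(F)=\{x\in V^d:\tau(x)=T\}$, and let $\mu_{X_T}$ be the restriction of $\mu_X/\tau^*\mu_Y$ to $X_T$. Top-degree forms on smooth $F$-varieties induce measures on their $F$-points in the usual way, denoted by the same symbols. Then $$\mathrm{Den}_T(C)=\mu_{X_T}(C\cap X_T(F))\cdot\frac{\mu_Y(\mathrm{Herm}_d(\mathcal{O}_{F'})^\vee)}{\mu_X(C)},$$ which does not depend on the choices of $\mu_X,\mu_Y$. *)

theory Defs
  imports "HOL-Analysis.Analysis" "HOL-Computational_Algebra.Polynomial"
begin

text \<open>The library has the separation axioms for \<open>vec\<close> only over metric spaces.\<close>

instance vec :: (t0_space, finite) t0_space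
proof
  fix x y :: "'a ^ 'b"
  assume "x \<noteq> y"
  then obtain i where i: "x $ i \<noteq> y $ i"
    unfolding vec_eq_iff by blast
  obtain U where U: "open U" "\<not> (x $ i \<in> U \<longleftrightarrow> y $ i \<in> U)"
    using Topological_Spaces.t0_space_class.t0_space[OF i] by blast
  show "\<exists>U. open U \<and> \<not> (x \<in> U \<longleftrightarrow> y \<in> U)"
  proof (intro exI conjI)
    show "open ((\<lambda>z. z $ i) -` U)"
      by (rule open_vimage_vec_nth[OF U(1)])
    show "\<not> (x \<in> (\<lambda>z. z $ i) -` U \<longleftrightarrow> y \<in> (\<lambda>z. z $ i) -` U)"
      unfolding vimage_eq by (rule U(2))
  qed
qed

instance vec :: (t1_space, finite) t1_space
proof
  fix x y :: "'a ^ 'b"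
  assume "x \<noteq> y"
  then obtain i where i: "x $ i \<noteq> y $ i"
    unfolding vec_eq_iff by blast
  obtain U where U: "open U" "x $ i \<in> U" "y $ i \<notin> U"
    using Topological_Spaces.t1_space_class.t1_space[OF i] by blast
  show "\<exists>U. open U \<and> x \<in> U \<and> y \<notin> U"
  proof (intro exI conjI)
    show "open ((\<lambda>z. z $ i) -` U)"
      by (rule open_vimage_vec_nth[OF U(1)])
    show "x \<in> (\<lambda>z. z $ i) -` U"
      unfolding vimage_eq by (rule U(2))
    show "y \<notin> (\<lambda>z. z $ i) -` U"
      unfolding vimage_eq by (rule U(3))
  qed
qed

instance vec :: (t2_space, finite) t2_space
proof
  fix x y :: "'a ^ 'b"
  assume "x \<noteq> y"
  then obtain i where i: "x $ i \<noteq> y $ i"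
    unfolding vec_eq_iff by blast
  obtain U V where UV: "open U" "open V" "x $ i \<in> U" "y $ i \<in> V" "U \<inter> V = {}"
    using hausdorff[OF i] by blast
  show "\<exists>U V. open U \<and> open V \<and> x \<in> U \<and> y \<in> V \<and> U \<inter> V = {}"
  proof (intro exI conjI)
    show "open ((\<lambda>z. z $ i) -` U)"
      by (rule open_vimage_vec_nth[OF UV(1)])
    show "open ((\<lambda>z. z $ i) -` V)"
      by (rule open_vimage_vec_nth[OF UV(2)])
    show "x \<in> (\<lambda>z. z $ i) -` U"
      unfolding vimage_eq by (rule UV(3))
    show "y \<in> (\<lambda>z. z $ i) -` V"
      unfolding vimage_eq by (rule UV(4))
    show "(\<lambda>z. z $ i) -` U \<inter> (\<lambda>z. z $ i) -` V = {}"
      unfolding vimage_Int[symmetric] UV(5) by (rule vimage_empty)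
  qed
qed


section \<open>Nonarchimedean local fields\<close>

text \<open>The absolute value is \<open>\<lambda>x. dist 0 x\<close>. It is not assumed to be normalised; the normalised
  absolute value is \<open>modulus\<close> below.\<close>

class nonarch_local_field = field + metric_space +
  assumes dist_translate: "dist (x + z) (y + z) = dist x y"
    and dist_0_mult: "dist 0 (x * y) = dist 0 x * dist 0 y"
    and ultrametric: "dist x z \<le> max (dist x y) (dist y z)"
    and nontrivial_absolute_value: "\<exists>x. x \<noteq> 0 \<and> dist 0 x \<noteq> 1"
    and locally_compact_0: "\<exists>e>0. compact {x. dist 0 x \<le> e}"

definition integer_ring :: "'f::nonarch_local_field set"
  where "integer_ring = {x. dist 0 x \<le> 1}"

definition field_embedding :: "('f::field \<Rightarrow> 'k::field) \<Rightarrow> bool"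
  where "field_embedding \<iota> \<longleftrightarrow>
    \<iota> 1 = 1 \<and> (\<forall>a b. \<iota> (a + b) = \<iota> a + \<iota> b) \<and> (\<forall>a b. \<iota> (a * b) = \<iota> a * \<iota> b)"

text \<open>Continuity of \<open>\<iota>\<close> says that the absolute value of the larger field restricts to one equivalent
  to that of the smaller field.\<close>

definition separable_quadratic_extension ::
  "('f::nonarch_local_field \<Rightarrow> 'k::nonarch_local_field) \<Rightarrow> bool"
  where "separable_quadratic_extension \<iota> \<longleftrightarrow>
    field_embedding \<iota> \<and> continuous_on UNIV \<iota> \<and>
    vector_space.dim (\<lambda>a x. \<iota> a * x) (UNIV :: 'k set) = 2 \<and>
    (\<forall>x. \<exists>p. irreducible p \<and> coprime p (pderiv p) \<and> poly (map_poly \<iota> p) x = 0)"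

definition galois_group :: "('f::field \<Rightarrow> 'k::field) \<Rightarrow> ('k \<Rightarrow> 'k) set"
  where "galois_group \<iota> = {\<sigma>. bij \<sigma> \<and> field_embedding \<sigma> \<and> (\<forall>a. \<sigma> (\<iota> a) = \<iota> a)}"


section \<open>Hermitian spaces and matrices\<close>

text \<open>A finite dimensional vector space over a local field has exactly one Hausdorff vector space
  topology, so the continuity conditions say that \<open>'v\<close> carries its canonical topology.\<close>

definition findim_topological_vector_space ::
  "('k::nonarch_local_field \<Rightarrow> 'v::{topological_ab_group_add,t2_space} \<Rightarrow> 'v) \<Rightarrow> bool"
  where "findim_topological_vector_space sV \<longleftrightarrow>
    (\<exists>B. finite_dimensional_vector_space sV B) \<and>
    continuous_on UNIV (\<lambda>(a, v). sV a v)"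

definition hermitian_form ::
  "('k::field \<Rightarrow> 'v::ab_group_add \<Rightarrow> 'v) \<Rightarrow> ('k \<Rightarrow> 'k) \<Rightarrow> ('v \<Rightarrow> 'v \<Rightarrow> 'k) \<Rightarrow> bool"
  where "hermitian_form sV \<sigma> h \<longleftrightarrow>
    (\<forall>x x' y. h (x + x') y = h x y + h x' y) \<and>
    (\<forall>a x y. h (sV a x) y = a * h x y) \<and>
    (\<forall>x y y'. h x (y + y') = h x y + h x y') \<and>
    (\<forall>a x y. h x (sV a y) = \<sigma> a * h x y) \<and>
    (\<forall>x y. h y x = \<sigma> (h x y))"

definition nondegenerate_form :: "('v::zero \<Rightarrow> 'v \<Rightarrow> 'k::zero) \<Rightarrow> bool"
  where "nondegenerate_form h \<longleftrightarrow> (\<forall>x. (\<forall>y. h x y = 0) \<longrightarrow> x = 0)"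

definition Herm :: "('k \<Rightarrow> 'k) \<Rightarrow> ('k^'d^'d) set"
  where "Herm \<sigma> = {t. \<forall>i j. t $ j $ i = \<sigma> (t $ i $ j)}"

definition Herm_integral :: "('k \<Rightarrow> 'k) \<Rightarrow> ('k::nonarch_local_field^'d^'d) set"
  where "Herm_integral \<sigma> = {t \<in> Herm \<sigma>. \<forall>i j. t $ i $ j \<in> integer_ring}"

definition Herm_dual ::
  "('f::nonarch_local_field \<Rightarrow> 'k::nonarch_local_field) \<Rightarrow> ('k \<Rightarrow> 'k) \<Rightarrow> ('k^'d::finite^'d) set"
  where "Herm_dual \<iota> \<sigma> = {t \<in> Herm \<sigma>. \<forall>s \<in> Herm_integral \<sigma>. trace (t ** s) \<in> \<iota> ` integer_ring}"

definition Herm_ns :: "('k \<Rightarrow> 'k) \<Rightarrow> ('k::field^'d::finite^'d) set"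
  where "Herm_ns \<sigma> = {t \<in> Herm \<sigma>. det t \<noteq> 0}"

definition moment_matrix :: "('v \<Rightarrow> 'v \<Rightarrow> 'k) \<Rightarrow> 'v^'d \<Rightarrow> 'k^'d^'d"
  where "moment_matrix h x = (\<chi> i j. h (x $ i) (x $ j))"

definition scale_tuple ::
  "('f \<Rightarrow> 'k) \<Rightarrow> ('k \<Rightarrow> 'v \<Rightarrow> 'v) \<Rightarrow> 'f \<Rightarrow> 'v^'d \<Rightarrow> 'v^'d"
  where "scale_tuple \<iota> sV a x = (\<chi> i. sV (\<iota> a) (x $ i))"

definition scale_matrix :: "('f \<Rightarrow> 'k::times) \<Rightarrow> 'f \<Rightarrow> 'k^'d^'d \<Rightarrow> 'k^'d^'d"
  where "scale_matrix \<iota> a t = (\<chi> i j. \<iota> a * t $ i $ j)"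


section \<open>Haar measures\<close>

definition haar_measure_on ::
  "'w::{ab_group_add,topological_space} set \<Rightarrow> 'w measure \<Rightarrow> bool"
  where "haar_measure_on W \<mu> \<longleftrightarrow>
    sets \<mu> = sets (restrict_space borel W) \<and>
    (\<forall>w\<in>W. \<forall>A\<in>sets \<mu>. emeasure \<mu> ((+) w ` A) = emeasure \<mu> A) \<and>
    (\<forall>K. K \<subseteq> W \<and> compact K \<longrightarrow> emeasure \<mu> K < \<infinity>) \<and>
    (\<forall>U. openin (top_of_set W) U \<and> U \<noteq> {} \<longrightarrow> 0 < emeasure \<mu> U)"

definition normalized_haar :: "'f::nonarch_local_field measure"
  where "normalized_haar =
    (THE \<mu>. haar_measure_on UNIV \<mu> \<and> emeasure \<mu> integer_ring = 1)"

text \<open>The normalised absolute value, as the factor by which multiplication scales Haar measure.\<close>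

definition modulus :: "'f::nonarch_local_field \<Rightarrow> real"
  where "modulus a = measure normalized_haar ((*) a ` integer_ring)"


section \<open>Measures attached to differential forms\<close>

text \<open>Affine \<open>k\<close>-space is the set of extensional functions on \<open>{..<k}\<close>, which is the space of the
  product measure \<open>Pi\<^sub>M {..<k} (\<lambda>_. normalized_haar)\<close>.\<close>

definition affine_space :: "nat \<Rightarrow> (nat \<Rightarrow> 'f) set"
  where "affine_space k = (\<Pi>\<^sub>E i\<in>{..<k}. UNIV)"

definition translate_along :: "nat \<Rightarrow> (nat \<Rightarrow> 'f::semiring_0) \<Rightarrow> (nat \<Rightarrow> 'f) \<Rightarrow> 'f \<Rightarrow> nat \<Rightarrow> 'f"
  where "translate_along k u v t = (\<lambda>i\<in>{..<k}. u i + t * v i)"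

text \<open>Continuous differentiability over a topological field: the difference quotients
  \<open>(\<phi> (u + t v) - \<phi> u) / t\<close> extend continuously to \<open>t = 0\<close>. Mere existence of continuous
  derivatives would be too weak over a nonarchimedean field (no inverse function theorem); maps given
  locally by convergent power series satisfy this condition.\<close>

definition C1_map ::
  "('f::nonarch_local_field \<Rightarrow> 'w::{ab_group_add,t2_space} \<Rightarrow> 'w) \<Rightarrow> nat \<Rightarrow>
    (nat \<Rightarrow> 'f) set \<Rightarrow> ((nat \<Rightarrow> 'f) \<Rightarrow> 'w) \<Rightarrow> bool"
  where "C1_map s k U \<phi> \<longleftrightarrow>
    (\<exists>g. continuous_on {(u, v, t). u \<in> U \<and> v \<in> affine_space k \<and> translate_along k u v t \<in> U}
           (\<lambda>(u, v, t). g u v t) \<and>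
         (\<forall>u v t. u \<in> U \<and> v \<in> affine_space k \<and> translate_along k u v t \<in> U \<longrightarrow>
           \<phi> (translate_along k u v t) - \<phi> u = s t (g u v t)))"

definition partial_deriv ::
  "('f::nonarch_local_field \<Rightarrow> 'w::{ab_group_add,t2_space} \<Rightarrow> 'w) \<Rightarrow>
    ((nat \<Rightarrow> 'f) \<Rightarrow> 'w) \<Rightarrow> (nat \<Rightarrow> 'f) \<Rightarrow> nat \<Rightarrow> 'w"
  where "partial_deriv s \<phi> u i =
    Lim (at 0) (\<lambda>t. s (inverse t) (\<phi> (u(i := u i + t)) - \<phi> u))"

text \<open>Local parametrisations (inverses of charts) of a \<open>k\<close>-dimensional submanifold \<open>S\<close> of a vector
  space with scalar multiplication \<open>s\<close>.\<close>

definition local_parametrization ::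
  "('f::nonarch_local_field \<Rightarrow> 'w::{ab_group_add,t2_space} \<Rightarrow> 'w) \<Rightarrow> 'w set \<Rightarrow> nat \<Rightarrow>
    (nat \<Rightarrow> 'f) set \<Rightarrow> ((nat \<Rightarrow> 'f) \<Rightarrow> 'w) \<Rightarrow> bool"
  where "local_parametrization s S k U \<phi> \<longleftrightarrow>
    openin (top_of_set (affine_space k)) U \<and>
    openin (top_of_set S) (\<phi> ` U) \<and>
    (\<exists>\<psi>. homeomorphism U (\<phi> ` U) \<phi> \<psi>) \<and>
    C1_map s k U \<phi> \<and>
    (\<forall>u\<in>U. \<forall>c. (\<Sum>i<k. s (c i) (partial_deriv s \<phi> u i)) = 0 \<longrightarrow> (\<forall>i<k. c i = 0))"

text \<open>The measure \<open>|\<omega>|\<close> on \<open>S\<close> defined by a form \<open>\<omega>\<close> of degree \<open>k = dim S\<close>, where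
  \<open>\<omega> x (v\<^sub>0, \<dots>, v\<^sub>k\<^sub>-\<^sub>1)\<close> is the value at the point \<open>x\<close> on tangent vectors. In local coordinates
  \<open>u\<close> with \<open>\<omega> = f du\<^sub>0 \<and> \<dots> \<and> du\<^sub>k\<^sub>-\<^sub>1\<close> it is \<open>|f| du\<close>, and \<open>f\<close> is the value of \<open>\<omega>\<close> on the
  coordinate vector fields. Analytic charts are among the charts used here; by the change of variables
  formula for \<open>C\<^sup>1\<close> maps, admitting all \<open>C\<^sup>1\<close> charts does not change the measure.\<close>

definition is_form_measure ::
  "('f::nonarch_local_field \<Rightarrow> 'w::{ab_group_add,t2_space} \<Rightarrow> 'w) \<Rightarrow> 'w set \<Rightarrow> nat \<Rightarrow>
    ('w \<Rightarrow> (nat \<Rightarrow> 'w) \<Rightarrow> 'f) \<Rightarrow> 'w measure \<Rightarrow> bool"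
  where "is_form_measure s S k \<omega> M \<longleftrightarrow>
    sets M = sets (restrict_space borel S) \<and>
    (\<forall>U \<phi> A. local_parametrization s S k U \<phi> \<and> A \<subseteq> U \<and>
        A \<in> sets (Pi\<^sub>M {..<k} (\<lambda>_. normalized_haar)) \<longrightarrow>
      emeasure M (\<phi> ` A) =
        (\<integral>\<^sup>+ u \<in> A. ennreal (modulus (\<omega> (\<phi> u) (partial_deriv s \<phi> u)))
           \<partial>(Pi\<^sub>M {..<k} (\<lambda>_. normalized_haar))))"

definition form_measure ::
  "('f::nonarch_local_field \<Rightarrow> 'w::{ab_group_add,t2_space} \<Rightarrow> 'w) \<Rightarrow> 'w set \<Rightarrow> nat \<Rightarrow>
    ('w \<Rightarrow> (nat \<Rightarrow> 'w) \<Rightarrow> 'f) \<Rightarrow> 'w measure"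
  where "form_measure s S k \<omega> = (THE M. is_form_measure s S k \<omega> M)"

definition alternating_form ::
  "('f::field \<Rightarrow> 'w::ab_group_add \<Rightarrow> 'w) \<Rightarrow> 'w set \<Rightarrow> nat \<Rightarrow> ((nat \<Rightarrow> 'w) \<Rightarrow> 'f) \<Rightarrow> bool"
  where "alternating_form s W n \<omega> \<longleftrightarrow>
    (\<forall>v w. (\<forall>i<n. v i = w i) \<longrightarrow> \<omega> v = \<omega> w) \<and>
    (\<forall>v i. (\<forall>j<n. v j \<in> W) \<and> i < n \<longrightarrow>
      (\<forall>x\<in>W. \<forall>y\<in>W. \<omega> (v(i := x + y)) = \<omega> (v(i := x)) + \<omega> (v(i := y))) \<and>
      (\<forall>a. \<forall>x\<in>W. \<omega> (v(i := s a x)) = a * \<omega> (v(i := x)))) \<and>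
    (\<forall>v i j. (\<forall>l<n. v l \<in> W) \<and> i < j \<and> j < n \<and> v i = v j \<longrightarrow> \<omega> v = 0)"

text \<open>A translation-invariant differential form on an affine space \<open>W\<close> is constant, that is, given by
  one alternating form on the vector space \<open>W\<close>.\<close>

definition nonzero_invariant_top_form ::
  "('f::field \<Rightarrow> 'w::ab_group_add \<Rightarrow> 'w) \<Rightarrow> 'w set \<Rightarrow> ((nat \<Rightarrow> 'w) \<Rightarrow> 'f) \<Rightarrow> bool"
  where "nonzero_invariant_top_form s W \<omega> \<longleftrightarrow>
    alternating_form s W (vector_space.dim s W) \<omega> \<and>
    (\<exists>v. (\<forall>i < vector_space.dim s W. v i \<in> W) \<and> \<omega> v \<noteq> 0)"


section \<open>Representation densities\<close>

definition dim_X ::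
  "('f::field \<Rightarrow> 'k::field) \<Rightarrow> ('k \<Rightarrow> 'v::ab_group_add \<Rightarrow> 'v) \<Rightarrow> 'd::finite itself \<Rightarrow> nat"
  where "dim_X \<iota> sV _ = vector_space.dim (scale_tuple \<iota> sV) (UNIV :: ('v^'d) set)"

definition dim_Y ::
  "('f::field \<Rightarrow> 'k::field) \<Rightarrow> ('k \<Rightarrow> 'k) \<Rightarrow> 'd::finite itself \<Rightarrow> nat"
  where "dim_Y \<iota> \<sigma> _ = vector_space.dim (scale_matrix \<iota>) (Herm \<sigma> :: ('k^'d^'d) set)"

text \<open>The differential of \<open>moment_matrix h\<close> at \<open>x\<close>, in the direction \<open>v\<close>.\<close>

definition deriv_moment ::
  "('f::nonarch_local_field \<Rightarrow> 'k::nonarch_local_field) \<Rightarrow>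
    ('k \<Rightarrow> 'v::{topological_ab_group_add,t2_space} \<Rightarrow> 'v) \<Rightarrow> ('v \<Rightarrow> 'v \<Rightarrow> 'k) \<Rightarrow>
    'v^'d::finite \<Rightarrow> 'v^'d \<Rightarrow> 'k^'d^'d"
  where "deriv_moment \<iota> sV h x v =
    Lim (at 0) (\<lambda>t. scale_matrix \<iota> (inverse t)
      (moment_matrix h (x + scale_tuple \<iota> sV t v) - moment_matrix h x))"

text \<open>The relative form \<open>\<mu>X / \<tau>\<^sup>*\<mu>Y\<close> at \<open>x\<close>, evaluated on vectors \<open>v\<^sub>0, v\<^sub>1, \<dots>\<close> tangent to the fibre
  through \<open>x\<close> (i.e. in the kernel of the differential of \<open>\<tau>\<close> at \<open>x\<close>). On tangent spaces, the
  factorisation \<open>\<mu>X = (\<mu>X / \<tau>\<^sup>*\<mu>Y) \<otimes> \<tau>\<^sup>*\<mu>Y\<close> says that \<open>\<mu>X (v, w) = (\<mu>X / \<tau>\<^sup>*\<mu>Y) (v) * \<mu>Y (d\<tau> w)\<close> for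
  all tuples \<open>w\<close> of vectors tangent to \<open>X\<close>.\<close>

definition relative_form ::
  "('f::nonarch_local_field \<Rightarrow> 'k::nonarch_local_field) \<Rightarrow> ('k \<Rightarrow> 'k) \<Rightarrow>
    ('k \<Rightarrow> 'v::{topological_ab_group_add,t2_space} \<Rightarrow> 'v) \<Rightarrow> ('v \<Rightarrow> 'v \<Rightarrow> 'k) \<Rightarrow>
    ((nat \<Rightarrow> 'v^'d::finite) \<Rightarrow> 'f) \<Rightarrow> ((nat \<Rightarrow> 'k^'d^'d) \<Rightarrow> 'f) \<Rightarrow>
    'v^'d \<Rightarrow> (nat \<Rightarrow> 'v^'d) \<Rightarrow> 'f"
  where "relative_form \<iota> \<sigma> sV h \<mu>X \<mu>Y x v =
    (let r = dim_X \<iota> sV TYPE('d) - dim_Y \<iota> \<sigma> TYPE('d) in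
      THE c. \<forall>w. \<mu>X (\<lambda>i. if i < r then v i else w (i - r)) =
                 c * \<mu>Y (\<lambda>i. deriv_moment \<iota> sV h x (w i)))"

definition fibre :: "('v \<Rightarrow> 'v \<Rightarrow> 'k) \<Rightarrow> 'k^'d^'d \<Rightarrow> ('v^'d) set"
  where "fibre h T = {x. moment_matrix h x = T}"

text \<open>If \<open>dim_X < dim_Y\<close> then the fibres over nonsingular matrices are empty, so the truncated
  subtraction is harmless.\<close>

definition fibre_measure ::
  "('f::nonarch_local_field \<Rightarrow> 'k::nonarch_local_field) \<Rightarrow> ('k \<Rightarrow> 'k) \<Rightarrow>
    ('k \<Rightarrow> 'v::{topological_ab_group_add,t2_space} \<Rightarrow> 'v) \<Rightarrow> ('v \<Rightarrow> 'v \<Rightarrow> 'k) \<Rightarrow>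
    ((nat \<Rightarrow> 'v^'d::finite) \<Rightarrow> 'f) \<Rightarrow> ((nat \<Rightarrow> 'k^'d^'d) \<Rightarrow> 'f) \<Rightarrow> 'k^'d^'d \<Rightarrow> ('v^'d) measure"
  where "fibre_measure \<iota> \<sigma> sV h \<mu>X \<mu>Y T =
    form_measure (scale_tuple \<iota> sV) (fibre h T)
      (dim_X \<iota> sV TYPE('d) - dim_Y \<iota> \<sigma> TYPE('d))
      (relative_form \<iota> \<sigma> sV h \<mu>X \<mu>Y)"

text \<open>The density of \<open>C\<close> computed with the forms \<open>\<mu>X\<close> and \<open>\<mu>Y\<close>; the value does not depend on them
  as long as they are nonzero.\<close>

definition Den ::
  "('f::nonarch_local_field \<Rightarrow> 'k::nonarch_local_field) \<Rightarrow> ('k \<Rightarrow> 'k) \<Rightarrow>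
    ('k \<Rightarrow> 'v::{topological_ab_group_add,t2_space} \<Rightarrow> 'v) \<Rightarrow> ('v \<Rightarrow> 'v \<Rightarrow> 'k) \<Rightarrow>
    ((nat \<Rightarrow> 'v^'d::finite) \<Rightarrow> 'f) \<Rightarrow> ((nat \<Rightarrow> 'k^'d^'d) \<Rightarrow> 'f) \<Rightarrow>
    'k^'d^'d \<Rightarrow> ('v^'d) set \<Rightarrow> real"
  where "Den \<iota> \<sigma> sV h \<mu>X \<mu>Y T C =
    measure (fibre_measure \<iota> \<sigma> sV h \<mu>X \<mu>Y T) (C \<inter> fibre h T) *
    (measure (form_measure (scale_matrix \<iota>) (Herm \<sigma>) (dim_Y \<iota> \<sigma> TYPE('d)) (\<lambda>_. \<mu>Y))
       (Herm_dual \<iota> \<sigma>) /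
     measure (form_measure (scale_tuple \<iota> sV) UNIV (dim_X \<iota> sV TYPE('d)) (\<lambda>_. \<mu>X)) C)"

end

theory Submission
  imports Defs
begin

text \<open>Polarising the moment map \<open>\<tau>\<close> gives an \<open>F\<close>-bilinear map \<open>B\<close> with \<open>\<tau> x = B x x\<close>, whose
  differential \<open>v \<mapsto> B x v + B v x\<close> is surjective whenever \<open>\<tau> x\<close> is nonsingular. By the ultrametric
  inequality, \<open>\<tau>\<close> is near such a point exactly a linear projection in coordinates that preserve the
  norm, and therefore Haar measure. Hence for every compact open \<open>A\<close> and nonsingular \<open>T\<close> there is a
  constant \<open>c\<close> such that the volume of \<open>A \<inter> \<tau> -` U\<close> is \<open>c\<close> times the volume of \<open>U\<close> for all compact
  open \<open>U\<close> contained in some neighbourhood of \<open>T\<close>. These constants are additive in \<open>A\<close>, so they define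
  a measure on the fibre over \<open>T\<close>; in charts it is the measure of the relative form. Both claims
  follow, since the same \<open>c\<close> serves all points of the neighbourhood.\<close>

section \<open>Topology of a local field\<close>

text \<open>\<open>Den\<close> is assembled from definite descriptions: normalised Haar measure, the
  relative form and the measures of forms. Each must be shown to exist and to be unique before it
  can be compared with volumes. On the fibre this has two sides: the measure built from tube volumes
  must satisfy the chart formula in every chart that is C1 in the strong sense, and such charts must
  cover the fibre. Change of variables is reduced to isometries and elementary linear changes. An
  error of relative size 1/2 leaves an ultrametric norm unchanged, so near a point every chart is an
  exact isometry once the target is measured in the basis of its partial derivatives. Replacing one
  basis vector at a time then scales volume by the modulus of one coefficient. The radii
  \<open>1 / (2 * K)\<close> are chosen to produce the relative error 1/2. The polarisation has to
  be Hermitian in every characteristic, so an element of trace 1 takes the place of 1/2.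
  Nonsingularity of \<open>T\<close> is used through the inverse of the moment matrix, which solves
  for a preimage under the differential.\<close>

abbreviation av :: "'f::nonarch_local_field \<Rightarrow> real" where "av x \<equiv> dist 0 x"

lemma dist_eq_av: "dist x y = av (y - x)" for x y :: "'f::nonarch_local_field"
  using dist_translate[of x "-x" y] by simp

lemma av_minus [simp]: "av (- x) = av x"
  by (metis add.inverse_inverse diff_0 dist_commute dist_eq_av)

lemma av_minus_commute: "av (x - y) = av (y - x)"
  by (metis av_minus minus_diff_eq)

lemma av_one [simp]: "av (1::'f::nonarch_local_field) = 1"
proof -
  have "av (1::'f) * av (1::'f) = av (1::'f)"
    using dist_0_mult[of "1::'f" "1::'f"] by simp
  moreover have "av (1::'f) \<noteq> 0" by simp
  ultimately show ?thesis by auto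
qed

lemma av_power: "av (x ^ n) = av x ^ n"
  by (induction n) (auto simp: dist_0_mult)

lemma av_inverse: "av (inverse x) = inverse (av x)"
proof (cases "x = 0")
  case False
  then have "av x * av (inverse x) = 1"
    by (simp flip: dist_0_mult)
  then show ?thesis by (metis inverse_unique)
qed simp

lemma av_add_le: "av (x + y) \<le> max (av x) (av y)"
proof -
  have "av (x + y) \<le> max (av x) (dist x (x + y))" by (rule ultrametric)
  then show ?thesis by (simp add: dist_eq_av[of x "x + y"])
qed

lemma av_diff_le: "av (x - y) \<le> max (av x) (av y)"
  using av_add_le[of x "-y"] by simp

lemma av_sum_le:
  assumes "0 \<le> r" "\<And>i. i \<in> I \<Longrightarrow> av (f i) \<le> r"
  shows "av (\<Sum>i\<in>I. f i) \<le> r"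
proof (cases "finite I")
  case True
  then show ?thesis using assms
  proof (induction I rule: finite_induct)
    case (insert i I)
    then show ?case
      using av_add_le[of "f i" "\<Sum>i\<in>I. f i"] by (auto simp: le_max_iff_disj intro: order_trans)
  qed simp
qed (use assms in simp)

text \<open>The reverse bound is the ultrametric inequality for x = (x + y) - y. That a smaller
  summand has no effect at all is what later turns approximate isometries into exact ones.\<close>

lemma av_add_dominant: "av y < av x \<Longrightarrow> av (x + y) = av x"
  using av_add_le[of x y] av_diff_le[of "x + y" y] by (simp add: max_def split: if_splits)

lemma dist_uminus: "dist (- x) (- y) = dist x y" for x y :: "'f::nonarch_local_field"
  by (simp add: dist_eq_av[of "-x" "-y"] dist_eq_av[of y x] dist_commute[of x y])

instance nonarch_local_field \<subseteq> topological_ab_group_add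
proof
  fix a b :: 'a
  show "((\<lambda>x. fst x + snd x) \<longlongrightarrow> a + b) (nhds a \<times>\<^sub>F nhds b)"
    unfolding tendsto_iff
  proof (intro allI impI)
    fix e :: real assume "e > 0"
    then have "eventually (\<lambda>x. dist x a < e) (nhds a)" "eventually (\<lambda>x. dist x b < e) (nhds b)"
      by (auto simp: eventually_nhds_metric)
    then have "eventually (\<lambda>x. dist (fst x) a < e \<and> dist (snd x) b < e) (nhds a \<times>\<^sub>F nhds b)"
      by (auto simp: eventually_prod_filter)
    then show "eventually (\<lambda>x. dist (fst x + snd x) (a + b) < e) (nhds a \<times>\<^sub>F nhds b)"
    proof (rule eventually_mono)
      fix x :: "'a \<times> 'a" assume *: "dist (fst x) a < e \<and> dist (snd x) b < e"
      have eq: "(a + b) - (fst x + snd x) = (a - fst x) + (b - snd x)" by simp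
      show "dist (fst x + snd x) (a + b) < e"
        using av_add_le[of "a - fst x" "b - snd x"] *
        unfolding dist_eq_av[of "fst x + snd x"] dist_eq_av[of "fst x"] dist_eq_av[of "snd x"] eq
        by (auto simp: max_def split: if_splits)
    qed
  qed
  show "(uminus \<longlongrightarrow> - a) (nhds a)"
    unfolding tendsto_iff dist_uminus by (auto simp: eventually_nhds_metric)
qed

instance nonarch_local_field \<subseteq> topological_comm_monoid_mult
proof
  fix a b :: 'a
  show "((\<lambda>x. fst x * snd x) \<longlongrightarrow> a * b) (nhds a \<times>\<^sub>F nhds b)"
    unfolding tendsto_iff
  proof (intro allI impI)
    fix e :: real assume e: "e > 0"
    \<comment> \<open>The first two bounds control the linear terms of the error; the bound 1
      reduces the product of the two errors to a linear term.\<close>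
    define d where "d = min (e / (av b + 1)) (min (e / (av a + 1)) 1)"
    have d: "d > 0" "d * (av b + 1) \<le> e" "d * (av a + 1) \<le> e" "d \<le> 1"
      using e by (auto simp: d_def min_le_iff_disj add_nonneg_pos pos_le_divide_eq[symmetric])
    then have "eventually (\<lambda>x. dist x a < d) (nhds a)" "eventually (\<lambda>x. dist x b < d) (nhds b)"
      by (auto simp: eventually_nhds_metric)
    then have "eventually (\<lambda>x. dist (fst x) a < d \<and> dist (snd x) b < d) (nhds a \<times>\<^sub>F nhds b)"
      by (auto simp: eventually_prod_filter)
    then show "eventually (\<lambda>x. dist (fst x * snd x) (a * b) < e) (nhds a \<times>\<^sub>F nhds b)"
    proof (rule eventually_mono)
      fix x :: "'a \<times> 'a" assume *: "dist (fst x) a < d \<and> dist (snd x) b < d"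
      define p q where "p = a - fst x" and "q = b - snd x"
      have pq: "av p < d" "av q < d" using *
        by (auto simp: p_def q_def dist_eq_av[of "fst x" a] dist_eq_av[of "snd x" b])
      have "a * b - fst x * snd x = a * q + (p * b - p * q)"
        by (simp add: p_def q_def algebra_simps)
      then have "av (a * b - fst x * snd x) \<le> max (av (a * q)) (max (av (p * b)) (av (p * q)))"
        using order_trans[OF av_add_le max.mono[OF order_refl av_diff_le], of "a * q" "p * b" "p * q"]
        by simp
      also have "\<dots> < e"
      proof -
        have "av a * av q < e"
          using mult_left_mono[of "av q" d "av a"] pq d by (simp add: algebra_simps)
        moreover have "av p * av b < e"
          using mult_right_mono[of "av p" d "av b"] pq d by (simp add: algebra_simps)
        moreover have "av p * av q < e"
        proof -
          have "av p * av q \<le> av p * 1" using pq d by (intro mult_left_mono) auto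
          moreover have "0 \<le> d * av a" using d by simp
          moreover have "d * (av a + 1) = d * av a + d" by (simp add: algebra_simps)
          ultimately show ?thesis using pq d by linarith
        qed
        ultimately show ?thesis by (simp add: dist_0_mult)
      qed
      finally show "dist (fst x * snd x) (a * b) < e" by (simp add: dist_eq_av[of "fst x * snd x"])
    qed
  qed
qed

lemma uniformizer_exists: "\<exists>p::'f::nonarch_local_field. p \<noteq> 0 \<and> av p < 1"
proof -
  obtain x :: 'f where x: "x \<noteq> 0" "av x \<noteq> 1" using nontrivial_absolute_value by blast
  show ?thesis
  proof (cases "av x < 1")
    case False
    then have "av (inverse x) < 1" using x by (simp add: av_inverse inverse_less_1_iff)
    then show ?thesis using x by (intro exI[of _ "inverse x"]) auto
  qed (use x in auto)
qed

lemma small_element: "e > 0 \<Longrightarrow> \<exists>p::'f::nonarch_local_field. p \<noteq> 0 \<and> av p < e"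
proof -
  assume e: "e > 0"
  obtain p :: 'f where p: "p \<noteq> 0" "av p < 1" using uniformizer_exists by blast
  obtain n where "av p ^ n < e" using real_arch_pow_inv[OF e p(2)] by blast
  then show ?thesis using p by (intro exI[of _ "p ^ n"]) (auto simp: av_power)
qed

lemma large_element: "\<exists>p::'f::nonarch_local_field. p \<noteq> 0 \<and> av p > R"
proof -
  obtain p :: 'f where p: "p \<noteq> 0" "av p < 1" using uniformizer_exists by blast
  then have "1 < av (inverse p)" by (simp add: av_inverse one_less_inverse_iff)
  then obtain n where "R < av (inverse p) ^ n" using real_arch_pow by blast
  then show ?thesis using p by (intro exI[of _ "inverse p ^ n"]) (auto simp: av_power)
qed

lemma closed_av: "closed {x::'f::nonarch_local_field. av x \<le> r}"
  using closed_cball[of "0::'f" r] by (simp add: cball_def)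

text \<open>Local compactness provides one compact ball; multiplication by an element of large
  absolute value carries it onto a compact set containing any prescribed ball.\<close>

lemma compact_av: "compact {x::'f::nonarch_local_field. av x \<le> r}"
proof -
  obtain e where e: "e > 0" "compact {x::'f. av x \<le> e}" using locally_compact_0 by blast
  obtain p :: 'f where p: "p \<noteq> 0" "av p > r / e" using large_element by blast
  have "compact ((*) p ` {x::'f. av x \<le> e})"
    by (rule compact_continuous_image[OF _ e(2)]) (intro continuous_intros)
  moreover have "{x::'f. av x \<le> r} \<subseteq> (*) p ` {x::'f. av x \<le> e}"
  proof
    fix x :: 'f assume "x \<in> {x::'f. av x \<le> r}"
    then have "av x \<le> r" by simp
    moreover have "r \<le> e * av p" using p e by (simp add: field_simps)
    ultimately have "av x * inverse (av p) \<le> e" using p by (simp add: field_simps)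
    then have "x * inverse p \<in> {x. av x \<le> e}" by (simp add: dist_0_mult av_inverse)
    moreover have "x = p * (x * inverse p)" using p by simp
    ultimately show "x \<in> (*) p ` {x::'f. av x \<le> e}" by blast
  qed
  ultimately show ?thesis
    using closed_av compact_Int_closed by (metis Int_absorb1)
qed

instance nonarch_local_field \<subseteq> heine_borel
proof
  fix f :: "nat \<Rightarrow> 'a"
  assume "bounded (range f)"
  then obtain r where "range f \<subseteq> {x. av x \<le> r}"
    unfolding bounded_any_center[where a=0] by auto
  then have f: "\<forall>n. f n \<in> {x. av x \<le> r}" by auto
  have "seq_compact {x::'a. av x \<le> r}"
    using compact_av by (rule compact_imp_seq_compact)
  then show "\<exists>l r. strict_mono r \<and> (f \<circ> r) \<longlonglongrightarrow> l"
    using f unfolding seq_compact_def by fast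
qed

instance nonarch_local_field \<subseteq> perfect_space
proof
  fix x :: 'a
  show "\<not> open {x}"
  proof
    assume "open {x}"
    then obtain e where e: "e > 0" "\<And>y. dist y x < e \<Longrightarrow> y = x"
      by (auto simp: open_dist)
    obtain p :: 'a where "p \<noteq> 0" "av p < e" using small_element[OF e(1)] by blast
    then show False using e(2)[of "x + p"] by (simp add: dist_eq_av[of _ x])
  qed
qed

instance nonarch_local_field \<subseteq> second_countable_topology
proof
  \<comment> \<open>\<open>F n\<close> will be a finite net of mesh 1/(n+1) in the ball of radius
    \<open>n\<close>; the union of these nets is countable and dense.\<close>
  define P where "P n F \<longleftrightarrow> finite F \<and> cball (0::'a) (real n) \<subseteq> (\<Union>x\<in>F. ball x (inverse (real (Suc n))))" for n F
  have "\<exists>F. P n F" for n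
  proof -
    have "\<forall>e>0. \<exists>k. finite k \<and> cball (0::'a) (real n) \<subseteq> (\<Union>x\<in>k. ball x e)"
      using compact_eq_totally_bounded[of "cball (0::'a) (real n)"] compact_cball[of "0::'a" "real n"] by simp
    then show ?thesis unfolding P_def by simp
  qed
  then obtain F where F: "\<And>n. P n (F n)" by metis
  define D where "D = (\<Union>n. F n)"
  have cD: "countable D" unfolding D_def using F by (intro countable_UN) (auto simp: P_def countable_finite)
  have dense: "\<exists>d\<in>D. dist d x < e" if "e > 0" for x :: 'a and e
  proof -
    obtain n where n: "real n \<ge> dist 0 x" "inverse (real (Suc n)) < e"
    proof -
      obtain m where "inverse (real (Suc m)) < e" using reals_Archimedean[OF \<open>e > 0\<close>] by blast
      moreover obtain l where "real l \<ge> dist 0 x" using real_arch_simple by blast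
      moreover have "inverse (real (Suc (max m l))) \<le> inverse (real (Suc m))" by simp
      ultimately show thesis by (intro that[of "max m l"]) linarith+
    qed
    then have "x \<in> cball 0 (real n)" by simp
    then obtain d where "d \<in> F n" "dist d x < inverse (real (Suc n))"
      using F[of n] unfolding P_def by (meson UN_E mem_ball subsetD)
    then show ?thesis using n unfolding D_def by force
  qed
  let ?B = "(\<lambda>(d,q). ball d (real_of_rat q)) ` (D \<times> UNIV)"
  have "topological_basis ?B"
  proof (rule topological_basisI)
    fix O' :: "'a set" and x assume "open O'" "x \<in> O'"
    then obtain e where e: "e > 0" "ball x e \<subseteq> O'" using open_contains_ball by blast
    obtain d where d: "d \<in> D" "dist d x < e / 3" using dense[of "e/3"] e by auto
    obtain q where q: "e / 3 < real_of_rat q" "real_of_rat q < e / 2"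
      using of_rat_dense[of "e/3" "e/2"] e by auto
    have "ball d (real_of_rat q) \<subseteq> ball x e"
    proof
      fix y assume "y \<in> ball d (real_of_rat q)"
      then show "y \<in> ball x e"
        using q d e dist_triangle[of x y d] by (simp add: dist_commute)
    qed
    moreover have "x \<in> ball d (real_of_rat q)" using d q by simp
    ultimately show "\<exists>B'\<in>?B. x \<in> B' \<and> B' \<subseteq> O'" using d e by (intro bexI[of _ "ball d (real_of_rat q)"]) auto
  qed auto
  moreover have "countable ?B" using cD by auto
  ultimately show "\<exists>B::'a set set. countable B \<and> open = generate_topology B"
    using topological_basis_imp_subbasis[of ?B] by (intro exI[of _ ?B] conjI)
qed


section \<open>Haar measure on a local field\<close>

text \<open>Intersecting with \<open>S\<close> respects complements and countable unions, so
  induction over the Borel sets applies. In the applications \<open>K\<close> consists of balls,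
  boxes or compact open sets, and the second assumption is a Lindelof argument.\<close>

lemma sigma_sets_restrict_borel:
  fixes S :: "'w::topological_space set"
  assumes "\<And>A. A \<in> K \<Longrightarrow> A \<in> sets (restrict_space borel S)"
    and "\<And>U. openin (top_of_set S) U \<Longrightarrow> \<exists>C. countable C \<and> C \<subseteq> K \<and> U = \<Union>C"
  shows "sigma_sets S K = sets (restrict_space borel S)"
proof
  have "S = space (restrict_space borel S)" by (simp add: space_restrict_space)
  then show "sigma_sets S K \<subseteq> sets (restrict_space borel S)"
    using sets.sigma_sets_subset[of K "restrict_space borel S"] assms(1) by auto
  show "sets (restrict_space borel S) \<subseteq> sigma_sets S K"
  proof -
    have "S \<inter> B \<in> sigma_sets S K" if "B \<in> sigma_sets UNIV {T. open T}" for B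
      using that
    proof induction
      case (Basic T)
      then have "openin (top_of_set S) (S \<inter> T)" by (simp add: openin_open_Int)
      from assms(2)[OF this] obtain C where C: "countable C \<and> C \<subseteq> K \<and> S \<inter> T = \<Union>C" ..
      have "\<Union>C \<in> sigma_sets S K"
        by (rule sigma_sets_UNION) (use C in \<open>auto intro: sigma_sets.Basic\<close>)
      then show ?case using C by simp
    next
      case Empty
      then show ?case by (simp add: sigma_sets.Empty)
    next
      case (Compl B)
      have "S \<inter> (UNIV - B) = S - S \<inter> B" by blast
      then show ?case using sigma_sets.Compl[OF Compl(2)] by simp
    next
      case (Union B)
      have "S \<inter> (\<Union>i. B i) = (\<Union>i. S \<inter> B i)" by blast
      then show ?case using sigma_sets.Union[of "\<lambda>i. S \<inter> B i", OF Union(2)] by simp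
    qed
    then show ?thesis
      unfolding sets_restrict_space borel_def by auto
  qed
qed

text \<open>Countable additivity is automatic: a compact set that is a disjoint union of open sets is a
  finite union of them.\<close>

lemma compact_open_ring_extension:
  fixes S :: "'w::topological_space set" and f :: "'w set \<Rightarrow> ennreal"
  assumes ring: "{} \<in> K" "\<And>A B. A \<in> K \<Longrightarrow> B \<in> K \<Longrightarrow> A \<union> B \<in> K" "\<And>A B. A \<in> K \<Longrightarrow> B \<in> K \<Longrightarrow> A - B \<in> K"
    and co: "\<And>A. A \<in> K \<Longrightarrow> compact A" "\<And>A. A \<in> K \<Longrightarrow> openin (top_of_set S) A"
    and gen: "\<And>U. openin (top_of_set S) U \<Longrightarrow> \<exists>C. countable C \<and> C \<subseteq> K \<and> U = \<Union>C"
    and f0: "f {} = 0"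
    and add: "\<And>A B. A \<in> K \<Longrightarrow> B \<in> K \<Longrightarrow> A \<inter> B = {} \<Longrightarrow> f (A \<union> B) = f A + f B"
  shows "\<exists>M. sets M = sets (restrict_space borel S) \<and> (\<forall>A\<in>K. emeasure M A = f A)"
proof -
  have KS: "K \<subseteq> Pow S" using co(2) openin_imp_subset by blast
  interpret ring_of_sets S K
    using KS ring by (intro ring_of_setsI) auto
  have fin_add: "f (\<Union>i\<in>I. A i) = (\<Sum>i\<in>I. f (A i)) \<and> (\<Union>i\<in>I. A i) \<in> K"
    if "finite I" "\<And>i. i \<in> I \<Longrightarrow> A i \<in> K" "disjoint_family_on A I" for A and I :: "nat set"
    using that
  proof (induction I rule: finite_induct)
    case (insert i I)
    have d: "disjoint_family_on A I" using insert(5) by (auto simp: disjoint_family_on_def)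
    have "A i \<inter> (\<Union>i\<in>I. A i) = {}"
      using insert(2,5) by (fastforce simp: disjoint_family_on_def)
    then show ?case using insert.IH[OF _ d] insert add ring(2) by simp
  qed (simp add: f0 ring)
  have ca: "countably_additive K f"
  proof (rule countably_additiveI)
    fix A :: "nat \<Rightarrow> 'w set"
    assume A: "range A \<subseteq> K" "disjoint_family A" "(\<Union>i. A i) \<in> K"
    have "\<forall>i. \<exists>T. open T \<and> A i = S \<inter> T" using co(2) A(1) by (metis openin_open range_subsetD)
    then obtain T where T: "\<And>i. open (T i)" "\<And>i. A i = S \<inter> T i" by metis
    obtain I where I: "finite I" "(\<Union>i. A i) \<subseteq> (\<Union>i\<in>I. T i)"
    proof (rule compactE_image[OF co(1)[OF A(3)], of UNIV T])
      show "(\<Union>i. A i) \<subseteq> (\<Union>i. T i)" using T by blast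
    qed (use T in auto)
    have empty: "A i = {}" if "i \<notin> I" for i
    proof (rule ccontr)
      assume "A i \<noteq> {}"
      then obtain x where x: "x \<in> A i" by blast
      then obtain j where j: "j \<in> I" "x \<in> T j" using I(2) by blast
      then have "x \<in> A j" using x T(2) by blast
      moreover have "i \<noteq> j" using j that by blast
      ultimately show False using A(2) x unfolding disjoint_family_on_def by blast
    qed
    have "(\<Sum>i. f (A i)) = (\<Sum>i\<in>I. f (A i))"
      by (rule suminf_finite[OF I(1)]) (simp add: empty f0)
    moreover have "(\<Union>i. A i) = (\<Union>i\<in>I. A i)" using empty by blast
    moreover have "f (\<Union>i\<in>I. A i) = (\<Sum>i\<in>I. f (A i))"
      using fin_add[OF I(1), of A] A by (auto simp: disjoint_family_on_def)
    ultimately show "(\<Sum>i. f (A i)) = f (\<Union>i. A i)" by simp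
  qed
  obtain \<mu> where \<mu>: "\<And>s. s \<in> K \<Longrightarrow> \<mu> s = f s" "measure_space S (sigma_sets S K) \<mu>"
    using caratheodory'[OF _ ca] f0 by (auto simp: positive_def)
  have ss: "sigma_sets S K = sets (restrict_space borel S)"
  proof (rule sigma_sets_restrict_borel)
    fix A assume "A \<in> K"
    then obtain T where "open T" "A = S \<inter> T" using co(2) by (metis openin_open)
    then show "A \<in> sets (restrict_space borel S)" by (auto simp: sets_restrict_space)
  qed (use gen in auto)
  define M where "M = measure_of S K \<mu>"
  have sM: "sets M = sigma_sets S K" unfolding M_def using KS by simp
  have "emeasure M A = f A" if "A \<in> K" for A
    using emeasure_measure_of[OF M_def KS, of A] \<mu> that sM
    by (simp add: measure_space_def)
  then show ?thesis using sM ss by blast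
qed

text \<open>Locally constant maps on compact sets. Applied to the map from a point to the ball or
  box of fixed radius around it, this shows that only finitely many of them occur.\<close>

lemma finite_partition_compact:
  assumes "compact A" and "\<And>x. x \<in> A \<Longrightarrow> \<exists>T. open T \<and> x \<in> T \<and> (\<forall>y\<in>A \<inter> T. P y = P x)"
  shows "finite (P ` A)"
proof -
  obtain T where T: "\<And>x. x \<in> A \<Longrightarrow> open (T x)" "\<And>x. x \<in> A \<Longrightarrow> x \<in> T x"
    "\<And>x y. x \<in> A \<Longrightarrow> y \<in> A \<Longrightarrow> y \<in> T x \<Longrightarrow> P y = P x"
    using assms(2) by (metis IntI)
  obtain C where C: "C \<subseteq> A" "finite C" "A \<subseteq> (\<Union>x\<in>C. T x)"
    by (rule compactE_image[OF assms(1), of A T]) (use T in auto)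
  then have "P ` A \<subseteq> P ` C" using T(3) by blast
  then show ?thesis using C(2) finite_surj by blast
qed

section \<open>Ultrametric balls and their number in a compact set\<close>

lemma cball_eq: "y \<in> cball x r \<Longrightarrow> cball y r = cball x r" for x y :: "'f::nonarch_local_field"
proof -
  have "cball y r \<subseteq> cball x r" if "y \<in> cball x r" for x y :: 'f
  proof
    fix z assume "z \<in> cball y r"
    then show "z \<in> cball x r" using that ultrametric[of x z y] by auto
  qed
  then show "y \<in> cball x r \<Longrightarrow> cball y r = cball x r" by (metis centre_in_cball dist_commute mem_cball zero_le_dist order_trans subset_antisym)
qed

lemma cball_subset: "y \<in> cball x r \<Longrightarrow> r' \<le> r \<Longrightarrow> cball y r' \<subseteq> cball x r" for x y :: "'f::nonarch_local_field"
  using cball_eq[of y x r] subset_cball by blast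

lemma open_cball: "r > 0 \<Longrightarrow> open (cball x r)" for x :: "'f::nonarch_local_field"
  unfolding open_contains_cball using cball_eq by blast

lemma cball_nested: "cball x r \<inter> cball y s = {} \<or> cball x r \<subseteq> cball y s \<or> cball y s \<subseteq> cball x r"
  for x y :: "'f::nonarch_local_field"
proof (cases "r \<le> s")
  case True
  then show ?thesis using cball_eq[of _ x r] cball_subset[of _ y s r] by blast
next
  case False
  then show ?thesis using cball_eq[of _ y s] cball_subset[of _ x r s] by (metis disjoint_iff linear)
qed

lemma cball_translate: "(+) w ` cball x r = cball (w + x) r" for x :: "'f::nonarch_local_field"
proof -
  have "y \<in> (+) w ` cball x r" if "y \<in> cball (w + x) r" for y
  proof -
    have "y = w + (y - w)" by simp
    moreover have "y - w \<in> cball x r" using that dist_translate[of x w "y - w"] by (simp add: add.commute)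
    ultimately show ?thesis by blast
  qed
  moreover have "w + y \<in> cball (w + x) r" if "y \<in> cball x r" for y
    using that dist_translate[of x w y] by (simp add: add.commute)
  ultimately show ?thesis by blast
qed

lemma cball_scale: "a \<noteq> 0 \<Longrightarrow> (*) a ` cball x r = cball (a * x) (av a * r)" for a :: "'f::nonarch_local_field"
proof -
  assume a: "a \<noteq> 0"
  have d: "dist (a * x) (a * y) = av a * dist x y" for x y
    unfolding dist_eq_av[of "a * x"] dist_eq_av[of x] by (simp flip: dist_0_mult add: right_diff_distrib)
  have "y \<in> (*) a ` cball x r" if "y \<in> cball (a * x) (av a * r)" for y
  proof -
    have y: "y = a * (inverse a * y)" using a by simp
    then have "inverse a * y \<in> cball x r" using that d[of x "inverse a * y"] a y by (metis dist_pos_lt mem_cball mult_le_cancel_left_pos)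
    then show ?thesis using y by blast
  qed
  then show ?thesis using d a by (auto simp: mult_left_mono)
qed

text \<open>Distinct balls are counted, not centres. Ratios of such counts at one small radius will
  serve as volumes, which makes translation invariance immediate.\<close>

definition ball_count :: "real \<Rightarrow> 'f::nonarch_local_field set \<Rightarrow> nat" where
  "ball_count r A = card ((\<lambda>x. cball x r) ` A)"

lemma finite_cballs: "compact A \<Longrightarrow> r > 0 \<Longrightarrow> finite ((\<lambda>x. cball x r) ` A)" for A :: "'f::nonarch_local_field set"
  proof (erule finite_partition_compact)
  fix x :: 'f assume "r > 0"
  then show "\<exists>T. open T \<and> x \<in> T \<and> (\<forall>y\<in>A \<inter> T. cball y r = cball x r)"
    by (intro exI[of _ "cball x r"] conjI ballI open_cball cball_eq) auto
qed

lemma ball_count_pos: "compact A \<Longrightarrow> r > 0 \<Longrightarrow> A \<noteq> {} \<Longrightarrow> ball_count r A > 0"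
  unfolding ball_count_def using finite_cballs by (auto simp: card_gt_0_iff)

lemma compact_cballF: "compact (cball x r)" for x :: "'f::nonarch_local_field"
  by (rule compact_cball)

lemma ball_count_translate: "ball_count r ((+) w ` A) = ball_count r A"
proof -
  have "(\<lambda>x. cball x r) ` (+) w ` A = (`) ((+) w) ` (\<lambda>x. cball x r) ` A"
    by (simp add: image_image cball_translate)
  moreover have "inj_on ((`) ((+) w)) X" for X
    by (rule inj_onI) (simp add: inj_image_eq_iff)
  ultimately show ?thesis unfolding ball_count_def by (simp add: card_image)
qed

lemma count_cballs_measure:
  fixes \<mu> :: "'f::nonarch_local_field measure"
  assumes \<mu>: "sets \<mu> = sets borel" "\<And>x r. r > 0 \<Longrightarrow> emeasure \<mu> (cball x r) = emeasure \<mu> (cball 0 r)"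
    and A: "compact A" "r > 0" "\<And>x. x \<in> A \<Longrightarrow> cball x r \<subseteq> A"
  shows "emeasure \<mu> A = of_nat (ball_count r A) * emeasure \<mu> (cball 0 r)"
proof -
  let ?P = "(\<lambda>x. cball x r) ` A"
  have U: "A = \<Union>?P"
  proof
    show "A \<subseteq> \<Union>?P"
    proof
      fix x assume "x \<in> A"
      then show "x \<in> \<Union>?P" using A(2) by (intro UnionI[of "cball x r"]) auto
    qed
  qed (use A(3) in blast)
  have "emeasure \<mu> (\<Union>B\<in>?P. B) = (\<Sum>B\<in>?P. emeasure \<mu> B)"
  proof (rule sum_emeasure[symmetric])
    show "disjoint_family_on (\<lambda>B. B) ?P"
      unfolding disjoint_family_on_def using cball_eq by blast
    show "finite ?P" using finite_cballs[OF A(1,2)] .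
  qed (auto simp: \<mu>(1))
  also have "\<dots> = (\<Sum>B\<in>?P. emeasure \<mu> (cball 0 r))"
    by (rule sum.cong) (use \<mu>(2)[OF A(2)] in auto)
  finally show ?thesis using U by (simp add: ball_count_def)
qed

text \<open>All balls of radius \<open>r\<close> are translates of one another, so each splits into
  equally many balls of radius \<open>r'\<close>. Hence ratios of counts do not change when the
  radius shrinks.\<close>

lemma ball_count_refine:
  fixes A :: "'f::nonarch_local_field set"
  assumes A: "compact A" "r > 0" "\<And>x. x \<in> A \<Longrightarrow> cball x r \<subseteq> A" and r': "0 < r'" "r' \<le> r"
  shows "ball_count r' A = ball_count r A * ball_count r' (cball (0::'f) r)"
proof -
  let ?Q = "\<lambda>B. (\<lambda>x. cball x r') ` B" and ?P = "(\<lambda>x. cball x r) ` A"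
  have "?Q A = (\<Union>B\<in>?P. ?Q B)"
  proof
    show "?Q A \<subseteq> (\<Union>B\<in>?P. ?Q B)"
    proof
      fix B assume "B \<in> ?Q A"
      then obtain x where x: "x \<in> A" "B = cball x r'" by blast
      then show "B \<in> (\<Union>B\<in>?P. ?Q B)" using A(2) by (intro UN_I[of "cball x r"]) auto
    qed
  qed (use A(3) in blast)
  then have "ball_count r' A = card (\<Union>B\<in>?P. ?Q B)" by (simp add: ball_count_def)
  also have "\<dots> = (\<Sum>B\<in>?P. card (?Q B))"
  proof (rule card_UN_disjoint)
    show "finite ?P" using finite_cballs A by blast
    show "\<forall>B\<in>?P. finite (?Q B)" using finite_cballs[OF compact_cballF r'(1)] by auto
    show "\<forall>B\<in>?P. \<forall>C\<in>?P. B \<noteq> C \<longrightarrow> ?Q B \<inter> ?Q C = {}"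
    proof (intro ballI impI)
      fix B C assume BC: "B \<in> ?P" "C \<in> ?P" "B \<noteq> C"
      show "?Q B \<inter> ?Q C = {}"
      proof (rule ccontr)
        assume "?Q B \<inter> ?Q C \<noteq> {}"
        then obtain x y where xy: "x \<in> B" "y \<in> C" "cball x r' = cball y r'" by auto
        then have "y \<in> cball x r'" using r' by (metis centre_in_cball less_imp_le)
        then have "y \<in> cball x r" using r' by auto
        then have "y \<in> B" using BC(1) xy(1) cball_eq by blast
        then show False using BC xy(2) cball_eq by blast
      qed
    qed
  qed
  also have "\<dots> = (\<Sum>B\<in>?P. ball_count r' (cball (0::'f) r))"
  proof (rule sum.cong)
    fix B assume "B \<in> ?P"
    then obtain x where "B = (+) x ` cball 0 r" by (auto simp: cball_translate)
    then show "card (?Q B) = ball_count r' (cball (0::'f) r)" using ball_count_translate unfolding ball_count_def by metis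
  qed simp
  finally show ?thesis by (simp add: ball_count_def)
qed

lemma cball_generate_borel:
  "sigma_sets UNIV (insert {} {cball x r |x r. r > 0}) = sets (borel :: 'f::nonarch_local_field measure)"
proof -
  have "sigma_sets UNIV (insert {} {cball x r |x r. r > 0}) = sets (restrict_space (borel::'f measure) UNIV)"
  proof (rule sigma_sets_restrict_borel)
    fix U :: "'f set" assume "openin (top_of_set UNIV) U"
    then have U: "open U" by simp
    let ?F = "{cball x r |x r. r > 0 \<and> cball x r \<subseteq> U}"
    have o: "\<And>S. S \<in> ?F \<Longrightarrow> open S" using open_cball by auto
    obtain C where C: "C \<subseteq> ?F" "countable C" "\<Union>C = \<Union>?F" by (rule Lindelof[of ?F], erule o, rule that)
    moreover have "\<Union>?F = U"
    proof
      show "U \<subseteq> \<Union>?F"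
      proof
        fix x assume "x \<in> U"
        then obtain e where "e > 0" "cball x e \<subseteq> U" using U open_contains_cball by blast
        then show "x \<in> \<Union>?F" by (intro UnionI[of "cball x e"]) auto
      qed
    qed auto
    ultimately show "\<exists>C. countable C \<and> C \<subseteq> insert {} {cball x r |x r. r > 0} \<and> U = \<Union> C"
      by (intro exI[of _ C]) auto
  qed auto
  then show ?thesis by simp
qed

text \<open>Two balls are nested or disjoint, so together with the empty set they are stable under
  intersection, and balls of integer radius exhaust the field. The uniqueness theorem for measures
  then applies.\<close>

lemma measure_eq_on_cballs:
  fixes M N :: "'f::nonarch_local_field measure"
  assumes "sets M = sets borel" "sets N = sets borel"
    and eq: "\<And>x r. r > 0 \<Longrightarrow> emeasure M (cball x r) = emeasure N (cball x r)"
    and fin: "\<And>x r. r > 0 \<Longrightarrow> emeasure M (cball x r) \<noteq> \<infinity>"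
  shows "M = N"
proof (rule measure_eqI_generator_eq[where A="\<lambda>i. cball 0 (real (Suc i))"])
  let ?E = "insert {} {cball x r |(x::'f) r. r > 0}"
  show "Int_stable ?E"
  proof (rule Int_stableI)
    fix a b assume "a \<in> ?E" "b \<in> ?E"
    then show "a \<inter> b \<in> ?E"
    proof (elim insertE CollectE exE conjE)
      fix x y :: 'f and r s assume *: "a = cball x r" "r > 0" "b = cball y s" "s > 0"
      consider "a \<inter> b = {}" | "a \<subseteq> b" | "b \<subseteq> a" using cball_nested[of x r y s] * by blast
      then have "a \<inter> b = {} \<or> a \<inter> b = a \<or> a \<inter> b = b" by cases auto
      then show ?thesis using * by auto
    qed auto
  qed
  show "(\<Union>i. cball 0 (real (Suc i))) = (UNIV :: 'f set)"
  proof -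
    have "\<exists>i. x \<in> cball 0 (real (Suc i))" for x :: 'f
      using real_arch_simple[of "av x"] by (metis dual_order.trans le_SucI mem_cball of_nat_mono order_refl)
    then show ?thesis by blast
  qed
  show "range (\<lambda>i. cball 0 (real (Suc i))) \<subseteq> ?E"
  proof (rule image_subsetI)
    fix i
    have "0 < real (Suc i)" by simp
    then show "cball 0 (real (Suc i)) \<in> ?E" by blast
  qed
  show "emeasure M (cball 0 (real (Suc i))) \<noteq> \<infinity>" for i by (rule fin) simp
qed (use assms(1,2) eq cball_generate_borel in auto)

text \<open>The volume of a compact open set is its number of balls of a small radius, divided by
  the number in the unit ball. By \<open>ball_count_refine\<close> this quotient is constant as soon
  as the set is a union of balls of that radius.\<close>

lemma haar_exists: "\<exists>\<mu>. haar_measure_on (UNIV::'f::nonarch_local_field set) \<mu> \<and> emeasure \<mu> integer_ring = 1"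
proof -
  let ?O = "cball (0::'f) 1"
  let ?K = "{A::'f set. compact A \<and> open A}"
  \<comment> \<open>The bound \<open>r \<le> 1\<close> ensures that the unit ball, which gives the
    denominator, is itself a union of balls of radius \<open>r\<close>.\<close>
  define sat where "sat r A \<longleftrightarrow> 0 < r \<and> r \<le> 1 \<and> (\<forall>x\<in>A. cball x r \<subseteq> A)" for r and A :: "'f set"
  have ex: "\<exists>r. sat r A" if "A \<in> ?K" for A
  proof -
    obtain e where e: "e > 0" "(\<Union>x\<in>A. ball x e) \<subseteq> A"
      using compact_subset_open_imp_ball_epsilon_subset[of A A] \<open>A \<in> ?K\<close> by auto
    have "cball x (min 1 (e / 2)) \<subseteq> A" if "x \<in> A" for x
      using e that by (force intro: subset_trans[of _ "ball x e"])
    then show ?thesis using e(1) unfolding sat_def by (intro exI[of _ "min 1 (e/2)"]) auto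
  qed
  define hh where "hh r A = real (ball_count r A) / real (ball_count r ?O)" for r and A :: "'f set"
  define f where "f A = hh (SOME r. sat r A) A" for A :: "'f set"
  have hh_mono: "hh r' A = hh r A" if "A \<in> ?K" "sat r A" "0 < r'" "r' \<le> r" for r r' A
  proof -
    have r: "0 < r" "r \<le> 1" using that(2) by (auto simp: sat_def)
    have "ball_count r' A = ball_count r A * ball_count r' (cball (0::'f) r)"
      using that by (intro ball_count_refine) (auto simp: sat_def)
    moreover have "ball_count r' ?O = ball_count r ?O * ball_count r' (cball (0::'f) r)"
      using that r by (intro ball_count_refine) (auto simp del: mem_cball simp: cball_subset)
    moreover have "ball_count r' (cball (0::'f) r) > 0" "ball_count r ?O > 0"
      using r that by (auto intro!: ball_count_pos)
    ultimately show ?thesis unfolding hh_def by simp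
  qed
  have hf: "f A = hh r A" if "A \<in> ?K" "sat r A" for r A
  proof -
    define r' where "r' = (SOME r. sat r A)"
    have r': "sat r' A" unfolding r'_def using that(2) by (rule someI)
    have "hh (min r r') A = hh r A" "hh (min r r') A = hh r' A"
      using that r' by (auto intro!: hh_mono simp: sat_def)
    then show ?thesis by (simp add: f_def r'_def)
  qed
  have f_nonneg: "f A \<ge> 0" for A by (simp add: f_def hh_def)
  have "\<exists>M. sets M = sets (restrict_space borel (UNIV::'f set)) \<and> (\<forall>A\<in>?K. emeasure M A = ennreal (f A))"
  proof (rule compact_open_ring_extension)
    show "\<And>A B. A \<in> ?K \<Longrightarrow> B \<in> ?K \<Longrightarrow> A - B \<in> ?K"
      by (auto intro: compact_diff open_Diff compact_imp_closed)
    show "\<exists>C. countable C \<and> C \<subseteq> ?K \<and> U = \<Union>C" if "openin (top_of_set UNIV) U" for U :: "'f set"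
    proof -
      have U: "open U" using that by simp
      let ?F = "{cball x r |x r. r > 0 \<and> cball x r \<subseteq> U}"
      have o: "\<And>S. S \<in> ?F \<Longrightarrow> open S" using open_cball by auto
      obtain C where C: "C \<subseteq> ?F" "countable C" "\<Union>C = \<Union>?F" by (rule Lindelof[of ?F], erule o, rule that)
      moreover have "U \<subseteq> \<Union>?F"
      proof
        fix x assume "x \<in> U"
        then obtain e where "e > 0" "cball x e \<subseteq> U" using U open_contains_cball by blast
        then show "x \<in> \<Union>?F" by (intro UnionI[of "cball x e"]) auto
      qed
      moreover have "?F \<subseteq> ?K" using open_cball compact_cballF by auto
      moreover have "\<Union>?F \<subseteq> U" by auto
      ultimately show ?thesis by (intro exI[of _ C] conjI) (assumption, rule subset_trans, assumption+, simp)
    qed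
    show "ennreal (f {}) = 0" by (simp add: f_def hh_def ball_count_def)
    fix A B assume AB: "A \<in> ?K" "B \<in> ?K" "A \<inter> B = {}"
    obtain r s where rs: "sat r A" "sat s B" using ex AB by meson
    define t where "t = min r s"
    have t: "sat t A" "sat t B" "sat t (A \<union> B)"
      using rs subset_cball[of t r] subset_cball[of t s] unfolding sat_def t_def by (auto 0 3 simp: min_le_iff_disj)
    have "t > 0" using t by (simp add: sat_def)
    have "card ((\<lambda>x. cball x t) ` (A \<union> B)) = card ((\<lambda>x. cball x t) ` A) + card ((\<lambda>x. cball x t) ` B)"
      unfolding image_Un
    proof (rule card_Un_disjoint)
      show "(\<lambda>x. cball x t) ` A \<inter> (\<lambda>x. cball x t) ` B = {}"
      proof (rule ccontr)
        assume "(\<lambda>x. cball x t) ` A \<inter> (\<lambda>x. cball x t) ` B \<noteq> {}"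
        then obtain x y where "x \<in> A" "y \<in> B" "cball x t = cball y t" by auto
        then have "y \<in> A \<inter> B" using t(1) unfolding sat_def by (metis IntI centre_in_cball less_imp_le subsetD)
        then show False using AB by simp
      qed
    qed (use finite_cballs[OF _ \<open>t > 0\<close>] AB in auto)
    then have "hh t (A \<union> B) = hh t A + hh t B" by (simp add: hh_def ball_count_def add_divide_distrib)
    moreover have "A \<union> B \<in> ?K" using AB by auto
    ultimately have "f (A \<union> B) = f A + f B" using hf[OF _ t(1)] hf[OF _ t(2)] hf[OF _ t(3)] AB by simp
    then show "ennreal (f (A \<union> B)) = ennreal (f A) + ennreal (f B)" by (simp add: ennreal_plus f_nonneg)
  qed (auto)
  then obtain M where M: "sets M = sets borel" "\<And>A. compact A \<Longrightarrow> open A \<Longrightarrow> emeasure M A = ennreal (f A)"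
    by auto
  have trans: "emeasure M (cball x r) = emeasure M (cball 0 r)" if "r > 0" for x r
  proof -
    obtain t where t: "sat t (cball (0::'f) r)"
      using ex[of "cball 0 r"] open_cball[OF \<open>r > 0\<close>, of 0] compact_cballF by auto
    have "cball y t \<subseteq> cball x r" if "y \<in> cball x r" for y
    proof -
      have "y - x \<in> cball 0 r" using that by (simp add: dist_eq_av[of x])
      then have "cball (y - x) t \<subseteq> cball 0 r" using t by (simp add: sat_def)
      then have "(+) x ` cball (y - x) t \<subseteq> (+) x ` cball 0 r" by (rule image_mono)
      then show ?thesis by (simp add: cball_translate)
    qed
    then have t': "sat t (cball x r)" using t by (simp add: sat_def)
    have "ball_count t (cball x r) = ball_count t (cball (0::'f) r)"
      using ball_count_translate[of t x "cball 0 r"] by (simp add: cball_translate)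
    then have "f (cball x r) = f (cball 0 r)"
      using hf[OF _ t] hf[OF _ t'] open_cball[OF that, of x] open_cball[OF that, of "0::'f"] by (simp add: hh_def)
    then show ?thesis using M(2) by (simp add: open_cball that)
  qed
  have fin: "emeasure M (cball x r) \<noteq> \<infinity>" if "r > 0" for x r
    using M(2) by (simp add: open_cball that)
  have one: "emeasure M integer_ring = 1"
  proof -
    have "integer_ring = ?O" by (auto simp: integer_ring_def)
    moreover have "sat 1 ?O" by (auto simp del: mem_cball simp: sat_def cball_subset)
    moreover have "ball_count 1 ?O > 0" by (intro ball_count_pos) auto
    ultimately show ?thesis using M(2) hf[of ?O 1] open_cball[of 1 "0::'f"] compact_cballF[of "0::'f" 1] by (simp add: hh_def)
  qed
  have inv: "emeasure M ((+) w ` A) = emeasure M A" if "A \<in> sets M" for w A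
  proof -
    \<comment> \<open>Invariance is so far known on balls only; the image measure under translation
      agrees with \<open>M\<close> there, hence on all Borel sets.\<close>
    have "M = distr M borel ((+) (-w))"
    proof (rule measure_eq_on_cballs)
      have meas: "(+) (- w) \<in> measurable M borel"
        using M(1) borel_measurable_continuous_onI[of "(+) (-w)"] by (simp add: continuous_intros cong: measurable_cong_sets)
      fix x :: 'f and r :: real assume r: "r > 0"
      have "(+) (- w) -` cball x r \<inter> space M = cball (w + x) r"
      proof -
        have "dist x (- w + y) = dist (w + x) y" for y
          using dist_translate[of x w "- w + y"] by (simp add: add.commute)
        then show ?thesis using sets_eq_imp_space_eq[OF M(1)] by auto
      qed
      then show "emeasure M (cball x r) = emeasure (distr M borel ((+) (- w))) (cball x r)"
        using trans[OF r, of x] trans[OF r, of "w + x"] by (simp add: emeasure_distr[OF meas])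
    qed (use M fin in auto)
    moreover have meas: "(+) (- w) \<in> measurable M borel"
        using M(1) borel_measurable_continuous_onI[of "(+) (-w)"] by (simp add: continuous_intros cong: measurable_cong_sets)
    moreover have "(+) (- w) -` A \<inter> space M = (+) w ` A"
      using sets_eq_imp_space_eq[OF M(1)] by (force simp: image_iff intro: bexI[of _ "- w + _"])
    ultimately show ?thesis using that emeasure_distr[OF meas, of A] M(1) by simp
  qed
  have "haar_measure_on UNIV M"
    unfolding haar_measure_on_def
  proof (intro conjI ballI allI impI)
    fix K :: "'f set" assume K: "K \<subseteq> UNIV \<and> compact K"
    then have "bounded K" by (simp add: compact_imp_bounded)
    then obtain R where "\<forall>y\<in>K. av y \<le> R" by (auto simp: bounded_any_center[where a=0])
    then have R: "K \<subseteq> cball 0 R" by auto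
    then have "K \<subseteq> cball 0 (max R 1)" by auto
    then have "emeasure M K \<le> emeasure M (cball 0 (max R 1))" by (rule emeasure_mono) (simp add: M)
    then show "emeasure M K < \<infinity>" using fin[of "max R 1" 0] by (simp add: less_top le_less_trans)
  next
    fix U :: "'f set" assume U: "openin (top_of_set UNIV) U \<and> U \<noteq> {}"
    then obtain x where "x \<in> U" by blast
    then obtain e where e: "e > 0" "cball x e \<subseteq> U" using U open_contains_cball[of U] by auto
    have "emeasure M integer_ring \<noteq> 0" using one by simp
    \<comment> \<open>If balls of radius \<open>e\<close> were null, so would be a larger ball
      containing the unit ball, which has measure 1.\<close>
    have "emeasure M (cball 0 (max 1 e)) = of_nat (ball_count e (cball (0::'f) (max 1 e))) * emeasure M (cball 0 e)"
      using e by (intro count_cballs_measure M trans) (auto simp del: mem_cball simp: cball_subset)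
    moreover have "emeasure M integer_ring \<le> emeasure M (cball 0 (max 1 e))"
      by (rule emeasure_mono) (auto simp: integer_ring_def M)
    ultimately have "emeasure M (cball 0 e) \<noteq> 0" using one by auto
    then have "emeasure M (cball x e) > 0" using trans[OF e(1), of x] by (simp add: zero_less_iff_neq_zero)
    moreover have "emeasure M (cball x e) \<le> emeasure M U" using e U M by (intro emeasure_mono) auto
    ultimately show "0 < emeasure M U" by simp
  qed (use M inv in auto)
  then show ?thesis using one by blast
qed

lemma haar_cball:
  fixes \<mu> :: "'f::nonarch_local_field measure"
  assumes "haar_measure_on UNIV \<mu>"
  shows "sets \<mu> = sets borel" "emeasure \<mu> (cball x r) = emeasure \<mu> (cball 0 r)" "emeasure \<mu> (cball x r) \<noteq> \<infinity>"
    "r > 0 \<Longrightarrow> emeasure \<mu> (cball x r) > 0"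
proof -
  show s: "sets \<mu> = sets borel" using assms by (simp add: haar_measure_on_def)
  show "emeasure \<mu> (cball x r) = emeasure \<mu> (cball 0 r)"
    using assms s cball_translate[of x 0 r] unfolding haar_measure_on_def by (metis UNIV_I add.right_neutral borel_closed closed_cball)
  show "emeasure \<mu> (cball x r) \<noteq> \<infinity>"
    using assms compact_cballF unfolding haar_measure_on_def by (metis less_irrefl subset_UNIV)
  show "r > 0 \<Longrightarrow> emeasure \<mu> (cball x r) > 0"
    using assms open_cball[of r x] unfolding haar_measure_on_def by auto
qed

text \<open>The larger ball contains a number of balls of the smaller radius that is the same for
  both measures. Products avoid division by a value that might be 0 or infinite.\<close>

lemma cball_ratio:
  fixes \<mu> \<nu> :: "'f::nonarch_local_field measure"
  assumes \<mu>: "sets \<mu> = sets borel" "\<And>x r. r > 0 \<Longrightarrow> emeasure \<mu> (cball x r) = emeasure \<mu> (cball 0 r)"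
    and \<nu>: "sets \<nu> = sets borel" "\<And>x r. r > 0 \<Longrightarrow> emeasure \<nu> (cball x r) = emeasure \<nu> (cball 0 r)"
    and r: "r > 0" "s > 0"
  shows "emeasure \<mu> (cball 0 r) * emeasure \<nu> (cball 0 s) = emeasure \<nu> (cball 0 r) * emeasure \<mu> (cball 0 s)"
proof -
  have *: "emeasure \<mu> (cball 0 r) * emeasure \<nu> (cball 0 s) = emeasure \<nu> (cball 0 r) * emeasure \<mu> (cball 0 s)"
    if "r > 0" "r \<le> s" for r s
  proof -
    have "emeasure \<mu> (cball 0 s) = of_nat (ball_count r (cball (0::'f) s)) * emeasure \<mu> (cball 0 r)"
      using that by (intro count_cballs_measure \<mu>) (auto simp del: mem_cball simp: cball_subset)
    moreover have "emeasure \<nu> (cball 0 s) = of_nat (ball_count r (cball (0::'f) s)) * emeasure \<nu> (cball 0 r)"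
      using that by (intro count_cballs_measure \<nu>) (auto simp del: mem_cball simp: cball_subset)
    ultimately show ?thesis by (simp add: ac_simps)
  qed
  show ?thesis using *[of r s] *[of s r] r by (cases "r \<le> s") (auto simp: mult.commute)
qed

section \<open>Normalised Haar measure, ball volumes and the modulus\<close>

abbreviation hF :: "'f::nonarch_local_field measure" where "hF \<equiv> normalized_haar"

text \<open>Makes the definite description \<open>normalized_haar\<close> meaningful. For
  uniqueness, \<open>cball_ratio\<close> with the unit ball as reference determines the volume of
  every ball.\<close>

lemma hF: "haar_measure_on (UNIV::'f::nonarch_local_field set) hF" "emeasure (hF :: 'f measure) integer_ring = 1"
proof -
  have "\<exists>!\<mu>. haar_measure_on (UNIV::'f set) \<mu> \<and> emeasure \<mu> integer_ring = 1"
  proof (rule ex_ex1I[OF haar_exists])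
    fix M N :: "'f measure"
    assume M: "haar_measure_on UNIV M \<and> emeasure M integer_ring = 1"
      and N: "haar_measure_on UNIV N \<and> emeasure N integer_ring = 1"
    have O: "integer_ring = cball (0::'f) 1" by (auto simp: integer_ring_def)
    show "M = N"
    proof (rule measure_eq_on_cballs)
      fix x :: 'f and r :: real assume "r > 0"
      then show "emeasure M (cball x r) = emeasure N (cball x r)"
        using cball_ratio[of M N r 1] haar_cball(1,2)[of M] haar_cball(1,2)[of N] M N
        by (metis O mult.right_neutral zero_less_one)
    next
      fix x :: 'f and r :: real
      show "emeasure M (cball x r) \<noteq> \<infinity>" using haar_cball(3)[of M] M by blast
    qed (use M N haar_cball(1) in auto)
  qed
  from theI'[OF this] show "haar_measure_on (UNIV::'f set) hF" "emeasure (hF :: 'f measure) integer_ring = 1"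
    unfolding normalized_haar_def by auto
qed

definition ball_volume :: "'f::nonarch_local_field itself \<Rightarrow> real \<Rightarrow> real" where
  "ball_volume _ r = measure (hF :: 'f measure) (cball 0 r)"

lemma sets_hF [measurable_cong]: "sets (hF :: 'f::nonarch_local_field measure) = sets borel"
  using hF(1) haar_cball by blast

lemma space_hF [simp]: "space (hF :: 'f::nonarch_local_field measure) = UNIV"
  using sets_eq_imp_space_eq[OF sets_hF] by simp

lemma emeasure_hF_cball: "emeasure hF (cball x r) = ennreal (ball_volume TYPE('f) r)" for x :: "'f::nonarch_local_field"
  using haar_cball(2,3)[OF hF(1)] unfolding ball_volume_def
  by (metis emeasure_eq_ennreal_measure infinity_ennreal_def)

lemma ball_volume_pos: "r > 0 \<Longrightarrow> ball_volume TYPE('f::nonarch_local_field) r > 0"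
  using haar_cball(4)[OF hF(1), of r "0::'f"] emeasure_hF_cball[of "0::'f" r] by (simp add: ennreal_less_zero_iff)

lemma ball_volume_one: "ball_volume TYPE('f::nonarch_local_field) 1 = 1"
proof -
  have "integer_ring = cball (0::'f) 1" by (auto simp: integer_ring_def)
  then show ?thesis using hF(2)[where 'f='f] by (simp add: ball_volume_def measure_def)
qed

lemma modulus_eq_ball_volume: "a \<noteq> 0 \<Longrightarrow> modulus a = ball_volume TYPE('f) (av a)" for a :: "'f::nonarch_local_field"
proof -
  assume "a \<noteq> 0"
  moreover have "integer_ring = cball (0::'f) 1" by (auto simp: integer_ring_def)
  ultimately show ?thesis using cball_scale[of a 0 1] by (simp add: modulus_def ball_volume_def)
qed

lemma modulus_pos: "a \<noteq> 0 \<Longrightarrow> modulus a > 0"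
  by (simp add: modulus_eq_ball_volume ball_volume_pos)

text \<open>The image of Haar measure under multiplication by \<open>inverse a\<close> again gives
  equal volume to balls of equal radius. By \<open>cball_ratio\<close> it differs from Haar measure
  by one factor, read off at the unit ball.\<close>

lemma ball_volume_scale:
  fixes a :: "'f::nonarch_local_field"
  assumes a: "a \<noteq> 0" and r: "r > 0"
  shows "ball_volume TYPE('f) (av a * r) = modulus a * ball_volume TYPE('f) r"
proof -
  define N where "N = distr hF borel ((*) (inverse a))"
  have meas: "(*) (inverse a) \<in> measurable hF borel"
    using borel_measurable_continuous_onI[of "(*) (inverse a)"]
    by (simp add: continuous_intros cong: measurable_cong_sets[OF sets_hF refl])
  have N: "emeasure N (cball x s) = ennreal (ball_volume TYPE('f) (av a * s))" for x s
  proof -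
    have "(*) (inverse a) -` cball x s \<inter> space hF = (*) a ` cball x s"
      using a by (auto simp: image_iff mult.assoc[symmetric] intro!: bexI[of _ "inverse a * _"])
    then show ?thesis unfolding N_def using meas a
      by (simp add: emeasure_distr cball_scale emeasure_hF_cball)
  qed
  have "emeasure N (cball 0 r) * emeasure hF (cball (0::'f) 1) = emeasure hF (cball (0::'f) r) * emeasure N (cball 0 1)"
    by (rule cball_ratio) (use r in \<open>auto simp: N emeasure_hF_cball sets_hF\<close>, simp_all add: N_def)
  then show ?thesis
    using ball_volume_pos[of r, where 'f='f] ball_volume_pos[of "av a * r", where 'f='f] r a modulus_pos[OF a]
    by (simp add: N emeasure_hF_cball ball_volume_one modulus_eq_ball_volume[symmetric] ennreal_mult[symmetric] mult.commute)
qed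

lemma modulus_mult: "a \<noteq> 0 \<Longrightarrow> b \<noteq> 0 \<Longrightarrow> modulus (a * b) = modulus a * modulus b" for a b :: "'f::nonarch_local_field"
  using ball_volume_scale[of a "av b"] by (simp add: modulus_eq_ball_volume dist_0_mult)

lemma modulus_divide: "a \<noteq> 0 \<Longrightarrow> b \<noteq> 0 \<Longrightarrow> modulus (a / b) = modulus a / modulus b" for a b :: "'f::nonarch_local_field"
  using modulus_mult[of "a / b" b] modulus_pos[of b] by (simp add: field_simps)


section \<open>Boxes in affine space\<close>

text \<open>The maximum norm. The inserted 0 covers the empty tuple, which occurs for a fibre of
  dimension 0.\<close>

definition nm :: "nat \<Rightarrow> (nat \<Rightarrow> 'f::nonarch_local_field) \<Rightarrow> real" where
  "nm n c = Max (insert 0 ((\<lambda>i. av (c i)) ` {..<n}))"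

lemma nm_le_iff: "0 \<le> r \<Longrightarrow> nm n c \<le> r \<longleftrightarrow> (\<forall>i<n. av (c i) \<le> r)"
  unfolding nm_def by (subst Max_le_iff) auto

lemma nm_less_iff: "0 < r \<Longrightarrow> nm n c < r \<longleftrightarrow> (\<forall>i<n. av (c i) < r)"
  unfolding nm_def by (subst Max_less_iff) auto

lemma nm_nonneg [simp]: "0 \<le> nm n c"
  unfolding nm_def by (intro Max_ge) auto

lemma av_le_nm: "i < n \<Longrightarrow> av (c i) \<le> nm n c"
  unfolding nm_def by (intro Max_ge) auto

lemma nm_attained: "nm n c = 0 \<or> (\<exists>i<n. nm n c = av (c i))"
proof -
  have "nm n c \<in> insert 0 ((\<lambda>i. av (c i)) ` {..<n})"
    unfolding nm_def by (intro Max_in) auto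
  then show ?thesis by auto
qed

lemma nm_cong: "(\<And>i. i < n \<Longrightarrow> av (c i) = av (d i)) \<Longrightarrow> nm n c = nm n d"
  unfolding nm_def by (intro arg_cong[of _ _ Max] arg_cong2[of _ _ _ _ insert] image_cong) auto

lemma nm_add_le: "nm n (\<lambda>i. a i + b i) \<le> max (nm n a) (nm n b)"
proof (subst nm_le_iff)
  show "\<forall>i<n. av (a i + b i) \<le> max (nm n a) (nm n b)"
  proof (intro allI impI)
    fix i assume i: "i < n"
    show "av (a i + b i) \<le> max (nm n a) (nm n b)"
      by (rule order_trans[OF av_add_le max.mono]) (rule av_le_nm[OF i])+
  qed
qed (simp add: le_max_iff_disj)

lemma nm_minus: "nm n (\<lambda>i. a i - b i) = nm n (\<lambda>i. b i - a i)"
  by (rule nm_cong) (rule av_minus_commute)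

lemma nm_scale: "nm n (\<lambda>i. t * c i) = av t * nm n c"
proof (rule antisym)
  show "nm n (\<lambda>i. t * c i) \<le> av t * nm n c"
    by (subst nm_le_iff) (auto simp: dist_0_mult intro: mult_left_mono av_le_nm)
  consider "nm n c = 0" | i where "i < n" "nm n c = av (c i)" using nm_attained by blast
  then show "av t * nm n c \<le> nm n (\<lambda>i. t * c i)"
  proof cases
    case 2
    then show ?thesis using av_le_nm[of i n "\<lambda>i. t * c i"] by (simp add: dist_0_mult)
  qed simp
qed

lemma nm_eq_0_iff: "nm n c = 0 \<longleftrightarrow> (\<forall>i<n. c i = 0)"
  using nm_le_iff[of 0 n c] nm_nonneg[of n c] by auto

lemma nm_zero [simp]: "nm n (\<lambda>i. 0) = 0"
  by (simp add: nm_eq_0_iff)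

lemma nm_add_dominant: "nm n b < nm n a \<Longrightarrow> nm n (\<lambda>i. a i + b i) = nm n a"
proof (rule antisym)
  assume *: "nm n b < nm n a"
  then show "nm n (\<lambda>i. a i + b i) \<le> nm n a" using nm_add_le[of n a b] by simp
  obtain i where i: "i < n" "nm n a = av (a i)" using nm_attained[of n a] * nm_nonneg[of n b] by auto
  then have "av (a i + b i) = av (a i)" using * av_le_nm[of i n b] by (intro av_add_dominant) simp
  then show "nm n a \<le> nm n (\<lambda>i. a i + b i)" using i av_le_nm[of i n "\<lambda>i. a i + b i"] by simp
qed

text \<open>The error is strictly dominated, so the ultrametric inequality absorbs it without loss.
  With \<open>e = 1/2\<close> this is applied to increments of nonlinear maps and of their linear
  parts, and yields exact isometries.\<close>

lemma nm_near:
  assumes "nm n (\<lambda>i. b i - a i) \<le> e * nm n a" "e < 1"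
  shows "nm n b = nm n a"
proof (cases "nm n a = 0")
  case True
  then have "nm n (\<lambda>i. b i - a i) = 0" using assms(1) nm_nonneg[of n "\<lambda>i. b i - a i"] by simp
  then have "nm n b = 0" using True unfolding nm_eq_0_iff by simp
  then show ?thesis using True by simp
next
  case False
  then have "e * nm n a < nm n a" using assms(2) nm_nonneg[of n a] by (simp add: less_le)
  then have "nm n (\<lambda>i. a i + (b i - a i)) = nm n a" using assms(1) by (intro nm_add_dominant) linarith
  then show ?thesis by simp
qed

text \<open>The points are extensional functions, as in the product measure, but the centre may be
  any function: its values from \<open>n\<close> on are ignored, so \<open>\<lambda>_. 0\<close> is
  a legitimate centre.\<close>

definition bx :: "nat \<Rightarrow> (nat \<Rightarrow> 'f::nonarch_local_field) \<Rightarrow> real \<Rightarrow> (nat \<Rightarrow> 'f) set" where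
  "bx n u r = (\<Pi>\<^sub>E i\<in>{..<n}. cball (u i) r)"

lemma bx_iff: "c \<in> bx n u r \<longleftrightarrow> c \<in> affine_space n \<and> (\<forall>i<n. dist (u i) (c i) \<le> r)"
  by (auto simp: bx_def affine_space_def PiE_iff)

lemma bx_iff_nm: "0 \<le> r \<Longrightarrow> c \<in> bx n u r \<longleftrightarrow> c \<in> affine_space n \<and> nm n (\<lambda>i. c i - u i) \<le> r"
  unfolding bx_iff by (subst nm_le_iff) (auto simp: dist_eq_av[of "u _"])

lemma bx_subset_affine: "bx n u r \<subseteq> affine_space n" by (auto simp: bx_iff)

lemma bx_center: "u \<in> affine_space n \<Longrightarrow> 0 \<le> r \<Longrightarrow> u \<in> bx n u r"
  by (auto simp: bx_iff)

lemma bx_cong: "(\<And>i. i < n \<Longrightarrow> u i = v i) \<Longrightarrow> bx n u r = bx n v r"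
  by (auto simp: bx_def intro!: PiE_cong)

lemma bx_mono: "r \<le> s \<Longrightarrow> bx n u r \<subseteq> bx n u s"
  unfolding bx_def by (intro PiE_mono subset_cball)

lemma bx_eq: "y \<in> bx n x r \<Longrightarrow> bx n y r = bx n x r"
  unfolding bx_def by (rule PiE_cong) (rule cball_eq, auto simp: PiE_iff)

lemma bx_subset: "y \<in> bx n x r \<Longrightarrow> s \<le> r \<Longrightarrow> bx n y s \<subseteq> bx n x r"
  using bx_eq[of y n x r] bx_mono[of s r n y] by simp

lemma bx_nested: "bx n x r \<inter> bx n y s = {} \<or> bx n x r \<subseteq> bx n y s \<or> bx n y s \<subseteq> bx n x r"
proof (cases "bx n x r \<inter> bx n y s = {}")
  case False
  then obtain z where "z \<in> bx n x r" "z \<in> bx n y s" by blast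
  then show ?thesis using bx_mono[of r s n z] bx_mono[of s r n z] bx_eq[of z n x r] bx_eq[of z n y s]
    by (cases "r \<le> s") auto
qed simp

lemma affine_eqI: "c \<in> affine_space n \<Longrightarrow> d \<in> affine_space n \<Longrightarrow> (\<And>i. i < n \<Longrightarrow> c i = d i) \<Longrightarrow> c = d"
  unfolding affine_space_def by (rule PiE_ext) auto

lemma restrict_affine [simp]: "restrict c {..<n} \<in> affine_space n"
  by (simp add: affine_space_def)

lemma openin_affine_PiE:
  assumes "\<And>i. i < n \<Longrightarrow> open (A i)"
  shows "openin (top_of_set (affine_space n)) (\<Pi>\<^sub>E i\<in>{..<n}. (A i :: 'f::nonarch_local_field set))"
proof -
  have "(\<Pi>\<^sub>E i\<in>{..<n}. A i) = affine_space n \<inter> (\<Inter>i\<in>{..<n}. (\<lambda>x. x i) -` A i)"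
    by (auto simp: affine_space_def PiE_iff)
  moreover have "open ((\<lambda>x::nat\<Rightarrow>'f. x i) -` A i)" if "i < n" for i
    using open_vimage[OF assms[OF that] continuous_on_product_coordinates] .
  then have "open (\<Inter>i\<in>{..<n}. (\<lambda>x::nat\<Rightarrow>'f. x i) -` A i)" by (intro open_INT) auto
  then have "openin (top_of_set (affine_space n)) (affine_space n \<inter> (\<Inter>i\<in>{..<n}. (\<lambda>x::nat\<Rightarrow>'f. x i) -` A i))"
    by (rule openin_open_Int)
  ultimately show ?thesis by simp
qed

lemma openin_bx: "r > 0 \<Longrightarrow> openin (top_of_set (affine_space n)) (bx n u r)"
  unfolding bx_def by (intro openin_affine_PiE open_cball)

lemma compact_bx: "compact (bx n u r)"
proof -
  \<comment> \<open>Pinning all coordinates from \<open>n\<close> on to \<open>undefined\<close>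
    turns the box into a product over all indices, where Tychonoff's theorem applies.\<close>
  let ?S = "\<lambda>i. if i < n then cball (u i) r else {undefined}"
  have "compactin (product_topology (\<lambda>i. euclidean) UNIV) (PiE UNIV ?S)"
    by (subst compactin_PiE) (auto simp: compact_cballF)
  moreover have "PiE UNIV ?S = bx n u r"
  proof (intro set_eqI iffI)
    fix c assume "c \<in> PiE UNIV ?S"
    then have c: "c i \<in> ?S i" for i by (rule PiE_mem) simp
    have "c i \<in> cball (u i) r" if "i < n" for i using c[of i] that by simp
    moreover have "c i = undefined" if "\<not> i < n" for i using c[of i] that by simp
    ultimately show "c \<in> bx n u r" by (auto simp: bx_def PiE_iff extensional_def)
  qed (auto simp: bx_def PiE_iff extensional_def)
  ultimately show ?thesis by (simp add: euclidean_product_topology)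
qed

lemma openin_contains_bx:
  assumes "openin (top_of_set (affine_space n)) U" "u \<in> U"
  shows "\<exists>r>0. bx n u r \<subseteq> (U :: (nat \<Rightarrow> 'f::nonarch_local_field) set)"
proof -
  obtain T where T: "open T" "U = affine_space n \<inter> T" using assms(1) by (auto simp: openin_open)
  have "openin (product_topology (\<lambda>i. euclidean) UNIV) T" using T(1) by (simp add: open_fun_def)
  from product_topology_open_contains_basis[OF this, of u] obtain X
    where X: "u \<in> PiE UNIV X" "\<And>i. open (X i)" "PiE UNIV X \<subseteq> T"
    using assms(2) T(2) by auto
  have "\<exists>r>0. cball (u i) r \<subseteq> X i" for i
  proof -
    have "u i \<in> X i" using X(1) by auto
    then show ?thesis using X(2)[of i] unfolding open_contains_cball by blast
  qed
  then obtain r where r: "\<And>i. r i > 0" "\<And>i. cball (u i) (r i) \<subseteq> X i" by metis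
  define s where "s = Min (insert 1 (r ` {..<n}))"
  have s: "s > 0" "\<And>i. i < n \<Longrightarrow> s \<le> r i" unfolding s_def using r(1) by auto
  have "bx n u s \<subseteq> T"
  proof
    fix c assume c: "c \<in> bx n u s"
    have "c i \<in> X i" for i
    proof (cases "i < n")
      case True
      then have "c i \<in> cball (u i) (r i)" using c s(2)[of i] by (auto simp: bx_iff)
      then show ?thesis using r(2) by blast
    next
      case False
      then have "c i = u i" using c assms(2) T(2) by (auto simp: bx_iff affine_space_def PiE_iff extensional_def)
      then show ?thesis using X(1) by auto
    qed
    then show "c \<in> T" using X(3) by auto
  qed
  then show ?thesis using s(1) T(2) bx_subset_affine by blast
qed

lemma continuous_on_affine_iff:
  fixes f :: "(nat \<Rightarrow> 'f::nonarch_local_field) \<Rightarrow> 'm::metric_space"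
  assumes A: "A \<subseteq> affine_space n"
    and *: "\<And>x e. x \<in> A \<Longrightarrow> e > 0 \<Longrightarrow> \<exists>d>0. \<forall>y\<in>A \<inter> bx n x d. dist (f y) (f x) < e"
  shows "continuous_on A f"
  unfolding continuous_on_topological
proof (intro ballI allI impI)
  fix x B assume xB: "x \<in> A" "open B" "f x \<in> B"
  then obtain e where e: "e > 0" "ball (f x) e \<subseteq> B" using open_contains_ball by blast
  obtain d where d: "d > 0" "\<And>y. y \<in> A \<inter> bx n x d \<Longrightarrow> dist (f y) (f x) < e" using *[OF xB(1) e(1)] by blast
  obtain T where T: "open T" "bx n x d = affine_space n \<inter> T" using openin_bx[OF d(1), of n x] by (auto simp: openin_open)
  have "x \<in> T" using T(2) bx_center[of x n d] A xB(1) d(1) by auto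
  moreover have "f y \<in> B" if "y \<in> A" "y \<in> T" for y
  proof -
    have "y \<in> A \<inter> bx n x d" using that A T(2) by auto
    then have "dist (f y) (f x) < e" by (rule d(2))
    then have "f y \<in> ball (f x) e" by (simp add: dist_commute)
    then show ?thesis using e(2) by blast
  qed
  ultimately show "\<exists>T. open T \<and> x \<in> T \<and> (\<forall>y\<in>A. y \<in> T \<longrightarrow> f y \<in> B)" using T(1) by blast
qed

lemma continuous_on_affine_contains_bx:
  fixes f :: "(nat \<Rightarrow> 'f::nonarch_local_field) \<Rightarrow> 'm::topological_space"
  assumes "continuous_on U f" "openin (top_of_set (affine_space n)) U" "u \<in> U" "open T" "f u \<in> T"
  shows "\<exists>r>0. bx n u r \<subseteq> U \<and> f ` bx n u r \<subseteq> T"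
proof -
  have "openin (top_of_set U) (U \<inter> f -` T)" using assms(1,4) continuous_on_open_gen by (simp add: continuous_openin_preimage_gen)
  then have "openin (top_of_set (affine_space n)) (U \<inter> f -` T)" using assms(2) openin_trans by blast
  from openin_contains_bx[OF this, of u] assms show ?thesis by auto
qed

text \<open>A Lebesgue number: take the least radius among finitely many covering boxes. Every point
  of a box is a centre of it, so this radius works at every point.\<close>

lemma compact_openin_uniform_bx:
  fixes A :: "(nat \<Rightarrow> 'f::nonarch_local_field) set"
  assumes "compact A" "openin (top_of_set (affine_space n)) A" "0 < R"
  shows "\<exists>r>0. r \<le> R \<and> (\<forall>x\<in>A. bx n x r \<subseteq> A)"
proof -
  have "\<exists>r>0. bx n x r \<subseteq> A" if "x \<in> A" for x using openin_contains_bx[OF assms(2) that] .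
  then obtain r where r: "\<And>x. x \<in> A \<Longrightarrow> r x > 0" "\<And>x. x \<in> A \<Longrightarrow> bx n x (r x) \<subseteq> A" by metis
  have "\<exists>T. open T \<and> bx n x (r x) = affine_space n \<inter> T" if "x \<in> A" for x
    using openin_bx[OF r(1)[OF that]] by (auto simp: openin_open)
  then obtain T where T: "\<And>x. x \<in> A \<Longrightarrow> open (T x)" "\<And>x. x \<in> A \<Longrightarrow> bx n x (r x) = affine_space n \<inter> T x" by metis
  have A: "A \<subseteq> affine_space n" using assms(2) openin_imp_subset by blast
  have xT: "x \<in> T x" if "x \<in> A" for x using T(2)[OF that] bx_center[of x n "r x"] r(1)[OF that] that A by auto
  obtain C where C: "C \<subseteq> A" "finite C" "A \<subseteq> (\<Union>x\<in>C. T x)"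
    by (rule compactE_image[OF assms(1), of A T]) (use T xT in auto)
  define s where "s = Min (insert R (r ` C))"
  have s: "s > 0" "s \<le> R" "\<And>x. x \<in> C \<Longrightarrow> s \<le> r x" unfolding s_def using C r(1) assms(3) by auto
  have "bx n y s \<subseteq> A" if "y \<in> A" for y
  proof -
    obtain x where x: "x \<in> C" "y \<in> T x" using C(3) \<open>y \<in> A\<close> by blast
    then have "y \<in> bx n x (r x)" using T(2)[of x] C(1) A \<open>y \<in> A\<close> by blast
    then have "bx n y s \<subseteq> bx n x (r x)" using s(3)[OF x(1)] by (rule bx_subset)
    then show ?thesis using r(2)[of x] x(1) C(1) by blast
  qed
  then show ?thesis using s by blast
qed

text \<open>Boxes of equal radius are equal or disjoint; \<open>Z\<close> picks one centre from each
  of the finitely many that occur.\<close>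

lemma bx_partition:
  fixes A :: "(nat \<Rightarrow> 'f::nonarch_local_field) set"
  assumes "compact A" "A \<subseteq> affine_space n" "r > 0" "\<And>x. x \<in> A \<Longrightarrow> bx n x r \<subseteq> A"
  shows "\<exists>Z. finite Z \<and> Z \<subseteq> A \<and> A = (\<Union>z\<in>Z. bx n z r) \<and> disjoint_family_on (\<lambda>z. bx n z r) Z"
proof -
  let ?P = "\<lambda>x. bx n x r"
  have fin: "finite (?P ` A)"
  proof (rule finite_partition_compact[OF assms(1)])
    fix x assume x: "x \<in> A"
    obtain T where T: "open T" "bx n x r = affine_space n \<inter> T" using openin_bx[OF assms(3), of n x] by (auto simp: openin_open)
    have "x \<in> T" using T(2) bx_center[of x n r] x assms(2,3) by auto
    moreover have "bx n y r = bx n x r" if "y \<in> A \<inter> T" for y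
      using that T(2) assms(2) by (intro bx_eq) auto
    ultimately show "\<exists>T. open T \<and> x \<in> T \<and> (\<forall>y\<in>A \<inter> T. bx n y r = bx n x r)" using T(1) by blast
  qed
  obtain Z where Z: "Z \<subseteq> A" "inj_on ?P Z" "?P ` A = ?P ` Z"
    using subset_image_inj[of "?P ` A" ?P A] by auto
  have "finite Z" using Z fin finite_imageD by metis
  moreover have "A = (\<Union>z\<in>Z. ?P z)"
  proof -
    have "A = (\<Union>z\<in>A. ?P z)"
    proof
      show "A \<subseteq> (\<Union>z\<in>A. ?P z)"
      proof
        fix x assume "x \<in> A"
        then show "x \<in> (\<Union>z\<in>A. ?P z)" using bx_center[of x n r] assms(2,3) by (intro UN_I[of x]) auto
      qed
    qed (use assms(4) in blast)
    then show ?thesis using Z(3) by auto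
  qed
  moreover have "disjoint_family_on ?P Z"
    unfolding disjoint_family_on_def
  proof (intro ballI impI)
    fix x y assume xy: "x \<in> Z" "y \<in> Z" "x \<noteq> y"
    show "?P x \<inter> ?P y = {}"
    proof (rule ccontr)
      assume "?P x \<inter> ?P y \<noteq> {}"
      then obtain z where z: "z \<in> ?P x" "z \<in> ?P y" by blast
      have "?P x = ?P y" using bx_eq[OF z(1)] bx_eq[OF z(2)] by simp
      then show False using Z(2) xy by (auto dest: inj_onD)
    qed
  qed
  ultimately show ?thesis using Z(1) by blast
qed

section \<open>The product measure and its sigma-algebra\<close>

abbreviation pm :: "nat \<Rightarrow> (nat \<Rightarrow> 'f::nonarch_local_field) measure" where
  "pm n \<equiv> Pi\<^sub>M {..<n} (\<lambda>_. normalized_haar)"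

interpretation hF: sigma_finite_measure "hF :: 'f::nonarch_local_field measure"
proof
  show "\<exists>A. countable A \<and> A \<subseteq> sets (hF :: 'f measure) \<and> \<Union>A = space hF \<and> (\<forall>a\<in>A. emeasure hF a \<noteq> \<infinity>)"
  proof (intro exI conjI)
    show "\<Union>(range (\<lambda>n. cball (0::'f) (real n))) = space hF"
    proof -
      have "\<exists>n. x \<in> cball 0 (real n)" for x :: 'f using real_arch_simple[of "av x"] by simp
      then show ?thesis by auto
    qed
  qed (auto simp: sets_hF emeasure_hF_cball)
qed

interpretation pF: product_sigma_finite "\<lambda>_::nat. hF :: 'f::nonarch_local_field measure"
  by standard

lemma space_pm: "space (pm n) = affine_space n"
  by (simp add: space_PiM affine_space_def)

lemma emeasure_pm_PiE:
  "(\<And>i. i < n \<Longrightarrow> \<rho> i > 0) \<Longrightarrow>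
    emeasure (pm n) (\<Pi>\<^sub>E i\<in>{..<n}. cball (u i :: 'f::nonarch_local_field) (\<rho> i)) = ennreal (\<Prod>i<n. ball_volume TYPE('f) (\<rho> i))"
  by (subst pF.emeasure_PiM) (auto simp: sets_hF emeasure_hF_cball ball_volume_pos less_imp_le intro!: prod_ennreal)

lemma emeasure_pm_bx: "r > 0 \<Longrightarrow> emeasure (pm n) (bx n (u :: nat \<Rightarrow> 'f::nonarch_local_field) r) = ennreal (ball_volume TYPE('f) r ^ n)"
  unfolding bx_def by (subst emeasure_pm_PiE) auto

lemma affine_openin_Union_bx:
  fixes U :: "(nat \<Rightarrow> 'f::nonarch_local_field) set"
  assumes "openin (top_of_set (affine_space n)) U"
  shows "\<exists>C. countable C \<and> C \<subseteq> {bx n u r |u r. u \<in> affine_space n \<and> r > 0 \<and> bx n u r \<subseteq> U} \<and> U = \<Union>C"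
proof -
  let ?F = "{bx n u r |u r. u \<in> affine_space n \<and> r > 0 \<and> bx n u r \<subseteq> U}"
  have o: "\<And>S. S \<in> ?F \<Longrightarrow> openin (top_of_set (affine_space n)) S" using openin_bx by auto
  obtain C where C: "C \<subseteq> ?F" "countable C" "\<Union>C = \<Union>?F"
    by (rule Lindelof_openin[of ?F, OF o], assumption, rule that)
  have "U \<subseteq> \<Union>?F"
  proof
    fix x assume x: "x \<in> U"
    then have xa: "x \<in> affine_space n" using assms openin_imp_subset by blast
    obtain r where r: "r > 0" "bx n x r \<subseteq> U" using openin_contains_bx[OF assms x] by blast
    show "x \<in> \<Union>?F"
      by (rule UnionI[of "bx n x r"]) (use r xa bx_center[OF xa, of r] in auto)
  qed
  moreover have "\<Union>?F \<subseteq> U" by auto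
  ultimately show ?thesis using C by (intro exI[of _ C]) auto
qed

lemma bx_in_sets_pm: "bx n u r \<in> sets (pm n)"
  unfolding bx_def by (rule sets_PiM_I_finite) (auto simp: sets_hF)

lemma sets_restrict_affine_bx:
  fixes U :: "(nat \<Rightarrow> 'f::nonarch_local_field) set"
  assumes "openin (top_of_set (affine_space n)) U"
  shows "sigma_sets U (insert {} {bx n u r |u r. u \<in> affine_space n \<and> r > 0 \<and> bx n u r \<subseteq> U}) = sets (restrict_space borel U)"
proof (rule sigma_sets_restrict_borel)
  fix A assume "A \<in> insert {} {bx n u r |u r. u \<in> affine_space n \<and> r > 0 \<and> bx n u r \<subseteq> U}"
  then consider "A = {}" | u r where "A = bx n u r" "r > 0" "bx n u r \<subseteq> U" by blast
  then show "A \<in> sets (restrict_space borel U)"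
  proof cases
    case 2
    have "closed A" using 2(1) compact_bx compact_imp_closed by blast
    then have "A \<in> sets borel" by (rule borel_closed)
    moreover have "A = U \<inter> A" using 2 by auto
    ultimately show ?thesis unfolding sets_restrict_space by (metis imageI)
  qed simp
next
  fix V assume V: "openin (top_of_set U) V"
  then have "openin (top_of_set (affine_space n)) V" using assms openin_trans by blast
  from affine_openin_Union_bx[OF this] obtain C where
    C: "countable C \<and> C \<subseteq> {bx n u r |u r. u \<in> affine_space n \<and> r > 0 \<and> bx n u r \<subseteq> V} \<and> V = \<Union>C" ..
  moreover have "V \<subseteq> U" using V openin_imp_subset by blast
  ultimately show "\<exists>C. countable C \<and> C \<subseteq> insert {} {bx n u r |u r. u \<in> affine_space n \<and> r > 0 \<and> bx n u r \<subseteq> U} \<and> V = \<Union>C"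
  proof (intro exI[of _ C] conjI)
    show "C \<subseteq> insert {} {bx n u r |u r. u \<in> affine_space n \<and> r > 0 \<and> bx n u r \<subseteq> U}"
    proof
      fix x assume "x \<in> C"
      then obtain u r where "x = bx n u r" "u \<in> affine_space n" "r > 0" "bx n u r \<subseteq> V" using C by blast
      then show "x \<in> insert {} {bx n u r |u r. u \<in> affine_space n \<and> r > 0 \<and> bx n u r \<subseteq> U}"
        using \<open>V \<subseteq> U\<close> by blast
    qed
  qed auto
qed

text \<open>Charts are measured with the product sigma-algebra, while continuity of maps gives Borel
  measurability. Boxes generate the Borel sets of affine space and lie in the product sigma-algebra;
  conversely, coordinates are continuous.\<close>

lemma sets_pm: "sets (pm n) = sets (restrict_space borel (affine_space n) :: (nat \<Rightarrow> 'f::nonarch_local_field) measure)"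
proof
  have "openin (top_of_set (affine_space n)) (affine_space n :: (nat \<Rightarrow> 'f) set)" by simp
  from sets_restrict_affine_bx[OF this] have
    "sets (restrict_space borel (affine_space n)) = sigma_sets (space (pm n)) (insert {} {bx n (u::nat\<Rightarrow>'f) r |u r. u \<in> affine_space n \<and> r > 0 \<and> bx n u r \<subseteq> affine_space n})"
    by (simp add: space_pm)
  also have "\<dots> \<subseteq> sets (pm n)"
    by (rule sets.sigma_sets_subset) (auto intro: bx_in_sets_pm)
  finally show "sets (restrict_space borel (affine_space n) :: (nat \<Rightarrow> 'f) measure) \<subseteq> sets (pm n)" .
  have sp: "space (restrict_space borel (affine_space n)) = (affine_space n :: (nat \<Rightarrow> 'f) set)"
    by (simp add: space_restrict_space)
  show "sets (pm n) \<subseteq> sets (restrict_space borel (affine_space n) :: (nat \<Rightarrow> 'f) measure)"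
    unfolding sets_PiM_single
    unfolding space_hF affine_space_def[symmetric] 
  proof (subst sp[symmetric], rule sets.sigma_sets_subset, safe)
    fix i and A :: "'f set" assume "i < n" "A \<in> sets hF"
    then have "A \<in> sets borel" by (simp add: sets_hF)
    then have "(\<lambda>x::nat\<Rightarrow>'f. x i) -` A \<inter> space borel \<in> sets borel"
      by (intro measurable_sets[OF borel_measurable_continuous_onI[OF continuous_on_product_coordinates]])
    then have "affine_space n \<inter> ((\<lambda>x::nat\<Rightarrow>'f. x i) -` A \<inter> space borel) \<in> sets (restrict_space borel (affine_space n))"
      unfolding sets_restrict_space by (rule imageI)
    moreover have "affine_space n \<inter> ((\<lambda>x::nat\<Rightarrow>'f. x i) -` A \<inter> space borel) = {f \<in> affine_space n. f i \<in> A}" by auto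
    ultimately show "{f \<in> affine_space n. f i \<in> A} \<in> sets (restrict_space borel (affine_space n))" by simp
  qed
qed

lemma openin_affine_sets_pm: "openin (top_of_set (affine_space n)) U \<Longrightarrow> U \<in> sets (pm n)"
proof -
  assume "openin (top_of_set (affine_space n)) U"
  then obtain T where "open T" "U = affine_space n \<inter> T" by (auto simp: openin_open)
  then show ?thesis unfolding sets_pm sets_restrict_space by (intro image_eqI[of _ _ T]) auto
qed

lemma sets_restrict_pm:
  fixes B :: "(nat \<Rightarrow> 'f::nonarch_local_field) set"
  assumes "openin (top_of_set (affine_space n)) B" "sets M = sets (pm n)"
  shows "sets (restrict_space M B) = sets (restrict_space borel B)"
proof -
  have "B \<subseteq> affine_space n" using assms(1) openin_imp_subset by blast
  then have "affine_space n \<inter> B = B" by blast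
  moreover have "sets (restrict_space M B) = sets (restrict_space (restrict_space borel (affine_space n)) B)"
    using assms(2) unfolding sets_pm by (rule sets_restrict_space_cong)
  ultimately show ?thesis by (simp add: sets_restrict_restrict_space)
qed

lemma measure_eq_on_bx:
  fixes B :: "(nat \<Rightarrow> 'f::nonarch_local_field) set"
  assumes B: "openin (top_of_set (affine_space n)) B"
    and s: "sets M = sets (restrict_space borel B)" "sets N = sets (restrict_space borel B)"
    and eq: "\<And>u r. u \<in> B \<Longrightarrow> r > 0 \<Longrightarrow> bx n u r \<subseteq> B \<Longrightarrow> emeasure M (bx n u r) = emeasure N (bx n u r)"
    and fin: "\<And>u r. u \<in> B \<Longrightarrow> r > 0 \<Longrightarrow> bx n u r \<subseteq> B \<Longrightarrow> emeasure M (bx n u r) \<noteq> \<infinity>"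
  shows "M = N"
proof -
  let ?G = "{bx n u r |u r. u \<in> affine_space n \<and> r > 0 \<and> bx n u r \<subseteq> B}"
  from affine_openin_Union_bx[OF B] obtain C where C: "countable C \<and> C \<subseteq> ?G \<and> B = \<Union>C" ..
  have in_B: "u \<in> B" if "u \<in> affine_space n" "r > 0" "bx n u r \<subseteq> B" for u r
    using bx_center[of u n r] that by auto
  show ?thesis
  proof (rule measure_eqI_generator_eq_countable[where \<Omega>=B and E="insert {} ?G" and A=C])
    show "Int_stable (insert {} ?G)"
    proof (rule Int_stableI)
      fix a b assume "a \<in> insert {} ?G" "b \<in> insert {} ?G"
      then consider "a \<inter> b = {}" | u r v s where "a = bx n u r" "b = bx n v s" "a \<in> ?G" "b \<in> ?G" by blast
      then show "a \<inter> b \<in> insert {} ?G"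
      proof cases
        case 2
        then have "a \<inter> b = {} \<or> a \<inter> b = a \<or> a \<inter> b = b" using bx_nested[of n u r v s] by auto
        then show ?thesis using 2 by (elim disjE) (simp_all only: insert_iff simp_thms)
      qed simp
    qed
    show "\<And>X. X \<in> insert {} ?G \<Longrightarrow> emeasure M X = emeasure N X" using eq in_B by auto
    show "sets M = sigma_sets B (insert {} ?G)" "sets N = sigma_sets B (insert {} ?G)"
      using s sets_restrict_affine_bx[OF B] by auto
    show "\<And>a. a \<in> C \<Longrightarrow> emeasure M a \<noteq> \<infinity>" using C fin in_B by blast
  qed (use C in auto)
qed

lemma emeasure_bx_partition:
  fixes A :: "(nat \<Rightarrow> 'f::nonarch_local_field) set"
  assumes "sets \<mu> = sets (pm n)" "finite Z" "disjoint_family_on (\<lambda>z. bx n z r) Z"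
  shows "emeasure \<mu> (\<Union>z\<in>Z. bx n z r) = (\<Sum>z\<in>Z. emeasure \<mu> (bx n z r :: (nat \<Rightarrow> 'f) set))"
  by (rule sum_emeasure[symmetric]) (use assms bx_in_sets_pm in auto)

text \<open>Uniqueness of Haar measure in coordinates. Volumes at two radii are related by the
  number of small boxes in the large one, so the value on the unit box determines all
  others.\<close>

lemma translation_invariant_eq_scale_pm:
  fixes N :: "(nat \<Rightarrow> 'f::nonarch_local_field) measure"
  assumes s: "sets N = sets (pm n)"
    and inv: "\<And>u r. r > 0 \<Longrightarrow> emeasure N (bx n u r) = emeasure N (bx n (\<lambda>_. 0) r)"
    and fin: "emeasure N (bx n (\<lambda>_. 0) 1) \<noteq> \<infinity>"
  shows "N = scale_measure (emeasure N (bx n (\<lambda>_. 0) 1)) (pm n)"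
proof -
  let ?z = "restrict (\<lambda>_. 0) {..<n} :: nat \<Rightarrow> 'f"
  let ?Z = "\<lambda>r. bx n (\<lambda>_. 0 :: 'f) r"
  \<comment> \<open>The count is chosen before the measure, so that the same \<open>m\<close> serves
    for \<open>N\<close> and for \<open>pm n\<close>.\<close>
  have count: "\<exists>m::nat. \<forall>\<mu>::(nat \<Rightarrow> 'f) measure. sets \<mu> = sets (pm n) \<longrightarrow>
      (\<forall>u r. r > 0 \<longrightarrow> emeasure \<mu> (bx n u r) = emeasure \<mu> (?Z r)) \<longrightarrow> emeasure \<mu> (?Z b) = of_nat m * emeasure \<mu> (?Z a)"
    if "0 < a" "a \<le> b" for a b :: real
  proof -
    have "bx n x a \<subseteq> ?Z b" if "x \<in> ?Z b" for x using that \<open>a \<le> b\<close> by (rule bx_subset)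
    from bx_partition[OF compact_bx bx_subset_affine that(1) this] obtain Z where
      Z: "finite Z" "?Z b = (\<Union>z\<in>Z. bx n z a)" "disjoint_family_on (\<lambda>z. bx n z a) Z" by blast
    have "emeasure \<mu> (?Z b) = of_nat (card Z) * emeasure \<mu> (?Z a)"
      if "sets \<mu> = sets (pm n)" "\<forall>u r. r > 0 \<longrightarrow> emeasure \<mu> (bx n u r) = emeasure \<mu> (?Z r)" for \<mu> :: "(nat \<Rightarrow> 'f) measure"
    proof -
      have "emeasure \<mu> (?Z b) = (\<Sum>z\<in>Z. emeasure \<mu> (bx n z a))"
        unfolding Z(2) by (rule emeasure_bx_partition[OF that(1) Z(1,3)])
      also have "\<dots> = (\<Sum>z\<in>Z. emeasure \<mu> (?Z a))" by (intro sum.cong refl) (rule that(2)[rule_format, OF \<open>0 < a\<close>])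
      finally show ?thesis by simp
    qed
    then show ?thesis by blast
  qed
  have pinv: "emeasure (pm n) (bx n u r) = emeasure (pm n) (?Z r)" if "r > 0" for u :: "nat \<Rightarrow> 'f" and r
    using that by (simp add: emeasure_pm_bx)
  have key: "emeasure N (?Z r) = emeasure N (?Z 1) * emeasure (pm n) (?Z r)" if r: "r > 0" for r
  proof -
    have p1: "emeasure (pm n) (?Z 1) = 1" by (simp add: emeasure_pm_bx ball_volume_one)
    show ?thesis
    proof (cases "r \<le> 1")
      case True
      from count[OF r True] obtain m where m: "\<forall>\<mu>::(nat \<Rightarrow> 'f) measure. sets \<mu> = sets (pm n) \<longrightarrow>
        (\<forall>u r. r > 0 \<longrightarrow> emeasure \<mu> (bx n u r) = emeasure \<mu> (?Z r)) \<longrightarrow> emeasure \<mu> (?Z 1) = of_nat m * emeasure \<mu> (?Z r)" ..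
      have m: "emeasure N (?Z 1) = of_nat m * emeasure N (?Z r)" "emeasure (pm n) (?Z 1) = of_nat m * emeasure (pm n) (?Z r)"
        by (rule m[rule_format], rule s, erule inv) (rule m[rule_format], rule refl, erule pinv)
      then have "emeasure N (?Z 1) * emeasure (pm n) (?Z r) = emeasure N (?Z r) * emeasure (pm n) (?Z 1)"
        by (simp add: ac_simps)
      then show ?thesis by (simp add: p1)
    next
      case False
      then have "1 \<le> r" by simp
      from count[OF zero_less_one \<open>1 \<le> r\<close>] obtain m where m: "\<forall>\<mu>::(nat \<Rightarrow> 'f) measure. sets \<mu> = sets (pm n) \<longrightarrow>
        (\<forall>u r. r > 0 \<longrightarrow> emeasure \<mu> (bx n u r) = emeasure \<mu> (?Z r)) \<longrightarrow> emeasure \<mu> (?Z r) = of_nat m * emeasure \<mu> (?Z 1)" ..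
      have "emeasure N (?Z r) = of_nat m * emeasure N (?Z 1)" "emeasure (pm n) (?Z r) = of_nat m * emeasure (pm n) (?Z 1)"
        by (rule m[rule_format], rule s, erule inv) (rule m[rule_format], rule refl, erule pinv)
      then show ?thesis by (simp add: p1 mult.commute)
    qed
  qed
  have *: "openin (top_of_set (affine_space n)) (affine_space n :: (nat \<Rightarrow> 'f) set)" by simp
  show ?thesis
  proof (rule measure_eq_on_bx[OF *])
    fix u :: "nat \<Rightarrow> 'f" and r :: real assume r: "r > 0"
    show "emeasure N (bx n u r) = emeasure (scale_measure (emeasure N (?Z 1)) (pm n)) (bx n u r)"
      using inv[OF r, of u] key[OF r] pinv[OF r, of u] by simp
    show "emeasure N (bx n u r) \<noteq> \<infinity>"
      using inv[OF r, of u] key[OF r] fin r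
      by (simp add: emeasure_pm_bx ennreal_mult_eq_top_iff)
  qed (use s sets_pm in auto)
qed

lemma isometry_continuous:
  fixes \<psi> :: "(nat \<Rightarrow> 'f::nonarch_local_field) \<Rightarrow> nat \<Rightarrow> 'f"
  assumes A: "A \<subseteq> affine_space n" and m: "\<And>a. a \<in> A \<Longrightarrow> \<psi> a \<in> affine_space k"
    and iso: "\<And>a b. a \<in> A \<Longrightarrow> b \<in> A \<Longrightarrow> nm k (\<lambda>i. \<psi> a i - \<psi> b i) \<le> nm n (\<lambda>i. a i - b i)"
  shows "continuous_on A \<psi>"
proof (rule continuous_on_coordinatewise_then_product)
  fix i
  show "continuous_on A (\<lambda>x. \<psi> x i)"
  proof (rule continuous_on_affine_iff[OF A])
    fix x and e :: real assume x: "x \<in> A" "e > 0"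
    have "dist (\<psi> y i) (\<psi> x i) < e" if y: "y \<in> A \<inter> bx n x (e/2)" for y
    proof (cases "i < k")
      case True
      have "av (\<psi> x i - \<psi> y i) \<le> nm k (\<lambda>i. \<psi> x i - \<psi> y i)" by (rule av_le_nm[OF True])
      also have "\<dots> \<le> nm n (\<lambda>i. x i - y i)" using iso x y by blast
      also have "\<dots> \<le> e / 2" using y x(2) by (subst nm_minus) (simp add: bx_iff_nm)
      finally show ?thesis using x(2) by (simp add: dist_eq_av[of "\<psi> y i"])
    next
      case False
      then have "\<psi> y i = \<psi> x i" using m[of x] m[of y] x y by (auto simp: affine_space_def PiE_iff extensional_def)
      then show ?thesis using x by simp
    qed
    then show "\<exists>d>0. \<forall>y\<in>A \<inter> bx n x d. dist (\<psi> y i) (\<psi> x i) < e" using x(2) by (intro exI[of _ "e/2"]) auto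
  qed
qed

text \<open>Surjectivity is a volume count: the image of a ball already has full measure at every scale.\<close>

lemma isometry_image_bx:
  fixes \<psi> :: "(nat \<Rightarrow> 'f::nonarch_local_field) \<Rightarrow> nat \<Rightarrow> 'f"
  assumes m: "\<And>a. a \<in> bx n x s \<Longrightarrow> \<psi> a \<in> affine_space n"
    and iso: "\<And>a b. a \<in> bx n x s \<Longrightarrow> b \<in> bx n x s \<Longrightarrow> nm n (\<lambda>i. \<psi> a i - \<psi> b i) = nm n (\<lambda>i. a i - b i)"
    and x: "x \<in> affine_space n" and s: "s > 0"
  shows "\<psi> ` bx n x s = bx n (\<psi> x) s"
proof
  have x': "x \<in> bx n x s" using s by (intro bx_center x) simp
  have sub: "\<psi> ` bx n z r \<subseteq> bx n (\<psi> z) r" if "z \<in> bx n x s" "0 \<le> r" "r \<le> s" for z r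
  proof (rule image_subsetI)
    fix a assume a: "a \<in> bx n z r"
    have "a \<in> bx n x s" using bx_subset[OF that(1,3)] a by blast
    then show "\<psi> a \<in> bx n (\<psi> z) r" using a that iso[of a z] m by (simp add: bx_iff_nm)
  qed
  then show "\<psi> ` bx n x s \<subseteq> bx n (\<psi> x) s" using x' s by simp
  have cpt: "compact (\<psi> ` bx n x s)"
    by (rule compact_continuous_image[OF _ compact_bx], rule isometry_continuous[of _ n _ n])
       (use bx_subset_affine m iso in auto)
  show "bx n (\<psi> x) s \<subseteq> \<psi> ` bx n x s"
  proof (rule ccontr)
    assume "\<not> ?thesis"
    then obtain y where y: "y \<in> bx n (\<psi> x) s" "y \<notin> \<psi> ` bx n x s" by blast
    have "openin (top_of_set (affine_space n)) (affine_space n \<inter> - (\<psi> ` bx n x s))"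
      using compact_imp_closed[OF cpt] by (intro openin_open_Int) (simp add: open_closed)
    moreover have ya: "y \<in> affine_space n" using y(1) bx_subset_affine by blast
    ultimately obtain r0 where r0: "r0 > 0" "bx n y r0 \<subseteq> - (\<psi> ` bx n x s)"
      using openin_contains_bx[of n "affine_space n \<inter> - (\<psi> ` bx n x s)" y] y(2) by auto
    define r where "r = min r0 s"
    have r: "r > 0" "r \<le> s" "bx n y r \<subseteq> - (\<psi> ` bx n x s)"
      using r0 s bx_mono[of r r0 n y] by (auto simp: r_def)
    have "bx n z r \<subseteq> bx n x s" if "z \<in> bx n x s" for z using that r(2) by (rule bx_subset)
    from bx_partition[OF compact_bx bx_subset_affine r(1) this] obtain Z where
      Z: "finite Z" "Z \<subseteq> bx n x s" "bx n x s = (\<Union>z\<in>Z. bx n z r)" "disjoint_family_on (\<lambda>z. bx n z r) Z" by blast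
    let ?v = "ball_volume TYPE('f) r ^ n"
    have v: "?v > 0" using ball_volume_pos[OF r(1), where 'f='f] by simp
    have tot: "emeasure (pm n) (bx n x s) = of_nat (card Z) * ennreal ?v"
      unfolding Z(3) using emeasure_bx_partition[OF refl Z(1,4)] r(1) by (simp add: emeasure_pm_bx)
    \<comment> \<open>Boxes of radius \<open>r\<close> around the images of the centres stay
      disjoint, since \<open>\<psi>\<close> preserves distances. Together they already have the
      volume of the target, which leaves no room for the missed box around \<open>y\<close>.\<close>
    have disj: "disjoint_family_on (\<lambda>z. bx n (\<psi> z) r) Z"
      unfolding disjoint_family_on_def
    proof (intro ballI impI)
      fix z w assume zw: "z \<in> Z" "w \<in> Z" "z \<noteq> w"
      show "bx n (\<psi> z) r \<inter> bx n (\<psi> w) r = {}"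
      proof (rule ccontr)
        assume "bx n (\<psi> z) r \<inter> bx n (\<psi> w) r \<noteq> {}"
        then obtain p where p: "p \<in> bx n (\<psi> z) r" "p \<in> bx n (\<psi> w) r" by blast
        have "bx n (\<psi> w) r = bx n (\<psi> z) r" using bx_eq[OF p(1)] bx_eq[OF p(2)] by simp
        moreover have "\<psi> w \<in> bx n (\<psi> w) r" using m[of w] zw Z(2) r(1) by (intro bx_center) auto
        ultimately have "\<psi> w \<in> bx n (\<psi> z) r" by simp
        then have "nm n (\<lambda>i. \<psi> w i - \<psi> z i) \<le> r" using r(1) by (simp add: bx_iff_nm)
        moreover have "w \<in> bx n x s" "z \<in> bx n x s" using zw Z(2) by auto
        ultimately have "nm n (\<lambda>i. w i - z i) \<le> r" using iso[of w z] by simp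
        moreover have "w \<in> affine_space n" using zw Z(2) bx_subset_affine by blast
        ultimately have "w \<in> bx n z r" using r(1) by (simp add: bx_iff_nm)
        moreover have "w \<in> bx n w r" using \<open>w \<in> affine_space n\<close> r(1) by (simp add: bx_center)
        ultimately show False using Z(4) zw unfolding disjoint_family_on_def by blast
      qed
    qed
    have ydis: "bx n y r \<inter> (\<Union>z\<in>Z. bx n (\<psi> z) r) = {}"
    proof (rule ccontr)
      assume "\<not> ?thesis"
      then obtain z p where p: "z \<in> Z" "p \<in> bx n y r" "p \<in> bx n (\<psi> z) r" by blast
      have "bx n y r = bx n (\<psi> z) r" using bx_eq[OF p(2)] bx_eq[OF p(3)] by simp
      moreover have "\<psi> z \<in> bx n (\<psi> z) r" using m[of z] p(1) Z(2) r(1) by (intro bx_center) auto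
      ultimately show False using r(3) p(1) Z(2) by blast
    qed
    have "emeasure (pm n) (bx n y r) + emeasure (pm n) (\<Union>z\<in>Z. bx n (\<psi> z) r)
        = emeasure (pm n) (bx n y r \<union> (\<Union>z\<in>Z. bx n (\<psi> z) r))"
      by (intro plus_emeasure bx_in_sets_pm ydis sets.finite_UN Z(1))
    also have "\<dots> \<le> emeasure (pm n) (bx n (\<psi> x) s)"
    proof (rule emeasure_mono)
      have "bx n (\<psi> z) r \<subseteq> bx n (\<psi> x) s" if "z \<in> Z" for z
      proof (rule bx_subset[OF _ r(2)])
        show "\<psi> z \<in> bx n (\<psi> x) s" using sub[OF x', of s] s that Z(2) by auto
      qed
      then show "bx n y r \<union> (\<Union>z\<in>Z. bx n (\<psi> z) r) \<subseteq> bx n (\<psi> x) s"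
        using bx_subset[OF y(1) r(2)] by blast
    qed (rule bx_in_sets_pm)
    also have "\<dots> = of_nat (card Z) * ennreal ?v" using tot s by (simp add: emeasure_pm_bx)
    also have "emeasure (pm n) (\<Union>z\<in>Z. bx n (\<psi> z) r) = of_nat (card Z) * ennreal ?v"
    proof -
      have "emeasure (pm n) (\<Union>z\<in>Z. bx n (\<psi> z) r) = (\<Sum>z\<in>Z. emeasure (pm n) (bx n (\<psi> z) r))"
        by (rule sum_emeasure[symmetric]) (use disj Z(1) bx_in_sets_pm in auto)
      then show ?thesis using r(1) by (simp add: emeasure_pm_bx)
    qed
    finally have "ennreal ?v + of_nat (card Z) * ennreal ?v \<le> of_nat (card Z) * ennreal ?v"
      using r(1) by (simp add: emeasure_pm_bx)
    moreover have "of_nat (card Z) * ennreal ?v = ennreal (real (card Z) * ?v)"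
      using v by (simp add: ennreal_mult ennreal_of_nat_eq_real_of_nat)
    ultimately have "ennreal (?v + real (card Z) * ?v) \<le> ennreal (real (card Z) * ?v)"
      using v by (simp add: ennreal_plus)
    moreover have "0 \<le> real (card Z) * ?v" using v by (intro mult_nonneg_nonneg) auto
    ultimately have "?v + real (card Z) * ?v \<le> real (card Z) * ?v" using ennreal_le_iff by blast
    then show False using v by linarith
  qed
qed


section \<open>Finite dimensional topological vector spaces\<close>

instance vec :: (topological_monoid_add, finite) topological_monoid_add
proof
  fix a b :: "'a ^ 'b"
  have "((\<lambda>x. fst x) \<longlongrightarrow> a) (nhds a \<times>\<^sub>F nhds b)" "((\<lambda>x. snd x) \<longlongrightarrow> b) (nhds a \<times>\<^sub>F nhds b)"
    by (rule filterlim_fst filterlim_snd)+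
  then show "((\<lambda>x. fst x + snd x) \<longlongrightarrow> a + b) (nhds a \<times>\<^sub>F nhds b)"
    by (intro vec_tendstoI) (auto intro!: tendsto_intros)
qed

instance vec :: (topological_comm_monoid_add, finite) topological_comm_monoid_add ..

instance vec :: (topological_group_add, finite) topological_group_add
proof
  fix a :: "'a ^ 'b"
  show "(uminus \<longlongrightarrow> - a) (nhds a)"
    by (rule vec_tendstoI) (auto intro!: tendsto_intros filterlim_ident)
qed

instance vec :: (topological_ab_group_add, finite) topological_ab_group_add ..

definition lin :: "('f \<Rightarrow> 'w \<Rightarrow> 'w) \<Rightarrow> nat \<Rightarrow> (nat \<Rightarrow> 'w) \<Rightarrow> (nat \<Rightarrow> 'f) \<Rightarrow> 'w::comm_monoid_add" where
  "lin s n b c = (\<Sum>i<n. s (c i) (b i))"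

lemma lin_cong: "(\<And>i. i < n \<Longrightarrow> c i = d i) \<Longrightarrow> (\<And>i. i < n \<Longrightarrow> b i = b' i) \<Longrightarrow> lin s n b c = lin s n b' d"
  unfolding lin_def by (rule sum.cong) auto

lemma continuous_restrict_measurable:
  assumes "continuous_on S f" "f ` S \<subseteq> T"
  shows "f \<in> measurable (restrict_space borel S) (restrict_space borel T)"
  using assms by (intro measurable_restrict_space2 borel_measurable_continuous_on_restrict)
    (auto simp: space_restrict_space)

lemma compact_affine_bounded:
  assumes "compact K" "K \<subseteq> affine_space n"
  shows "\<exists>R>0. K \<subseteq> bx n (\<lambda>_. 0 :: 'f::nonarch_local_field) R"
proof -
  have "\<exists>R. \<forall>c\<in>K. av (c i) \<le> R" for i
  proof -
    have "continuous_on K (\<lambda>c. c i)"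
      using continuous_on_product_coordinates[of i] continuous_on_subset by blast
    then have "compact ((\<lambda>c. c i) ` K)" by (rule compact_continuous_image[OF _ assms(1)])
    then have "bounded ((\<lambda>c. c i) ` K)" by (rule compact_imp_bounded)
    then show ?thesis unfolding bounded_any_center[where a=0] by auto
  qed
  then obtain R where R: "\<And>i c. c \<in> K \<Longrightarrow> av (c i) \<le> R i" by metis
  have "K \<subseteq> bx n (\<lambda>_. 0) (Max (insert 1 (R ` {..<n})))"
  proof
    fix c assume c: "c \<in> K"
    have "av (c i) \<le> Max (insert 1 (R ` {..<n}))" if "i < n" for i
    proof -
      have "R i \<le> Max (insert 1 (R ` {..<n}))" using that by (intro Max_ge) auto
      then show ?thesis using R[OF c, of i] by linarith
    qed
    then show "c \<in> bx n (\<lambda>_. 0) (Max (insert 1 (R ` {..<n})))" using c assms(2) by (auto simp: bx_iff)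
  qed
  moreover have "Max (insert 1 (R ` {..<n})) > 0"
    by (rule less_le_trans[OF zero_less_one Max_ge]) auto
  ultimately show ?thesis by blast
qed

locale tvs = vector_space s
  for s :: "'f::nonarch_local_field \<Rightarrow> 'w::{topological_ab_group_add,t2_space} \<Rightarrow> 'w" +
  assumes cont_scale: "continuous_on UNIV (\<lambda>(a, v). s a v)"
begin

lemma lin_add: "lin s n b (\<lambda>i. c i + d i) = lin s n b c + lin s n b d"
  by (simp add: lin_def scale_left_distrib sum.distrib)

lemma lin_diff: "lin s n b (\<lambda>i. c i - d i) = lin s n b c - lin s n b d"
  by (simp add: lin_def scale_left_diff_distrib sum_subtractf)

lemma lin_scale: "lin s n b (\<lambda>i. t * c i) = s t (lin s n b c)"
  by (simp add: lin_def scale_sum_right)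

lemma lin_zero [simp]: "lin s n b (\<lambda>i. 0) = 0"
  by (simp add: lin_def)

lemma lin_restrict [simp]: "lin s n b (restrict c {..<n}) = lin s n b c"
  by (rule lin_cong) auto

lemma lin_unit: "k < n \<Longrightarrow> lin s n b (\<lambda>i. if i = k then 1 else 0) = b k"
  unfolding lin_def by (subst sum.remove[of _ k]) auto

lemma tendsto_scale: "(f \<longlongrightarrow> a) F \<Longrightarrow> (g \<longlongrightarrow> v) F \<Longrightarrow> ((\<lambda>x. s (f x) (g x)) \<longlongrightarrow> s a v) F"
proof -
  assume "(f \<longlongrightarrow> a) F" "(g \<longlongrightarrow> v) F"
  then have "((\<lambda>x. (f x, g x)) \<longlongrightarrow> (a, v)) F" by (rule tendsto_Pair)
  moreover have "isCont (\<lambda>(a, v). s a v) (a, v)" using cont_scale by (simp add: continuous_on_eq_continuous_at)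
  ultimately have "((\<lambda>x. case (f x, g x) of (a, v) \<Rightarrow> s a v) \<longlongrightarrow> (case (a, v) of (a, v) \<Rightarrow> s a v)) F"
    by (rule isCont_tendsto_compose[rotated])
  then show ?thesis by simp
qed

lemma continuous_on_scale:
  "continuous_on S f \<Longrightarrow> continuous_on S g \<Longrightarrow> continuous_on S (\<lambda>x. s (f x) (g x))"
  unfolding continuous_on_def by (auto intro: tendsto_scale)

lemma continuous_on_lin:
  assumes "\<And>i. i < n \<Longrightarrow> continuous_on S (\<lambda>x. f x i)"
  shows "continuous_on S (\<lambda>x. lin s n b (f x))"
  unfolding lin_def by (intro continuous_on_sum continuous_on_scale assms continuous_intros) auto

lemma continuous_on_lin_id: "continuous_on S (lin s n b)"
  by (rule continuous_on_lin[of n S "\<lambda>x. x"]) (rule continuous_on_subset[OF continuous_on_product_coordinates], simp)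

text \<open>Independence of an indexed family, so that a repeated vector counts as a relation. Forms
  and coordinates need the order of the vectors.\<close>

definition indep :: "nat \<Rightarrow> (nat \<Rightarrow> 'w) \<Rightarrow> bool" where
  "indep n b \<longleftrightarrow> (\<forall>c. lin s n b c = 0 \<longrightarrow> (\<forall>i<n. c i = 0))"

definition co :: "nat \<Rightarrow> (nat \<Rightarrow> 'w) \<Rightarrow> 'w \<Rightarrow> nat \<Rightarrow> 'f" where
  "co n b w = (THE c. c \<in> affine_space n \<and> lin s n b c = w)"

lemma indep_inj: "indep n b \<Longrightarrow> lin s n b c = lin s n b d \<Longrightarrow> i < n \<Longrightarrow> c i = d i"
  using lin_diff[of n b c d] unfolding indep_def by fastforce

lemma co_lin: "indep n b \<Longrightarrow> co n b (lin s n b c) = restrict c {..<n}"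
  unfolding co_def
proof (rule the_equality)
  fix d assume "indep n b" "d \<in> affine_space n \<and> lin s n b d = lin s n b c"
  then show "d = restrict c {..<n}" by (intro affine_eqI[of _ n]) (auto dest: indep_inj)
qed simp

lemma co_lin_nth: "indep n b \<Longrightarrow> i < n \<Longrightarrow> co n b (lin s n b c) i = c i"
  by (simp add: co_lin)

text \<open>This is why coordinates are continuous. The unit sphere \<open>?S\<close> is compact and
  its image avoids 0, so by joint continuity of scaling a small scalar times a small vector avoids
  that image; but a small vector with large coordinates could be scaled into the image by a small
  scalar.\<close>

lemma bounded_coordinates:
  assumes b: "indep n b" and e: "e > 0"
  shows "\<exists>N. open N \<and> 0 \<in> N \<and> (\<forall>c. lin s n b c \<in> N \<longrightarrow> nm n c < e)"
proof -
  let ?S = "bx n (\<lambda>_. 0) 1 \<inter> (\<Union>i<n. {c :: nat \<Rightarrow> 'f. av (c i) \<ge> 1})"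
  have "closed {c :: nat \<Rightarrow> 'f. av (c i) \<ge> 1}" for i
    by (intro closed_Collect_le continuous_intros continuous_on_product_coordinates)
  then have "closed (\<Union>i<n. {c :: nat \<Rightarrow> 'f. av (c i) \<ge> 1})" by (intro closed_UN) auto
  then have S: "compact ?S" by (rule compact_Int_closed[OF compact_bx])
  define V where "V = - (lin s n b ` ?S)"
  have "compact (lin s n b ` ?S)" by (intro compact_continuous_image[OF _ S] continuous_on_lin_id)
  then have V: "open V" unfolding V_def by (simp add: compact_imp_closed open_Compl)
  have V0: "0 \<in> V"
  proof (rule ccontr)
    assume "0 \<notin> V"
    then obtain c i where c: "lin s n b c = 0" "i < n" "av (c i) \<ge> 1" unfolding V_def by auto
    then have "c i = 0" using b unfolding indep_def by blast
    then show False using c by simp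
  qed
  have "open ((\<lambda>(a, v). s a v) -` V)" using open_vimage[OF V cont_scale] .
  moreover have "(0, 0) \<in> (\<lambda>(a, v). s a v) -` V" using V0 by simp
  ultimately obtain A N where AN: "open A" "open N" "(0, 0) \<in> A \<times> N" "A \<times> N \<subseteq> (\<lambda>(a, v). s a v) -` V"
    by (rule open_prod_elim)
  obtain \<delta> where \<delta>: "\<delta> > 0" "cball 0 \<delta> \<subseteq> A" using AN(1,3) open_contains_cball[of A] by auto
  have N: "nm n c < 1 / \<delta>" if "lin s n b c \<in> N" for c
  proof (rule ccontr)
    assume "\<not> nm n c < 1 / \<delta>"
    then have ge: "1 / \<delta> \<le> nm n c" by simp
    then have pos: "0 < nm n c" using \<delta>(1) by (meson divide_pos_pos less_le_trans zero_less_one)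
    then obtain j where j: "j < n" "nm n c = av (c j)" using nm_attained[of n c] by auto
    have cj: "c j \<noteq> 0" using pos j by auto
    let ?d = "restrict (\<lambda>i. inverse (c j) * c i) {..<n}"
    have "av (inverse (c j)) \<le> \<delta>" using le_imp_inverse_le[OF ge] \<delta>(1) j(2) by (simp add: av_inverse)
    then have "inverse (c j) \<in> A" using \<delta>(2) by auto
    then have "s (inverse (c j)) (lin s n b c) \<in> V" using AN(4) that by auto
    moreover have "lin s n b ?d = s (inverse (c j)) (lin s n b c)" by (simp add: lin_scale)
    moreover have "?d \<in> ?S"
    proof (intro IntI)
      have "av (inverse (c j) * c i) \<le> 1" if "i < n" for i
      proof -
        have "av (inverse (c j) * c i) = av (c i) / av (c j)"
          by (simp only: dist_0_mult av_inverse divide_inverse mult.commute)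
        also have "\<dots> \<le> 1" using av_le_nm[OF that, of c] j pos by simp
        finally show ?thesis .
      qed
      then show "?d \<in> bx n (\<lambda>_. 0) 1" by (simp add: bx_iff)
      show "?d \<in> (\<Union>i<n. {c. av (c i) \<ge> 1})" using j cj by (intro UN_I[of j]) auto
    qed
    then have "lin s n b ?d \<in> lin s n b ` ?S" by (rule imageI)
    ultimately show False unfolding V_def by simp
  qed
  \<comment> \<open>A further scaling improves the bound \<open>1 / \<delta>\<close> to the required
    \<open>e\<close>.\<close>
  obtain p :: 'f where p: "p \<noteq> 0" "av p < e * \<delta>" using small_element[of "e * \<delta>"] e \<delta>(1) by auto
  let ?N = "(\<lambda>w. s (inverse p) w) -` N"
  have "open ?N" by (intro open_vimage AN(2) continuous_on_scale continuous_intros)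
  moreover have "0 \<in> ?N" using AN(3) by simp
  moreover have "nm n c < e" if "lin s n b c \<in> ?N" for c
  proof -
    have "nm n (\<lambda>i. inverse p * c i) < 1 / \<delta>" using N[of "\<lambda>i. inverse p * c i"] that by (simp add: lin_scale)
    then have "inverse (av p) * nm n c < 1 / \<delta>" using nm_scale[of n "inverse p" c] by (simp only: av_inverse)
    then have "nm n c * \<delta> < av p" using \<delta>(1) p(1) by (simp add: field_simps)
    then show ?thesis using p(2) \<delta>(1) by (meson less_trans mult_less_cancel_right_pos)
  qed
  ultimately show ?thesis by blast
qed

lemma lin_homeomorphism:
  assumes b: "indep n b"
  shows "homeomorphism (affine_space n) (lin s n b ` affine_space n) (lin s n b) (co n b)"
proof (rule homeomorphismI)
  let ?R = "lin s n b ` affine_space n"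
  show "continuous_on (affine_space n) (lin s n b)" by (rule continuous_on_lin_id)
  show "continuous_on ?R (co n b)"
  proof (rule continuous_on_coordinatewise_then_product)
    fix i
    show "continuous_on ?R (\<lambda>w. co n b w i)"
    proof (cases "i < n")
      case True
      show ?thesis
        unfolding continuous_on_topological
      proof (intro ballI allI impI)
        fix w B assume w: "w \<in> ?R" "open B" "co n b w i \<in> B"
        then obtain c where c: "w = lin s n b c" by blast
        obtain e where e: "e > 0" "ball (co n b w i) e \<subseteq> B" using w(2,3) open_contains_ball by blast
        obtain N where N: "open N" "0 \<in> N" "\<And>c. lin s n b c \<in> N \<Longrightarrow> nm n c < e"
          using bounded_coordinates[OF b e(1)] by blast
        let ?T = "(\<lambda>x. x - w) -` N"
        have "open ?T" by (intro open_vimage N(1) continuous_intros)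
        moreover have "w \<in> ?T" using N(2) by simp
        moreover have "co n b x i \<in> B" if "x \<in> ?R" "x \<in> ?T" for x
        proof -
          obtain d where d: "x = lin s n b d" using \<open>x \<in> ?R\<close> by blast
          have "nm n (\<lambda>i. d i - c i) < e" using N(3)[of "\<lambda>i. d i - c i"] that c d by (simp add: lin_diff)
          then have "av (d i - c i) < e" using av_le_nm[OF True, of "\<lambda>i. d i - c i"] by simp
          then have "dist (c i) (d i) < e" by (simp add: dist_eq_av[of "c i"])
          then show ?thesis using e(2) c d co_lin_nth[OF b True] by auto
        qed
        ultimately show "\<exists>T. open T \<and> w \<in> T \<and> (\<forall>x\<in>?R. x \<in> T \<longrightarrow> co n b x i \<in> B)" by blast
      qed
    next
      case False
      have "co n b w i = undefined" if "w \<in> ?R" for w using that False by (auto simp: co_lin[OF b])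
      then show ?thesis using continuous_on_const[of ?R undefined] by (simp cong: continuous_on_cong)
    qed
  qed
  show "\<And>y. y \<in> ?R \<Longrightarrow> lin s n b (co n b y) = y" by (auto simp: co_lin[OF b])
  show "\<And>x. x \<in> affine_space n \<Longrightarrow> co n b (lin s n b x) = x"
    by (auto simp: co_lin[OF b] intro!: affine_eqI[of _ n])
qed (auto simp: co_lin[OF b])

lemma indep_imp_independent:
  assumes b: "indep n b"
  shows "inj_on b {..<n}" "independent (b ` {..<n})"
proof -
  show inj: "inj_on b {..<n}"
  proof (rule inj_onI)
    fix i j assume ij: "i \<in> {..<n}" "j \<in> {..<n}" "b i = b j"
    show "i = j"
    proof (rule ccontr)
      assume "i \<noteq> j"
      have "lin s n b (\<lambda>k. if k = i then 1 else 0) = lin s n b (\<lambda>k. if k = j then 1 else 0)"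
        using ij by (simp add: lin_unit)
      from indep_inj[OF b this, of i] show False using ij \<open>i \<noteq> j\<close> by simp
    qed
  qed
  show "independent (b ` {..<n})"
  proof
    assume "dependent (b ` {..<n})"
    then obtain u v where u: "v \<in> b ` {..<n}" "u v \<noteq> 0" "(\<Sum>v\<in>b ` {..<n}. s (u v) v) = 0"
      using dependent_finite[of "b ` {..<n}"] by auto
    have "lin s n b (\<lambda>i. u (b i)) = 0" using u(3) unfolding lin_def by (simp add: sum.reindex[OF inj])
    then show False using b u(1,2) unfolding indep_def by blast
  qed
qed

lemma independent_imp_indep:
  assumes "finite B" "independent B" "card B = n"
  shows "\<exists>b. b ` {..<n} = B \<and> indep n b"
proof -
  obtain b where b: "bij_betw b {..<n} B"
    using ex_bij_betw_nat_finite[OF assms(1)] assms(3) by (auto simp: atLeast0LessThan)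
  then have inj: "inj_on b {..<n}" and im: "b ` {..<n} = B" by (auto simp: bij_betw_def)
  have "indep n b"
    unfolding indep_def
  proof (intro allI impI)
    fix c i assume c: "lin s n b c = 0" and i: "i < n"
    have "(\<Sum>v\<in>B. s (c (inv_into {..<n} b v)) v) = (\<Sum>i<n. s (c i) (b i))"
      unfolding im[symmetric] sum.reindex[OF inj] by (rule sum.cong) (auto simp: inv_into_f_f[OF inj])
    then have "(\<Sum>v\<in>B. s (c (inv_into {..<n} b v)) v) = 0" using c by (simp add: lin_def)
    then have "c (inv_into {..<n} b (b i)) = 0"
      using independentD[OF assms(2,1) subset_refl, of "\<lambda>v. c (inv_into {..<n} b v)" "b i"] i im by blast
    then show "c i = 0" using i by (simp add: inv_into_f_f[OF inj])
  qed
  then show ?thesis using im by blast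
qed

lemma lin_in_subspace: "subspace W \<Longrightarrow> (\<And>i. i < n \<Longrightarrow> b i \<in> W) \<Longrightarrow> lin s n b c \<in> W"
  unfolding lin_def by (intro subspace_sum subspace_scale) auto

lemma span_image_eq_lin: "span (b ` {..<n}) = lin s n b ` affine_space n"
proof
  show "span (b ` {..<n}) \<subseteq> lin s n b ` affine_space n"
  proof (rule span_minimal)
    show "b ` {..<n} \<subseteq> lin s n b ` affine_space n"
    proof (rule image_subsetI)
      fix k assume "k \<in> {..<n}"
      then have "b k = lin s n b (restrict (\<lambda>i. if i = k then 1 else 0) {..<n})"
        using lin_unit[of k n b] by simp
      then show "b k \<in> lin s n b ` affine_space n" using restrict_affine by blast
    qed
    show "subspace (lin s n b ` affine_space n)"
    proof (rule subspaceI)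
      have "0 = lin s n b (restrict (\<lambda>i. 0) {..<n})" by simp
      then show "0 \<in> lin s n b ` affine_space n" using restrict_affine by blast
    next
      fix x y assume "x \<in> lin s n b ` affine_space n" "y \<in> lin s n b ` affine_space n"
      then obtain c d where "x = lin s n b c" "y = lin s n b d" by blast
      then have "x + y = lin s n b (restrict (\<lambda>i. c i + d i) {..<n})" by (simp add: lin_add)
      then show "x + y \<in> lin s n b ` affine_space n" using restrict_affine by blast
    next
      fix t x assume "x \<in> lin s n b ` affine_space n"
      then obtain c where "x = lin s n b c" by blast
      then have "s t x = lin s n b (restrict (\<lambda>i. t * c i) {..<n})" by (simp add: lin_scale)
      then show "s t x \<in> lin s n b ` affine_space n" using restrict_affine by blast
    qed
  qed
  show "lin s n b ` affine_space n \<subseteq> span (b ` {..<n})"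
    by (rule image_subsetI, rule lin_in_subspace[OF subspace_span]) (auto intro: span_base)
qed

end

text \<open>A subspace \<open>W\<close> instead of the whole type, because the Hermitian matrices
  form only a subset of the type of matrices.\<close>

locale ftvs = tvs s
  for s :: "'f::nonarch_local_field \<Rightarrow> 'w::{topological_ab_group_add,t2_space} \<Rightarrow> 'w" +
  fixes W :: "'w set" and n :: nat
  assumes subspace_W: "subspace W"
    and basis_W: "\<exists>B. finite B \<and> independent B \<and> span B = W \<and> card B = n"
begin

abbreviation L :: "(nat \<Rightarrow> 'w) \<Rightarrow> (nat \<Rightarrow> 'f) \<Rightarrow> 'w" where "L \<equiv> lin s n"

definition is_basis :: "(nat \<Rightarrow> 'w) \<Rightarrow> bool" where
  "is_basis b \<longleftrightarrow> (\<forall>i<n. b i \<in> W) \<and> indep n b"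

lemma is_basis_exists: "\<exists>b. is_basis b"
proof -
  obtain B where B: "finite B" "independent B" "span B = W" "card B = n" using basis_W by blast
  then obtain b where "b ` {..<n} = B" "indep n b" using independent_imp_indep by blast
  then show ?thesis using B(3) span_superset[of B] unfolding is_basis_def by blast
qed

lemma indep_W_le: "(\<And>i. i < k \<Longrightarrow> b i \<in> W) \<Longrightarrow> indep k b \<Longrightarrow> k \<le> n"
proof -
  assume b: "\<And>i. i < k \<Longrightarrow> b i \<in> W" "indep k b"
  obtain B where B: "finite B" "span B = W" "card B = n" using basis_W by blast
  have "card (b ` {..<k}) \<le> card B"
    using independent_span_bound[OF B(1) indep_imp_independent(2)[OF b(2)]] b(1) B(2) by auto
  then show ?thesis using card_image[OF indep_imp_independent(1)[OF b(2)]] B(3) by simp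
qed

lemma is_basis_range: "is_basis b \<Longrightarrow> L b ` affine_space n = W"
proof
  assume b: "is_basis b"
  show "L b ` affine_space n \<subseteq> W"
    using lin_in_subspace[OF subspace_W] b unfolding is_basis_def by blast
  show "W \<subseteq> L b ` affine_space n"
  proof (rule ccontr)
    assume "\<not> ?thesis"
    then obtain w where w: "w \<in> W" "w \<notin> span (b ` {..<n})" unfolding span_image_eq_lin by blast
    have i: "independent (b ` {..<n})" "inj_on b {..<n}" using b indep_imp_independent unfolding is_basis_def by auto
    have "independent (insert w (b ` {..<n}))" using independent_insertI[OF w(2) i(1)] .
    obtain B where B: "finite B" "span B = W" "card B = n" using basis_W by blast
    have "b ` {..<n} \<subseteq> W" using b unfolding is_basis_def by auto
    then have sub: "insert w (b ` {..<n}) \<subseteq> span B" using w(1) B(2) by simp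
    have "card (insert w (b ` {..<n})) \<le> card B"
      using independent_span_bound[OF B(1) \<open>independent (insert w (b ` {..<n}))\<close> sub] by simp
    moreover have "w \<notin> b ` {..<n}" using w(2) span_base[of w "b ` {..<n}"] by blast
    ultimately show False using card_image[OF i(2)] B(3) by simp
  qed
qed

lemma is_basis_indep: "is_basis b \<Longrightarrow> indep n b" by (simp add: is_basis_def)

lemma is_basis_homeomorphism: "is_basis b \<Longrightarrow> homeomorphism (affine_space n) W (L b) (co n b)"
  using lin_homeomorphism[OF is_basis_indep, of b] is_basis_range[of b] by simp

lemma L_in_W: "is_basis b \<Longrightarrow> L b c \<in> W"
  using lin_in_subspace[OF subspace_W] unfolding is_basis_def by blast

lemma co_affine: "is_basis b \<Longrightarrow> w \<in> W \<Longrightarrow> co n b w \<in> affine_space n"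
  using is_basis_homeomorphism[of b] by (auto simp: homeomorphism_def)

lemma L_co: "is_basis b \<Longrightarrow> w \<in> W \<Longrightarrow> L b (co n b w) = w"
  using is_basis_homeomorphism[of b] by (auto simp: homeomorphism_def)

lemma co_eqI: "is_basis b \<Longrightarrow> w = L b c \<Longrightarrow> i < n \<Longrightarrow> co n b w i = c i"
  using co_lin_nth[OF is_basis_indep] by blast

lemma co_add: "is_basis b \<Longrightarrow> v \<in> W \<Longrightarrow> w \<in> W \<Longrightarrow> i < n \<Longrightarrow> co n b (v + w) i = co n b v i + co n b w i"
  by (rule co_eqI) (auto simp: lin_add L_co)

lemma co_diff: "is_basis b \<Longrightarrow> v \<in> W \<Longrightarrow> w \<in> W \<Longrightarrow> i < n \<Longrightarrow> co n b (v - w) i = co n b v i - co n b w i"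
  by (rule co_eqI) (auto simp: lin_diff L_co)

lemma co_scale: "is_basis b \<Longrightarrow> w \<in> W \<Longrightarrow> i < n \<Longrightarrow> co n b (s t w) i = t * co n b w i"
  by (rule co_eqI) (auto simp: lin_scale L_co)

text \<open>Adjoining an outside vector \<open>x\<close> to a basis of \<open>W\<close> gives an
  independent family; its last coordinate is continuous on the span, equal to 1 at \<open>x\<close>
  and to 0 on \<open>W\<close>. Closedness keeps derivatives of maps into \<open>W\<close> inside
  \<open>W\<close>.\<close>

lemma closed_W: "closed W"
proof -
  obtain b where b: "is_basis b" using is_basis_exists by blast
  have "\<exists>T. open T \<and> x \<in> T \<and> T \<subseteq> - W" if x: "x \<notin> W" for x
  proof -
    define b' where "b' = b(n := x)"
    have lin': "lin s (Suc n) b' c = L b c + s (c n) x" for c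
      unfolding lin_def b'_def by simp
    have ind: "indep (Suc n) b'"
      unfolding indep_def
    proof (intro allI impI)
      fix c i assume c: "lin s (Suc n) b' c = 0" and i: "i < Suc n"
      have "c n = 0"
      proof (rule ccontr)
        assume cn: "c n \<noteq> 0"
        have "s (c n) x = - L b c" using c unfolding lin' by (simp add: eq_neg_iff_add_eq_0 add.commute)
        then have "s (inverse (c n)) (s (c n) x) \<in> W"
          using L_in_W[OF b, of c] subspace_W by (simp add: subspace_neg subspace_scale)
        then show False using cn x by simp
      qed
      moreover from this have "\<forall>i<n. c i = 0" using c is_basis_indep[OF b] unfolding lin' indep_def by simp
      ultimately show "c i = 0" using i by (auto simp: less_Suc_eq)
    qed
    let ?R = "lin s (Suc n) b' ` affine_space (Suc n)"
    note h = lin_homeomorphism[OF ind]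
    have "continuous_on ?R (\<lambda>y. co (Suc n) b' y n)"
      by (rule continuous_on_product_then_coordinatewise[OF homeomorphism_cont2[OF h]])
    then have "openin (top_of_set ?R) (?R \<inter> (\<lambda>y. co (Suc n) b' y n) -` (- {0}))"
      by (rule continuous_openin_preimage_gen) auto
    then obtain T where T: "open T" "?R \<inter> (\<lambda>y. co (Suc n) b' y n) -` (- {0}) = ?R \<inter> T" by (auto simp: openin_open)
    have co': "co (Suc n) b' (L b c + s t x) n = t" for c t
    proof -
      have "L b c + s t x = lin s (Suc n) b' (c(n := t))"
        unfolding lin' by (simp add: lin_def)
      then show ?thesis using co_lin_nth[OF ind, of n "c(n := t)"] by simp
    qed
    have inR: "L b c + s t x \<in> ?R" for c t
    proof -
      have "L b c + s t x = lin s (Suc n) b' (c(n := t))"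
        unfolding lin' by (simp add: lin_def)
      also have "\<dots> = lin s (Suc n) b' (restrict (c(n := t)) {..<Suc n})" by simp
      finally show ?thesis using restrict_affine by blast
    qed
    have "x \<in> T" using T(2) co'[of "\<lambda>_. 0" 1] inR[of "\<lambda>_. 0" 1] by auto
    moreover have "w \<notin> T" if "w \<in> W" for w
    proof -
      have "w = L b (co n b w) + s 0 x" using L_co[OF b that] by simp
      then have "w \<in> ?R" "co (Suc n) b' w n = 0" using co'[of _ 0] inR[of _ 0] by metis+
      then show ?thesis using T(2) by blast
    qed
    ultimately show ?thesis using T(1) by blast
  qed
  note * = this
  have "open (- W)"
  proof (subst open_subopen, intro ballI)
    fix x assume "x \<in> - W"
    then show "\<exists>T. open T \<and> x \<in> T \<and> T \<subseteq> - W" by (intro *) simp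
  qed
  then show ?thesis by (simp add: closed_def)
qed

lemma lin_fun_upd:
  assumes "i < n"
  shows "L (v(i := L v a)) c = L v (\<lambda>l. (if l = i then 0 else c l) + c i * a l)"
proof -
  have "L (v(i := L v a)) c = s (c i) (L v a) + (\<Sum>l\<in>{..<n} - {i}. s (c l) (v l))"
    unfolding lin_def[of s n "v(i := L v a)"] using assms by (subst sum.remove[of _ i]) auto
  also have "(\<Sum>l\<in>{..<n} - {i}. s (c l) (v l)) = L v (\<lambda>l. if l = i then 0 else c l)"
    unfolding lin_def using assms by (subst sum.remove[of "{..<n}" i]) auto
  finally have eq: "L (v(i := L v a)) c = s (c i) (L v a) + L v (\<lambda>l. if l = i then 0 else c l)" .
  show ?thesis unfolding eq lin_add lin_scale by (rule add.commute)
qed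

lemma is_basis_fun_upd:
  assumes v: "is_basis v" and i: "i < n" "a i \<noteq> 0"
  shows "is_basis (v(i := L v a))"
  unfolding is_basis_def
proof (intro conjI allI impI)
  fix k assume "k < n"
  then show "(v(i := L v a)) k \<in> W" using v L_in_W unfolding is_basis_def by auto
next
  show "indep n (v(i := L v a))"
    unfolding indep_def
  proof (intro allI impI)
    fix c k assume c: "L (v(i := L v a)) c = 0" and k: "k < n"
    then have *: "(if l = i then 0 else c l) + c i * a l = 0" if "l < n" for l
      using is_basis_indep[OF v] that unfolding lin_fun_upd[OF i(1)] indep_def by blast
    have "c i = 0" using *[OF i(1)] i(2) by simp
    then show "c k = 0" using *[OF k] by (auto split: if_splits)
  qed
qed

text \<open>Any two bases are connected by replacing one vector at a time by a combination of the current
  ones in which it occurs.\<close>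

lemma basis_exchange:
  assumes w: "is_basis w" "P w" and v: "is_basis v"
    and cong: "\<And>u u'. (\<And>i. i < n \<Longrightarrow> u i = u' i) \<Longrightarrow> P u \<Longrightarrow> P u'"
    and step: "\<And>u i a. is_basis u \<Longrightarrow> i < n \<Longrightarrow> a i \<noteq> 0 \<Longrightarrow> P u \<Longrightarrow> P (u(i := L u a))"
  shows "P v"
proof -
  have "\<exists>u. is_basis u \<and> P u \<and> (\<forall>i<j. u i = v i)" if "j \<le> n" for j
    using that
  proof (induction j)
    case 0
    then show ?case using w by auto
  next
    case (Suc j)
    then obtain u where u: "is_basis u" "P u" "\<forall>i<j. u i = v i" by auto
    have vj: "v j \<in> W" using v Suc.prems unfolding is_basis_def by auto
    define a where "a = co n u (v j)"
    have a: "v j = L u a" using L_co[OF u(1) vj] by (simp add: a_def)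
    \<comment> \<open>The first \<open>j\<close> vectors of \<open>u\<close> are those of
      \<open>v\<close>, and \<open>v j\<close> is not a combination of them.\<close>
    have "\<exists>k. j \<le> k \<and> k < n \<and> a k \<noteq> 0"
    proof (rule ccontr)
      assume "\<not> ?thesis"
      then have a0: "a k = 0" if "j \<le> k" "k < n" for k using that by auto
      have "L v (\<lambda>i. if i < j then a i else 0) = L u a"
        unfolding lin_def using u(3) a0 by (intro sum.cong) auto
      then have "L v (\<lambda>i. if i < j then a i else 0) = L v (\<lambda>i. if i = j then 1 else 0)"
        using a lin_unit[of j n v] Suc.prems by simp
      from indep_inj[OF is_basis_indep[OF v] this, of j] show False using Suc.prems by simp
    qed
    then obtain k where k: "j \<le> k" "k < n" "a k \<noteq> 0" by blast
    show ?case
    proof (cases "a j = 0")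
      case False
      then have "is_basis (u(j := L u a))" "P (u(j := L u a))"
        using is_basis_fun_upd[OF u(1), of j a] step[OF u(1), of j a] u(2) Suc.prems by auto
      moreover have "\<forall>i<Suc j. (u(j := L u a)) i = v i" using u(3) a by (auto simp: less_Suc_eq)
      ultimately show ?thesis by blast
    next
      case True
      then have kj: "k \<noteq> j" using k(3) by auto
      \<comment> \<open>The coefficient at \<open>j\<close> vanishes, so \<open>v j\<close> cannot
        be inserted there at once. Replacing \<open>u k\<close> by \<open>u k - u j\<close> first
        brings the coefficient \<open>a k\<close> to position \<open>j\<close> as well.\<close>
      define d where "d = (\<lambda>i. (if i = k then 1 else 0) - (if i = j then 1 else (0::'f)))"
      define u' where "u' = u(k := L u d)"
      have dk: "d k \<noteq> 0" using kj by (simp add: d_def)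
      have u': "is_basis u'" "P u'" "\<forall>i<j. u' i = v i"
        unfolding u'_def using is_basis_fun_upd[of u k d, OF u(1) k(2) dk] step[of u k d, OF u(1) k(2) dk u(2)] u(3) k(1)
        by simp_all
      define a' where "a' = a(j := a k)"
      have "L u' a' = v j"
      proof -
        have "L u' a' = L u (\<lambda>l. (if l = k then 0 else a' l) + a' k * d l)"
          unfolding u'_def by (rule lin_fun_upd[OF k(2)])
        also have "\<dots> = L u a"
          using True kj by (intro lin_cong) (auto simp: a'_def d_def)
        finally show ?thesis using a by simp
      qed
      moreover have "a' j \<noteq> 0" using k(3) by (simp add: a'_def)
      ultimately have "is_basis (u'(j := v j))" "P (u'(j := v j))"
        using is_basis_fun_upd[OF u'(1), of j a'] step[OF u'(1), of j a'] u'(2) Suc.prems by auto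
      moreover have "\<forall>i<Suc j. (u'(j := v j)) i = v i" using u'(3) by (auto simp: less_Suc_eq)
      ultimately show ?thesis by blast
    qed
  qed
  from this[OF order_refl] obtain u where "is_basis u" "P u" "\<forall>i<n. u i = v i" by blast
  then show ?thesis using cong[of u v] by blast
qed

end

text \<open>Expanding in slot \<open>i\<close>, every term except the \<open>i\<close>-th contains a
  vector twice. Together with \<open>basis_exchange\<close> this takes the place of
  determinants.\<close>

lemma alternating_form_lin:
  assumes "alternating_form s W n \<omega>" "vector_space s" "module.subspace s W" "\<And>i. i < n \<Longrightarrow> v i \<in> W" "i < n"
  shows "\<omega> (v(i := lin s n v a)) = a i * \<omega> v"
proof -
  interpret vector_space s by fact
  note alt = assms(1)[unfolded alternating_form_def]
  have add: "\<omega> (v(i := x + y)) = \<omega> (v(i := x)) + \<omega> (v(i := y))" if "x \<in> W" "y \<in> W" for x y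
    using alt assms(4,5) that by blast
  have scale: "\<omega> (v(i := s t x)) = t * \<omega> (v(i := x))" if "x \<in> W" for x t
    using alt assms(4,5) that by blast
  have zero: "\<omega> (v(i := v l)) = 0" if "l < n" "l \<noteq> i" for l
  proof -
    have 3: "\<And>v i j. (\<forall>l<n. v l \<in> W) \<and> i < j \<and> j < n \<and> v i = v j \<Longrightarrow> \<omega> v = 0" using alt by blast
    have "\<forall>k<n. (v(i := v l)) k \<in> W" using assms(4) that by auto
    then show ?thesis
      using 3[of "v(i := v l)" "min i l" "max i l"] assms(5) that
      by (cases "i < l") (auto simp: min_def max_def)
  qed
  have "\<omega> (v(i := (\<Sum>l<k. s (a l) (v l)))) = (\<Sum>l<k. a l * \<omega> (v(i := v l)))" if "k \<le> n" for k
    using that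
  proof (induction k)
    case 0
    have "0 \<in> W" using assms(3) subspace_0 by blast
    from scale[OF this, of 0] have "\<omega> (v(i := 0)) = 0" by (simp only: scale_zero_right mult_zero_left)
    then show ?case by (simp only: lessThan_0 sum.empty)
  next
    case (Suc k)
    have "(\<Sum>l<k. s (a l) (v l)) \<in> W" "s (a k) (v k) \<in> W" "v k \<in> W"
      using Suc.prems assms(3,4) by (auto intro!: subspace_sum subspace_scale)
    from add[OF this(1,2)] scale[OF this(3), of "a k"] Suc.IH Suc.prems
    show ?case by (simp only: sum.lessThan_Suc Suc_leD)
  qed
  from this[OF order_refl] have "\<omega> (v(i := lin s n v a)) = (\<Sum>l<n. a l * \<omega> (v(i := v l)))" by (simp add: lin_def)
  also have "\<dots> = a i * \<omega> v" using assms(5) zero by (subst sum.remove[of _ i]) auto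
  finally show ?thesis .
qed

context ftvs
begin

lemma form_upd: "alternating_form s W n \<omega> \<Longrightarrow> (\<And>i. i < n \<Longrightarrow> v i \<in> W) \<Longrightarrow> i < n \<Longrightarrow>
    \<omega> (v(i := L v a)) = a i * \<omega> v"
  by (rule alternating_form_lin[OF _ vector_space_axioms subspace_W])

text \<open>A relation and the trivial combination put the same vector 0 into slot \<open>i\<close>,
  but \<open>form_upd\<close> evaluates them to \<open>c i * \<omega> v\<close> and to 0.\<close>

lemma form_dependent:
  assumes \<omega>: "alternating_form s W n \<omega>" and v: "\<And>i. i < n \<Longrightarrow> v i \<in> W" "\<not> indep n v"
  shows "\<omega> v = 0"
proof -
  obtain c i where c: "L v c = 0" "i < n" "c i \<noteq> 0" using v(2) unfolding indep_def by blast
  have "\<omega> (v(i := L v c)) = c i * \<omega> v" by (rule form_upd[OF \<omega> v(1) c(2)])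
  moreover have "\<omega> (v(i := L v (\<lambda>_. 0))) = 0 * \<omega> v" by (rule form_upd[OF \<omega> v(1) c(2)])
  ultimately show ?thesis using c by simp
qed

lemma form_cong: "alternating_form s W n \<omega> \<Longrightarrow> (\<And>i. i < n \<Longrightarrow> v i = w i) \<Longrightarrow> \<omega> v = \<omega> w"
  unfolding alternating_form_def
  by (drule conjunct1, drule spec[of _ v], drule spec[of _ w], erule mp, simp)

lemma form_nonzero:
  assumes \<omega>: "alternating_form s W n \<omega>" and v: "\<And>i. i < n \<Longrightarrow> v i \<in> W" "\<omega> v \<noteq> 0" and b: "is_basis b"
  shows "\<omega> b \<noteq> 0"
proof (rule basis_exchange[of v "\<lambda>u. \<omega> u \<noteq> 0"])
  show "is_basis v"
  proof (rule ccontr)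
    assume "\<not> is_basis v"
    then have "\<not> indep n v" using v(1) unfolding is_basis_def by auto
    from form_dependent[OF \<omega> v(1) this] show False using v(2) by simp
  qed
  show "\<omega> u' \<noteq> 0" if "\<And>i. i < n \<Longrightarrow> u i = u' i" "\<omega> u \<noteq> 0" for u u'
    using form_cong[OF \<omega> that(1)] that(2) by auto
  show "\<omega> (u(i := L u a)) \<noteq> 0" if "is_basis u" "i < n" "a i \<noteq> 0" "\<omega> u \<noteq> 0" for u i a
    using form_upd[OF \<omega>, of u i a] that unfolding is_basis_def by simp
qed (use v b in auto)

text \<open>Top forms make up a line. For independent \<open>v\<close> the ratio is propagated from
  \<open>b\<close> by basis exchange; for dependent \<open>v\<close> both sides vanish.\<close>

lemma forms_proportional:
  assumes \<omega>: "alternating_form s W n \<omega>" and \<omega>': "alternating_form s W n \<omega>'"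
    and b: "is_basis b" "\<omega> b \<noteq> 0" and v: "\<And>i. i < n \<Longrightarrow> v i \<in> W"
  shows "\<omega>' v = \<omega>' b / \<omega> b * \<omega> v"
proof (cases "indep n v")
  case True
  then have "is_basis v" using v by (simp add: is_basis_def)
  show ?thesis
  proof (rule basis_exchange[of b "\<lambda>u. \<omega>' u = \<omega>' b / \<omega> b * \<omega> u"])
    show "\<omega>' u' = \<omega>' b / \<omega> b * \<omega> u'" if "\<And>i. i < n \<Longrightarrow> u i = u' i" "\<omega>' u = \<omega>' b / \<omega> b * \<omega> u" for u u'
      using form_cong[OF \<omega> that(1)] form_cong[OF \<omega>' that(1)] that(2) by simp
    show "\<omega>' (u(i := L u a)) = \<omega>' b / \<omega> b * \<omega> (u(i := L u a))"
      if "is_basis u" "i < n" "a i \<noteq> 0" "\<omega>' u = \<omega>' b / \<omega> b * \<omega> u" for u i a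
      using form_upd[OF \<omega>, of u i a] form_upd[OF \<omega>', of u i a] that unfolding is_basis_def by simp
  qed (use b \<open>is_basis v\<close> in auto)
next
  case False
  then show ?thesis using form_dependent[OF \<omega> v] form_dependent[OF \<omega>' v] by simp
qed

end


section \<open>Haar measures and invariant top forms\<close>

lemma measurable_pm_cong:
  fixes f :: "'x \<Rightarrow> nat \<Rightarrow> 'f::nonarch_local_field"
  assumes "f \<in> measurable M (restrict_space borel (affine_space n))"
  shows "f \<in> measurable M (pm n)"
  using assms by (simp only: measurable_cong_sets[OF refl sets_pm[symmetric]])

lemma measurable_pm_cong_dom:
  fixes f :: "(nat \<Rightarrow> 'f::nonarch_local_field) \<Rightarrow> 'x"
  assumes "f \<in> measurable (restrict_space borel (affine_space n)) M"
  shows "f \<in> measurable (pm n) M"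
  using assms by (simp only: measurable_cong_sets[OF sets_pm[symmetric] refl])

lemma openin_affine_self: "openin (top_of_set (affine_space n)) (affine_space n)"
  by simp

lemma pm_translate:
  fixes A :: "(nat \<Rightarrow> 'f::nonarch_local_field) set"
  assumes "A \<in> sets (pm n)"
  shows "{c \<in> affine_space n. restrict (\<lambda>i. c i + t i) {..<n} \<in> A} \<in> sets (pm n)"
    and "emeasure (pm n) {c \<in> affine_space n. restrict (\<lambda>i. c i + t i) {..<n} \<in> A} = emeasure (pm n) A"
proof -
  let ?f = "\<lambda>c::nat\<Rightarrow>'f. restrict (\<lambda>i. c i + t i) {..<n}"
  have "continuous_on (affine_space n) ?f"
    by (rule isometry_continuous[of _ n _ n]) (auto intro!: eq_refl nm_cong)
  then have f: "?f \<in> measurable (pm n) (pm n)"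
    by (intro measurable_pm_cong measurable_pm_cong_dom continuous_restrict_measurable) auto
  have vi: "?f -` A \<inter> space (pm n) = {c \<in> affine_space n. ?f c \<in> A}" for A by (auto simp: space_pm)
  show "{c \<in> affine_space n. ?f c \<in> A} \<in> sets (pm n)"
    using measurable_sets[OF f assms] unfolding vi .
  have "distr (pm n) (pm n) ?f = pm n"
  proof (rule measure_eq_on_bx[OF openin_affine_self])
    fix u :: "nat \<Rightarrow> 'f" and r :: real assume r: "r > 0"
    have "{c \<in> affine_space n. ?f c \<in> bx n u r} = bx n (\<lambda>i. u i - t i) r"
    proof -
      have "dist (u i) (c i + t i) = dist (u i - t i) (c i)" for c i
        using dist_translate[of "u i - t i" "t i" "c i"] by simp
      then show ?thesis by (auto simp: bx_iff)
    qed
    then show "emeasure (distr (pm n) (pm n) ?f) (bx n u r) = emeasure (pm n) (bx n u r)"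
      using r by (simp only: emeasure_distr[OF f bx_in_sets_pm] vi emeasure_pm_bx)
    then show "emeasure (distr (pm n) (pm n) ?f) (bx n u r) \<noteq> \<infinity>"
      using r by (simp add: emeasure_pm_bx)
  qed (simp_all add: sets_pm)
  then have "emeasure (distr (pm n) (pm n) ?f) A = emeasure (pm n) A" by simp
  then show "emeasure (pm n) {c \<in> affine_space n. ?f c \<in> A} = emeasure (pm n) A"
    by (simp only: emeasure_distr[OF f assms] vi)
qed

lemma homeomorphism_image_sets:
  fixes B :: "(nat \<Rightarrow> 'f::nonarch_local_field) set" and \<phi> :: "_ \<Rightarrow> 'w::topological_space"
  assumes h: "homeomorphism B (\<phi> ` B) \<phi> g" and B: "openin (top_of_set (affine_space n)) B"
    and S: "\<phi> ` B \<in> sets (restrict_space borel S)"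
    and A: "A \<in> sets (pm n)" "A \<subseteq> B"
  shows "\<phi> ` A \<in> sets (restrict_space borel S)"
proof -
  have BA: "B \<subseteq> affine_space n" using B openin_imp_subset by blast
  have "g \<in> measurable (restrict_space borel (\<phi> ` B)) (pm n)"
    by (rule measurable_pm_cong, rule continuous_restrict_measurable)
       (use h BA in \<open>auto simp: homeomorphism_def\<close>)
  from measurable_sets[OF this A(1)] have "g -` A \<inter> \<phi> ` B \<in> sets (restrict_space borel (\<phi> ` B))"
    by (simp add: space_restrict_space)
  moreover have "g -` A \<inter> \<phi> ` B = \<phi> ` A" using h A(2) by (force simp: homeomorphism_def)
  ultimately have "\<phi> ` A \<in> sets (restrict_space borel (\<phi> ` B))" by simp
  moreover have "\<phi> ` B \<subseteq> S" using sets.sets_into_space[OF S] by (simp add: space_restrict_space)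
  then have "sets (restrict_space borel (\<phi> ` B)) = sets (restrict_space (restrict_space borel S) (\<phi> ` B))"
    by (simp add: sets_restrict_restrict_space Int_absorb1)
  moreover have "\<phi> ` B \<inter> space (restrict_space borel S) \<in> sets (restrict_space borel S)"
    using S by (intro sets.Int) auto
  ultimately show ?thesis by (simp add: sets_restrict_space_iff)
qed

text \<open>Both sides are measures in \<open>A\<close>, the left one transported by the inverse
  \<open>g\<close>. They agree on the boxes inside \<open>B\<close>, and these determine a measure
  on \<open>B\<close>.\<close>

lemma measure_image_eq:
  fixes B :: "(nat \<Rightarrow> 'f::nonarch_local_field) set" and \<phi> :: "_ \<Rightarrow> 'w::topological_space"
  assumes M: "sets M = sets (restrict_space borel S)"
    and h: "homeomorphism B (\<phi> ` B) \<phi> g" and B: "openin (top_of_set (affine_space n)) B"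
    and S: "\<phi> ` B \<in> sets M"
    and eq: "\<And>u r. u \<in> B \<Longrightarrow> r > 0 \<Longrightarrow> bx n u r \<subseteq> B \<Longrightarrow> emeasure M (\<phi> ` bx n u r) = ennreal \<kappa> * emeasure (pm n) (bx n u r)"
    and A: "A \<in> sets (pm n)" "A \<subseteq> B"
  shows "emeasure M (\<phi> ` A) = ennreal \<kappa> * emeasure (pm n) A"
proof -
  have BA: "B \<subseteq> affine_space n" using B openin_imp_subset by blast
  have gm: "g \<in> measurable (restrict_space M (\<phi> ` B)) (restrict_space borel B)"
  proof -
    have "g \<in> measurable (restrict_space borel (\<phi> ` B)) (restrict_space borel B)"
      by (rule continuous_restrict_measurable) (use h in \<open>auto simp: homeomorphism_def\<close>)
    moreover have e: "sets (restrict_space borel (\<phi> ` B)) = sets (restrict_space M (\<phi> ` B))"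
    proof -
      have "\<phi> ` B \<subseteq> S" using sets.sets_into_space[OF S] sets_eq_imp_space_eq[OF M] by (simp add: space_restrict_space)
      moreover have "sets (restrict_space M (\<phi> ` B)) = sets (restrict_space (restrict_space borel S) (\<phi> ` B))"
        using M by (rule sets_restrict_space_cong)
      ultimately show ?thesis by (simp add: sets_restrict_restrict_space Int_absorb1)
    qed
    ultimately show ?thesis unfolding measurable_cong_sets[OF e refl] by blast
  qed
  have Sp: "\<phi> ` B \<inter> space M \<in> sets M" using S by (intro sets.Int) auto
  have Bs: "B \<in> sets (pm n)" by (rule openin_affine_sets_pm[OF B])
  define M1 where "M1 = distr (restrict_space M (\<phi> ` B)) (restrict_space borel B) g"
  define M2 where "M2 = scale_measure (ennreal \<kappa>) (restrict_space (pm n) B)"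
  have M1: "emeasure M1 A = emeasure M (\<phi> ` A)" if "A \<in> sets (restrict_space borel B)" for A
  proof -
    have AB: "A \<subseteq> B" using sets.sets_into_space[OF that] by (simp add: space_restrict_space)
    have "\<phi> ` B \<subseteq> space M" using S sets.sets_into_space by blast
    then have "g -` A \<inter> space (restrict_space M (\<phi> ` B)) = \<phi> ` A"
      using h AB by (force simp: homeomorphism_def space_restrict_space)
    then show ?thesis unfolding M1_def using emeasure_distr[OF gm that] emeasure_restrict_space[OF Sp, of "\<phi> ` A"] AB
      by (simp add: image_mono)
  qed
  have Bsp: "B \<inter> space (pm n) \<in> sets (pm n)" using Bs by (intro sets.Int) auto
  have "M1 = M2"
  proof (rule measure_eq_on_bx[OF B])
    show s2: "sets M2 = sets (restrict_space borel B)"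
      unfolding M2_def using sets_restrict_pm[OF B refl] by simp
    show s1: "sets M1 = sets (restrict_space borel B)" by (simp add: M1_def)
    fix u :: "nat \<Rightarrow> 'f" and r :: real assume u: "u \<in> B" "r > 0" "bx n u r \<subseteq> B"
    have "bx n u r \<in> sets (restrict_space borel B)"
      unfolding sets_restrict_pm[OF B refl, symmetric] sets_restrict_space_iff[OF Bsp] using u(3) bx_in_sets_pm by blast
    from M1[OF this] show e: "emeasure M1 (bx n u r) = emeasure M2 (bx n u r)"
      unfolding M2_def using eq[OF u] emeasure_restrict_space[OF Bsp u(3)] by simp
    show "emeasure M1 (bx n u r) \<noteq> \<infinity>"
      unfolding e unfolding M2_def using emeasure_restrict_space[OF Bsp u(3)] u(2)
      by (simp add: emeasure_pm_bx ennreal_mult_eq_top_iff)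
  qed
  moreover have As: "A \<in> sets (restrict_space borel B)"
    unfolding sets_restrict_pm[OF B refl, symmetric] sets_restrict_space_iff[OF Bsp] using A by blast
  ultimately show ?thesis using M1[OF As] emeasure_restrict_space[OF Bsp A(2)] by (simp add: M2_def)
qed

context ftvs
begin

lemma L_measurable: "is_basis b \<Longrightarrow> L b \<in> measurable (pm n) (restrict_space borel W)"
  using is_basis_homeomorphism[of b]
  by (intro measurable_pm_cong_dom continuous_restrict_measurable) (auto simp: homeomorphism_def)

lemma co_measurable: "is_basis b \<Longrightarrow> co n b \<in> measurable (restrict_space borel W) (pm n)"
  using is_basis_homeomorphism[of b]
  by (intro measurable_pm_cong continuous_restrict_measurable) (auto simp: homeomorphism_def)

definition basis_measure :: "(nat \<Rightarrow> 'w) \<Rightarrow> 'w measure" where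
  "basis_measure b = distr (pm n) (restrict_space borel W) (L b)"

lemma sets_basis_measure [simp]: "sets (basis_measure b) = sets (restrict_space borel W)"
  by (simp add: basis_measure_def)

lemma co_L: "is_basis b \<Longrightarrow> c \<in> affine_space n \<Longrightarrow> co n b (L b c) = c"
  using is_basis_homeomorphism homeomorphism_apply1 by blast

lemma L_image_eq: "is_basis b \<Longrightarrow> D \<subseteq> affine_space n \<Longrightarrow> L b ` D = co n b -` D \<inter> W"
  using is_basis_homeomorphism[of b] by (force simp: homeomorphism_def)

lemma L_image_sets: "is_basis b \<Longrightarrow> D \<in> sets (pm n) \<Longrightarrow> L b ` D \<in> sets (restrict_space borel W)"
  using measurable_sets[OF co_measurable, of b D] L_image_eq[of b D] sets.sets_into_space[of D "pm n"]
  by (simp add: space_restrict_space space_pm)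

lemma emeasure_basis_measure: "is_basis b \<Longrightarrow> A \<in> sets (restrict_space borel W) \<Longrightarrow> emeasure (basis_measure b) A = emeasure (pm n) {c \<in> affine_space n. L b c \<in> A}"
  unfolding basis_measure_def using emeasure_distr[OF L_measurable, of b A]
  by (simp add: space_pm vimage_def Int_def conj_commute)

lemma preimage_sets_pm: "is_basis b \<Longrightarrow> A \<in> sets (restrict_space borel W) \<Longrightarrow> {c \<in> affine_space n. L b c \<in> A} \<in> sets (pm n)"
  using measurable_sets[OF L_measurable, of b A] by (simp add: space_pm vimage_def Int_def conj_commute)

lemma emeasure_basis_measure_image: "is_basis b \<Longrightarrow> D \<in> sets (pm n) \<Longrightarrow> emeasure (basis_measure b) (L b ` D) = emeasure (pm n) D"
proof -
  assume b: "is_basis b" and D: "D \<in> sets (pm n)"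
  have "D \<subseteq> affine_space n" using sets.sets_into_space[OF D] by (simp add: space_pm)
  have "{c \<in> affine_space n. L b c \<in> L b ` D} = D"
  proof (intro set_eqI iffI)
    fix c assume "c \<in> {c \<in> affine_space n. L b c \<in> L b ` D}"
    then obtain d where d: "c \<in> affine_space n" "d \<in> D" "L b c = L b d" by auto
    then have "c = d" using co_L[OF b, of c] co_L[OF b, of d] \<open>D \<subseteq> affine_space n\<close> by auto
    then show "c \<in> D" using d by simp
  qed (use \<open>D \<subseteq> affine_space n\<close> in auto)
  then show ?thesis using emeasure_basis_measure[OF b L_image_sets[OF b D]] by simp
qed

lemma translate_image: "w \<in> W \<Longrightarrow> A \<subseteq> W \<Longrightarrow> (+) w ` A = (\<lambda>x. x - w) -` A \<inter> W"
proof (intro set_eqI iffI)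
  fix x assume "w \<in> W" "A \<subseteq> W" "x \<in> (\<lambda>x. x - w) -` A \<inter> W"
  then have "x = w + (x - w)" "x - w \<in> A" by auto
  then show "x \<in> (+) w ` A" by blast
qed (auto simp: subspace_add[OF subspace_W] subset_iff)

lemma translate_sets: "w \<in> W \<Longrightarrow> A \<in> sets (restrict_space borel W) \<Longrightarrow> (+) w ` A \<in> sets (restrict_space borel W)"
proof -
  assume w: "w \<in> W" and A: "A \<in> sets (restrict_space borel W)"
  have "(\<lambda>x. x - w) \<in> measurable (restrict_space borel W) (restrict_space borel W)"
    by (rule continuous_restrict_measurable) (auto intro!: continuous_intros subspace_diff[OF subspace_W] w)
  from measurable_sets[OF this A] show ?thesis
    using translate_image[OF w, of A] sets.sets_into_space[OF A] by (simp add: space_restrict_space)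
qed

lemma basis_measure_translate:
  assumes b: "is_basis b" and w: "w \<in> W" and A: "A \<in> sets (restrict_space borel W)"
  shows "emeasure (basis_measure b) ((+) w ` A) = emeasure (basis_measure b) A"
proof -
  have AW: "A \<subseteq> W" using sets.sets_into_space[OF A] by (simp add: space_restrict_space)
  have "{c \<in> affine_space n. L b c \<in> (+) w ` A}
      = {c \<in> affine_space n. restrict (\<lambda>i. c i + - co n b w i) {..<n} \<in> {c \<in> affine_space n. L b c \<in> A}}"
    unfolding translate_image[OF w AW] using L_in_W[OF b] L_co[OF b w] lin_diff[of n b _ "co n b w"] by auto
  then show ?thesis
    using emeasure_basis_measure[OF b A] emeasure_basis_measure[OF b translate_sets[OF w A]]
      pm_translate(2)[OF preimage_sets_pm[OF b A], of "\<lambda>i. - co n b w i"] by simp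
qed

lemma L_image_bx: "is_basis b \<Longrightarrow> L b ` bx n u r = (+) (L b u) ` L b ` bx n (\<lambda>_. 0) r"
proof -
  assume b: "is_basis b"
  have "x \<in> (+) (L b u) ` L b ` bx n (\<lambda>_. 0) r" if x: "x \<in> L b ` bx n u r" for x
  proof -
    obtain c where c: "x = L b c" "c \<in> bx n u r" using x by blast
    let ?d = "restrict (\<lambda>i. c i - u i) {..<n}"
    have "?d \<in> bx n (\<lambda>_. 0) r" using c(2) by (auto simp: bx_iff dist_eq_av[of "u _"])
    moreover have "x = L b u + L b ?d" using c(1) by (simp add: lin_diff)
    ultimately show ?thesis by blast
  qed
  moreover have "L b u + L b c \<in> L b ` bx n u r" if c: "c \<in> bx n (\<lambda>_. 0) r" for c
  proof -
    let ?d = "restrict (\<lambda>i. u i + c i) {..<n}"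
    have "?d \<in> bx n u r" using c by (auto simp: bx_iff dist_eq_av[of "u _"])
    moreover have "L b u + L b c = L b ?d" by (simp add: lin_add)
    ultimately show ?thesis by blast
  qed
  ultimately show ?thesis by blast
qed

lemma invariant_measure_eq_scale_basis_measure:
  assumes b: "is_basis b" and N: "sets N = sets (restrict_space borel W)"
    and inv: "\<And>w A. w \<in> W \<Longrightarrow> A \<in> sets (restrict_space borel W) \<Longrightarrow> emeasure N ((+) w ` A) = emeasure N A"
    and fin: "emeasure N (L b ` bx n (\<lambda>_. 0) 1) \<noteq> \<infinity>"
  shows "N = scale_measure (emeasure N (L b ` bx n (\<lambda>_. 0) 1)) (basis_measure b)"
proof -
  have cm: "co n b \<in> measurable N (pm n)"
    using co_measurable[OF b] by (simp only: measurable_cong_sets[OF N refl])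
  have spN: "space N = W" using sets_eq_imp_space_eq[OF N] by (simp add: space_restrict_space)
  define N' where "N' = distr N (pm n) (co n b)"
  have N'D: "emeasure N' D = emeasure N (L b ` D)" if "D \<in> sets (pm n)" for D
  proof -
    have "D \<subseteq> affine_space n" using sets.sets_into_space[OF that] by (simp add: space_pm)
    then show ?thesis unfolding N'_def using emeasure_distr[OF cm that] L_image_eq[OF b] spN by simp
  qed
  let ?\<kappa> = "emeasure N (L b ` bx n (\<lambda>_. 0) 1)"
  have "N' = scale_measure (emeasure N' (bx n (\<lambda>_. 0) 1)) (pm n)"
  proof (rule translation_invariant_eq_scale_pm)
    fix u r
    show "emeasure N' (bx n u r) = emeasure N' (bx n (\<lambda>_. 0) r)"
      using inv[OF L_in_W[OF b] L_image_sets[OF b bx_in_sets_pm], of u "\<lambda>_. 0" r]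
      by (simp only: N'D bx_in_sets_pm L_image_bx[OF b, of u r])
  next
    show "emeasure N' (bx n (\<lambda>_. 0) 1) \<noteq> \<infinity>" using fin N'D[OF bx_in_sets_pm] by simp
  qed (simp add: N'_def)
  then have N': "N' = scale_measure ?\<kappa> (pm n)" using N'D[OF bx_in_sets_pm, of "\<lambda>_. 0" 1] by simp
  show ?thesis
  proof (rule measure_eqI)
    fix A assume "A \<in> sets N"
    then have A: "A \<in> sets (restrict_space borel W)" by (simp add: N)
    then have AW: "A \<subseteq> W" using sets.sets_into_space by (fastforce simp: space_restrict_space)
    have "L b ` {c \<in> affine_space n. L b c \<in> A} = A"
      using is_basis_homeomorphism[OF b] AW by (force simp: homeomorphism_def)
    then have "emeasure N A = emeasure N' {c \<in> affine_space n. L b c \<in> A}"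
      using N'D[OF preimage_sets_pm[OF b A]] by simp
    also have "\<dots> = ?\<kappa> * emeasure (basis_measure b) A" unfolding N' by (simp add: emeasure_basis_measure[OF b A])
    finally show "emeasure N A = emeasure (scale_measure ?\<kappa> (basis_measure b)) A" by simp
  qed (simp add: N)
qed

text \<open>The scaling factor is read off a box that is so thin in the \<open>i\<close>-th direction that the change of
  basis maps it onto a box.\<close>

lemma basis_measure_fun_upd:
  assumes b: "is_basis b" and i: "i < n" "a i \<noteq> 0"
  shows "basis_measure b = scale_measure (ennreal (modulus (a i))) (basis_measure (b(i := L b a)))"
proof -
  let ?b = "b(i := L b a)"
  have b': "is_basis ?b" by (rule is_basis_fun_upd[of b i a, OF b i])
  obtain R where R: "R > 0" "L ?b ` bx n (\<lambda>_. 0) 1 \<subseteq> L b ` bx n (\<lambda>_. 0) R"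
  proof -
    have "compact (co n b ` L ?b ` bx n (\<lambda>_. 0) 1)"
    proof (intro compact_continuous_image continuous_on_lin_id compact_bx)
      show "continuous_on (L ?b ` bx n (\<lambda>_. 0) 1) (co n b)"
        using is_basis_homeomorphism[OF b] L_in_W[OF b'] by (auto simp: homeomorphism_def intro: continuous_on_subset)
    qed
    moreover have "co n b ` L ?b ` bx n (\<lambda>_. 0) 1 \<subseteq> affine_space n" using co_affine[OF b] L_in_W[OF b'] by blast
    ultimately have "\<exists>R>0. co n b ` L ?b ` bx n (\<lambda>_. 0) 1 \<subseteq> bx n (\<lambda>_. 0) R"
      by (rule compact_affine_bounded)
    then obtain R where R: "R > 0" "co n b ` L ?b ` bx n (\<lambda>_. 0) 1 \<subseteq> bx n (\<lambda>_. 0) R" by blast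
    have "x \<in> L b ` bx n (\<lambda>_. 0) R" if "x \<in> L ?b ` bx n (\<lambda>_. 0) 1" for x
    proof -
      have "co n b x \<in> bx n (\<lambda>_. 0) R" using R(2) that by blast
      moreover have "x \<in> W" using that L_in_W[OF b'] by blast
      ultimately show ?thesis using L_co[OF b, of x] by (metis imageI)
    qed
    then show thesis using that R(1) by blast
  qed
  define \<kappa> where "\<kappa> = emeasure (basis_measure b) (L ?b ` bx n (\<lambda>_. 0) 1)"
  have "\<kappa> \<le> emeasure (basis_measure b) (L b ` bx n (\<lambda>_. 0) R)"
    unfolding \<kappa>_def by (rule emeasure_mono[OF R(2)]) (simp add: L_image_sets[OF b bx_in_sets_pm])
  then have fin: "\<kappa> \<noteq> \<infinity>"
    using R(1) by (simp add: emeasure_basis_measure_image[OF b bx_in_sets_pm] emeasure_pm_bx) (auto simp: top_unique)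
  have eq: "basis_measure b = scale_measure \<kappa> (basis_measure ?b)"
    unfolding \<kappa>_def
    by (rule invariant_measure_eq_scale_basis_measure[OF b' sets_basis_measure basis_measure_translate[OF b]]) (use fin \<kappa>_def in auto)
  \<comment> \<open>With this width in direction \<open>i\<close>, the change of basis alters the
    other coordinates by at most 1, so it preserves their unit balls.\<close>
  define e where "e = inverse (nm n a)"
  have nma: "nm n a > 0" using av_le_nm[OF i(1), of a] i(2) by (metis dist_pos_lt less_le_trans)
  have e: "e > 0" "av (a l) * e \<le> 1" if "l < n" for l
    using nma av_le_nm[OF that, of a] by (simp_all add: e_def field_simps)
  let ?D = "\<lambda>r. \<Pi>\<^sub>E l\<in>{..<n}. cball (0::'f) (if l = i then r else 1)"
  have DS: "?D r \<in> sets (pm n)" for r by (intro sets_PiM_I_finite) (auto simp: sets_hF)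
  have vD: "emeasure (pm n) (?D r) = ennreal (ball_volume TYPE('f) r)" if "r > 0" for r
  proof -
    have "(\<Prod>l<n. ball_volume TYPE('f) (if l = i then r else 1)) = ball_volume TYPE('f) r"
      using i(1) by (subst prod.remove[of _ i]) (auto simp: ball_volume_one intro!: prod.neutral)
    then show ?thesis using emeasure_pm_PiE[of n "\<lambda>l. if l = i then r else 1" "\<lambda>_. 0::'f"] that by simp
  qed
  have img: "L ?b ` ?D e = L b ` ?D (av (a i) * e)"
  proof (intro subset_antisym image_subsetI)
    fix c assume c: "c \<in> ?D e"
    let ?d = "restrict (\<lambda>l. (if l = i then 0 else c l) + c i * a l) {..<n}"
    have ci: "av (c i) \<le> e" using PiE_mem[OF c, of i] i(1) by simp
    have "?d \<in> ?D (av (a i) * e)"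
    proof (rule PiE_I)
      fix l assume "l \<in> {..<n}"
      then have l: "l < n" by simp
      show "?d l \<in> cball 0 (if l = i then av (a i) * e else 1)"
      proof (cases "l = i")
        case True
        then show ?thesis using l ci mult_left_mono[OF ci, of "av (a i)"] by (simp add: dist_0_mult mult.commute)
      next
        case False
        have "av (c l) \<le> 1" using PiE_mem[OF c, of l] l False by simp
        moreover have "av (c i * a l) \<le> 1"
          using mult_left_mono[OF ci, of "av (a l)"] e(2)[OF l] by (simp add: dist_0_mult mult.commute)
        ultimately show ?thesis using l False av_add_le[of "c l" "c i * a l"] by simp
      qed
    qed simp
    moreover have "L ?b c = L b ?d" by (simp add: lin_fun_upd[OF i(1)])
    ultimately show "L ?b c \<in> L b ` ?D (av (a i) * e)" by blast
  next
    fix d assume d: "d \<in> ?D (av (a i) * e)"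
    let ?t = "d i / a i"
    let ?c = "restrict (\<lambda>l. if l = i then ?t else d l - ?t * a l) {..<n}"
    have "av (d i) \<le> av (a i) * e" using PiE_mem[OF d, of i] i(1) by simp
    moreover have "av ?t = av (d i) / av (a i)" by (simp only: divide_inverse dist_0_mult av_inverse)
    ultimately have t: "av ?t \<le> e"
      using i(2) by (simp add: pos_divide_le_eq mult.commute)
    have mem: "?c \<in> ?D e"
    proof (rule PiE_I)
      fix l assume "l \<in> {..<n}"
      then have l: "l < n" by simp
      show "?c l \<in> cball 0 (if l = i then e else 1)"
      proof (cases "l = i")
        case False
        have "av (d l) \<le> 1" using PiE_mem[OF d, of l] l False by simp
        moreover have "av (?t * a l) \<le> 1"
        proof -
          have "av (?t * a l) = av (a l) * av ?t" by (simp only: dist_0_mult mult.commute)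
          then show ?thesis using mult_left_mono[OF t, of "av (a l)"] e(2)[OF l] by simp
        qed
        ultimately show ?thesis using l False av_diff_le[of "d l" "?t * a l"] by simp
      qed (use t l in simp)
    qed simp
    have eq: "L ?b ?c = L b d"
    proof -
      have "L ?b ?c = L b (\<lambda>l. (if l = i then 0 else ?c l) + ?c i * a l)" by (rule lin_fun_upd[OF i(1)])
      also have "\<dots> = L b d" using i by (intro lin_cong) auto
      finally show ?thesis .
    qed
    show "L b d \<in> L ?b ` ?D e" using imageI[OF mem, of "L ?b"] unfolding eq .
  qed
  have "emeasure (basis_measure b) (L b ` ?D (av (a i) * e)) = \<kappa> * emeasure (basis_measure ?b) (L ?b ` ?D e)"
    unfolding img[symmetric] by (subst eq) simp
  then have "ennreal (ball_volume TYPE('f) (av (a i) * e)) = \<kappa> * ennreal (ball_volume TYPE('f) e)"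
    using e(1)[OF i(1)] i(2) by (simp only: emeasure_basis_measure_image[OF b DS] emeasure_basis_measure_image[OF b' DS] vD mult_pos_pos dist_pos_lt)
      (simp add: vD)
  then have "\<kappa> * ennreal (ball_volume TYPE('f) e) = ennreal (modulus (a i)) * ennreal (ball_volume TYPE('f) e)"
    using ball_volume_scale[OF i(2) e(1)[OF i(1)]] modulus_pos[OF i(2)] ball_volume_pos[OF e(1)[OF i(1)], where 'f='f]
    by (simp add: ennreal_mult)
  moreover obtain k where k: "\<kappa> = ennreal k" "k \<ge> 0" using fin by (cases \<kappa>) auto
  ultimately have "k * ball_volume TYPE('f) e = modulus (a i) * ball_volume TYPE('f) e"
    using modulus_pos[OF i(2)] ball_volume_pos[OF e(1)[OF i(1)], where 'f='f]
    by (simp add: ennreal_mult[symmetric])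
  then have "\<kappa> = ennreal (modulus (a i))"
    using ball_volume_pos[OF e(1)[OF i(1)], where 'f='f] k by simp
  then show ?thesis using eq by simp
qed

definition top_form :: "((nat \<Rightarrow> 'w) \<Rightarrow> 'f) \<Rightarrow> bool" where
  "top_form \<omega> \<longleftrightarrow> alternating_form s W n \<omega> \<and> (\<exists>v. (\<forall>i<n. v i \<in> W) \<and> \<omega> v \<noteq> 0)"

lemma top_form_nonzero: "top_form \<omega> \<Longrightarrow> is_basis b \<Longrightarrow> \<omega> b \<noteq> 0"
  unfolding top_form_def using form_nonzero by blast

definition vol :: "((nat \<Rightarrow> 'w) \<Rightarrow> 'f) \<Rightarrow> 'w measure" where
  "vol \<omega> = scale_measure (ennreal (modulus (\<omega> (SOME b. is_basis b)))) (basis_measure (SOME b. is_basis b))"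

lemma sets_vol [simp]: "sets (vol \<omega>) = sets (restrict_space borel W)"
  by (simp add: vol_def)

text \<open>Independence of the chosen basis: an exchange step multiplies \<open>\<omega> b\<close>
  by \<open>a i\<close> and divides the basis measure by the modulus of \<open>a i\<close>.\<close>

lemma vol_eq:
  assumes \<omega>: "top_form \<omega>" and b: "is_basis b"
  shows "vol \<omega> = scale_measure (ennreal (modulus (\<omega> b))) (basis_measure b)"
proof (rule basis_exchange[of "SOME b. is_basis b" "\<lambda>b. vol \<omega> = scale_measure (ennreal (modulus (\<omega> b))) (basis_measure b)"])
  have alt: "alternating_form s W n \<omega>" using \<omega> by (simp add: top_form_def)
  show "is_basis (SOME b. is_basis b)" using is_basis_exists by (rule someI_ex)
  show "vol \<omega> = scale_measure (ennreal (modulus (\<omega> u'))) (basis_measure u')"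
    if "\<And>i. i < n \<Longrightarrow> u i = u' i" "vol \<omega> = scale_measure (ennreal (modulus (\<omega> u))) (basis_measure u)" for u u'
  proof -
    have "L u = L u'" using that(1) by (intro ext lin_cong) auto
    then have "basis_measure u = basis_measure u'" by (simp add: basis_measure_def)
    then show ?thesis using form_cong[OF alt that(1)] that(2) by simp
  qed
  show "vol \<omega> = scale_measure (ennreal (modulus (\<omega> (u(i := L u a))))) (basis_measure (u(i := L u a)))"
    if u: "is_basis u" "i < n" "a i \<noteq> 0" "vol \<omega> = scale_measure (ennreal (modulus (\<omega> u))) (basis_measure u)" for u i a
  proof -
    have "\<omega> (u(i := L u a)) = a i * \<omega> u" using form_upd[OF alt, of u i a] u(1,2) by (simp add: is_basis_def)
    then have m: "modulus (\<omega> (u(i := L u a))) = modulus (\<omega> u) * modulus (a i)"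
      using modulus_mult[OF u(3) top_form_nonzero[OF \<omega> u(1)]] by (simp add: mult.commute)
    have "ennreal (modulus (\<omega> (u(i := L u a)))) = ennreal (modulus (\<omega> u)) * ennreal (modulus (a i))"
      unfolding m using modulus_pos[OF u(3)] modulus_pos[OF top_form_nonzero[OF \<omega> u(1)]]
      by (simp add: ennreal_mult)
    then show ?thesis unfolding u(4) by (subst basis_measure_fun_upd[of u i a, OF u(1-3)]) (simp add: scale_scale_measure)
  qed
  show "vol \<omega> = scale_measure (ennreal (modulus (\<omega> (SOME b. is_basis b)))) (basis_measure (SOME b. is_basis b))"
    by (rule vol_def)
qed (rule b)

definition lball :: "(nat \<Rightarrow> 'w) \<Rightarrow> 'w \<Rightarrow> real \<Rightarrow> 'w set" where
  "lball b w r = (\<lambda>c. w + L b c) ` bx n (\<lambda>_. 0) r"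

lemma lball_eq: "is_basis b \<Longrightarrow> w \<in> W \<Longrightarrow> 0 \<le> r \<Longrightarrow> lball b w r = {x \<in> W. nm n (co n b (x - w)) \<le> r}"
proof (intro set_eqI iffI)
  fix x assume b: "is_basis b" "w \<in> W" "0 \<le> r" and x: "x \<in> lball b w r"
  obtain c where c: "x = w + L b c" "c \<in> bx n (\<lambda>_. 0) r" using x by (auto simp: lball_def)
  have "nm n (co n b (x - w)) = nm n c" using c(1) co_lin_nth[OF is_basis_indep[OF b(1)]] by (intro nm_cong) auto
  then show "x \<in> {x \<in> W. nm n (co n b (x - w)) \<le> r}"
    using c b L_in_W[OF b(1)] subspace_add[OF subspace_W] by (auto simp: bx_iff_nm)
next
  fix x assume b: "is_basis b" "w \<in> W" "0 \<le> r" and x: "x \<in> {x \<in> W. nm n (co n b (x - w)) \<le> r}"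
  have xw: "x - w \<in> W" using x b(2) subspace_diff[OF subspace_W] by blast
  have "co n b (x - w) \<in> bx n (\<lambda>_. 0) r" using x b(3) co_affine[OF b(1) xw] by (simp add: bx_iff_nm)
  moreover have "x = w + L b (co n b (x - w))" by (simp add: L_co[OF b(1) xw])
  ultimately show "x \<in> lball b w r" unfolding lball_def by blast
qed

lemma compact_lball: "compact (lball b w r)"
  unfolding lball_def
  by (intro compact_continuous_image[OF _ compact_bx] continuous_intros continuous_on_lin_id)

lemma lball_subset: "is_basis b \<Longrightarrow> w \<in> W \<Longrightarrow> lball b w r \<subseteq> W"
  unfolding lball_def using L_in_W subspace_add[OF subspace_W] by blast

lemma lball_image: "lball b w r = (+) w ` L b ` bx n (\<lambda>_. 0) r"
  by (auto simp: lball_def)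

lemma lball_sets: "is_basis b \<Longrightarrow> w \<in> W \<Longrightarrow> lball b w r \<in> sets (restrict_space borel W)"
  unfolding lball_image by (intro translate_sets L_image_sets bx_in_sets_pm)

lemma vol_lball:
  assumes "top_form \<omega>" "is_basis b" "w \<in> W" "r > 0"
  shows "emeasure (vol \<omega>) (lball b w r) = ennreal (modulus (\<omega> b) * ball_volume TYPE('f) r ^ n)"
proof -
  have "emeasure (basis_measure b) (lball b w r) = ennreal (ball_volume TYPE('f) r ^ n)"
    unfolding lball_image using assms
    by (simp add: basis_measure_translate L_image_sets bx_in_sets_pm emeasure_basis_measure_image emeasure_pm_bx)
  then show ?thesis using vol_eq[OF assms(1,2)] modulus_pos[OF top_form_nonzero[OF assms(1,2)]] ball_volume_pos[OF assms(4), where 'f='f]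
    by (simp add: ennreal_mult)
qed

lemma lball_center: "is_basis b \<Longrightarrow> w \<in> W \<Longrightarrow> 0 \<le> r \<Longrightarrow> w \<in> lball b w r"
  unfolding lball_def
  by (rule image_eqI[of _ _ "restrict (\<lambda>_. 0) {..<n}"]) (auto simp: bx_iff)

lemma co_continuous: "is_basis b \<Longrightarrow> S \<subseteq> W \<Longrightarrow> continuous_on S (co n b)"
  using is_basis_homeomorphism[of b] by (auto simp: homeomorphism_def intro: continuous_on_subset)

lemma co_diff_continuous: "is_basis b \<Longrightarrow> w \<in> W \<Longrightarrow> S \<subseteq> W \<Longrightarrow> continuous_on S (\<lambda>x. co n b (x - w))"
  by (rule continuous_on_compose2[OF co_continuous[OF _ subset_refl]])
     (auto intro!: continuous_intros subspace_diff[OF subspace_W])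

lemma openin_lball: "is_basis b \<Longrightarrow> w \<in> W \<Longrightarrow> r > 0 \<Longrightarrow> openin (top_of_set W) (lball b w r)"
proof -
  assume b: "is_basis b" "w \<in> W" "r > 0"
  obtain T where T: "open T" "bx n (\<lambda>_. 0 :: 'f) r = affine_space n \<inter> T" using openin_bx[OF b(3), of n "\<lambda>_. 0"] by (auto simp: openin_open)
  have "openin (top_of_set W) (W \<inter> (\<lambda>x. co n b (x - w)) -` T)"
    using co_diff_continuous[OF b(1,2) subset_refl] T(1) by (rule continuous_openin_preimage_gen)
  moreover have "lball b w r = W \<inter> (\<lambda>x. co n b (x - w)) -` T"
  proof (intro set_eqI)
    fix x
    have "co n b (x - w) \<in> affine_space n" if "x \<in> W"
      using co_affine[OF b(1)] that b(2) subspace_diff[OF subspace_W] by blast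
    then have "x \<in> W \<Longrightarrow> (co n b (x - w) \<in> T) = (co n b (x - w) \<in> bx n (\<lambda>_. 0) r)" using T(2) by blast
    then show "x \<in> lball b w r \<longleftrightarrow> x \<in> W \<inter> (\<lambda>x. co n b (x - w)) -` T"
      using b co_affine[OF b(1)] subspace_diff[OF subspace_W _ b(2)] by (auto simp: lball_eq bx_iff_nm)
  qed
  ultimately show ?thesis by simp
qed

lemma openin_contains_lball:
  assumes b: "is_basis b" and U: "openin (top_of_set W) U" "w \<in> U"
  shows "\<exists>r>0. lball b w r \<subseteq> U"
proof -
  have wW: "w \<in> W" using U openin_imp_subset by blast
  obtain T where T: "open T" "U = W \<inter> T" using U(1) by (auto simp: openin_open)
  have "continuous_on (affine_space n) (\<lambda>c. w + L b c)"
    by (intro continuous_intros continuous_on_lin_id)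
  from continuous_on_affine_contains_bx[OF this openin_affine_self, of "restrict (\<lambda>_. 0) {..<n}" T]
  obtain r where r: "r > 0" "(\<lambda>c. w + L b c) ` bx n (restrict (\<lambda>_. 0) {..<n}) r \<subseteq> T"
    using T U(2) by auto
  have "bx n (restrict (\<lambda>_. 0) {..<n}) r = bx n (\<lambda>_. 0 :: 'f) r" by (rule bx_cong) simp
  then have "lball b w r \<subseteq> U" using r(2) T(2) lball_subset[OF b wW] unfolding lball_def by auto
  then show ?thesis using r(1) by blast
qed

lemma lball_mono: "r \<le> r' \<Longrightarrow> lball b w r \<subseteq> lball b w r'"
  unfolding lball_def by (intro image_mono bx_mono)

lemma haar_eq_scale_vol:
  assumes \<mu>: "haar_measure_on W \<mu>" and \<omega>: "top_form \<omega>"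
  shows "\<exists>\<kappa>>0. \<mu> = scale_measure (ennreal \<kappa>) (vol \<omega>)"
proof -
  obtain b where b: "is_basis b" using is_basis_exists by blast
  have s: "sets \<mu> = sets (restrict_space borel W)" using \<mu> by (simp add: haar_measure_on_def)
  have inv: "\<And>w A. w \<in> W \<Longrightarrow> A \<in> sets (restrict_space borel W) \<Longrightarrow> emeasure \<mu> ((+) w ` A) = emeasure \<mu> A"
    using \<mu> s by (simp add: haar_measure_on_def)
  have h3: "\<And>K. K \<subseteq> W \<Longrightarrow> compact K \<Longrightarrow> emeasure \<mu> K < \<infinity>"
    using \<mu> unfolding haar_measure_on_def by (elim conjE) simp
  have h4: "\<And>U. openin (top_of_set W) U \<Longrightarrow> U \<noteq> {} \<Longrightarrow> 0 < emeasure \<mu> U"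
    using \<mu> unfolding haar_measure_on_def by (elim conjE) simp
  have W0: "0 \<in> W" using subspace_0[OF subspace_W] .
  have LB: "L b ` bx n (\<lambda>_. 0) 1 = lball b 0 1" by (simp add: lball_def)
  have fin: "emeasure \<mu> (lball b 0 1) < \<infinity>" by (rule h3[OF lball_subset[OF b W0] compact_lball])
  have "lball b 0 1 \<noteq> {}" using lball_center[OF b W0, of 1] by auto
  then have pos: "0 < emeasure \<mu> (lball b 0 1)" by (rule h4[OF openin_lball[OF b W0 zero_less_one]])
  have eq: "\<mu> = scale_measure (emeasure \<mu> (lball b 0 1)) (basis_measure b)"
    unfolding LB[symmetric]
    by (rule invariant_measure_eq_scale_basis_measure[OF b s inv]) (use fin LB in auto)
  define m where "m = measure \<mu> (lball b 0 1)"
  have m: "emeasure \<mu> (lball b 0 1) = ennreal m" "m > 0"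
    using fin pos unfolding m_def measure_def by (auto simp: enn2real_positive_iff)
  let ?o = "modulus (\<omega> b)"
  have o: "?o > 0" using modulus_pos top_form_nonzero[OF \<omega> b] by blast
  have "ennreal (m / ?o) * ennreal ?o = ennreal m"
    using m(2) o by (subst ennreal_mult[symmetric]) auto
  then have "\<mu> = scale_measure (ennreal (m / ?o)) (vol \<omega>)"
    using eq vol_eq[OF \<omega> b] m(1) by (simp add: scale_scale_measure)
  then show ?thesis using m(2) o by (intro exI[of _ "m / ?o"]) auto
qed

definition isometric :: "(nat \<Rightarrow> 'w) \<Rightarrow> (nat \<Rightarrow> 'f) set \<Rightarrow> ((nat \<Rightarrow> 'f) \<Rightarrow> 'w) \<Rightarrow> bool" where
  "isometric b B f \<longleftrightarrow> (\<forall>a\<in>B. f a \<in> W) \<and> (\<forall>a\<in>B. \<forall>c\<in>B. nm n (co n b (f a - f c)) = nm n (\<lambda>i. a i - c i))"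

lemma isometric_image_bx:
  assumes b: "is_basis b" and f: "isometric b (bx n x r) f" and x: "x \<in> affine_space n" and r: "r > 0"
  shows "f ` bx n x r = lball b (f x) r"
proof -
  have xx: "x \<in> bx n x r" using x r by (simp add: bx_center)
  have fW: "\<And>a. a \<in> bx n x r \<Longrightarrow> f a \<in> W" using f by (simp add: isometric_def)
  note fx = fW[OF xx]
  have d: "\<And>a. a \<in> bx n x r \<Longrightarrow> f a - f x \<in> W" using fW fx subspace_diff[OF subspace_W] by blast
  let ?\<psi> = "\<lambda>a. co n b (f a - f x)"
  have "?\<psi> ` bx n x r = bx n (?\<psi> x) r"
  proof (rule isometry_image_bx[OF _ _ x r])
    fix a c assume ac: "a \<in> bx n x r" "c \<in> bx n x r"
    have "nm n (\<lambda>i. ?\<psi> a i - ?\<psi> c i) = nm n (co n b (f a - f c))"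
    proof (rule nm_cong)
      fix i assume "i < n"
      then show "av (?\<psi> a i - ?\<psi> c i) = av (co n b (f a - f c) i)"
        using co_diff[OF b d[OF ac(1)] d[OF ac(2)]] by simp
    qed
    then show "nm n (\<lambda>i. ?\<psi> a i - ?\<psi> c i) = nm n (\<lambda>i. a i - c i)" using f ac by (simp add: isometric_def)
  qed (use co_affine[OF b d] in auto)
  moreover have "bx n (?\<psi> x) r = bx n (\<lambda>_. 0) r"
  proof (rule bx_cong)
    fix i assume "i < n"
    then show "?\<psi> x i = 0" using co_eqI[OF b, of 0 "\<lambda>_. 0" i] by simp
  qed
  ultimately have eq: "?\<psi> ` bx n x r = bx n (\<lambda>_. 0) r" by simp
  have "f a = f x + L b (?\<psi> a)" if "a \<in> bx n x r" for a using L_co[OF b d[OF that]] by simp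
  then have "f ` bx n x r = (\<lambda>c. f x + L b c) ` ?\<psi> ` bx n x r" by (simp add: image_image cong: image_cong)
  then show ?thesis unfolding eq lball_def .
qed

lemma isometric_subset: "isometric b B f \<Longrightarrow> A \<subseteq> B \<Longrightarrow> isometric b A f"
  unfolding isometric_def by blast

lemma isometric_homeomorphism:
  assumes b: "is_basis b" and f: "isometric b (bx n u \<rho>) f" and u: "u \<in> affine_space n" and r: "\<rho> > 0"
  shows "\<exists>g. homeomorphism (bx n u \<rho>) (f ` bx n u \<rho>) f g"
proof -
  have iso: "nm n (co n b (f a - f c)) = nm n (\<lambda>i. a i - c i)" if "a \<in> bx n u \<rho>" "c \<in> bx n u \<rho>" for a c
    using f that by (simp add: isometric_def)
  have fW: "\<And>a. a \<in> bx n u \<rho> \<Longrightarrow> f a \<in> W" using f by (simp add: isometric_def)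
  have uu: "u \<in> bx n u \<rho>" using u r by (simp add: bx_center)
  have inj: "inj_on f (bx n u \<rho>)"
  proof (rule inj_onI)
    fix a c assume ac: "a \<in> bx n u \<rho>" "c \<in> bx n u \<rho>" "f a = f c"
    have "nm n (\<lambda>i. a i - c i) = nm n (co n b 0)" using iso[OF ac(1,2)] ac(3) by simp
    also have "\<dots> = nm n (\<lambda>_. 0 :: 'f)"
      using co_eqI[OF b, of 0 "\<lambda>_. 0"] by (intro nm_cong) simp
    finally show "a = c"
      using ac(1,2) by (intro affine_eqI[of _ n] subsetD[OF bx_subset_affine]) (auto simp: nm_eq_0_iff)
  qed
  have d: "\<And>a. a \<in> bx n u \<rho> \<Longrightarrow> f a - f u \<in> W" using fW[OF uu] fW subspace_diff[OF subspace_W] by blast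
  have "continuous_on (bx n u \<rho>) (\<lambda>a. co n b (f a - f u))"
  proof (rule isometry_continuous[OF bx_subset_affine, where k=n])
    fix a c assume ac: "a \<in> bx n u \<rho>" "c \<in> bx n u \<rho>"
    have "nm n (\<lambda>i. co n b (f a - f u) i - co n b (f c - f u) i) = nm n (co n b (f a - f c))"
    proof (rule nm_cong)
      fix i assume "i < n"
      then show "av (co n b (f a - f u) i - co n b (f c - f u) i) = av (co n b (f a - f c) i)"
        using co_diff[OF b d[OF ac(1)] d[OF ac(2)]] by simp
    qed
    then show "nm n (\<lambda>i. co n b (f a - f u) i - co n b (f c - f u) i) \<le> nm n (\<lambda>i. a i - c i)"
      using iso[OF ac] by simp
  qed (use co_affine[OF b d] in auto)
  then have "continuous_on (bx n u \<rho>) (\<lambda>a. f u + L b (co n b (f a - f u)))"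
    by (intro continuous_intros continuous_on_lin) (rule continuous_on_product_then_coordinatewise)
  then have "continuous_on (bx n u \<rho>) f"
    using L_co[OF b d] by (simp cong: continuous_on_cong)
  from homeomorphism_compact[OF compact_bx this refl inj] show ?thesis by blast
qed

text \<open>Change of variables with constant density: boxes go to balls of the same radius, and
  agreement on boxes extends to measurable sets.\<close>

lemma isometric_measure:
  assumes \<omega>: "top_form \<omega>" and b: "is_basis b" and f: "isometric b (bx n u \<rho>) f" and u: "u \<in> affine_space n" and r: "\<rho> > 0"
    and A: "A \<in> sets (pm n)" "A \<subseteq> bx n u \<rho>"
  shows "f ` A \<in> sets (restrict_space borel W)"
    and "emeasure (vol \<omega>) (f ` A) = ennreal (modulus (\<omega> b)) * emeasure (pm n) A"
proof -
  obtain g where g: "homeomorphism (bx n u \<rho>) (f ` bx n u \<rho>) f g" using isometric_homeomorphism[OF b f u r] by blast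
  have fW: "\<And>a. a \<in> bx n u \<rho> \<Longrightarrow> f a \<in> W" using f by (simp add: isometric_def)
  have img: "f ` bx n u \<rho> \<in> sets (restrict_space borel W)"
    unfolding isometric_image_bx[OF b f u r] using bx_center[OF u, of \<rho>] r fW by (intro lball_sets[OF b]) auto
  show "f ` A \<in> sets (restrict_space borel W)"
    by (rule homeomorphism_image_sets[OF g openin_bx[OF r] img A])
  show "emeasure (vol \<omega>) (f ` A) = ennreal (modulus (\<omega> b)) * emeasure (pm n) A"
  proof (rule measure_image_eq[OF sets_vol g openin_bx[OF r] _ _ A])
    fix x and t :: real assume x: "x \<in> bx n u \<rho>" "t > 0" "bx n x t \<subseteq> bx n u \<rho>"
    have "x \<in> affine_space n" using x(1) bx_subset_affine by blast
    then have "f ` bx n x t = lball b (f x) t"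
      using isometric_image_bx[OF b isometric_subset[OF f x(3)]] x(2) by simp
    then show "emeasure (vol \<omega>) (f ` bx n x t) = ennreal (modulus (\<omega> b)) * emeasure (pm n) (bx n x t)"
      using vol_lball[OF \<omega> b fW[OF x(1)] x(2)] modulus_pos[OF top_form_nonzero[OF \<omega> b]] ball_volume_pos[OF x(2), where 'f='f]
      by (simp add: emeasure_pm_bx[OF x(2)] ennreal_mult)
  qed (use img in simp)
qed

end


section \<open>Differentiable maps and measures attached to forms\<close>

lemma translate_along_affine [simp]: "translate_along k u v t \<in> affine_space k"
  by (simp add: translate_along_def)

lemma translate_along_zero: "u \<in> affine_space k \<Longrightarrow> translate_along k u v 0 = u"
  for u :: "nat \<Rightarrow> 'f::nonarch_local_field"
  by (rule affine_eqI[of _ k]) (auto simp: translate_along_def)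

lemma continuous_on_translate_along:
  fixes p :: "'x::topological_space \<Rightarrow> nat \<Rightarrow> 'f::nonarch_local_field"
  assumes "continuous_on S p" "continuous_on S v" "continuous_on S q"
  shows "continuous_on S (\<lambda>x. translate_along k (p x) (v x) (q x))"
proof (rule continuous_on_coordinatewise_then_product)
  fix i
  show "continuous_on S (\<lambda>x. translate_along k (p x) (v x) (q x) i)"
  proof (cases "i < k")
    case True
    have "continuous_on S (\<lambda>x. p x i + q x * v x i)"
      by (intro continuous_on_add continuous_on_mult' assms(3))
         (rule continuous_on_product_then_coordinatewise[OF assms(1)] continuous_on_product_then_coordinatewise[OF assms(2)])+
    then show ?thesis using True by (simp add: translate_along_def)
  qed (simp add: translate_along_def)
qed

definition unit_vec :: "nat \<Rightarrow> nat \<Rightarrow> nat \<Rightarrow> 'f::nonarch_local_field" where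
  "unit_vec k i = restrict (\<lambda>l. if l = i then 1 else 0) {..<k}"

text \<open>Names the witness in \<open>C1_map\<close>. Its values at \<open>t = 0\<close> are the
  directional derivatives.\<close>

definition C1_quotient ::
  "('f::nonarch_local_field \<Rightarrow> 'w::{ab_group_add,t2_space} \<Rightarrow> 'w) \<Rightarrow> nat \<Rightarrow>
    (nat \<Rightarrow> 'f) set \<Rightarrow> ((nat \<Rightarrow> 'f) \<Rightarrow> 'w) \<Rightarrow> ((nat \<Rightarrow> 'f) \<Rightarrow> (nat \<Rightarrow> 'f) \<Rightarrow> 'f \<Rightarrow> 'w) \<Rightarrow> bool" where
  "C1_quotient s k U \<phi> g \<longleftrightarrow>
     continuous_on {(u, v, t). u \<in> U \<and> v \<in> affine_space k \<and> translate_along k u v t \<in> U} (\<lambda>(u, v, t). g u v t) \<and>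
     (\<forall>u v t. u \<in> U \<and> v \<in> affine_space k \<and> translate_along k u v t \<in> U \<longrightarrow>
           \<phi> (translate_along k u v t) - \<phi> u = s t (g u v t))"

lemma C1_map_iff: "C1_map s k U \<phi> \<longleftrightarrow> (\<exists>g. C1_quotient s k U \<phi> g)"
  by (simp add: C1_map_def C1_quotient_def)

context tvs
begin

text \<open>Base point and step may both vary with \<open>t\<close>: additivity of the derivative
  needs a moving base point, homogeneity a rescaled step.\<close>

lemma C1_quotient_tendsto:
  assumes g: "C1_quotient s k U \<phi> g" and U: "openin (top_of_set (affine_space k)) U"
    and p: "continuous_on UNIV p" "\<And>t. p t \<in> affine_space k" "p 0 \<in> U"
    and q: "continuous_on UNIV q" "q 0 = 0" and v: "v \<in> affine_space k"
  shows "((\<lambda>t::'f. g (p t) v (q t)) \<longlongrightarrow> g (p 0) v 0) (at 0)"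
    and "eventually (\<lambda>t. p t \<in> U \<and> translate_along k (p t) v (q t) \<in> U) (at 0)"
proof -
  obtain O' where O': "open O'" "U = affine_space k \<inter> O'" using U by (auto simp: openin_open)
  let ?r = "\<lambda>t. translate_along k (p t) v (q t)"
  have r: "continuous_on UNIV ?r" by (rule continuous_on_translate_along[OF p(1) continuous_on_const q(1)])
  define T where "T = p -` O' \<inter> ?r -` O'"
  have T: "open T" unfolding T_def by (intro open_Int open_vimage[OF O'(1) p(1)] open_vimage[OF O'(1) r])
  have TU: "t \<in> T \<longleftrightarrow> p t \<in> U \<and> ?r t \<in> U" for t using p(2) O'(2) by (auto simp: T_def)
  have T0: "0 \<in> T" using p(3) q(2) translate_along_zero[OF p(2), of 0 v] by (simp add: TU)
  show "eventually (\<lambda>t. p t \<in> U \<and> ?r t \<in> U) (at 0)"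
    using eventually_at_topological T T0 TU by blast
  let ?G = "{(u, v, t). u \<in> U \<and> v \<in> affine_space k \<and> translate_along k u v t \<in> U}"
  have "continuous_on T ((\<lambda>(u, v, t). g u v t) \<circ> (\<lambda>t. (p t, v, q t)))"
  proof (rule continuous_on_compose)
    show "continuous_on T (\<lambda>t. (p t, v, q t))"
      by (intro continuous_intros continuous_on_subset[OF p(1)] continuous_on_subset[OF q(1)]) auto
    have "(\<lambda>t. (p t, v, q t)) ` T \<subseteq> ?G" using TU v by auto
    then show "continuous_on ((\<lambda>t. (p t, v, q t)) ` T) (\<lambda>(u, v, t). g u v t)"
      using g unfolding C1_quotient_def by (blast intro: continuous_on_subset)
  qed
  then have "continuous_on T (\<lambda>t. g (p t) v (q t))" by (simp add: o_def)
  then have "isCont (\<lambda>t. g (p t) v (q t)) 0" using T T0 by (simp add: continuous_on_eq_continuous_at)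
  then show "((\<lambda>t. g (p t) v (q t)) \<longlongrightarrow> g (p 0) v 0) (at 0)" using q(2) by (simp add: isCont_def)
qed

lemma C1_quotient_eq:
  "C1_quotient s k U \<phi> g \<Longrightarrow> u \<in> U \<Longrightarrow> v \<in> affine_space k \<Longrightarrow> translate_along k u v t \<in> U \<Longrightarrow>
    \<phi> (translate_along k u v t) - \<phi> u = s t (g u v t)"
  unfolding C1_quotient_def by blast

lemma partial_deriv_eq:
  assumes g: "C1_quotient s k U \<phi> g" and U: "openin (top_of_set (affine_space k)) U" and u: "u \<in> U" and i: "i < k"
  shows "partial_deriv s \<phi> u i = g u (unit_vec k i) 0"
proof -
  have ua: "u \<in> affine_space k" using U u openin_imp_subset by blast
  let ?e = "unit_vec k i :: nat \<Rightarrow> 'f"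
  have e: "?e \<in> affine_space k" by (simp add: unit_vec_def)
  have tr: "translate_along k u ?e t = u(i := u i + t)" for t
    by (rule affine_eqI[of _ k])
       (use ua i in \<open>auto simp: translate_along_def unit_vec_def affine_space_def PiE_iff extensional_def\<close>)
  note lim = C1_quotient_tendsto[OF g U continuous_on_const ua u continuous_on_id refl e]
  have "eventually (\<lambda>t. s (inverse t) (\<phi> (u(i := u i + t)) - \<phi> u) = g u ?e t) (at 0)"
    using lim(2) eventually_neq_at_within[of 0 0 UNIV]
  proof eventually_elim
    case (elim t)
    have "\<phi> (u(i := u i + t)) - \<phi> u = s t (g u ?e t)"
      using C1_quotient_eq[OF g u e, of t] elim by (simp add: tr)
    then show ?case using elim by simp
  qed
  then have "((\<lambda>t. s (inverse t) (\<phi> (u(i := u i + t)) - \<phi> u)) \<longlongrightarrow> g u ?e 0) (at 0)"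
    using lim(1) by (simp add: tendsto_cong)
  then show ?thesis unfolding partial_deriv_def by (intro tendsto_Lim) auto
qed

text \<open>For \<open>t \<noteq> 0\<close> the same end point is reached in two ways, which gives
  homogeneity and additivity of difference quotients. Continuity of \<open>g\<close> carries both
  over to \<open>t = 0\<close>, where the values on unit vectors are the partial
  derivatives.\<close>

lemma C1_quotient_linear:
  assumes g: "C1_quotient s k U \<phi> g" and U: "openin (top_of_set (affine_space k)) U" and u: "u \<in> U"
    and v: "v \<in> affine_space k"
  shows "g u v 0 = lin s k (partial_deriv s \<phi> u) v"
proof -
  have ua: "u \<in> affine_space k" using U u openin_imp_subset by blast
  let ?R = "\<lambda>c. restrict c {..<k} :: nat \<Rightarrow> 'f"
  have scale: "g u (?R (\<lambda>i. a * x i)) 0 = s a (g u x 0)" if x: "x \<in> affine_space k" for a x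
  proof -
    let ?ax = "?R (\<lambda>i. a * x i)"
    note l1 = C1_quotient_tendsto[OF g U continuous_on_const ua u continuous_on_id refl restrict_affine, of "\<lambda>i. a * x i"]
    have qc: "continuous_on UNIV (\<lambda>t. t * a)" by (intro continuous_intros)
    have q0: "0 * a = 0" by simp
    note l2 = C1_quotient_tendsto[OF g U continuous_on_const ua u qc q0 x]
    have "eventually (\<lambda>t. g u ?ax t = s a (g u x (t * a))) (at 0)"
      using l1(2) l2(2) eventually_neq_at_within[of 0 0 UNIV]
    proof eventually_elim
      case (elim t)
      have "translate_along k u ?ax t = translate_along k u x (t * a)"
        unfolding translate_along_def by (intro restrict_ext) (simp add: ac_simps)
      then have "s t (g u ?ax t) = s (t * a) (g u x (t * a))"
        using C1_quotient_eq[OF g u restrict_affine, of "\<lambda>i. a * x i" t] C1_quotient_eq[OF g u x, of "t * a"] elim by simp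
      then have "s t (g u ?ax t) = s t (s a (g u x (t * a)))" by simp
      then show ?case using elim by (simp only: scale_left_imp_eq)
    qed
    then have "((\<lambda>t. s a (g u x (t * a))) \<longlongrightarrow> g u ?ax 0) (at 0)" using l1(1) by (simp add: tendsto_cong)
    moreover have "((\<lambda>t. s a (g u x (t * a))) \<longlongrightarrow> s a (g u x 0)) (at 0)"
      by (intro tendsto_scale tendsto_const) (rule l2(1))
    ultimately show ?thesis by (intro tendsto_unique[of "at (0::'f)"]) auto
  qed
  have add: "g u (?R (\<lambda>i. x i + y i)) 0 = g u x 0 + g u y 0" if x: "x \<in> affine_space k" and y: "y \<in> affine_space k" for x y
  proof -
    let ?xy = "?R (\<lambda>i. x i + y i)"
    let ?p = "\<lambda>t. translate_along k u x t"
    have pc: "continuous_on UNIV ?p" by (rule continuous_on_translate_along) (intro continuous_intros continuous_on_id)+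
    have p0: "?p 0 = u" by (rule translate_along_zero[OF ua])
    note l1 = C1_quotient_tendsto[OF g U continuous_on_const ua u continuous_on_id refl restrict_affine, of "\<lambda>i. x i + y i"]
    note l2 = C1_quotient_tendsto[OF g U continuous_on_const ua u continuous_on_id refl x]
    note l3 = C1_quotient_tendsto[OF g U pc translate_along_affine _ continuous_on_id refl y, unfolded p0, OF u]
    have "eventually (\<lambda>t. g u ?xy t = g u x t + g (?p t) y t) (at 0)"
      using l1(2) l2(2) l3(2) eventually_neq_at_within[of 0 0 UNIV]
    proof eventually_elim
      case (elim t)
      have "translate_along k u ?xy t = translate_along k (?p t) y t"
        unfolding translate_along_def by (intro restrict_ext) (simp add: algebra_simps)
      then have "s t (g u ?xy t) = s t (g u x t) + s t (g (?p t) y t)"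
        using C1_quotient_eq[OF g u restrict_affine, of "\<lambda>i. x i + y i" t] C1_quotient_eq[OF g u x, of t]
          C1_quotient_eq[OF g _ y, of "?p t" t] elim by (simp add: algebra_simps)
      then have "s t (g u ?xy t) = s t (g u x t + g (?p t) y t)" by (simp only: scale_right_distrib)
      then show ?case using elim by (simp only: scale_left_imp_eq)
    qed
    then have "((\<lambda>t. g u x t + g (?p t) y t) \<longlongrightarrow> g u ?xy 0) (at 0)" using l1(1) by (simp add: tendsto_cong)
    moreover have "((\<lambda>t. g u x t + g (?p t) y t) \<longlongrightarrow> g u x 0 + g u y 0) (at 0)"
      by (intro tendsto_add l2(1) l3(1))
    ultimately show ?thesis by (intro tendsto_unique[of "at (0::'f)"]) auto
  qed
  have "g u (?R (\<lambda>i. if i < j then v i else 0)) 0 = (\<Sum>i<j. s (v i) (partial_deriv s \<phi> u i))" if "j \<le> k" for j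
    using that
  proof (induction j)
    case 0
    have "?R (\<lambda>i. if i < 0 then v i else 0) = ?R (\<lambda>i. 0 * v i)" by (intro restrict_ext) simp
    then show ?case using scale[OF v, of 0] by (simp only: lessThan_0 sum.empty scale_zero_left)
  next
    case (Suc j)
    let ?x = "?R (\<lambda>i. if i < j then v i else 0)" and ?y = "?R (\<lambda>i. v j * unit_vec k j i)"
    have "?R (\<lambda>i. if i < Suc j then v i else 0) = ?R (\<lambda>i. ?x i + ?y i)"
      by (intro restrict_ext) (auto simp: unit_vec_def less_Suc_eq)
    then have "g u (?R (\<lambda>i. if i < Suc j then v i else 0)) 0 = g u ?x 0 + g u ?y 0"
      using add[OF restrict_affine restrict_affine] by simp
    also have "g u ?y 0 = s (v j) (partial_deriv s \<phi> u j)"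
      using scale[of "unit_vec k j" "v j"] partial_deriv_eq[OF g U u, of j] Suc.prems
      by (simp add: unit_vec_def)
    finally show ?case using Suc by simp
  qed
  from this[OF order_refl] have "g u (?R (\<lambda>i. if i < k then v i else 0)) 0 = lin s k (partial_deriv s \<phi> u) v"
    by (simp add: lin_def)
  moreover have "?R (\<lambda>i. if i < k then v i else 0) = v"
    by (rule affine_eqI[of _ k]) (use v in auto)
  ultimately show ?thesis by simp
qed

end

context ftvs
begin

text \<open>For \<open>t \<noteq> 0\<close> the quotient is a scaled difference of points of
  \<open>W\<close>; the value at 0 is a limit of such vectors, and \<open>W\<close> is
  closed.\<close>

lemma C1_quotient_in_W:
  assumes g: "C1_quotient s k U \<phi> g" and U: "openin (top_of_set (affine_space k)) U" and W: "\<phi> ` U \<subseteq> W"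
    and u: "u \<in> U" "v \<in> affine_space k" "translate_along k u v t \<in> U"
  shows "g u v t \<in> W"
proof -
  have ua: "u \<in> affine_space k" using U u openin_imp_subset by blast
  have nz: "g u v t \<in> W" if "t \<noteq> 0" "translate_along k u v t \<in> U" for t
  proof -
    have "s t (g u v t) \<in> W"
      using C1_quotient_eq[OF g u(1,2) that(2)] subspace_diff[OF subspace_W, of "\<phi> (translate_along k u v t)" "\<phi> u"] W u(1) that(2) by auto
    then have "s (inverse t) (s t (g u v t)) \<in> W" by (rule subspace_scale[OF subspace_W])
    then show ?thesis using that(1) by simp
  qed
  show ?thesis
  proof (cases "t = 0")
    case True
    note lim = C1_quotient_tendsto[OF g U continuous_on_const ua u(1) continuous_on_id refl u(2)]
    have "eventually (\<lambda>t. g u v t \<in> W) (at 0)"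
      using lim(2) eventually_neq_at_within[of 0 0 UNIV] by eventually_elim (use nz in blast)
    then show ?thesis using Lim_in_closed_set[OF closed_W _ _ lim(1)] True by simp
  qed (use nz u in blast)
qed

lemma partial_deriv_in_W:
  assumes "C1_map s k U \<phi>" "openin (top_of_set (affine_space k)) U" "\<phi> ` U \<subseteq> W" "u \<in> U" "i < k"
  shows "partial_deriv s \<phi> u i \<in> W"
proof -
  obtain g where g: "C1_quotient s k U \<phi> g" using assms(1) C1_map_iff by blast
  have "u \<in> affine_space k" using assms(2,4) openin_imp_subset by blast
  then show ?thesis
    unfolding partial_deriv_eq[OF g assms(2,4,5)]
    using assms(4) by (intro C1_quotient_in_W[OF g assms(2,3,4)]) (auto simp: unit_vec_def translate_along_zero)
qed

text \<open>The reason for the strong notion of differentiability: by compactness of the unit ball it is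
  uniform in the direction, i.e. strict.\<close>

lemma C1_strict:
  assumes C1: "C1_map s k U \<phi>" and U: "openin (top_of_set (affine_space k)) U" and W: "\<phi> ` U \<subseteq> W" and u0: "u0 \<in> U"
    and b: "is_basis b" and e: "\<epsilon> > 0"
  shows "\<exists>\<rho>>0. bx k u0 \<rho> \<subseteq> U \<and> (\<forall>a\<in>bx k u0 \<rho>. \<forall>c\<in>bx k u0 \<rho>.
     nm n (co n b (\<phi> a - \<phi> c - lin s k (partial_deriv s \<phi> u0) (\<lambda>i. a i - c i))) \<le> \<epsilon> * nm k (\<lambda>i. a i - c i))"
proof -
  obtain g where g: "C1_quotient s k U \<phi> g" using C1 C1_map_iff by blast
  have ua: "u0 \<in> affine_space k" using U u0 openin_imp_subset by blast
  obtain \<rho>0 where \<rho>0: "\<rho>0 > 0" "bx k u0 \<rho>0 \<subseteq> U" using openin_contains_bx[OF U u0] by blast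
  let ?K = "bx k (\<lambda>_. 0 :: 'f) 1"
  let ?U' = "bx k u0 \<rho>0 \<times> cball (0::'f) \<rho>0"
  have tr_in: "translate_along k u v t \<in> bx k u0 r" if "u \<in> bx k u0 r" "v \<in> ?K" "av t \<le> r" for u v t r
  proof -
    have "dist (u0 i) (u i + t * v i) \<le> r" if i: "i < k" for i
    proof -
      have "av (v i) \<le> 1" using \<open>v \<in> ?K\<close> i by (auto simp: bx_iff)
      then have "av (t * v i) \<le> r" using mult_left_mono[of "av (v i)" 1 "av t"] \<open>av t \<le> r\<close> by (simp add: dist_0_mult)
      moreover have "av (u i - u0 i) \<le> r" using \<open>u \<in> bx k u0 r\<close> i by (auto simp: bx_iff dist_eq_av[of "u0 i"])
      ultimately have "av ((u i - u0 i) + t * v i) \<le> r" using av_add_le[of "u i - u0 i" "t * v i"] by simp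
      then show ?thesis by (simp add: dist_eq_av[of "u0 i"] algebra_simps)
    qed
    then show ?thesis by (simp add: bx_iff translate_along_def)
  qed
  have inG: "u \<in> U \<and> v \<in> affine_space k \<and> translate_along k u v t \<in> U" if "(u, t) \<in> ?U'" "v \<in> ?K" for u v t
    using that tr_in[of u \<rho>0 v t] \<rho>0(2) bx_subset_affine[of k "\<lambda>_. 0 :: 'f" 1] by auto
  define F where "F i = (\<lambda>(x, v). co n b (g (fst x) v (snd x)) i)" for i
  have cF: "continuous_on (?U' \<times> ?K) (F i)" for i
  proof -
    have "continuous_on (?U' \<times> ?K) ((\<lambda>(u, v, t). g u v t) \<circ> (\<lambda>(x, v). (fst x, v, snd x)))"
    proof (rule continuous_on_compose)
      show "continuous_on (?U' \<times> ?K) (\<lambda>(x, v). (fst x, v, snd x))"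
        unfolding case_prod_beta by (intro continuous_intros)
      have "(\<lambda>(x, v). (fst x, v, snd x)) ` (?U' \<times> ?K) \<subseteq> {(u, v, t). u \<in> U \<and> v \<in> affine_space k \<and> translate_along k u v t \<in> U}"
        using inG by auto
      then show "continuous_on ((\<lambda>(x, v). (fst x, v, snd x)) ` (?U' \<times> ?K)) (\<lambda>(u, v, t). g u v t)"
        using g unfolding C1_quotient_def by (blast intro: continuous_on_subset)
    qed
    then have c1: "continuous_on (?U' \<times> ?K) (\<lambda>(x, v). g (fst x) v (snd x))" by (simp add: o_def case_prod_beta)
    have "(\<lambda>(x, v). g (fst x) v (snd x)) ` (?U' \<times> ?K) \<subseteq> W"
      using C1_quotient_in_W[OF g U W] inG by auto
    from continuous_on_compose[OF c1 co_continuous[OF b this]]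
    have "continuous_on (?U' \<times> ?K) (\<lambda>y. (co n b \<circ> (\<lambda>(x, v). g (fst x) v (snd x))) y i)"
      by (rule continuous_on_product_then_coordinatewise)
    then show ?thesis by (simp add: F_def o_def case_prod_beta)
  qed
  have u0': "(u0, 0) \<in> ?U'" using \<rho>0(1) bx_center[OF ua] by simp
  \<comment> \<open>The tube lemma: one neighbourhood of \<open>(u0, 0)\<close> serves all
    directions in the compact box \<open>?K\<close>.\<close>
  have "\<exists>X. (u0, 0) \<in> X \<and> open X \<and> (\<forall>x\<in>X \<inter> ?U'. \<forall>v\<in>?K. dist (F i (x, v)) (F i ((u0, 0), v)) \<le> \<epsilon>)" for i
    by (rule continuous_on_prod_compactE[OF cF[of i] compact_bx u0' e]) blast
  then obtain X where X: "\<And>i. (u0, 0) \<in> X i" "\<And>i. open (X i)"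
    "\<And>i x v. x \<in> X i \<inter> ?U' \<Longrightarrow> v \<in> ?K \<Longrightarrow> dist (F i (x, v)) (F i ((u0, 0), v)) \<le> \<epsilon>" by metis
  have "open (\<Inter>i<n. X i)" by (intro open_INT) (auto simp: X)
  moreover have "(u0, 0) \<in> (\<Inter>i<n. X i)" using X by simp
  ultimately obtain A C where AC: "open A" "open C" "(u0, 0) \<in> A \<times> C" "A \<times> C \<subseteq> (\<Inter>i<n. X i)" by (rule open_prod_elim)
  have "openin (top_of_set (affine_space k)) (affine_space k \<inter> A)" using AC(1) by (rule openin_open_Int)
  then obtain \<rho>1 where \<rho>1: "\<rho>1 > 0" "bx k u0 \<rho>1 \<subseteq> affine_space k \<inter> A"
    using openin_contains_bx[of k "affine_space k \<inter> A" u0] ua AC(3) by auto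
  obtain \<rho>2 where \<rho>2: "\<rho>2 > 0" "cball 0 \<rho>2 \<subseteq> C" using AC(2,3) open_contains_cball[of C] by auto
  define \<rho> where "\<rho> = min \<rho>0 (min \<rho>1 \<rho>2)"
  have \<rho>: "\<rho> > 0" "\<rho> \<le> \<rho>0" "\<rho> \<le> \<rho>1" "\<rho> \<le> \<rho>2" using \<rho>0 \<rho>1 \<rho>2 by (auto simp: \<rho>_def)
  have bound: "nm n (co n b (g u v t - g u0 v 0)) \<le> \<epsilon>" if "u \<in> bx k u0 \<rho>" "v \<in> ?K" "av t \<le> \<rho>" for u v t
  proof (subst nm_le_iff)
    show "\<forall>i<n. av (co n b (g u v t - g u0 v 0) i) \<le> \<epsilon>"
    proof (intro allI impI)
      fix i assume i: "i < n"
      have m1: "(u, t) \<in> ?U'" using that \<rho> bx_mono[OF \<rho>(2), of k u0] by auto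
      have "u \<in> A" "t \<in> C" using that \<rho> \<rho>1(2) \<rho>2(2) bx_mono[OF \<rho>(3), of k u0] by auto
      then have "(u, t) \<in> X i" using AC(4) i by blast
      then have "dist (F i ((u, t), v)) (F i ((u0, 0), v)) \<le> \<epsilon>" using X(3) m1 that(2) by blast
      then have "av (co n b (g u v t) i - co n b (g u0 v 0) i) \<le> \<epsilon>"
        by (simp add: F_def dist_eq_av[of "co n b (g u v t) i"] av_minus_commute)
      moreover have "g u v t \<in> W" "g u0 v 0 \<in> W"
        using C1_quotient_in_W[OF g U W] inG[OF m1 that(2)] inG[OF u0' that(2)] by auto
      ultimately show "av (co n b (g u v t - g u0 v 0) i) \<le> \<epsilon>" using co_diff[OF b _ _ i] by simp
    qed
  qed (use e in simp)
  have main: "nm n (co n b (\<phi> a - \<phi> c - lin s k (partial_deriv s \<phi> u0) (\<lambda>i. a i - c i))) \<le> \<epsilon> * nm k (\<lambda>i. a i - c i)"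
    if ac: "a \<in> bx k u0 \<rho>" "c \<in> bx k u0 \<rho>" for a c
  proof -
    let ?d = "\<lambda>i. a i - c i"
    let ?D = "partial_deriv s \<phi> u0"
    have aff: "a \<in> affine_space k" "c \<in> affine_space k" using ac bx_subset_affine by blast+
    show ?thesis
    proof (cases "nm k ?d = 0")
      case True
      then have d0: "\<And>i. i < k \<Longrightarrow> a i = c i" by (simp add: nm_eq_0_iff)
      then have "a = c" using aff by (intro affine_eqI[of _ k])
      then have "\<phi> a - \<phi> c - lin s k ?D ?d = 0" by simp
      moreover have "nm n (co n b 0) = 0"
        using co_eqI[OF b, of 0 "\<lambda>_. 0"] by (simp add: nm_eq_0_iff)
      ultimately show ?thesis using True by simp
    next
      case False
      then obtain j where j: "j < k" "nm k ?d = av (?d j)" using nm_attained[of k ?d] by blast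
      \<comment> \<open>Dividing by a coordinate of largest absolute value writes the increment as
        \<open>t * v\<close>, with \<open>v\<close> in the compact unit box and \<open>av t\<close>
        equal to the norm of the increment.\<close>
      define t where "t = ?d j"
      have t: "t \<noteq> 0" "av t = nm k ?d" using j False by (auto simp: t_def)
      define v where "v = restrict (\<lambda>i. inverse t * ?d i) {..<k}"
      have cons: "bx k c \<rho> = bx k u0 \<rho>" by (rule bx_eq[OF ac(2)])
      have "a \<in> bx k c \<rho>" using ac(1) unfolding cons .
      then have "nm k ?d \<le> \<rho>" using \<rho>(1) by (simp only: bx_iff_nm less_imp_le)
      then have t\<rho>: "av t \<le> \<rho>" using t(2) by simp
      have vK: "v \<in> ?K"
      proof -
        have "nm k (\<lambda>i. inverse t * ?d i) = inverse (av t) * av t" by (simp only: nm_scale av_inverse t(2))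
        also have "\<dots> \<le> 1" using t(1) by simp
        finally have "\<forall>i<k. av (inverse t * ?d i) \<le> 1" by (simp only: nm_le_iff zero_le_one)
        then show ?thesis by (simp add: bx_iff v_def)
      qed
      have va: "v \<in> affine_space k" by (simp add: v_def)
      have tv: "t * v i = ?d i" if "i < k" for i using that t(1) by (simp add: v_def mult.assoc[symmetric])
      have tr: "translate_along k c v t = a"
        by (rule affine_eqI[of _ k]) (use aff tv in \<open>auto simp: translate_along_def\<close>)
      have cU: "c \<in> U" "a \<in> U" using ac \<rho>0(2) bx_mono[OF \<rho>(2), of k u0] by auto
      have "\<phi> a - \<phi> c = s t (g c v t)" using C1_quotient_eq[OF g cU(1) va, of t] cU(2) by (simp add: tr)
      moreover have "lin s k ?D ?d = lin s k ?D (\<lambda>i. t * v i)" using tv by (intro lin_cong) auto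
      then have "lin s k ?D ?d = s t (g u0 v 0)"
        using C1_quotient_linear[OF g U u0 va] by (simp add: lin_scale)
      ultimately have eq: "\<phi> a - \<phi> c - lin s k ?D ?d = s t (g c v t - g u0 v 0)"
        by (simp add: scale_right_diff_distrib)
      have "g c v t \<in> W" "g u0 v 0 \<in> W"
        using C1_quotient_in_W[OF g U W cU(1) va] C1_quotient_in_W[OF g U W u0 va] cU(2) tr translate_along_zero[OF ua] u0 by auto
      then have gW: "g c v t - g u0 v 0 \<in> W" by (rule subspace_diff[OF subspace_W])
      have "nm n (co n b (s t (g c v t - g u0 v 0))) = nm n (\<lambda>i. t * co n b (g c v t - g u0 v 0) i)"
        by (rule nm_cong) (simp add: co_scale[OF b gW])
      also have "\<dots> = av t * nm n (co n b (g c v t - g u0 v 0))" by (rule nm_scale)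
      also have "\<dots> \<le> av t * \<epsilon>" using bound[OF ac(2) vK t\<rho>] by (rule mult_left_mono) simp
      finally show ?thesis unfolding eq using t(2) by (simp add: mult.commute)
    qed
  qed
  have "bx k u0 \<rho> \<subseteq> U" using \<rho>0(2) bx_mono[OF \<rho>(2), of k u0] by blast
  then show ?thesis using \<rho>(1) main by blast
qed

text \<open>Strict differentiability with error 1/2, measured in the basis of partial derivatives,
  where the linear part is the identity; \<open>nm_near\<close> then removes the error. This plays
  the part of the inverse function theorem.\<close>

lemma C1_isometric:
  assumes C1: "C1_map s n U \<phi>" and U: "openin (top_of_set (affine_space n)) U" and W: "\<phi> ` U \<subseteq> W" and u0: "u0 \<in> U"
    and b: "is_basis (partial_deriv s \<phi> u0)"
  shows "\<exists>\<rho>>0. bx n u0 \<rho> \<subseteq> U \<and> isometric (partial_deriv s \<phi> u0) (bx n u0 \<rho>) \<phi>"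
proof -
  let ?D = "partial_deriv s \<phi> u0"
  have "0 < (1/2::real)" by simp
  from C1_strict[OF C1 U W u0 b this] obtain \<rho> where \<rho>: "\<rho> > 0" "bx n u0 \<rho> \<subseteq> U"
    "\<And>a c. a \<in> bx n u0 \<rho> \<Longrightarrow> c \<in> bx n u0 \<rho> \<Longrightarrow>
      nm n (co n ?D (\<phi> a - \<phi> c - L ?D (\<lambda>i. a i - c i))) \<le> 1/2 * nm n (\<lambda>i. a i - c i)" by blast
  have "nm n (co n ?D (\<phi> a - \<phi> c)) = nm n (\<lambda>i. a i - c i)" if ac: "a \<in> bx n u0 \<rho>" "c \<in> bx n u0 \<rho>" for a c
  proof (rule nm_near[where e="1/2"])
    have pW: "\<phi> a - \<phi> c \<in> W" using ac \<rho>(2) W subspace_diff[OF subspace_W] by blast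
    have "nm n (\<lambda>i. co n ?D (\<phi> a - \<phi> c) i - (a i - c i)) = nm n (co n ?D (\<phi> a - \<phi> c - L ?D (\<lambda>i. a i - c i)))"
      by (rule nm_cong) (simp add: co_diff[OF b pW L_in_W[OF b]] co_lin_nth[OF is_basis_indep[OF b]])
    then show "nm n (\<lambda>i. co n ?D (\<phi> a - \<phi> c) i - (a i - c i)) \<le> 1/2 * nm n (\<lambda>i. a i - c i)" using \<rho>(3)[OF ac] by simp
  qed simp
  then show ?thesis using \<rho>(1,2) W unfolding isometric_def by blast
qed

text \<open>The type of vectors carries no countability assumption. Open covers are pulled back to
  coordinates, where second countability holds.\<close>

lemma Lindelof_W:
  assumes "S \<subseteq> W" "\<And>x. x \<in> S \<Longrightarrow> openin (top_of_set S) (T x)" "\<And>x. x \<in> S \<Longrightarrow> x \<in> T x"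
  shows "\<exists>C. countable C \<and> C \<subseteq> S \<and> S = (\<Union>x\<in>C. T x)"
proof -
  obtain b where b: "is_basis b" using is_basis_exists by blast
  have "\<exists>O'. open O' \<and> T x = S \<inter> O'" if "x \<in> S" for x using assms(2)[OF that] by (auto simp: openin_open)
  then obtain O' where O': "\<And>x. x \<in> S \<Longrightarrow> open (O' x)" "\<And>x. x \<in> S \<Longrightarrow> T x = S \<inter> O' x" by metis
  let ?P = "\<lambda>x. affine_space n \<inter> L b -` O' x"
  have o: "openin (top_of_set (affine_space n)) V" if "V \<in> ?P ` S" for V
    using that O'(1) continuous_openin_preimage_gen[OF continuous_on_lin_id] by auto
  obtain F where F: "F \<subseteq> ?P ` S" "countable F" "\<Union>F = \<Union>(?P ` S)"
    by (rule Lindelof_openin[of "?P ` S", OF o], assumption, rule that)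
  then obtain C where C: "countable C" "C \<subseteq> S" "F = ?P ` C" using countable_subset_image[of F ?P S] by blast
  have "S \<subseteq> (\<Union>x\<in>C. T x)"
  proof
    fix x assume x: "x \<in> S"
    have "x \<in> O' x" using assms(3)[OF x] O'(2)[OF x] by blast
    then have "co n b x \<in> ?P x" using x assms(1) co_affine[OF b] L_co[OF b, of x] by auto
    then have "co n b x \<in> \<Union>F" using F(3) x by blast
    then obtain y where y: "y \<in> C" "co n b x \<in> ?P y" using C(3) by blast
    then have "x \<in> O' y" using L_co[OF b, of x] x assms(1) by auto
    then show "x \<in> (\<Union>x\<in>C. T x)" using y(1) C(2) x O'(2) by blast
  qed
  moreover have "(\<Union>x\<in>C. T x) \<subseteq> S" using C(2) O'(2) by blast
  ultimately show ?thesis using C by blast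
qed

end

section \<open>Existence and uniqueness of the measure of a form\<close>

lemma local_parametrizationD:
  assumes "local_parametrization s S k U \<phi>"
  shows "openin (top_of_set (affine_space k)) U" "openin (top_of_set S) (\<phi> ` U)"
    "\<exists>\<psi>. homeomorphism U (\<phi> ` U) \<phi> \<psi>" "C1_map s k U \<phi>"
    "\<And>u c i. u \<in> U \<Longrightarrow> (\<Sum>i<k. s (c i) (partial_deriv s \<phi> u i)) = 0 \<Longrightarrow> i < k \<Longrightarrow> c i = 0"
  using assms unfolding local_parametrization_def by blast+

lemma openin_sets_restrict: "openin (top_of_set S) T \<Longrightarrow> T \<in> sets (restrict_space borel S)"
proof -
  assume "openin (top_of_set S) T"
  then obtain O' where "open O'" "T = S \<inter> O'" by (auto simp: openin_open)
  then show ?thesis unfolding sets_restrict_space by (intro image_eqI[of _ _ O']) auto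
qed

lemma countable_cover_disjoint:
  assumes "countable C" "A \<subseteq> \<Union>C" "A \<noteq> {}"
  shows "\<exists>D :: nat \<Rightarrow> _. disjoint_family D \<and> A = (\<Union>i. A \<inter> D i) \<and> (\<forall>i. \<exists>c\<in>C. D i \<subseteq> c) \<and>
    (\<forall>M. C \<subseteq> sets M \<longrightarrow> range D \<subseteq> sets M)"
proof -
  have "C \<noteq> {}" using assms by auto
  then have r: "range (from_nat_into C) = C" using assms(1) by (rule range_from_nat_into)
  let ?D = "disjointed (from_nat_into C)"
  have "(\<Union>i. ?D i) = \<Union>C" unfolding UN_disjointed_eq r ..
  then have "A = A \<inter> (\<Union>i. ?D i)" using assms(2) by (simp add: Int_absorb2)
  then have "A = (\<Union>i. A \<inter> ?D i)" by (simp only: Int_UN_distrib)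
  moreover have "\<exists>c\<in>C. ?D i \<subseteq> c" for i using disjointed_subset[of "from_nat_into C" i] r by blast
  moreover have "range ?D \<subseteq> sets M" if "C \<subseteq> sets M" for M
    by (rule sets.range_disjointed_sets) (use r that in auto)
  ultimately show ?thesis using disjoint_family_disjointed[of "from_nat_into C"]
    by (intro exI[of _ ?D] conjI allI impI) simp_all
qed

context ftvs
begin

text \<open>Under \<open>loc\<close> the modulus of the form in a chart is locally constant, as
  \<open>const\<close> shows. A countable disjoint refinement of the boxes then turns the integral
  into a sum of constants times volumes.\<close>

lemma is_form_measureI:
  assumes M: "sets M = sets (restrict_space borel S)"
    and loc: "\<And>U \<phi> u. local_parametrization s S k U \<phi> \<Longrightarrow> u \<in> U \<Longrightarrow>
      \<exists>\<rho>>0. bx k u \<rho> \<subseteq> U \<and> (\<forall>x r. x \<in> bx k u \<rho> \<longrightarrow> 0 < r \<longrightarrow> bx k x r \<subseteq> bx k u \<rho> \<longrightarrow>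
        emeasure M (\<phi> ` bx k x r) = ennreal (modulus (\<omega> (\<phi> u) (partial_deriv s \<phi> u))) * emeasure (pm k) (bx k x r))"
  shows "is_form_measure s S k \<omega> M"
  unfolding is_form_measure_def
proof (intro conjI allI impI, rule M)
  fix U \<phi> A assume *: "local_parametrization s S k U \<phi> \<and> A \<subseteq> U \<and> A \<in> sets (pm k)"
  then have lp: "local_parametrization s S k U \<phi>" and AU: "A \<subseteq> U" and A: "A \<in> sets (pm k)" by auto
  note lpD = local_parametrizationD[OF lp]
  let ?m = "\<lambda>u. modulus (\<omega> (\<phi> u) (partial_deriv s \<phi> u))"
  obtain \<psi> where \<psi>: "homeomorphism U (\<phi> ` U) \<phi> \<psi>" using lpD(3) by blast
  have UA: "U \<subseteq> affine_space k" using lpD(1) openin_imp_subset by blast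
  have imS: "\<phi> ` U \<in> sets (restrict_space borel S)" by (rule openin_sets_restrict[OF lpD(2)])
  have im: "\<phi> ` B \<in> sets M" if "B \<in> sets (pm k)" "B \<subseteq> U" for B
    using homeomorphism_image_sets[OF \<psi> lpD(1) imS that] M by simp
  obtain \<rho> where \<rho>: "\<And>u. u \<in> U \<Longrightarrow> \<rho> u > 0" "\<And>u. u \<in> U \<Longrightarrow> bx k u (\<rho> u) \<subseteq> U"
    "\<And>u x r. u \<in> U \<Longrightarrow> x \<in> bx k u (\<rho> u) \<Longrightarrow> 0 < r \<Longrightarrow> bx k x r \<subseteq> bx k u (\<rho> u) \<Longrightarrow>
        emeasure M (\<phi> ` bx k x r) = ennreal (?m u) * emeasure (pm k) (bx k x r)"
    using loc[OF lp] by metis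
  \<comment> \<open>Both densities describe \<open>M\<close> on a common small box around
    \<open>x\<close>, whose volume is positive and finite.\<close>
  have const: "ennreal (?m x) = ennreal (?m u)" if u: "u \<in> U" and x: "x \<in> bx k u (\<rho> u)" for u x
  proof -
    have xU: "x \<in> U" using \<rho>(2)[OF u] x by blast
    define r where "r = min (\<rho> u) (\<rho> x)"
    have r: "r > 0" using \<rho>(1)[OF u] \<rho>(1)[OF xU] by (simp add: r_def)
    have s1: "bx k x r \<subseteq> bx k u (\<rho> u)" by (rule bx_subset[OF x]) (simp add: r_def)
    have xx: "x \<in> bx k x (\<rho> x)" using UA xU \<rho>(1)[OF xU] by (intro bx_center) auto
    have s2: "bx k x r \<subseteq> bx k x (\<rho> x)" by (rule bx_subset[OF xx]) (simp add: r_def)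
    have "ennreal (?m x) * emeasure (pm k) (bx k x r) = ennreal (?m u) * emeasure (pm k) (bx k x r)"
      using \<rho>(3)[OF u x r s1] \<rho>(3)[OF xU xx r s2] by simp
    then have "ennreal (?m x) * ennreal (ball_volume TYPE('f) r ^ k) * ennreal (1 / ball_volume TYPE('f) r ^ k)
        = ennreal (?m u) * ennreal (ball_volume TYPE('f) r ^ k) * ennreal (1 / ball_volume TYPE('f) r ^ k)"
      by (simp add: emeasure_pm_bx[OF r])
    moreover have "ennreal (ball_volume TYPE('f) r ^ k) * ennreal (1 / ball_volume TYPE('f) r ^ k) = 1"
      using ball_volume_pos[OF r, where 'f='f] by (subst ennreal_mult[symmetric]) auto
    ultimately show ?thesis by (simp add: mult.assoc)
  qed
  have part: "emeasure M (\<phi> ` B) = ennreal (?m u) * emeasure (pm k) B"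
    if u: "u \<in> U" and B: "B \<in> sets (pm k)" "B \<subseteq> bx k u (\<rho> u)" for u B
  proof (rule measure_image_eq[OF M _ openin_bx[OF \<rho>(1)[OF u]] _ _ B])
    show "homeomorphism (bx k u (\<rho> u)) (\<phi> ` bx k u (\<rho> u)) \<phi> \<psi>"
      by (rule homeomorphism_of_subsets[OF \<psi> \<rho>(2)[OF u] _ refl]) (use \<rho>(2)[OF u] in auto)
    show "\<phi> ` bx k u (\<rho> u) \<in> sets M" by (rule im[OF bx_in_sets_pm \<rho>(2)[OF u]])
  qed (rule \<rho>(3)[OF u])
  show "emeasure M (\<phi> ` A) = (\<integral>\<^sup>+ u \<in> A. ennreal (?m u) \<partial>(pm k))"
  proof (cases "A = {}")
    case False
    let ?F = "(\<lambda>u. bx k u (\<rho> u)) ` U"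
    have o: "openin (top_of_set (affine_space k)) V" if "V \<in> ?F" for V
      using that openin_bx \<rho>(1) by auto
    obtain C where C: "C \<subseteq> ?F" "countable C" "\<Union>C = \<Union>?F"
      by (rule Lindelof_openin[of ?F, OF o], assumption, rule that)
    have "U \<subseteq> \<Union>?F"
    proof
      fix u assume u: "u \<in> U"
      then show "u \<in> \<Union>?F" using bx_center[of u k "\<rho> u"] UA \<rho>(1)[OF u] by auto
    qed
    then have "A \<subseteq> \<Union>C" using AU C(3) by blast
    from countable_cover_disjoint[OF C(2) this False] obtain D :: "nat \<Rightarrow> _" where
      D': "disjoint_family D \<and> A = (\<Union>i. A \<inter> D i) \<and> (\<forall>i. \<exists>c\<in>C. D i \<subseteq> c) \<and> (\<forall>M. C \<subseteq> sets M \<longrightarrow> range D \<subseteq> sets M)" ..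
    then have D: "disjoint_family D" "A = (\<Union>i. A \<inter> D i)" "\<And>i. \<exists>c\<in>C. D i \<subseteq> c" by (elim conjE, simp)+
    have "C \<subseteq> sets (pm k)" using C(1) bx_in_sets_pm by blast
    then have "range D \<subseteq> sets (pm k)" using D' by (elim conjE) simp
    then have Ds: "D i \<in> sets (pm k)" for i by blast
    have "\<exists>u\<in>U. D i \<subseteq> bx k u (\<rho> u)" for i using D(3)[of i] C(1) by blast
    then obtain u where u: "\<And>i. u i \<in> U" "\<And>i. D i \<subseteq> bx k (u i) (\<rho> (u i))" by metis
    let ?A = "\<lambda>i. A \<inter> D i"
    have As: "?A i \<in> sets (pm k)" for i using A Ds by blast
    have dA: "disjoint_family ?A" using D(1) unfolding disjoint_family_on_def by blast
    have UA': "\<phi> ` A = (\<Union>i. \<phi> ` ?A i)" using D(2) by blast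
    have dj: "disjoint_family (\<lambda>i. \<phi> ` ?A i)"
      unfolding disjoint_family_on_def
    proof (intro ballI impI)
      fix i j :: nat assume "i \<noteq> j"
      then have "?A i \<inter> ?A j = {}" using dA unfolding disjoint_family_on_def by blast
      moreover have "inj_on \<phi> U" using \<psi> by (metis homeomorphism_def inj_on_inverseI)
      then have "\<phi> ` ?A i \<inter> \<phi> ` ?A j = \<phi> ` (?A i \<inter> ?A j)"
        by (rule inj_on_image_Int[symmetric]) (use AU in auto)
      ultimately show "\<phi> ` ?A i \<inter> \<phi> ` ?A j = {}" by simp
    qed
    have "\<phi> ` ?A i \<in> sets M" for i by (rule im[OF As]) (use AU in auto)
    then have "range (\<lambda>i. \<phi> ` ?A i) \<subseteq> sets M" by blast
    then have "emeasure M (\<phi> ` A) = (\<Sum>i. emeasure M (\<phi> ` ?A i))"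
      unfolding UA' by (rule suminf_emeasure[OF _ dj, symmetric])
    also have "\<dots> = (\<Sum>i. ennreal (?m (u i)) * emeasure (pm k) (?A i))"
    proof (rule suminf_cong)
      fix i show "emeasure M (\<phi> ` ?A i) = ennreal (?m (u i)) * emeasure (pm k) (?A i)"
        by (rule part[OF u(1) As]) (use u(2) in blast)
    qed
    also have "\<dots> = (\<Sum>i. \<integral>\<^sup>+ x. ennreal (?m (u i)) * indicator (?A i) x \<partial>(pm k))"
      using As by (simp add: nn_integral_cmult_indicator)
    also have "\<dots> = (\<integral>\<^sup>+ x. (\<Sum>i. ennreal (?m (u i)) * indicator (?A i) x) \<partial>(pm k))"
      by (rule nn_integral_suminf[symmetric]) (intro borel_measurable_times_ennreal borel_measurable_const borel_measurable_indicator As)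
    also have "\<dots> = (\<integral>\<^sup>+ x \<in> A. ennreal (?m x) \<partial>(pm k))"
    proof (rule nn_integral_cong)
      fix x
      show "(\<Sum>i. ennreal (?m (u i)) * indicator (?A i) x) = ennreal (?m x) * indicator A x"
      proof (cases "x \<in> A")
        case True
        then obtain j where j: "x \<in> ?A j" using D(2) by blast
        have "x \<notin> ?A i" if "i \<noteq> j" for i using dA j that unfolding disjoint_family_on_def by blast
        then have "(\<Sum>i. ennreal (?m (u i)) * indicator (?A i) x) = (\<Sum>i\<in>{j}. ennreal (?m (u i)) * indicator (?A i) x)"
          by (intro suminf_finite) (auto simp: indicator_def)
        also have "\<dots> = ennreal (?m (u j))" using j by simp
        also have "\<dots> = ennreal (?m x)" by (rule const[symmetric, OF u(1)]) (use j u(2) in blast)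
        finally show ?thesis using True by simp
      qed simp
    qed
    finally show ?thesis .
  qed simp
qed

text \<open>Countably many chart images cover \<open>S\<close>, and the chart formula fixes the
  measure of every Borel piece inside one of them. Together with existence this evaluates the
  definite description in \<open>form_measure\<close>.\<close>

lemma is_form_measure_unique:
  assumes SW: "S \<subseteq> W" and M: "is_form_measure s S k \<omega> M" and N: "is_form_measure s S k \<omega> N"
    and cover: "\<And>x. x \<in> S \<Longrightarrow> \<exists>U \<phi>. local_parametrization s S k U \<phi> \<and> x \<in> \<phi> ` U"
  shows "N = M"
proof (rule measure_eqI)
  have sM: "sets M = sets (restrict_space borel S)" using M by (simp add: is_form_measure_def)
  have sN: "sets N = sets (restrict_space borel S)" using N by (simp add: is_form_measure_def)
  show "sets N = sets M" by (simp add: sM sN)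
  fix E assume "E \<in> sets N"
  then have E: "E \<in> sets (restrict_space borel S)" by (simp add: sN)
  then have ES: "E \<subseteq> S" using sets.sets_into_space by (fastforce simp: space_restrict_space)
  show "emeasure N E = emeasure M E"
  proof (cases "E = {}")
    case False
    obtain U \<phi> where lp: "\<And>x. x \<in> S \<Longrightarrow> local_parametrization s S k (U x) (\<phi> x)" "\<And>x. x \<in> S \<Longrightarrow> x \<in> \<phi> x ` U x"
      using cover by metis
    have lp2: "openin (top_of_set S) (\<phi> x ` U x)" if "x \<in> S" for x by (rule local_parametrizationD(2)[OF lp(1)[OF that]])
    from Lindelof_W[OF SW lp2 lp(2)] obtain C where C: "countable C" "C \<subseteq> S" "S = (\<Union>x\<in>C. \<phi> x ` U x)" by blast
    let ?C = "(\<lambda>x. \<phi> x ` U x) ` C"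
    have "countable ?C" "E \<subseteq> \<Union>?C" using C(1) ES unfolding C(3)[symmetric] by auto
    from countable_cover_disjoint[OF this False] obtain D :: "nat \<Rightarrow> _" where
      D': "disjoint_family D \<and> E = (\<Union>i. E \<inter> D i) \<and> (\<forall>i. \<exists>c\<in>?C. D i \<subseteq> c) \<and> (\<forall>M. ?C \<subseteq> sets M \<longrightarrow> range D \<subseteq> sets M)" ..
    then have D: "disjoint_family D" "E = (\<Union>i. E \<inter> D i)" "\<And>i. \<exists>c\<in>?C. D i \<subseteq> c" by (elim conjE, simp)+
    have "?C \<subseteq> sets (restrict_space borel S)" using lp2 C(2) openin_sets_restrict by blast
    then have "range D \<subseteq> sets (restrict_space borel S)" using D' by (elim conjE) simp
    then have Ds: "D i \<in> sets (restrict_space borel S)" for i by blast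
    have Es: "E \<inter> D i \<in> sets (restrict_space borel S)" for i using E Ds by blast
    have dE: "disjoint_family (\<lambda>i. E \<inter> D i)" using D(1) unfolding disjoint_family_on_def by blast
    have eq: "emeasure N (E \<inter> D i) = emeasure M (E \<inter> D i)" for i
    proof -
      obtain x where x: "x \<in> S" "D i \<subseteq> \<phi> x ` U x" using D(3)[of i] C(2) by blast
      note l = lp(1)[OF x(1)]
      note lD = local_parametrizationD[OF l]
      let ?A = "{u \<in> U x. \<phi> x u \<in> E \<inter> D i}"
      have img: "\<phi> x ` ?A = E \<inter> D i" using x(2) by blast
      have "\<phi> x \<in> measurable (restrict_space borel (U x)) (restrict_space borel S)"
      proof (rule continuous_restrict_measurable)
        show "continuous_on (U x) (\<phi> x)" using lD(3) by (auto simp: homeomorphism_def)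
        show "\<phi> x ` U x \<subseteq> S" using lD(2) openin_imp_subset by blast
      qed
      from measurable_sets[OF this Es[of i]] have "?A \<in> sets (restrict_space borel (U x))"
        by (simp add: space_restrict_space vimage_def Int_def conj_commute)
      then have "?A \<in> sets (restrict_space (pm k) (U x))" using sets_restrict_pm[OF lD(1) refl] by simp
      moreover have "U x \<inter> space (pm k) \<in> sets (pm k)"
        using openin_affine_sets_pm[OF lD(1)] by (intro sets.Int) auto
      ultimately have As: "?A \<in> sets (pm k)" by (simp add: sets_restrict_space_iff)
      have "emeasure N (\<phi> x ` ?A) = emeasure M (\<phi> x ` ?A)"
        using M N l As unfolding is_form_measure_def by (metis (no_types, lifting) mem_Collect_eq subsetI)
      then show ?thesis unfolding img .
    qed
    have "emeasure N E = (\<Sum>i. emeasure N (E \<inter> D i))"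
      using suminf_emeasure[of "\<lambda>i. E \<inter> D i" N] Es dE D(2) by (simp add: sN image_subset_iff)
    also have "\<dots> = (\<Sum>i. emeasure M (E \<inter> D i))" by (simp add: eq)
    also have "\<dots> = emeasure M E"
      using suminf_emeasure[of "\<lambda>i. E \<inter> D i" M] Es dE D(2) by (simp add: sM image_subset_iff)
    finally show ?thesis .
  qed simp
qed

lemma form_measure_eqI:
  assumes "S \<subseteq> W" "is_form_measure s S k \<omega> M"
    and "\<And>x. x \<in> S \<Longrightarrow> \<exists>U \<phi>. local_parametrization s S k U \<phi> \<and> x \<in> \<phi> ` U"
  shows "form_measure s S k \<omega> = M"
  unfolding form_measure_def using assms(2) is_form_measure_unique[OF assms(1,2) _ assms(3)] by (rule the_equality)

text \<open>At each point the partial derivatives of a chart form a basis in which the chart is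
  isometric nearby, and \<open>vol\<close> may be computed in that basis. A linear parametrisation
  provides the chart required for uniqueness.\<close>

lemma form_measure_vol:
  assumes \<omega>: "top_form \<omega>"
  shows "form_measure s W n (\<lambda>_. \<omega>) = vol \<omega>"
proof (rule form_measure_eqI[OF subset_refl])
  show "is_form_measure s W n (\<lambda>_. \<omega>) (vol \<omega>)"
  proof (rule is_form_measureI[OF sets_vol])
    fix U \<phi> u assume lp: "local_parametrization s W n U \<phi>" and u: "u \<in> U"
    note lD = local_parametrizationD[OF lp]
    let ?D = "partial_deriv s \<phi> u"
    have W: "\<phi> ` U \<subseteq> W" using lD(2) openin_imp_subset by blast
    have b: "is_basis ?D"
      unfolding is_basis_def indep_def lin_def using partial_deriv_in_W[OF lD(4,1) W u] lD(5)[OF u] by blast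
    from C1_isometric[OF lD(4,1) W u b] obtain \<rho> where \<rho>: "\<rho> > 0" "bx n u \<rho> \<subseteq> U" "isometric ?D (bx n u \<rho>) \<phi>" by blast
    have ua: "u \<in> affine_space n" using lD(1) u openin_imp_subset by blast
    show "\<exists>\<rho>>0. bx n u \<rho> \<subseteq> U \<and> (\<forall>x r. x \<in> bx n u \<rho> \<longrightarrow> 0 < r \<longrightarrow> bx n x r \<subseteq> bx n u \<rho> \<longrightarrow>
        emeasure (vol \<omega>) (\<phi> ` bx n x r) = ennreal (modulus (\<omega> ?D)) * emeasure (pm n) (bx n x r))"
      using isometric_measure(2)[OF \<omega> b \<rho>(3) ua \<rho>(1) bx_in_sets_pm] \<rho>(1,2) by blast
  qed
next
  fix x assume x: "x \<in> W"
  obtain b where b: "is_basis b" using is_basis_exists by blast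
  have g: "C1_quotient s n (affine_space n) (L b) (\<lambda>u v t. L b v)"
    unfolding C1_quotient_def
  proof (intro conjI allI impI)
    show "continuous_on {(u, v, t). u \<in> affine_space n \<and> v \<in> affine_space n \<and> translate_along n u v t \<in> affine_space n} (\<lambda>(u, v, t). L b v)"
      unfolding case_prod_beta
      by (rule continuous_on_lin, rule continuous_on_product_then_coordinatewise) (intro continuous_intros)
    fix u v t
    have "L b (translate_along n u v t) = L b (\<lambda>i. u i + t * v i)" by (simp add: translate_along_def)
    then show "L b (translate_along n u v t) - L b u = s t (L b v)" by (simp add: lin_add lin_scale)
  qed
  have "local_parametrization s W n (affine_space n) (L b)"
    unfolding local_parametrization_def
  proof (intro conjI ballI allI impI)
    show "openin (top_of_set W) (L b ` affine_space n)" using is_basis_range[OF b] by simp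
    show "\<exists>\<psi>. homeomorphism (affine_space n) (L b ` affine_space n) (L b) \<psi>"
      using lin_homeomorphism[OF is_basis_indep[OF b]] by blast
    show "C1_map s n (affine_space n) (L b)" using g C1_map_iff by blast
    fix u c i assume u: "u \<in> affine_space n" and c: "(\<Sum>i<n. s (c i) (partial_deriv s (L b) u i)) = 0" and i: "i < n"
    have "partial_deriv s (L b) u i = b i" if "i < n" for i
      using partial_deriv_eq[OF g openin_affine_self u that] lin_unit[OF that, of b] by (simp add: unit_vec_def)
    then have "L b c = 0" using c by (simp add: lin_def)
    then show "c i = 0" using is_basis_indep[OF b] i unfolding indep_def by blast
  qed simp
  moreover have "x \<in> L b ` affine_space n" using is_basis_range[OF b] x by simp
  ultimately show "\<exists>U \<phi>. local_parametrization s W n U \<phi> \<and> x \<in> \<phi> ` U" by blast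
qed

end


section \<open>Straightening a quadratic map\<close>

lemma sum_lessThan_add: "(\<Sum>i<r + m. f i) = (\<Sum>i<r. f i) + (\<Sum>j<m. f (r + j))"
  for f :: "nat \<Rightarrow> 'a::comm_monoid_add"
  by (induction m) (simp_all add: add.assoc)

lemma nm_split:
  assumes "m \<le> n"
  shows "nm n c = max (nm (n - m) c) (nm m (\<lambda>j. c (n - m + j)))"
proof (rule antisym)
  show "nm n c \<le> max (nm (n - m) c) (nm m (\<lambda>j. c (n - m + j)))"
  proof (subst nm_le_iff)
    show "\<forall>i<n. av (c i) \<le> max (nm (n - m) c) (nm m (\<lambda>j. c (n - m + j)))"
    proof (intro allI impI)
      fix i assume i: "i < n"
      show "av (c i) \<le> max (nm (n - m) c) (nm m (\<lambda>j. c (n - m + j)))"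
      proof (cases "i < n - m")
        case True
        then show ?thesis using av_le_nm[of i "n - m" c] by simp
      next
        case False
        then have "i - (n - m) < m" "n - m + (i - (n - m)) = i" using i assms by auto
        then show ?thesis using av_le_nm[of "i - (n - m)" m "\<lambda>j. c (n - m + j)"] by simp
      qed
    qed
  qed (simp add: le_max_iff_disj)
  show "max (nm (n - m) c) (nm m (\<lambda>j. c (n - m + j))) \<le> nm n c"
    using assms by (auto simp: nm_le_iff intro!: av_le_nm)
qed

context ftvs
begin

lemma lball_L: "is_basis b \<Longrightarrow> lball b (L b u) r = L b ` bx n u r"
  unfolding lball_image L_image_bx[of b u] ..

lemma lball_partition:
  assumes b: "is_basis b" and U: "compact U" "openin (top_of_set W) U" and R: "R > 0"
  shows "\<exists>t Z. 0 < t \<and> t \<le> R \<and> finite Z \<and> Z \<subseteq> U \<and> U = (\<Union>z\<in>Z. lball b z t) \<and> disjoint_family_on (\<lambda>z. lball b z t) Z"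
proof -
  note h = is_basis_homeomorphism[OF b]
  have UW: "U \<subseteq> W" using U(2) openin_imp_subset by blast
  let ?U = "co n b ` U"
  have c: "compact ?U" by (rule compact_continuous_image[OF co_continuous[OF b UW] U(1)])
  have o: "openin (top_of_set (affine_space n)) ?U"
  proof -
    have "openin (top_of_set (affine_space n)) (affine_space n \<inter> L b -` U)"
      by (rule continuous_on_open_gen[THEN iffD1, rule_format, OF _ _ U(2)])
         (use h in \<open>auto simp: homeomorphism_def\<close>)
    moreover have "affine_space n \<inter> L b -` U = ?U"
    proof (intro set_eqI iffI)
      fix c assume c: "c \<in> affine_space n \<inter> L b -` U"
      then have "c = co n b (L b c)" using co_L[OF b] by simp
      then show "c \<in> ?U" using c by blast
    next
      fix c assume "c \<in> ?U"
      then show "c \<in> affine_space n \<inter> L b -` U" using co_affine[OF b] L_co[OF b] UW by auto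
    qed
    ultimately show ?thesis by simp
  qed
  obtain t where t: "t > 0" "t \<le> R" "\<And>x. x \<in> ?U \<Longrightarrow> bx n x t \<subseteq> ?U"
    using compact_openin_uniform_bx[OF c o R] by blast
  have Ua: "?U \<subseteq> affine_space n" using o openin_imp_subset by blast
  from bx_partition[OF c Ua t(1) t(3)] obtain Z where
    Z: "finite Z" "Z \<subseteq> ?U" "?U = (\<Union>z\<in>Z. bx n z t)" "disjoint_family_on (\<lambda>z. bx n z t) Z" by blast
  have LU: "L b ` ?U = U" using L_co[OF b] UW by (force simp: image_image)
  have inj: "inj_on (L b) (affine_space n)" using co_L[OF b] by (rule inj_on_inverseI)
  have Za: "Z \<subseteq> affine_space n" using Z(2) Ua by blast
  let ?Z = "L b ` Z"
  have 1: "?Z \<subseteq> U" using Z(2) LU by blast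
  have 2: "U = (\<Union>z\<in>?Z. lball b z t)"
  proof -
    have "U = L b ` (\<Union>z\<in>Z. bx n z t)" unfolding Z(3)[symmetric] LU ..
    also have "\<dots> = (\<Union>z\<in>Z. L b ` bx n z t)" by (rule image_UN)
    also have "\<dots> = (\<Union>z\<in>?Z. lball b z t)" by (simp add: lball_L[OF b])
    finally show ?thesis .
  qed
  have 3: "disjoint_family_on (\<lambda>z. lball b z t) ?Z"
    unfolding disjoint_family_on_def
  proof (intro ballI impI)
    fix x y assume xy: "x \<in> ?Z" "y \<in> ?Z" "x \<noteq> y"
    then obtain c d where cd: "c \<in> Z" "d \<in> Z" "x = L b c" "y = L b d" "c \<noteq> d" by blast
    have "bx n c t \<inter> bx n d t = {}" using Z(4) cd(1,2,5) unfolding disjoint_family_on_def by blast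
    then have "L b ` bx n c t \<inter> L b ` bx n d t = {}"
      using inj_on_image_Int[OF inj bx_subset_affine bx_subset_affine, of c t d t] by simp
    then show "lball b x t \<inter> lball b y t = {}" by (simp add: cd lball_L[OF b])
  qed
  show ?thesis using t(1,2) Z(1) 1 2 3 by blast
qed

end

text \<open>Only scalars of \<open>F\<close> will act, and \<open>\<sigma>\<close> fixes these, so a
  form that is sesquilinear over the larger field becomes bilinear here.\<close>

locale quad = X: ftvs s UNIV n + Y: ftvs s' W' m
  for s :: "'f::nonarch_local_field \<Rightarrow> 'x::{topological_ab_group_add,t2_space} \<Rightarrow> 'x" and n :: nat
    and s' :: "'f \<Rightarrow> 'y::{topological_ab_group_add,t2_space} \<Rightarrow> 'y" and W' :: "'y set" and m :: nat +
  fixes B :: "'x \<Rightarrow> 'x \<Rightarrow> 'y"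
  assumes B_add_left: "B (x + y) z = B x z + B y z"
    and B_add_right: "B x (y + z) = B x y + B x z"
    and B_scale_left: "B (s a x) y = s' a (B x y)"
    and B_scale_right: "B x (s a y) = s' a (B x y)"
    and B_in: "B x y \<in> W'"
begin

definition \<tau> :: "'x \<Rightarrow> 'y" where "\<tau> x = B x x"

definition d\<tau> :: "'x \<Rightarrow> 'x \<Rightarrow> 'y" where "d\<tau> x v = B x v + B v x"

lemma B_zero_left [simp]: "B 0 y = 0" using B_add_left[of 0 0 y] by simp
lemma B_zero_right [simp]: "B x 0 = 0" using B_add_right[of x 0 0] by simp
lemma B_minus_left: "B (- x) y = - B x y" using B_add_left[of x "-x" y] by (simp add: eq_neg_iff_add_eq_0 add.commute)
lemma B_minus_right: "B x (- y) = - B x y" using B_add_right[of x y "-y"] by (simp add: eq_neg_iff_add_eq_0 add.commute)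
lemma B_diff_left: "B (x - y) z = B x z - B y z" using B_add_left[of x "-y" z] by (simp add: B_minus_left)
lemma B_diff_right: "B x (y - z) = B x y - B x z" using B_add_right[of x y "-z"] by (simp add: B_minus_right)

lemma \<tau>_in: "\<tau> x \<in> W'" by (simp add: \<tau>_def B_in)
lemma d\<tau>_in: "d\<tau> x v \<in> W'" by (simp add: d\<tau>_def B_in Y.subspace_add[OF Y.subspace_W])

lemma d\<tau>_add: "d\<tau> x (v + w) = d\<tau> x v + d\<tau> x w" by (simp add: d\<tau>_def B_add_left B_add_right)
lemma d\<tau>_scale: "d\<tau> x (s a v) = s' a (d\<tau> x v)" by (simp add: d\<tau>_def B_scale_left B_scale_right Y.scale_right_distrib)
lemma d\<tau>_zero [simp]: "d\<tau> x 0 = 0" by (simp add: d\<tau>_def)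
lemma d\<tau>_diff: "d\<tau> x (v - w) = d\<tau> x v - d\<tau> x w" by (simp add: d\<tau>_def B_diff_left B_diff_right)

lemma d\<tau>_lin: "d\<tau> x (lin s k b c) = lin s' k (\<lambda>i. d\<tau> x (b i)) c"
  unfolding lin_def by (induction k) (simp_all add: d\<tau>_add d\<tau>_scale)

lemma \<tau>_add: "\<tau> (x + v) = \<tau> x + d\<tau> x v + \<tau> v"
  by (simp add: \<tau>_def d\<tau>_def B_add_left B_add_right algebra_simps)

text \<open>Exact, without a second order remainder: linear in \<open>a - a'\<close>, with
  coefficients given by the two end points.\<close>

lemma \<tau>_diff: "\<tau> a - \<tau> a' = B (a - a') a + B a' (a - a')"
  by (simp add: \<tau>_def B_diff_left B_diff_right)

lemma B_lin: "B (lin s k b c) (lin s k b d) = (\<Sum>i<k. \<Sum>j<k. s' (c i * d j) (B (b i) (b j)))"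
proof -
  have l: "B (lin s k b c) z = (\<Sum>i<k. s' (c i) (B (b i) z))" for z
    unfolding lin_def by (induction k) (simp_all add: B_add_left B_scale_left)
  have r: "B z (lin s k b d) = (\<Sum>i<k. s' (d i) (B z (b i)))" for z
    unfolding lin_def by (induction k) (simp_all add: B_add_right B_scale_right)
  show ?thesis unfolding l unfolding r by (simp add: Y.scale_sum_right)
qed

lemma continuous_\<tau>: "continuous_on S \<tau>"
proof -
  obtain b where b: "X.is_basis b" using X.is_basis_exists by blast
  have "\<tau> = (\<lambda>x. \<Sum>i<n. \<Sum>j<n. s' (X.co n b x i * X.co n b x j) (B (b i) (b j)))"
  proof
    fix x
    have "\<tau> x = B (X.L b (X.co n b x)) (X.L b (X.co n b x))" using X.L_co[OF b, of x] by (simp add: \<tau>_def)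
    then show "\<tau> x = (\<Sum>i<n. \<Sum>j<n. s' (X.co n b x i * X.co n b x j) (B (b i) (b j)))" by (simp only: B_lin)
  qed
  moreover have "continuous_on S (\<lambda>x. X.co n b x i)" for i
    by (rule continuous_on_product_then_coordinatewise[OF X.co_continuous[OF b]]) simp
  ultimately show ?thesis
    by (auto intro!: continuous_on_sum Y.continuous_on_scale continuous_on_mult' continuous_on_const)
qed

lemma continuous_d\<tau>: "continuous_on S (d\<tau> x)"
proof -
  have "d\<tau> x = (\<lambda>v. \<tau> (x + v) - \<tau> x - \<tau> v)" by (rule ext) (simp add: \<tau>_add)
  moreover have "continuous_on S (\<lambda>v. \<tau> (x + v))"
    by (rule continuous_on_compose2[OF continuous_\<tau>[of UNIV]]) (auto intro!: continuous_intros)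
  ultimately show ?thesis by (auto intro!: continuous_intros continuous_\<tau>)
qed

lemma B_bound:
  assumes b: "X.is_basis b" and y: "Y.is_basis y"
  shows "\<exists>K>0. \<forall>a w. nm m (Y.co m y (B a w)) \<le> K * nm n (X.co n b a) * nm n (X.co n b w)"
proof -
  define \<beta> where "\<beta> i j = Y.co m y (B (b i) (b j))" for i j
  \<comment> \<open>A sum in place of a maximum bounds the structure constants also when there are
    none; the added 1 makes \<open>K\<close> positive.\<close>
  define K where "K = 1 + (\<Sum>i<n. \<Sum>j<n. nm m (\<beta> i j))"
  have K: "nm m (\<beta> i j) \<le> K" if "i < n" "j < n" for i j
  proof -
    have "nm m (\<beta> i j) \<le> (\<Sum>j<n. nm m (\<beta> i j))" by (rule member_le_sum) (use that in auto)
    also have "\<dots> \<le> (\<Sum>i<n. \<Sum>j<n. nm m (\<beta> i j))"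
      by (rule member_le_sum[where f="\<lambda>i. \<Sum>j<n. nm m (\<beta> i j)"]) (use that in \<open>auto intro: sum_nonneg\<close>)
    finally show ?thesis by (simp add: K_def)
  qed
  have K0: "K > 0" unfolding K_def by (intro add_pos_nonneg sum_nonneg) auto
  have "nm m (Y.co m y (B a w)) \<le> K * nm n (X.co n b a) * nm n (X.co n b w)" for a w
  proof -
    let ?c = "X.co n b a" and ?d = "X.co n b w"
    have "B a w = B (X.L b ?c) (X.L b ?d)" using X.L_co[OF b] by simp
    also have "\<dots> = (\<Sum>i<n. \<Sum>j<n. s' (?c i * ?d j) (Y.L y (\<beta> i j)))"
      using Y.L_co[OF y B_in] by (simp add: B_lin \<beta>_def)
    also have "\<dots> = Y.L y (\<lambda>l. \<Sum>i<n. \<Sum>j<n. ?c i * ?d j * \<beta> i j l)"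
    proof -
      have *: "(\<Sum>i\<in>I. Y.L y (f i)) = Y.L y (\<lambda>l. \<Sum>i\<in>I. f i l)" if "finite I" for I :: "nat set" and f
        using that by (induction I rule: finite_induct) (simp_all add: Y.lin_add)
      show ?thesis by (simp add: * flip: Y.lin_scale)
    qed
    finally have eq: "B a w = Y.L y (\<lambda>l. \<Sum>i<n. \<Sum>j<n. ?c i * ?d j * \<beta> i j l)" .
    have KK: "0 \<le> K * nm n ?c * nm n ?d" using K0 by simp
    show ?thesis
    proof (subst nm_le_iff[OF KK], intro allI impI)
      fix l assume l: "l < m"
      have "av (?c i * ?d j * \<beta> i j l) \<le> K * nm n ?c * nm n ?d" if "i < n" "j < n" for i j
      proof -
        have "av (\<beta> i j l) \<le> K" using av_le_nm[OF l, of "\<beta> i j"] K[OF that] by simp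
        then have "av (?c i) * av (?d j) * av (\<beta> i j l) \<le> nm n ?c * nm n ?d * K"
          using that by (intro mult_mono av_le_nm) (auto intro: mult_nonneg_nonneg)
        then show ?thesis by (simp add: dist_0_mult mult.commute mult.left_commute)
      qed
      then have "av (\<Sum>i<n. \<Sum>j<n. ?c i * ?d j * \<beta> i j l) \<le> K * nm n ?c * nm n ?d"
        by (intro av_sum_le KK) auto
      then show "av (Y.co m y (B a w) l) \<le> K * nm n ?c * nm n ?d"
        using Y.co_eqI[OF y eq l] by simp
    qed
  qed
  then show ?thesis using K0 by blast
qed

text \<open>The first \<open>n - m\<close> vectors span the kernel of the differential at
  \<open>x\<close>, the last \<open>m\<close> lift a basis of the target. \<open>m \<le> n\<close>
  is included because \<open>n - m\<close> is truncated subtraction.\<close>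

definition adapted :: "'x \<Rightarrow> (nat \<Rightarrow> 'x) \<Rightarrow> (nat \<Rightarrow> 'y) \<Rightarrow> bool" where
  "adapted x b y \<longleftrightarrow> m \<le> n \<and> X.is_basis b \<and> Y.is_basis y \<and> (\<forall>i<n - m. d\<tau> x (b i) = 0) \<and> (\<forall>j<m. d\<tau> x (b (n - m + j)) = y j)"

lemma lin_split: "m \<le> n \<Longrightarrow> lin s n b c = lin s (n - m) b c + lin s m (\<lambda>j. b (n - m + j)) (\<lambda>j. c (n - m + j))"
  unfolding lin_def using sum_lessThan_add[of "\<lambda>i. s (c i) (b i)" "n - m" m] by simp

lemma lin_d\<tau>_kernel: "(\<And>i. i < k \<Longrightarrow> d\<tau> x (b i) = 0) \<Longrightarrow> d\<tau> x (lin s k b c) = 0"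
  by (simp only: d\<tau>_lin) (simp add: lin_def)

lemma adapted_d\<tau>: "adapted x b y \<Longrightarrow> d\<tau> x (X.L b c) = Y.L y (\<lambda>j. c (n - m + j))"
proof -
  assume a: "adapted x b y"
  then have "d\<tau> x (X.L b c) = d\<tau> x (lin s m (\<lambda>j. b (n - m + j)) (\<lambda>j. c (n - m + j)))"
    unfolding adapted_def using lin_split[of b c] lin_d\<tau>_kernel[of "n - m" x b c] by (simp add: d\<tau>_add)
  also have "\<dots> = Y.L y (\<lambda>j. c (n - m + j))"
    unfolding d\<tau>_lin using a by (intro lin_cong) (auto simp: adapted_def)
  finally show ?thesis .
qed

lemma adapted_indep:
  assumes y: "Y.is_basis y" and k: "X.indep r k" "\<And>i. i < r \<Longrightarrow> d\<tau> x (k i) = 0" and N: "\<And>j. j < m \<Longrightarrow> d\<tau> x (N j) = y j"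
  shows "X.indep (r + m) (\<lambda>i. if i < r then k i else N (i - r))"
  unfolding X.indep_def
proof (intro allI impI)
  let ?b = "\<lambda>i. if i < r then k i else N (i - r)"
  fix c i assume c: "lin s (r + m) ?b c = 0" and i: "i < r + m"
  have "lin s (r + m) ?b c = (\<Sum>i<r. s (c i) (?b i)) + (\<Sum>j<m. s (c (r + j)) (?b (r + j)))"
    unfolding lin_def by (rule sum_lessThan_add)
  then have split: "lin s (r + m) ?b c = lin s r k c + lin s m N (\<lambda>j. c (r + j))" by (simp add: lin_def)
  have "0 = d\<tau> x (lin s r k c) + d\<tau> x (lin s m N (\<lambda>j. c (r + j)))" using c split by (simp flip: d\<tau>_add)
  also have "d\<tau> x (lin s r k c) = 0" by (rule lin_d\<tau>_kernel[OF k(2)])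
  also have "d\<tau> x (lin s m N (\<lambda>j. c (r + j))) = Y.L y (\<lambda>j. c (r + j))"
    unfolding d\<tau>_lin using N by (intro lin_cong) auto
  finally have "Y.L y (\<lambda>j. c (r + j)) = 0" by simp
  then have c2: "\<forall>j<m. c (r + j) = 0" using Y.is_basis_indep[OF y] unfolding Y.indep_def by blast
  then have "lin s m N (\<lambda>j. c (r + j)) = 0" by (simp add: lin_def)
  then have "lin s r k c = 0" using c split by simp
  then have "\<forall>i<r. c i = 0" using k(1) unfolding X.indep_def by blast
  then show "c i = 0" using c2[rule_format, of "i - r"] i by (cases "i < r") auto
qed

text \<open>Rank and nullity: a basis of the kernel together with lifts of a basis of the target is
  independent and spans, so its length \<open>r + m\<close> is \<open>n\<close>.\<close>

lemma adapted_exists: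
  assumes surj: "\<And>y. y \<in> W' \<Longrightarrow> \<exists>v. d\<tau> x v = y"
  shows "\<exists>b y. adapted x b y"
proof -
  obtain y where y: "Y.is_basis y" using Y.is_basis_exists by blast
  have "\<exists>v. j < m \<longrightarrow> d\<tau> x v = y j" for j using surj y unfolding Y.is_basis_def by blast
  then obtain N where N: "\<And>j. j < m \<Longrightarrow> d\<tau> x (N j) = y j" by metis
  let ?V = "{v. d\<tau> x v = 0}"
  obtain BX where BX: "finite BX" "X.independent BX" "X.span BX = UNIV" "card BX = n" using X.basis_W by blast
  obtain K where K: "K \<subseteq> ?V" "X.independent K" "?V \<subseteq> X.span K"
    using X.maximal_independent_subset[of ?V] by blast
  have fK: "finite K" using X.independent_span_bound[OF BX(1) K(2)] BX(3) by simp
  define r where "r = card K"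
  obtain k where k: "k ` {..<r} = K" "X.indep r k" using X.independent_imp_indep[OF fK K(2)] r_def by blast
  have k0: "d\<tau> x (k i) = 0" if "i < r" for i using k(1) K(1) that by blast
  let ?b = "\<lambda>i. if i < r then k i else N (i - r)"
  have ind: "X.indep (r + m) ?b" by (rule adapted_indep[OF y k(2) k0 N])
  have le: "r + m \<le> n" by (rule X.indep_W_le[OF _ ind]) simp
  have "UNIV \<subseteq> X.span (?b ` {..<r + m})"
  proof
    fix w
    define c where "c = Y.co m y (d\<tau> x w)"
    have "d\<tau> x (w - lin s m N c) = d\<tau> x w - Y.L y c"
      unfolding d\<tau>_diff d\<tau>_lin using N by (intro arg_cong2[of _ _ _ _ "(-)"] lin_cong) auto
    then have "d\<tau> x (w - lin s m N c) = 0" using Y.L_co[OF y d\<tau>_in, of x w] by (simp add: c_def)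
    then have "w - lin s m N c \<in> X.span K" using K(3) by blast
    moreover have "K \<subseteq> ?b ` {..<r + m}"
    proof
      fix v assume "v \<in> K"
      then obtain i where "i < r" "v = k i" using k(1) by blast
      then show "v \<in> ?b ` {..<r + m}" by (intro image_eqI[of _ _ i]) auto
    qed
    ultimately have 1: "w - lin s m N c \<in> X.span (?b ` {..<r + m})" using X.span_mono by blast
    have "N j \<in> X.span (?b ` {..<r + m})" if "j < m" for j
    proof (rule X.span_base)
      show "N j \<in> ?b ` {..<r + m}" using that by (intro image_eqI[of _ _ "r + j"]) auto
    qed
    then have 2: "lin s m N c \<in> X.span (?b ` {..<r + m})" by (intro X.lin_in_subspace[OF X.subspace_span])
    have "w = (w - lin s m N c) + lin s m N c" by simp
    then show "w \<in> X.span (?b ` {..<r + m})" using X.span_add[OF 1 2] by simp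
  qed
  then have "BX \<subseteq> X.span (?b ` {..<r + m})" by blast
  from X.independent_span_bound[OF _ BX(2) this] have "n \<le> card (?b ` {..<r + m})" using BX(4) by simp
  also have "\<dots> \<le> r + m" using card_image_le[of "{..<r + m}" ?b] by simp
  finally have n: "n = r + m" using le by simp
  then have "adapted x ?b y"
    unfolding adapted_def X.is_basis_def using ind y k0 N by auto
  then show ?thesis by blast
qed

text \<open>Joins coordinates \<open>u\<close> along the kernel with transversal coordinates
  \<open>w\<close>, in the order of an adapted basis. With \<open>w = 0\<close> it embeds the
  coordinates of the fibre.\<close>

definition emb :: "(nat \<Rightarrow> 'f) \<Rightarrow> (nat \<Rightarrow> 'f) \<Rightarrow> nat \<Rightarrow> 'f" where
  "emb u w = restrict (\<lambda>i. if i < n - m then u i else w (i - (n - m))) {..<n}"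

lemma emb_affine [simp]: "emb u w \<in> affine_space n" by (simp add: emb_def)

lemma emb_nth1: "i < n - m \<Longrightarrow> emb u w i = u i" by (auto simp: emb_def)
lemma emb_nth2: "m \<le> n \<Longrightarrow> j < m \<Longrightarrow> emb u w (n - m + j) = w j"
proof -
  assume "m \<le> n" "j < m"
  then have "n - m + j < n" "\<not> n - m + j < n - m" "n - m + j - (n - m) = j" by auto
  then show ?thesis unfolding emb_def by (simp only: restrict_apply lessThan_iff if_True if_False)
qed

lemma emb_split: "z \<in> affine_space n \<Longrightarrow> emb (restrict z {..<n - m}) (\<lambda>j. z (n - m + j)) = z"
  by (rule affine_eqI[of _ n]) (auto simp: emb_def)

lemma bx_emb_iff:
  assumes "m \<le> n" "z \<in> affine_space n"
  shows "z \<in> bx n (emb u w) r \<longleftrightarrow> restrict z {..<n - m} \<in> bx (n - m) u r \<and> restrict (\<lambda>j. z (n - m + j)) {..<m} \<in> bx m w r"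
proof -
  have "(\<forall>i<n. dist (emb u w i) (z i) \<le> r) \<longleftrightarrow>
    (\<forall>i<n - m. dist (u i) (z i) \<le> r) \<and> (\<forall>j<m. dist (w j) (z (n - m + j)) \<le> r)" (is "?l \<longleftrightarrow> ?r1 \<and> ?r2")
  proof (intro iffI conjI allI impI)
    fix i assume l: ?l and "i < n - m"
    then show "dist (u i) (z i) \<le> r" using l[rule_format, of i] by (simp add: emb_nth1)
  next
    fix j assume l: ?l and "j < m"
    then have "n - m + j < n" using assms(1) by auto
    from l[rule_format, OF this] show "dist (w j) (z (n - m + j)) \<le> r"
      by (simp only: emb_nth2[OF assms(1) \<open>j < m\<close>])
  next
    fix i assume r: "?r1 \<and> ?r2" and i: "i < n"
    show "dist (emb u w i) (z i) \<le> r"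
    proof (cases "i < n - m")
      case True
      then show ?thesis using r by (simp add: emb_nth1)
    next
      case False
      then have j: "i - (n - m) < m" "n - m + (i - (n - m)) = i" using i assms(1) by auto
      have "emb u w i = w (i - (n - m))" using False i by (simp add: emb_def)
      then show ?thesis using r j by metis
    qed
  qed
  then show ?thesis using assms(2) by (simp add: bx_iff)
qed

text \<open>Replacing the last coordinates of an adapted basis by those of \<open>\<tau>\<close> is an isometry near
  \<open>x\<close>; hence \<open>\<tau>\<close> is a linear projection in suitable isometric coordinates.\<close>

lemma straighten:
  assumes ad: "adapted x b y"
  shows "\<exists>\<rho>>0. \<exists>f. X.isometric b (bx n (\<lambda>_. 0) \<rho>) f \<and> f (restrict (\<lambda>_. 0) {..<n}) = x \<and>
    (\<forall>z\<in>bx n (\<lambda>_. 0) \<rho>. \<tau> (f z) = \<tau> x + Y.L y (\<lambda>j. z (n - m + j)) \<and> (\<forall>i<n - m. X.co n b (f z - x) i = z i))"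
proof -
  have mn: "m \<le> n" and b: "X.is_basis b" and y: "Y.is_basis y" using ad by (auto simp: adapted_def)
  obtain K where K: "K > 0" "\<And>a w. nm m (Y.co m y (B a w)) \<le> K * nm n (X.co n b a) * nm n (X.co n b w)"
    using B_bound[OF b y] by blast
  \<comment> \<open>\<open>K * \<rho> = 1/2\<close> bounds the quadratic error by half of the
    increment, as \<open>nm_near\<close> requires.\<close>
  define \<rho> where "\<rho> = 1 / (2 * K)"
  have \<rho>: "\<rho> > 0" "K * \<rho> = 1/2" using K(1) by (auto simp: \<rho>_def)
  let ?B = "bx n (\<lambda>_. 0 :: 'f) \<rho>"
  define \<psi> where "\<psi> z = emb z (Y.co m y (\<tau> (x + X.L b z) - \<tau> x))" for z
  have coL: "nm n (X.co n b (X.L b z)) = nm n z" for z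
    using X.co_lin_nth[OF X.is_basis_indep[OF b]] by (intro nm_cong) simp
  have dW: "\<tau> a - \<tau> a' \<in> W'" for a a' by (rule Y.subspace_diff[OF Y.subspace_W \<tau>_in \<tau>_in])
  have iso: "nm n (\<lambda>i. \<psi> z i - \<psi> z' i) = nm n (\<lambda>i. z i - z' i)" if z: "z \<in> ?B" "z' \<in> ?B" for z z'
  proof (rule nm_near[where e="1/2"])
    let ?d = "\<lambda>i. z i - z' i"
    define w where "w = X.L b ?d"
    define a a' where "a = x + X.L b z" and "a' = x + X.L b z'"
    have aa: "a - a' = w" by (simp add: a_def a'_def w_def X.lin_diff)
    define e where "e = B w (X.L b z) + B (X.L b z') w"
    have eW: "e \<in> W'" by (simp add: e_def B_in Y.subspace_add[OF Y.subspace_W])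
    have "\<tau> a - \<tau> a' = d\<tau> x w + e"
      unfolding \<tau>_diff aa by (simp add: d\<tau>_def e_def a_def a'_def B_add_left B_add_right)
    then have eq: "\<tau> a - \<tau> a' = Y.L y (\<lambda>j. ?d (n - m + j)) + e" by (simp add: w_def adapted_d\<tau>[OF ad])
    have zb: "nm n z \<le> \<rho>" "nm n z' \<le> \<rho>" using z \<rho>(1) by (simp_all add: bx_iff_nm)
    have bd: "K * nm n ?d * t \<le> 1/2 * nm n ?d" "K * t * nm n ?d \<le> 1/2 * nm n ?d" if "t \<le> \<rho>" for t
    proof -
      have "K * t \<le> 1/2" using mult_left_mono[OF that, of K] K(1) \<rho>(2) by simp
      then have "K * t * nm n ?d \<le> 1/2 * nm n ?d" by (rule mult_right_mono) simp
      then show "K * nm n ?d * t \<le> 1/2 * nm n ?d" "K * t * nm n ?d \<le> 1/2 * nm n ?d" by (simp_all add: mult.commute mult.left_commute)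
    qed
    have "nm m (Y.co m y e) = nm m (\<lambda>j. Y.co m y (B w (X.L b z)) j + Y.co m y (B (X.L b z') w) j)"
      by (rule nm_cong) (simp add: e_def Y.co_add[OF y B_in B_in])
    also have "\<dots> \<le> max (nm m (Y.co m y (B w (X.L b z)))) (nm m (Y.co m y (B (X.L b z') w)))" by (rule nm_add_le)
    also have "\<dots> \<le> 1/2 * nm n ?d"
      using K(2)[of w "X.L b z"] K(2)[of "X.L b z'" w] bd[OF zb(1)] bd[OF zb(2)] by (simp add: coL w_def)
    finally have en: "nm m (Y.co m y e) \<le> 1/2 * nm n ?d" .
    let ?e = "\<lambda>i. (\<psi> z i - \<psi> z' i) - ?d i"
    have "nm n ?e = max (nm (n - m) ?e) (nm m (\<lambda>j. ?e (n - m + j)))" by (rule nm_split[OF mn])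
    also have "nm (n - m) ?e = 0" by (simp add: nm_eq_0_iff \<psi>_def emb_nth1)
    also have "nm m (\<lambda>j. ?e (n - m + j)) = nm m (Y.co m y e)"
    proof (rule nm_cong)
      fix j assume j: "j < m"
      have "\<psi> z (n - m + j) - \<psi> z' (n - m + j) = Y.co m y ((\<tau> a - \<tau> x) - (\<tau> a' - \<tau> x)) j"
        by (simp only: \<psi>_def emb_nth2[OF mn j] a_def[symmetric] a'_def[symmetric] Y.co_diff[OF y dW dW j])
      also have "(\<tau> a - \<tau> x) - (\<tau> a' - \<tau> x) = Y.L y (\<lambda>j. ?d (n - m + j)) + e" using eq by simp
      also have "Y.co m y \<dots> j = ?d (n - m + j) + Y.co m y e j"
        using Y.co_add[OF y Y.L_in_W[OF y] eW j] Y.co_lin_nth[OF Y.is_basis_indep[OF y] j] by simp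
      finally show "av (?e (n - m + j)) = av (Y.co m y e j)" by simp
    qed
    finally show "nm n ?e \<le> 1/2 * nm n ?d" using en by simp
  qed simp
  let ?z = "restrict (\<lambda>_. 0) {..<n} :: nat \<Rightarrow> 'f"
  have bz: "bx n ?z r = bx n (\<lambda>_. 0) r" for r by (rule bx_cong) simp
  have \<psi>0: "\<psi> ?z = ?z"
  proof (rule affine_eqI[of _ n])
    fix i assume i: "i < n"
    have "Y.co m y 0 (i - (n - m)) = 0" if "\<not> i < n - m"
      using Y.co_eqI[OF y, of 0 "\<lambda>_. 0" "i - (n - m)"] that i mn by simp
    then show "\<psi> ?z i = ?z i" using i by (simp add: \<psi>_def emb_def)
  qed (simp_all add: \<psi>_def)
  \<comment> \<open>An isometry of the box that fixes its centre maps the box onto itself; the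
    inverse of \<open>\<psi>\<close> will give \<open>f\<close>.\<close>
  have img: "\<psi> ` ?B = ?B"
    using isometry_image_bx[of n ?z \<rho> \<psi>, unfolded bz] iso \<rho>(1) by (simp add: \<psi>0 bz) (simp add: \<psi>_def)
  have inj: "inj_on \<psi> ?B"
  proof (rule inj_onI)
    fix z z' assume z: "z \<in> ?B" "z' \<in> ?B" "\<psi> z = \<psi> z'"
    have "nm n (\<lambda>i. z i - z' i) = 0" using iso[OF z(1,2)] z(3) by simp
    then show "z = z'" using z(1,2) by (intro affine_eqI[of _ n] subsetD[OF bx_subset_affine]) (auto simp: nm_eq_0_iff)
  qed
  define h where "h = inv_into ?B \<psi>"
  have h: "h z \<in> ?B" "\<psi> (h z) = z" if "z \<in> ?B" for z
    using that inv_into_into[of z \<psi> ?B] f_inv_into_f[of z \<psi> ?B] unfolding h_def img by auto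
  define f where "f z = x + X.L b (h z)" for z
  have "X.isometric b ?B f"
    unfolding X.isometric_def
  proof (intro conjI ballI)
    fix z z' assume z: "z \<in> ?B" "z' \<in> ?B"
    have "f z - f z' = X.L b (\<lambda>i. h z i - h z' i)" by (simp add: f_def X.lin_diff)
    then have "nm n (X.co n b (f z - f z')) = nm n (\<lambda>i. h z i - h z' i)" by (simp only: coL)
    also have "\<dots> = nm n (\<lambda>i. z i - z' i)" using iso[OF h(1)[OF z(1)] h(1)[OF z(2)]] h(2)[OF z(1)] h(2)[OF z(2)] by simp
    finally show "nm n (X.co n b (f z - f z')) = nm n (\<lambda>i. z i - z' i)" .
  qed simp
  moreover have "f ?z = x"
  proof -
    have "?z \<in> ?B" using \<rho>(1) by (simp add: bx_iff)
    then have "h ?z = ?z" using inv_into_f_f[OF inj, of ?z] \<psi>0 by (simp add: h_def)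
    then show ?thesis by (simp add: f_def)
  qed
  moreover have "\<tau> (f z) = \<tau> x + Y.L y (\<lambda>j. z (n - m + j)) \<and> (\<forall>i<n - m. X.co n b (f z - x) i = z i)" if z: "z \<in> ?B" for z
  proof
    have "z (n - m + j) = Y.co m y (\<tau> (f z) - \<tau> x) j" if "j < m" for j
      using h(2)[OF z] emb_nth2[OF mn that, of "h z" "Y.co m y (\<tau> (f z) - \<tau> x)"] by (simp add: \<psi>_def f_def)
    then have "Y.L y (\<lambda>j. z (n - m + j)) = Y.L y (Y.co m y (\<tau> (f z) - \<tau> x))" by (intro lin_cong) auto
    also have "\<dots> = \<tau> (f z) - \<tau> x" by (rule Y.L_co[OF y dW])
    finally show "\<tau> (f z) = \<tau> x + Y.L y (\<lambda>j. z (n - m + j))" by simp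
    show "\<forall>i<n - m. X.co n b (f z - x) i = z i"
    proof (intro allI impI)
      fix i assume i: "i < n - m"
      have "X.co n b (f z - x) i = h z i" using X.co_lin_nth[OF X.is_basis_indep[OF b], of i "h z"] i by (simp add: f_def)
      also have "\<dots> = \<psi> (h z) i" using i by (simp add: \<psi>_def emb_nth1)
      finally show "X.co n b (f z - x) i = z i" using h(2)[OF z] by simp
    qed
  qed
  ultimately show ?thesis using \<rho>(1) by blast
qed

end


section \<open>Volumes of tubes around a fibre\<close>

locale quad_fibre = quad s n s' W' m B
  for s :: "'f::nonarch_local_field \<Rightarrow> 'x::{topological_ab_group_add,t2_space} \<Rightarrow> 'x" and n :: nat
    and s' :: "'f \<Rightarrow> 'y::{topological_ab_group_add,t2_space} \<Rightarrow> 'y" and W' :: "'y set" and m :: nat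
    and B :: "'x \<Rightarrow> 'x \<Rightarrow> 'y" +
  fixes T :: 'y and \<omega>X :: "(nat \<Rightarrow> 'x) \<Rightarrow> 'f" and \<omega>Y :: "(nat \<Rightarrow> 'y) \<Rightarrow> 'f"
  assumes T_in: "T \<in> W'"
    and regular: "\<And>x y. \<tau> x = T \<Longrightarrow> y \<in> W' \<Longrightarrow> \<exists>v. d\<tau> x v = y"
    and \<omega>X: "X.top_form \<omega>X" and \<omega>Y: "Y.top_form \<omega>Y"
begin

abbreviation XT :: "'x set" where "XT \<equiv> {x. \<tau> x = T}"
abbreviation \<mu>X :: "'x measure" where "\<mu>X \<equiv> X.vol \<omega>X"
abbreviation \<mu>Y :: "'y measure" where "\<mu>Y \<equiv> Y.vol \<omega>Y"

text \<open>The sets \<open>U\<close> range over all compact open subsets of a neighbourhood of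
  \<open>T\<close>, not only over those containing \<open>T\<close>; this makes the constant usable
  at neighbouring points. Nonnegativity lets \<open>c\<close> be recovered from
  \<open>ennreal c\<close>.\<close>

definition tube_density :: "'x set \<Rightarrow> real \<Rightarrow> bool" where
  "tube_density A c \<longleftrightarrow> 0 \<le> c \<and> (\<exists>V. openin (top_of_set W') V \<and> T \<in> V \<and>
    (\<forall>U. U \<subseteq> V \<and> compact U \<and> openin (top_of_set W') U \<longrightarrow>
      emeasure \<mu>X (A \<inter> \<tau> -` U) = ennreal c * emeasure \<mu>Y U))"

lemma tube_densityE:
  assumes "tube_density A c"
  obtains V where "0 \<le> c" "openin (top_of_set W') V" "T \<in> V"
    "\<And>U. U \<subseteq> V \<Longrightarrow> compact U \<Longrightarrow> openin (top_of_set W') U \<Longrightarrow> emeasure \<mu>X (A \<inter> \<tau> -` U) = ennreal c * emeasure \<mu>Y U"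
  using assms unfolding tube_density_def by blast

lemma tube_densityI:
  assumes "0 \<le> c" "openin (top_of_set W') V" "T \<in> V"
    and "\<And>U. U \<subseteq> V \<Longrightarrow> compact U \<Longrightarrow> openin (top_of_set W') U \<Longrightarrow> emeasure \<mu>X (A \<inter> \<tau> -` U) = ennreal c * emeasure \<mu>Y U"
  shows "tube_density A c"
  unfolding tube_density_def using assms by (intro conjI exI[of _ V]) auto

lemma \<tau>_preimage_sets: "openin (top_of_set W') U \<Longrightarrow> \<tau> -` U \<in> sets \<mu>X"
proof -
  assume "openin (top_of_set W') U"
  then obtain O' where "open O'" "U = W' \<inter> O'" by (auto simp: openin_open)
  then have "\<tau> -` U = \<tau> -` O'" using \<tau>_in by auto
  moreover have "open (\<tau> -` O')" using open_vimage[OF \<open>open O'\<close> continuous_\<tau>] .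
  ultimately show ?thesis by simp
qed

lemma vol_Y_lball_pos:
  assumes "Y.is_basis y" "w \<in> W'" "t > 0"
  shows "\<exists>q>0. emeasure \<mu>Y (Y.lball y w t) = ennreal q"
proof -
  have "modulus (\<omega>Y y) * ball_volume TYPE('f) t ^ m > 0"
    using modulus_pos[OF Y.top_form_nonzero[OF \<omega>Y assms(1)]] ball_volume_pos[OF assms(3), where 'f='f] by simp
  then show ?thesis using Y.vol_lball[OF \<omega>Y assms] by blast
qed

lemma tube_density_unique: "tube_density A c \<Longrightarrow> tube_density A c' \<Longrightarrow> c = c'"
proof -
  assume c: "tube_density A c" and c': "tube_density A c'"
  obtain V where V: "0 \<le> c" "openin (top_of_set W') V" "T \<in> V"
      "\<And>U. U \<subseteq> V \<Longrightarrow> compact U \<Longrightarrow> openin (top_of_set W') U \<Longrightarrow> emeasure \<mu>X (A \<inter> \<tau> -` U) = ennreal c * emeasure \<mu>Y U"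
    using tube_densityE[OF c] by blast
  obtain V' where V': "0 \<le> c'" "openin (top_of_set W') V'" "T \<in> V'"
      "\<And>U. U \<subseteq> V' \<Longrightarrow> compact U \<Longrightarrow> openin (top_of_set W') U \<Longrightarrow> emeasure \<mu>X (A \<inter> \<tau> -` U) = ennreal c' * emeasure \<mu>Y U"
    using tube_densityE[OF c'] by blast
  obtain y where y: "Y.is_basis y" using Y.is_basis_exists by blast
  have "openin (top_of_set W') (V \<inter> V')" "T \<in> V \<inter> V'" using V V' by auto
  from Y.openin_contains_lball[OF y this] obtain t where t: "t > 0" "Y.lball y T t \<subseteq> V \<inter> V'" by blast
  let ?U = "Y.lball y T t"
  obtain q where q: "q > 0" "emeasure \<mu>Y ?U = ennreal q" using vol_Y_lball_pos[OF y T_in t(1)] by blast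
  have "ennreal c * ennreal q = ennreal c' * ennreal q"
    using V(4)[of ?U] V'(4)[of ?U] t(2) Y.compact_lball Y.openin_lball[OF y T_in t(1)] q(2) by simp
  then have "c * q = c' * q" using V(1) V'(1) q(1) by (simp flip: ennreal_mult)
  then show ?thesis using q(1) by simp
qed

lemma tube_density_union:
  assumes "tube_density A c" "tube_density A' c'" "A \<inter> A' = {}" "A \<in> sets \<mu>X" "A' \<in> sets \<mu>X"
  shows "tube_density (A \<union> A') (c + c')"
proof -
  obtain V where V: "0 \<le> c" "openin (top_of_set W') V" "T \<in> V"
      "\<And>U. U \<subseteq> V \<Longrightarrow> compact U \<Longrightarrow> openin (top_of_set W') U \<Longrightarrow> emeasure \<mu>X (A \<inter> \<tau> -` U) = ennreal c * emeasure \<mu>Y U"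
    using tube_densityE[OF assms(1)] by blast
  obtain V' where V': "0 \<le> c'" "openin (top_of_set W') V'" "T \<in> V'"
      "\<And>U. U \<subseteq> V' \<Longrightarrow> compact U \<Longrightarrow> openin (top_of_set W') U \<Longrightarrow> emeasure \<mu>X (A' \<inter> \<tau> -` U) = ennreal c' * emeasure \<mu>Y U"
    using tube_densityE[OF assms(2)] by blast
  have "emeasure \<mu>X ((A \<union> A') \<inter> \<tau> -` U) = ennreal (c + c') * emeasure \<mu>Y U"
    if U: "U \<subseteq> V \<inter> V'" "compact U" "openin (top_of_set W') U" for U
  proof -
    have "emeasure \<mu>X ((A \<inter> \<tau> -` U) \<union> (A' \<inter> \<tau> -` U)) = emeasure \<mu>X (A \<inter> \<tau> -` U) + emeasure \<mu>X (A' \<inter> \<tau> -` U)"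
      by (rule plus_emeasure[symmetric]) (use assms \<tau>_preimage_sets[OF U(3)] in \<open>auto intro!: sets.Int\<close>)
    also have "\<dots> = ennreal c * emeasure \<mu>Y U + ennreal c' * emeasure \<mu>Y U"
      using V(4)[OF _ U(2,3)] V'(4)[OF _ U(2,3)] U(1) by simp
    finally show ?thesis using V(1) V'(1) by (simp add: Int_Un_distrib2 ennreal_plus distrib_right)
  qed
  moreover have "openin (top_of_set W') (V \<inter> V')" "T \<in> V \<inter> V'" using V V' by auto
  ultimately show ?thesis using V(1) V'(1) by (intro tube_densityI[of _ "V \<inter> V'"]) auto
qed

text \<open>The compact image of \<open>A\<close> misses \<open>T\<close>, so tubes over a small
  enough neighbourhood do not meet \<open>A\<close>.\<close>

lemma tube_density_off:
  assumes A: "compact A" "A \<inter> XT = {}"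
  shows "tube_density A 0"
proof -
  have "compact (\<tau> ` A)" by (rule compact_continuous_image[OF continuous_\<tau> A(1)])
  then have "open (- (\<tau> ` A))" by (simp add: compact_imp_closed open_Compl)
  then have "openin (top_of_set W') (W' \<inter> - (\<tau> ` A))" by (rule openin_open_Int)
  moreover have "T \<in> W' \<inter> - (\<tau> ` A)" using T_in A(2) by auto
  moreover have "emeasure \<mu>X (A \<inter> \<tau> -` U) = ennreal 0 * emeasure \<mu>Y U" if "U \<subseteq> W' \<inter> - (\<tau> ` A)" for U
  proof -
    have "A \<inter> \<tau> -` U = {}" using that by auto
    then show ?thesis by simp
  qed
  ultimately show ?thesis by (intro tube_densityI[of _ "W' \<inter> - (\<tau> ` A)"]) auto
qed

text \<open>The condition passes to compact open subsets, so a finite cover by such sets can be made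
  disjoint.\<close>

definition good :: "'x set \<Rightarrow> bool" where
  "good P \<longleftrightarrow> compact P \<and> open P \<and> (\<forall>A. compact A \<and> open A \<and> A \<subseteq> P \<longrightarrow> (\<exists>c. tube_density A c))"

text \<open>In the coordinates of \<open>f\<close>, \<open>\<tau>\<close> is the projection to the
  last \<open>m\<close> coordinates. A compact open set is there a union of boxes of some radius
  \<open>\<delta>\<close>, so its slices over all points within \<open>\<delta>\<close> of
  \<open>T\<close> coincide. The density is the volume of this slice times the ratio of the
  normalisations of the two forms.\<close>

lemma good_straightened:
  assumes ad: "adapted x b y" and \<rho>: "\<rho> > 0" and x: "\<tau> x = T"
    and f: "X.isometric b (bx n (\<lambda>_. 0) \<rho>) f"
    and f\<tau>: "\<And>z. z \<in> bx n (\<lambda>_. 0) \<rho> \<Longrightarrow> \<tau> (f z) = T + Y.L y (\<lambda>j. z (n - m + j))"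
  shows "good (f ` bx n (\<lambda>_. 0) \<rho>)"
proof -
  have mn: "m \<le> n" and b: "X.is_basis b" and y: "Y.is_basis y" using ad by (auto simp: adapted_def)
  let ?B = "bx n (\<lambda>_. 0 :: 'f) \<rho>"
  let ?z = "restrict (\<lambda>_. 0) {..<n} :: nat \<Rightarrow> 'f"
  have bz: "bx n ?z r = bx n (\<lambda>_. 0) r" for r by (rule bx_cong) simp
  have za: "?z \<in> affine_space n" by simp
  note fz = f[folded bz]
  have img: "f ` ?B = X.lball b (f ?z) \<rho>" using X.isometric_image_bx[OF b fz za \<rho>] by (simp add: bz)
  have meas: "f ` D \<in> sets \<mu>X" "emeasure \<mu>X (f ` D) = ennreal (modulus (\<omega>X b)) * emeasure (pm n) D"
    if "D \<in> sets (pm n)" "D \<subseteq> ?B" for D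
    using X.isometric_measure[OF \<omega>X b fz za \<rho> that(1)] that(2) by (simp_all add: bz)
  obtain g where g: "homeomorphism ?B (f ` ?B) f g" using X.isometric_homeomorphism[OF b fz za \<rho>] by (auto simp: bz)
  have "\<exists>c. tube_density A c" if A: "compact A" "open A" "A \<subseteq> f ` ?B" for A
  proof -
    define A' where "A' = g ` A"
    have gf: "\<And>z. z \<in> ?B \<Longrightarrow> g (f z) = z" and fg: "\<And>p. p \<in> f ` ?B \<Longrightarrow> f (g p) = p"
      using homeomorphism_apply1[OF g] homeomorphism_apply2[OF g] by auto
    have A'B: "A' \<subseteq> ?B" using image_mono[OF A(3), of g] gf unfolding A'_def by (simp add: image_image)
    have "f ` A' = (\<lambda>p. p) ` A" unfolding A'_def image_image by (rule image_cong[OF refl]) (use fg A(3) in blast)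
    then have fA': "f ` A' = A" by simp
    have cA': "compact A'" unfolding A'_def
      by (rule compact_continuous_image[OF _ A(1)]) (use g A(3) in \<open>auto simp: homeomorphism_def intro: continuous_on_subset\<close>)
    have fc: "continuous_on ?B f" using g by (simp add: homeomorphism_def)
    have "A' = ?B \<inter> f -` A"
    proof (intro set_eqI iffI)
      fix z assume "z \<in> ?B \<inter> f -` A"
      then have z: "z \<in> ?B" "f z \<in> A" by auto
      have "g (f z) \<in> A'" unfolding A'_def using z(2) by (rule imageI)
      then show "z \<in> A'" using gf[OF z(1)] by simp
    qed (use A'B fA' in auto)
    then have "openin (top_of_set ?B) A'" using continuous_openin_preimage_gen[OF fc A(2)] by simp
    then have oA': "openin (top_of_set (affine_space n)) A'" using openin_trans openin_bx[OF \<rho>] by blast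
    obtain \<delta> where \<delta>: "\<delta> > 0" "\<delta> \<le> \<rho>" "\<And>z. z \<in> A' \<Longrightarrow> bx n z \<delta> \<subseteq> A'"
      using compact_openin_uniform_bx[OF cA' oA' \<rho>] by blast
    let ?r = "n - m"
    let ?e = "\<lambda>u. emb u (\<lambda>_. 0 :: 'f)"
    \<comment> \<open>The slice of \<open>A'\<close> over \<open>T\<close>; by the choice of
      \<open>\<delta>\<close> it is also the slice over every nearby point.\<close>
    define A'' where "A'' = {u \<in> affine_space ?r. ?e u \<in> A'}"
    have A''B: "A'' \<subseteq> bx ?r (\<lambda>_. 0) \<rho>"
    proof
      fix u assume u: "u \<in> A''"
      then have "?e u \<in> ?B" using A'B by (auto simp: A''_def)
      then have "dist 0 (u i) \<le> \<rho>" if "i < ?r" for i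
        using that emb_nth1[OF that, of u "\<lambda>_. 0"] by (auto simp: bx_iff) (metis diff_le_self less_le_trans)
      then show "u \<in> bx ?r (\<lambda>_. 0) \<rho>" using u by (simp add: bx_iff A''_def)
    qed
    have "compact A''"
    proof -
      have "continuous_on UNIV ?e"
      proof (rule continuous_on_coordinatewise_then_product)
        fix i
        show "continuous_on UNIV (\<lambda>u. ?e u i)"
          by (cases "i < n"; cases "i < ?r") (simp_all add: emb_def)
      qed
      then have "closed (?e -` A')" by (intro closed_vimage compact_imp_closed[OF cA'])
      then have "compact (bx ?r (\<lambda>_. 0) \<rho> \<inter> ?e -` A')" by (rule compact_Int_closed[OF compact_bx])
      moreover have "bx ?r (\<lambda>_. 0) \<rho> \<inter> ?e -` A' = A''"
        using A''B by (auto simp: A''_def dest: subsetD[OF bx_subset_affine])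
      ultimately show ?thesis by simp
    qed
    have A''t: "bx ?r u t \<subseteq> A''" if u: "u \<in> A''" and t: "t \<le> \<delta>" "0 < t" for u t
    proof
      fix v assume v: "v \<in> bx ?r u t"
      have "?e v \<in> bx n (?e u) t"
      proof (subst bx_emb_iff[OF mn emb_affine], intro conjI)
        have "restrict (?e v) {..<?r} = v"
          by (rule affine_eqI[of _ ?r]) (use v bx_subset_affine in \<open>auto simp: emb_nth1\<close>)
        then show "restrict (?e v) {..<?r} \<in> bx ?r u t" using v by simp
        show "restrict (\<lambda>j. ?e v (?r + j)) {..<m} \<in> bx m (\<lambda>_. 0) t"
          unfolding bx_iff
        proof (intro conjI allI impI restrict_affine)
          fix j assume j: "j < m"
          have "?e v (?r + j) = 0" by (rule emb_nth2[OF mn j])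
          then show "dist 0 (restrict (\<lambda>j. ?e v (?r + j)) {..<m} j) \<le> t" using j t(2) by (simp only: restrict_apply lessThan_iff if_True) simp
        qed
      qed
      also have "\<dots> \<subseteq> bx n (?e u) \<delta>" by (rule bx_mono[OF t(1)])
      also have "\<dots> \<subseteq> A'" using u \<delta>(3) by (simp add: A''_def)
      finally show "v \<in> A''" using subsetD[OF bx_subset_affine v] by (simp add: A''_def)
    qed
    have A''s: "A'' \<subseteq> affine_space ?r" by (auto simp: A''_def)
    define k where "k = measure (pm ?r) A''"
    define c where "c = modulus (\<omega>X b) / modulus (\<omega>Y y) * k"
    note mX = modulus_pos[OF X.top_form_nonzero[OF \<omega>X b]]
    note mY = modulus_pos[OF Y.top_form_nonzero[OF \<omega>Y y]]
    have k0: "k \<ge> 0" by (simp add: k_def)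
    have ball: "\<exists>S\<in>sets \<mu>X. S = A \<inter> \<tau> -` Y.lball y w t \<and> emeasure \<mu>X S = ennreal c * emeasure \<mu>Y (Y.lball y w t)"
      if w: "w \<in> Y.lball y T \<delta>" and t: "0 < t" "t \<le> \<delta>" for w t
    proof -
      have wW: "w \<in> W'" using w Y.lball_subset[OF y T_in] by blast
      define w' where "w' = Y.co m y (w - T)"
      have wT: "w - T \<in> W'" using wW T_in Y.subspace_diff[OF Y.subspace_W] by blast
      have w'a: "w' \<in> affine_space m" unfolding w'_def by (rule Y.co_affine[OF y wT])
      have w'\<delta>: "nm m w' \<le> \<delta>" using w \<delta>(1) T_in by (simp add: Y.lball_eq[OF y] w'_def)
      have wL: "w = T + Y.L y w'" using Y.L_co[OF y wT] by (simp add: w'_def)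
      obtain Z where Z: "finite Z" "Z \<subseteq> A''" "A'' = (\<Union>z\<in>Z. bx ?r z t)" "disjoint_family_on (\<lambda>z. bx ?r z t) Z"
        using bx_partition[OF \<open>compact A''\<close> A''s t(1) A''t[OF _ t(2,1)]] by blast
      let ?v = "ball_volume TYPE('f) t"
      have v: "?v > 0" by (rule ball_volume_pos[OF t(1)])
      have "emeasure (pm ?r) A'' = (\<Sum>z\<in>Z. emeasure (pm ?r) (bx ?r z t))"
        by (subst Z(3)) (rule emeasure_bx_partition[OF refl Z(1,4)])
      also have "\<dots> = of_nat (card Z) * ennreal (?v ^ ?r)" by (simp add: emeasure_pm_bx[OF t(1)])
      also have "\<dots> = ennreal (real (card Z) * ?v ^ ?r)" using v by (simp add: ennreal_mult ennreal_of_nat_eq_real_of_nat)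
      finally have k: "k = real (card Z) * ?v ^ ?r" using v by (simp add: k_def measure_def)
      let ?E = "\<lambda>z. bx n (emb z w') t"
      let ?D = "\<Union>z\<in>Z. ?E z"
      have dE: "disjoint_family_on ?E Z"
        unfolding disjoint_family_on_def
      proof (intro ballI impI)
        fix u v assume uv: "u \<in> Z" "v \<in> Z" "u \<noteq> v"
        then have "bx ?r u t \<inter> bx ?r v t = {}" using Z(4) unfolding disjoint_family_on_def by blast
        then show "?E u \<inter> ?E v = {}" using bx_emb_iff[OF mn] bx_subset_affine by blast
      qed
      \<comment> \<open>Over the ball of radius \<open>t\<close> around \<open>w\<close>, the set
        \<open>A'\<close> is the product of its slice with that ball. Both directions compare
        \<open>z\<close> with the point having last coordinates 0: the two lie in a common box of
        radius \<open>\<delta>\<close>, so one is in \<open>A'\<close> if and only if the other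
        is.\<close>
      have D: "z \<in> ?D \<longleftrightarrow> z \<in> A' \<and> restrict (\<lambda>j. z (?r + j)) {..<m} \<in> bx m w' t" for z
      proof
        assume "z \<in> ?D"
        then obtain u where u: "u \<in> Z" "z \<in> ?E u" by blast
        have za: "z \<in> affine_space n" using u(2) bx_subset_affine by blast
        have z1: "restrict z {..<?r} \<in> bx ?r u t" and z2: "restrict (\<lambda>j. z (?r + j)) {..<m} \<in> bx m w' t"
          using u(2) bx_emb_iff[OF mn za] by auto
        have "restrict z {..<?r} \<in> A''" using z1 u(1) Z(3) by blast
        then have eA: "?e (restrict z {..<?r}) \<in> A'" by (simp add: A''_def)
        have "z \<in> bx n (?e (restrict z {..<?r})) \<delta>"
        proof (subst bx_emb_iff[OF mn za], intro conjI)
          show "restrict z {..<?r} \<in> bx ?r (restrict z {..<?r}) \<delta>" using \<delta>(1) by (intro bx_center) auto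
          have "w' \<in> bx m (\<lambda>_. 0) \<delta>" using w'a w'\<delta> \<delta>(1) by (simp add: bx_iff_nm)
          from bx_subset[OF this t(2)] show "restrict (\<lambda>j. z (?r + j)) {..<m} \<in> bx m (\<lambda>_. 0) \<delta>" using z2 by blast
        qed
        then show "z \<in> A' \<and> restrict (\<lambda>j. z (?r + j)) {..<m} \<in> bx m w' t" using \<delta>(3)[OF eA] z2 by blast
      next
        assume z: "z \<in> A' \<and> restrict (\<lambda>j. z (?r + j)) {..<m} \<in> bx m w' t"
        then have za: "z \<in> affine_space n" using A'B bx_subset_affine by blast
        have "?e (restrict z {..<?r}) \<in> bx n z \<delta>"
        proof -
          have "w' \<in> bx m (\<lambda>_. 0) \<delta>" using w'a w'\<delta> \<delta>(1) by (simp add: bx_iff_nm)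
          from bx_subset[OF this t(2)] have "restrict (\<lambda>j. z (?r + j)) {..<m} \<in> bx m (\<lambda>_. 0) \<delta>" using z by blast
          moreover have "restrict z {..<?r} \<in> bx ?r (restrict z {..<?r}) \<delta>" using \<delta>(1) by (intro bx_center) auto
          ultimately have "z \<in> bx n (?e (restrict z {..<?r})) \<delta>" using bx_emb_iff[OF mn za] by blast
          from bx_eq[OF this] have "bx n z \<delta> = bx n (?e (restrict z {..<?r})) \<delta>" .
          then show ?thesis using bx_center[OF emb_affine, of \<delta> "restrict z {..<?r}" "\<lambda>_. 0"] \<delta>(1) by simp
        qed
        then have "?e (restrict z {..<?r}) \<in> A'" using \<delta>(3) z by blast
        then have "restrict z {..<?r} \<in> A''" by (simp add: A''_def)
        then obtain u where "u \<in> Z" "restrict z {..<?r} \<in> bx ?r u t" using Z(3) by blast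
        then show "z \<in> ?D" using bx_emb_iff[OF mn za] z by blast
      qed
      have DB: "?D \<subseteq> ?B" using D A'B by blast
      have Ds: "?D \<in> sets (pm n)" by (intro sets.finite_UN Z(1) bx_in_sets_pm)
      have "emeasure (pm n) ?D = (\<Sum>z\<in>Z. emeasure (pm n) (?E z))"
        by (rule sum_emeasure[symmetric]) (use dE Z(1) bx_in_sets_pm in auto)
      also have "\<dots> = of_nat (card Z) * ennreal (?v ^ n)" by (simp add: emeasure_pm_bx[OF t(1)])
      also have "\<dots> = ennreal (real (card Z) * ?v ^ n)" using v by (simp add: ennreal_mult ennreal_of_nat_eq_real_of_nat)
      also have "real (card Z) * ?v ^ n = k * ?v ^ m" using mn by (simp add: k power_add[symmetric])
      finally have pD: "emeasure (pm n) ?D = ennreal (k * ?v ^ m)" .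
      have fD: "f ` ?D = A \<inter> \<tau> -` Y.lball y w t"
      proof -
        have "f z \<in> \<tau> -` Y.lball y w t \<longleftrightarrow> z \<in> ?D" if z: "z \<in> A'" for z
        proof -
          have zB: "z \<in> ?B" using z A'B by blast
          let ?z2 = "\<lambda>j. z (?r + j)"
          have "\<tau> (f z) - w = Y.L y (\<lambda>j. ?z2 j - w' j)" unfolding f\<tau>[OF zB] wL by (simp add: Y.lin_diff)
          then have "nm m (Y.co m y (\<tau> (f z) - w)) = nm m (\<lambda>j. ?z2 j - w' j)"
            using Y.co_lin_nth[OF Y.is_basis_indep[OF y]] by (intro nm_cong) simp
          also have "\<dots> = nm m (\<lambda>j. restrict ?z2 {..<m} j - w' j)" by (rule nm_cong) simp
          finally have "f z \<in> \<tau> -` Y.lball y w t \<longleftrightarrow> nm m (\<lambda>j. restrict ?z2 {..<m} j - w' j) \<le> t"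
            using Y.lball_eq[OF y wW, of t] t(1) \<tau>_in by simp
          also have "\<dots> \<longleftrightarrow> restrict ?z2 {..<m} \<in> bx m w' t" using t(1) by (simp add: bx_iff_nm)
          finally show ?thesis using D z by blast
        qed
        moreover have "?D \<subseteq> A'" using D by blast
        ultimately show ?thesis unfolding fA'[symmetric] by blast
      qed
      have "emeasure \<mu>X (f ` ?D) = ennreal (modulus (\<omega>X b)) * ennreal (k * ?v ^ m)" using meas(2)[OF Ds DB] pD by simp
      also have "\<dots> = ennreal (modulus (\<omega>X b) * (k * ?v ^ m))" using mX k0 v by (simp add: ennreal_mult)
      also have "modulus (\<omega>X b) * (k * ?v ^ m) = c * (modulus (\<omega>Y y) * ?v ^ m)" using mY by (simp add: c_def)
      also have "ennreal \<dots> = ennreal c * emeasure \<mu>Y (Y.lball y w t)"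
        unfolding Y.vol_lball[OF \<omega>Y y wW t(1)] using mX mY k0 v by (intro ennreal_mult) (auto simp: c_def)
      finally show ?thesis using fD meas(1)[OF Ds DB] by metis
    qed
    have "emeasure \<mu>X (A \<inter> \<tau> -` U) = ennreal c * emeasure \<mu>Y U"
      if U: "U \<subseteq> Y.lball y T \<delta>" "compact U" "openin (top_of_set W') U" for U
    proof -
      obtain t Z where t: "0 < t" "t \<le> \<delta>" and Z: "finite Z" "Z \<subseteq> U" "U = (\<Union>z\<in>Z. Y.lball y z t)"
        "disjoint_family_on (\<lambda>z. Y.lball y z t) Z"
        using Y.lball_partition[OF y U(2,3) \<delta>(1)] by blast
      have zb: "z \<in> Y.lball y T \<delta>" if "z \<in> Z" for z using that Z(2) U(1) by blast
      let ?S = "\<lambda>z. A \<inter> \<tau> -` Y.lball y z t"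
      have S: "?S z \<in> sets \<mu>X" "emeasure \<mu>X (?S z) = ennreal c * emeasure \<mu>Y (Y.lball y z t)" if "z \<in> Z" for z
        using ball[OF zb[OF that] t] by auto
      have "A \<inter> \<tau> -` U = (\<Union>z\<in>Z. ?S z)" by (subst Z(3)) auto
      then have "emeasure \<mu>X (A \<inter> \<tau> -` U) = emeasure \<mu>X (\<Union>z\<in>Z. ?S z)" by simp
      also have "\<dots> = (\<Sum>z\<in>Z. emeasure \<mu>X (?S z))"
      proof (rule sum_emeasure[symmetric])
        show "disjoint_family_on ?S Z" using Z(4) unfolding disjoint_family_on_def by blast
      qed (use S(1) Z(1) in auto)
      also have "\<dots> = (\<Sum>z\<in>Z. ennreal c * emeasure \<mu>Y (Y.lball y z t))" using S(2) by (intro sum.cong) auto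
      also have "\<dots> = ennreal c * (\<Sum>z\<in>Z. emeasure \<mu>Y (Y.lball y z t))" by (simp add: sum_distrib_left)
      also have "(\<Sum>z\<in>Z. emeasure \<mu>Y (Y.lball y z t)) = emeasure \<mu>Y U"
      proof (subst Z(3), rule sum_emeasure)
        have "z \<in> W'" if "z \<in> Z" for z using zb[OF that] Y.lball_subset[OF y T_in] by blast
        then show "(\<lambda>z. Y.lball y z t) ` Z \<subseteq> sets \<mu>Y" using Y.lball_sets[OF y] by auto
      qed (use Z in auto)
      finally show ?thesis .
    qed
    moreover have "0 \<le> c" using mX mY k0 by (simp add: c_def)
    moreover have "T \<in> Y.lball y T \<delta>" using Y.lball_center[OF y T_in] \<delta>(1) by simp
    ultimately have "tube_density A c" using Y.openin_lball[OF y T_in \<delta>(1)] by (intro tube_densityI[of _ "Y.lball y T \<delta>"]) auto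
    then show ?thesis by blast
  qed
  moreover have "compact (f ` ?B)" unfolding img by (rule X.compact_lball)
  moreover have "open (f ` ?B)" unfolding img using X.openin_lball[OF b _ \<rho>, of "f ?z"] by simp
  ultimately show ?thesis unfolding good_def by blast
qed

lemma good_exists: "x \<in> XT \<Longrightarrow> \<exists>P. good P \<and> x \<in> P"
proof -
  assume x: "x \<in> XT"
  obtain b y where ad: "adapted x b y" using adapted_exists[of x] regular x by blast
  from straighten[OF ad] obtain \<rho> f where f: "\<rho> > 0" "X.isometric b (bx n (\<lambda>_. 0) \<rho>) f" "f (restrict (\<lambda>_. 0) {..<n}) = x"
    "\<And>z. z \<in> bx n (\<lambda>_. 0) \<rho> \<Longrightarrow> \<tau> (f z) = \<tau> x + Y.L y (\<lambda>j. z (n - m + j))" by blast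
  have "good (f ` bx n (\<lambda>_. 0) \<rho>)" using good_straightened[OF ad f(1) _ f(2)] x f(4) by simp
  moreover have "restrict (\<lambda>_. 0) {..<n} \<in> bx n (\<lambda>_. 0 :: 'f) \<rho>" using f(1) by (simp add: bx_iff)
  then have "x \<in> f ` bx n (\<lambda>_. 0) \<rho>" using f(3) by (metis imageI)
  ultimately show ?thesis by blast
qed

text \<open>Finitely many good sets cover the part of the fibre in \<open>A\<close>. Splitting them
  off one at a time leaves a set that misses the fibre and has density 0.\<close>

lemma tube_density_exists:
  assumes A: "compact A" "open A"
  shows "\<exists>c. tube_density A c"
proof -
  have main: "\<exists>c. tube_density A c" if "finite F" "\<And>P. P \<in> F \<Longrightarrow> good P" "compact A" "open A" "A \<inter> XT \<subseteq> \<Union>F" for F A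
    using that
  proof (induction F arbitrary: A rule: finite_induct)
    case empty
    then show ?case using tube_density_off[of A] by blast
  next
    case (insert P F)
    have P: "compact P" "open P" "closed P" using insert.prems(1)[of P] compact_imp_closed by (auto simp: good_def)
    have 1: "compact (A \<inter> P)" "open (A \<inter> P)" using insert.prems(2,3) P by (auto intro: compact_Int_closed)
    have 2: "compact (A - P)" "open (A - P)" using insert.prems(2,3) P by (auto intro: compact_diff open_Diff)
    obtain c where c: "tube_density (A \<inter> P) c" using insert.prems(1)[of P] 1 unfolding good_def by blast
    obtain d where d: "tube_density (A - P) d" using insert.IH[OF _ 2] insert.prems(1,4) by blast
    have "tube_density ((A \<inter> P) \<union> (A - P)) (c + d)"
      by (rule tube_density_union[OF c d]) (use 1 2 in auto)
    moreover have "(A \<inter> P) \<union> (A - P) = A" by blast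
    ultimately show ?case by auto
  qed
  have "closed XT" using continuous_closed_vimage[of "{T}" \<tau>] continuous_\<tau>[of UNIV]
    by (simp add: vimage_def continuous_on_eq_continuous_at)
  then have cA: "compact (A \<inter> XT)" by (rule compact_Int_closed[OF A(1)])
  obtain P where P: "\<And>x. x \<in> XT \<Longrightarrow> good (P x)" "\<And>x. x \<in> XT \<Longrightarrow> x \<in> P x" using good_exists by metis
  obtain C where C: "C \<subseteq> A \<inter> XT" "finite C" "A \<inter> XT \<subseteq> (\<Union>x\<in>C. P x)"
  proof (rule compactE_image[OF cA, of "A \<inter> XT" P])
    show "\<And>x. x \<in> A \<inter> XT \<Longrightarrow> open (P x)" using P(1) by (auto simp: good_def)
    show "A \<inter> XT \<subseteq> (\<Union>x\<in>A \<inter> XT. P x)" using P(2) by blast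
  qed
  show ?thesis by (rule main[of "P ` C", OF _ _ A]) (use C P(1) in auto)
qed

lemma closed_XT: "closed XT"
  using continuous_closed_vimage[of "{T}" \<tau>] continuous_\<tau>[of UNIV]
  by (simp add: vimage_def continuous_on_eq_continuous_at)

text \<open>The density of \<open>A\<close> depends only on \<open>A \<inter> XT\<close>, because
  the part of \<open>A\<close> outside another set with the same trace misses the fibre. So
  densities form an additive function on traces of compact open sets, which extends to a
  measure.\<close>

lemma fibre_measure_exists:
  "\<exists>M. sets M = sets (restrict_space borel XT) \<and> (\<forall>A c. compact A \<and> open A \<and> tube_density A c \<longrightarrow> emeasure M (A \<inter> XT) = ennreal c)"
proof -
  let ?C = "{A. compact A \<and> open A}"
  let ?K = "(\<lambda>A. A \<inter> XT) ` ?C"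
  have wd: "c = c'" if A: "compact A" "open A" "tube_density A c" "compact A'" "open A'" "tube_density A' c'" "A \<inter> XT = A' \<inter> XT" for A A' c c'
  proof -
    have key: "tube_density (A \<inter> A') c" if A: "compact A" "open A" "tube_density A c" "compact A'" "open A'" "A \<inter> XT = A' \<inter> XT" for A A' c
    proof -
      have 1: "compact (A \<inter> A')" "open (A \<inter> A')" using A by (auto intro: compact_Int)
      have 2: "compact (A - A')" "open (A - A')" using A by (auto intro: compact_diff open_Diff compact_imp_closed)
      obtain d where d: "tube_density (A \<inter> A') d" using tube_density_exists[OF 1] by blast
      have "tube_density (A - A') 0" by (rule tube_density_off[OF 2(1)]) (use A(6) in blast)
      then have "tube_density ((A \<inter> A') \<union> (A - A')) (d + 0)" by (intro tube_density_union[OF d]) (use 1 2 in auto)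
      moreover have "(A \<inter> A') \<union> (A - A') = A" by blast
      ultimately have "c = d" using tube_density_unique[OF A(3)] by simp
      then show ?thesis using d by simp
    qed
    have "tube_density (A \<inter> A') c" by (rule key[OF A(1-5,7)])
    moreover have "tube_density (A \<inter> A') c'" using key[OF A(4-6,1,2) A(7)[symmetric]] by (simp add: Int_commute)
    ultimately show ?thesis by (rule tube_density_unique)
  qed
  define f where "f K = ennreal (SOME c. \<exists>A. compact A \<and> open A \<and> tube_density A c \<and> K = A \<inter> XT)" for K
  have f: "f (A \<inter> XT) = ennreal c" if "compact A" "open A" "tube_density A c" for A c
  proof -
    have "\<exists>c' A'. compact A' \<and> open A' \<and> tube_density A' c' \<and> A \<inter> XT = A' \<inter> XT" using that by blast
    from someI_ex[OF this] obtain A' where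
      "compact A' \<and> open A' \<and> tube_density A' (SOME c. \<exists>A'. compact A' \<and> open A' \<and> tube_density A' c \<and> A \<inter> XT = A' \<inter> XT) \<and> A \<inter> XT = A' \<inter> XT" ..
    then have "(SOME c. \<exists>A'. compact A' \<and> open A' \<and> tube_density A' c \<and> A \<inter> XT = A' \<inter> XT) = c" using wd that by blast
    then show ?thesis by (simp add: f_def)
  qed
  have "\<exists>M. sets M = sets (restrict_space borel XT) \<and> (\<forall>K\<in>?K. emeasure M K = f K)"
  proof (rule compact_open_ring_extension)
    show "{} \<in> ?K" by (rule image_eqI[of _ _ "{}"]) auto
    fix K K' assume "K \<in> ?K" "K' \<in> ?K"
    then obtain A A' where A: "compact A" "open A" "K = A \<inter> XT" "compact A'" "open A'" "K' = A' \<inter> XT" by blast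
    show "K \<union> K' \<in> ?K" by (rule image_eqI[of _ _ "A \<union> A'"]) (use A in auto)
    have 2: "compact (A' - A)" "open (A' - A)" using A by (auto intro: compact_diff open_Diff compact_imp_closed)
    show "K - K' \<in> ?K"
      by (rule image_eqI[of _ _ "A - A'"]) (use A in \<open>auto intro: compact_diff open_Diff compact_imp_closed\<close>)
    assume dis: "K \<inter> K' = {}"
    obtain c d where c: "tube_density A c" and d: "tube_density (A' - A) d" using tube_density_exists A(1,2) 2 by meson
    have "tube_density (A \<union> (A' - A)) (c + d)" by (rule tube_density_union[OF c d]) (use A 2 in auto)
    moreover have "K \<union> K' = (A \<union> (A' - A)) \<inter> XT" using A by blast
    moreover have "K' = (A' - A) \<inter> XT" using A dis by blast
    moreover have "compact (A \<union> (A' - A))" "open (A \<union> (A' - A))" using A 2 by auto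
    ultimately have "f (K \<union> K') = ennreal (c + d)" "f K = ennreal c" "f K' = ennreal d"
      using f[of "A \<union> (A' - A)" "c + d"] f[OF A(1,2) c] f[OF 2 d] A(3) by auto
    then show "f (K \<union> K') = f K + f K'" using c d by (simp add: tube_density_def)
  next
    fix K assume "K \<in> ?K"
    then obtain A where A: "compact A" "open A" "K = A \<inter> XT" by blast
    show "compact K" unfolding A(3) by (rule compact_Int_closed[OF A(1) closed_XT])
    show "openin (top_of_set XT) K" unfolding A(3) using openin_open_Int[OF A(2), of XT] by (simp add: Int_commute)
  next
    have "tube_density {} 0" by (rule tube_density_off) auto
    then show "f {} = 0" using f[of "{}" 0] by simp
  next
    fix U assume "openin (top_of_set XT) U"
    then obtain O' where O': "open O'" "U = XT \<inter> O'" by (auto simp: openin_open)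
    obtain b where b: "X.is_basis b" using X.is_basis_exists by blast
    have "\<exists>r. r > 0 \<and> X.lball b x r \<subseteq> O'" if "x \<in> U" for x
      using X.openin_contains_lball[OF b, of O' x] O' that by auto
    then obtain r where r: "\<And>x. x \<in> U \<Longrightarrow> r x > 0" "\<And>x. x \<in> U \<Longrightarrow> X.lball b x (r x) \<subseteq> O'" by metis
    have l: "open (X.lball b x (r x))" if "x \<in> U" for x using X.openin_lball[OF b _ r(1)[OF that], of x] by simp
    let ?T = "\<lambda>x. X.lball b x (r x) \<inter> XT"
    have TU: "?T x \<subseteq> U" if "x \<in> U" for x using r(2)[OF that] O'(2) by blast
    have o: "openin (top_of_set U) (?T x)" if "x \<in> U" for x
    proof -
      have "?T x = U \<inter> X.lball b x (r x)" using TU[OF that] O'(2) by blast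
      then show ?thesis using openin_open_Int[OF l[OF that]] by simp
    qed
    have "x \<in> ?T x" if "x \<in> U" for x using X.lball_center[OF b, of x "r x"] r(1)[OF that] that O'(2) by auto
    from X.Lindelof_W[OF subset_UNIV o this] obtain C where C: "countable C" "C \<subseteq> U" "U = (\<Union>x\<in>C. ?T x)" by blast
    show "\<exists>D. countable D \<and> D \<subseteq> ?K \<and> U = \<Union>D"
    proof (intro exI conjI)
      show "?T ` C \<subseteq> ?K"
      proof (rule image_subsetI)
        fix x assume "x \<in> C"
        then have "X.lball b x (r x) \<in> ?C" using C(2) l X.compact_lball by auto
        then show "?T x \<in> ?K" by (rule imageI)
      qed
    qed (use C in auto)
  qed
  then obtain M where M: "sets M = sets (restrict_space borel XT) \<and> (\<forall>K\<in>?K. emeasure M K = f K)" ..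
  have "emeasure M (A \<inter> XT) = ennreal c" if A: "compact A" "open A" "tube_density A c" for A c
  proof -
    have "A \<in> ?C" using A by simp
    then have "A \<inter> XT \<in> ?K" by (rule imageI)
    then have "emeasure M (A \<inter> XT) = f (A \<inter> XT)" using M by (elim conjE) (rule bspec)
    then show ?thesis using f[OF A] by simp
  qed
  then show ?thesis using M by (intro exI[of _ M]) auto
qed

end


section \<open>The relative form\<close>

lemma prod_if_lessThan: "(\<Prod>i<r + m. if i < r then a else b) = a ^ r * (b :: 'a::comm_monoid_mult) ^ m"
  by (induction m) (simp_all add: ac_simps)

lemma nm_eventually:
  fixes h :: "'z::topological_space \<Rightarrow> nat \<Rightarrow> 'f::nonarch_local_field"
  assumes "continuous_on G h" "P \<in> G" "e > 0"
  shows "eventually (\<lambda>Q. nm k (\<lambda>i. h Q i - h P i) < e) (at P within G)"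
proof -
  have "eventually (\<lambda>Q. av (h Q i - h P i) < e) (at P within G)" for i
  proof -
    have "((\<lambda>Q. h Q i) \<longlongrightarrow> h P i) (at P within G)"
      using continuous_on_product_then_coordinatewise[OF assms(1), of i] assms(2) by (simp add: continuous_on_def)
    then have "eventually (\<lambda>Q. dist (h Q i) (h P i) < e) (at P within G)" using assms(3) by (rule tendstoD)
    then show ?thesis by (simp add: dist_eq_av[of "h _ i"] av_minus_commute)
  qed
  then have "eventually (\<lambda>Q. \<forall>i\<in>{..<k}. av (h Q i - h P i) < e) (at P within G)"
    by (intro eventually_ball_finite) auto
  then show ?thesis by (rule eventually_mono) (simp add: nm_less_iff[OF assms(3)])
qed

context quad
begin

lemma nm_emb_diff: "m \<le> n \<Longrightarrow> nm n (\<lambda>i. emb u w i - emb u' w' i) = max (nm (n - m) (\<lambda>i. u i - u' i)) (nm m (\<lambda>j. w j - w' j))"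
proof -
  assume mn: "m \<le> n"
  have "nm (n - m) (\<lambda>i. emb u w i - emb u' w' i) = nm (n - m) (\<lambda>i. u i - u' i)"
    by (rule nm_cong) (simp add: emb_nth1)
  moreover have "nm m (\<lambda>j. emb u w (n - m + j) - emb u' w' (n - m + j)) = nm m (\<lambda>j. w j - w' j)"
    by (rule nm_cong) (simp only: emb_nth2[OF mn])
  ultimately show ?thesis using nm_split[OF mn, of "\<lambda>i. emb u w i - emb u' w' i"] by simp
qed

lemma nm_emb: "m \<le> n \<Longrightarrow> nm n (emb u w) = max (nm (n - m) u) (nm m w)"
proof -
  assume mn: "m \<le> n"
  have "nm (n - m) (emb u w) = nm (n - m) u" by (rule nm_cong) (simp add: emb_nth1)
  moreover have "nm m (\<lambda>j. emb u w (n - m + j)) = nm m w" by (rule nm_cong) (simp only: emb_nth2[OF mn])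
  ultimately show ?thesis using nm_split[OF mn, of "emb u w"] by simp
qed

lemma continuous_emb: "continuous_on S (\<lambda>u. emb u (\<lambda>_. 0))"
proof (rule continuous_on_coordinatewise_then_product)
  fix i
  have "continuous_on S (\<lambda>u::nat \<Rightarrow> 'f. u i)"
    by (rule continuous_on_subset[OF continuous_on_product_coordinates]) simp
  then show "continuous_on S (\<lambda>u. emb u (\<lambda>_. 0) i)"
    by (cases "i < n"; cases "i < n - m") (simp_all add: emb_def)
qed

lemma \<tau>_scale: "\<tau> (s t v) = s' (t * t) (\<tau> v)"
  by (simp add: \<tau>_def B_scale_left B_scale_right)

end

context quad_fibre
begin

text \<open>\<open>relative_form\<close> in the abstract setting; the identification is made in
  \<open>fibre_density\<close>.\<close>

definition rel :: "'x \<Rightarrow> (nat \<Rightarrow> 'x) \<Rightarrow> 'f" where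
  "rel x v = (THE c. \<forall>w. \<omega>X (\<lambda>i. if i < n - m then v i else w (i - (n - m))) = c * \<omega>Y (\<lambda>i. d\<tau> x (w i)))"

text \<open>The factor in the definite description exists and is unique. Changing some
  \<open>w j\<close> by a kernel vector, which is a combination of \<open>D\<close>, does not affect
  \<open>\<omega>X\<close>; so the value depends on the images \<open>d\<tau> x (w j)\<close> alone,
  in an alternating way, and is proportional to \<open>\<omega>Y\<close>.\<close>

lemma rel_eq:
  assumes mn: "m \<le> n" and D: "X.indep (n - m) D" "\<And>i. i < n - m \<Longrightarrow> d\<tau> x (D i) = 0"
    and y: "Y.is_basis y" and N: "\<And>j. j < m \<Longrightarrow> d\<tau> x (N j) = y j"
  defines "b \<equiv> \<lambda>i. if i < n - m then D i else N (i - (n - m))"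
  shows "adapted x b y" and "rel x D = \<omega>X b / \<omega>Y y"
proof -
  let ?r = "n - m"
  have rm: "?r + m = n" using mn by simp
  have b: "X.is_basis b"
    unfolding X.is_basis_def b_def using adapted_indep[OF y D N] by (simp add: rm)
  show ad: "adapted x b y"
    unfolding adapted_def
  proof (intro conjI allI impI mn b y)
    fix j assume "j < m"
    moreover have "b (?r + j) = N j" unfolding b_def by (simp only: not_add_less1 if_False add_diff_cancel_left')
    ultimately show "d\<tau> x (b (?r + j)) = y j" using N by simp
  qed (simp add: b_def D(2))
  have altX: "alternating_form s UNIV n \<omega>X" using \<omega>X by (simp add: X.top_form_def)
  have altY: "alternating_form s' W' m \<omega>Y" using \<omega>Y by (simp add: Y.top_form_def)
  note aX = altX[unfolded alternating_form_def]
  have aX2: "\<omega>X (v(i := p + q)) = \<omega>X (v(i := p)) + \<omega>X (v(i := q))" if "i < n" for v i p q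
    using aX that by blast
  have aX3: "\<omega>X (v(i := s a p)) = a * \<omega>X (v(i := p))" if "i < n" for v i p a
    using aX that by blast
  have aX4: "\<omega>X v = 0" if "i < j" "j < n" "v i = v j" for v i j
    using aX that by blast
  \<comment> \<open>A linear section of the differential at \<open>x\<close>.\<close>
  define Nh where "Nh \<eta> = lin s m N (Y.co m y \<eta>)" for \<eta>
  have Nh_add: "Nh (p + q) = Nh p + Nh q" if "p \<in> W'" "q \<in> W'" for p q
    unfolding Nh_def X.lin_add[symmetric] using that by (intro lin_cong) (simp_all add: Y.co_add[OF y])
  have Nh_scale: "Nh (s' a p) = s a (Nh p)" if "p \<in> W'" for p a
    unfolding Nh_def X.lin_scale[symmetric] using that by (intro lin_cong) (simp_all add: Y.co_scale[OF y])
  have d\<tau>_Nh: "d\<tau> x (Nh \<eta>) = \<eta>" if "\<eta> \<in> W'" for \<eta>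
  proof -
    have "d\<tau> x (Nh \<eta>) = Y.L y (Y.co m y \<eta>)" unfolding Nh_def d\<tau>_lin using N by (intro lin_cong) auto
    then show ?thesis using Y.L_co[OF y that] by simp
  qed
  have Nhy: "Nh (y j) = N j" if "j < m" for j
  proof -
    have "Y.co m y (y j) i = (if i = j then 1 else 0)" if "i < m" for i
      using Y.co_lin_nth[OF Y.is_basis_indep[OF y] that, of "\<lambda>i. if i = j then 1 else 0"] Y.lin_unit[OF \<open>j < m\<close>, of y] by simp
    then have "Nh (y j) = lin s m N (\<lambda>i. if i = j then 1 else 0)"
      unfolding Nh_def by (intro lin_cong) auto
    then show ?thesis using X.lin_unit[OF that] by simp
  qed
  let ?t = "\<lambda>w i. if i < ?r then D i else w (i - ?r)"
  define \<omega>' where "\<omega>' \<eta> = \<omega>X (?t (\<lambda>j. Nh (\<eta> j)))" for \<eta>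
  have upd: "?t (\<lambda>j. Nh ((v(i := p)) j)) = (?t (\<lambda>j. Nh (v j)))(?r + i := Nh p)" for v i p
    by (rule ext) auto
  have alt': "alternating_form s' W' m \<omega>'"
    unfolding alternating_form_def
  proof (intro conjI allI impI ballI)
    fix v w :: "nat \<Rightarrow> 'y" assume "\<forall>i<m. v i = w i"
    then show "\<omega>' v = \<omega>' w" unfolding \<omega>'_def using rm by (intro X.form_cong[OF altX]) auto
  next
    fix v :: "nat \<Rightarrow> 'y" and i p q assume i: "(\<forall>j<m. v j \<in> W') \<and> i < m" and p: "p \<in> W'" "q \<in> W'"
    show "\<omega>' (v(i := p + q)) = \<omega>' (v(i := p)) + \<omega>' (v(i := q))"
      unfolding \<omega>'_def upd Nh_add[OF p] using i rm by (intro aX2) auto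
  next
    fix v :: "nat \<Rightarrow> 'y" and i a p assume i: "(\<forall>j<m. v j \<in> W') \<and> i < m" and p: "p \<in> W'"
    show "\<omega>' (v(i := s' a p)) = a * \<omega>' (v(i := p))"
      unfolding \<omega>'_def upd Nh_scale[OF p] using i rm by (intro aX3) auto
  next
    fix v :: "nat \<Rightarrow> 'y" and i j assume v: "(\<forall>l<m. v l \<in> W') \<and> i < j \<and> j < m \<and> v i = v j"
    show "\<omega>' v = 0" unfolding \<omega>'_def using v rm by (intro aX4[of "?r + i" "?r + j"]) auto
  qed
  have oy: "\<omega>Y y \<noteq> 0" by (rule Y.top_form_nonzero[OF \<omega>Y y])
  have \<omega>'y: "\<omega>' y = \<omega>X b" unfolding \<omega>'_def using Nhy rm by (intro X.form_cong[OF altX]) (auto simp: b_def)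
  let ?c = "\<omega>X b / \<omega>Y y"
  have main: "\<omega>X (?t w) = ?c * \<omega>Y (\<lambda>i. d\<tau> x (w i))" for w
  proof -
    \<comment> \<open>The first \<open>j\<close> transversal slots hold lifts of the images of their
      vectors; passing from \<open>j\<close> to \<open>j + 1\<close> alters one slot by a kernel
      vector.\<close>
    define t where "t j = ?t (\<lambda>i. if i < j then Nh (d\<tau> x (w i)) else w i)" for j
    have "\<omega>X (t j) = \<omega>X (?t w)" if "j \<le> m" for j
      using that
    proof (induction j)
      case (Suc j)
      then have j: "j < m" and jn: "?r + j < n" using rm by auto
      let ?q = "Nh (d\<tau> x (w j))" and ?p = "?r + j"
      define k where "k = w j - ?q"
      have "d\<tau> x k = 0" by (simp add: k_def d\<tau>_diff d\<tau>_Nh d\<tau>_in)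
      define c where "c = X.co n b k"
      have kc: "k = X.L b c" using X.L_co[OF b] by (simp add: c_def)
      then have "Y.L y (\<lambda>j. c (?r + j)) = 0" using \<open>d\<tau> x k = 0\<close> adapted_d\<tau>[OF ad, of c] by simp
      then have "\<forall>j<m. c (?r + j) = 0" using Y.is_basis_indep[OF y] unfolding Y.indep_def by blast
      then have c0: "c i = 0" if "\<not> i < ?r" "i < n" for i
        using that rm by (metis add_diff_inverse_nat nat_add_left_cancel_less)
      have kt: "k = X.L (t j) (\<lambda>i. if i < ?r then c i else 0)"
        unfolding kc lin_def using c0 by (intro sum.cong) (auto simp: t_def b_def)
      have tp: "t j = (t j)(?p := ?q + k)" by (rule ext) (auto simp: t_def k_def)
      have tS: "t (Suc j) = (t j)(?p := ?q)"
        by (rule ext) (auto simp: t_def less_Suc_eq)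
      have "\<omega>X (t j) = \<omega>X ((t j)(?p := ?q + k))" using tp by simp
      also have "\<dots> = \<omega>X ((t j)(?p := ?q)) + \<omega>X ((t j)(?p := k))" by (rule aX2[OF jn])
      also have "\<omega>X ((t j)(?p := k)) = 0"
        unfolding kt by (subst X.form_upd[OF altX _ jn]) auto
      finally show ?case using Suc.IH Suc.prems tS by simp
    next
      case 0
      have "t 0 = ?t w" by (rule ext) (simp add: t_def)
      then show ?case by simp
    qed
    from this[OF order_refl] have "\<omega>X (?t w) = \<omega>X (t m)" by simp
    also have "\<dots> = \<omega>' (\<lambda>i. d\<tau> x (w i))"
      unfolding \<omega>'_def t_def using rm by (intro X.form_cong[OF altX]) auto
    also have "\<dots> = ?c * \<omega>Y (\<lambda>i. d\<tau> x (w i))"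
      using Y.forms_proportional[OF altY alt' y oy, of "\<lambda>i. d\<tau> x (w i)"] d\<tau>_in \<omega>'y by simp
    finally show ?thesis .
  qed
  show "rel x D = ?c"
    unfolding rel_def
  proof (rule the_equality)
    show "\<forall>w. \<omega>X (?t w) = ?c * \<omega>Y (\<lambda>i. d\<tau> x (w i))" using main by blast
    \<comment> \<open>Evaluation at the lifts \<open>N\<close> determines \<open>c\<close>, since
      \<open>\<omega>Y\<close> does not vanish on a basis.\<close>
    fix c assume "\<forall>w. \<omega>X (?t w) = c * \<omega>Y (\<lambda>i. d\<tau> x (w i))"
    then have "c * \<omega>Y (\<lambda>i. d\<tau> x (N i)) = ?c * \<omega>Y (\<lambda>i. d\<tau> x (N i))" using main[of N] by metis
    moreover have "\<omega>Y (\<lambda>i. d\<tau> x (N i)) = \<omega>Y y" using N by (intro Y.form_cong[OF altY]) auto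
    ultimately have "c * \<omega>Y y = ?c * \<omega>Y y" by simp
    then show "c = ?c" using oy mult_right_cancel by blast
  qed
qed

text \<open>Along the fibre \<open>\<tau>\<close> is constant. Dividing its exact expansion by
  \<open>t\<close> leaves the differential of the difference quotient plus \<open>t\<close> times a
  quadratic term, and the latter vanishes in the limit.\<close>

lemma partial_deriv_tangent:
  assumes C1: "C1_map s k U \<phi>" and U: "openin (top_of_set (affine_space k)) U" and \<phi>: "\<phi> ` U \<subseteq> XT"
    and u: "u \<in> U" and i: "i < k"
  shows "d\<tau> (\<phi> u) (partial_deriv s \<phi> u i) = 0"
proof -
  obtain g where g: "C1_quotient s k U \<phi> g" using C1 C1_map_iff by blast
  have ua: "u \<in> affine_space k" using U u openin_imp_subset by blast
  have e: "unit_vec k i \<in> affine_space k" by (simp add: unit_vec_def)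
  let ?g = "\<lambda>t. g u (unit_vec k i) t" and ?D = "partial_deriv s \<phi> u i"
  note lim = X.C1_quotient_tendsto[OF g U continuous_on_const ua u continuous_on_id refl e]
  have D: "?D = ?g 0" by (rule X.partial_deriv_eq[OF g U u i])
  have "eventually (\<lambda>t. d\<tau> (\<phi> u) (?g t) + s' t (\<tau> (?g t)) = 0) (at 0)"
    using lim(2) eventually_neq_at_within[of 0 0 UNIV]
  proof eventually_elim
    case (elim t)
    let ?p = "translate_along k u (unit_vec k i) t"
    have "\<phi> ?p - \<phi> u = s t (?g t)" using X.C1_quotient_eq[OF g u e, of t] elim by simp
    then have "\<phi> ?p = \<phi> u + s t (?g t)" by (simp add: algebra_simps)
    moreover have "\<tau> (\<phi> ?p) = \<tau> (\<phi> u)" using \<phi> u elim by auto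
    ultimately have "d\<tau> (\<phi> u) (s t (?g t)) + \<tau> (s t (?g t)) = 0" by (simp add: \<tau>_add)
    then have "s' t (d\<tau> (\<phi> u) (?g t) + s' t (\<tau> (?g t))) = 0"
      by (simp add: d\<tau>_scale \<tau>_scale Y.scale_right_distrib)
    then show ?case using elim by simp
  qed
  then have "((\<lambda>t. d\<tau> (\<phi> u) (?g t) + s' t (\<tau> (?g t))) \<longlongrightarrow> 0) (at 0)" by (simp add: tendsto_eventually)
  moreover have "((\<lambda>t. d\<tau> (\<phi> u) (?g t) + s' t (\<tau> (?g t))) \<longlongrightarrow> d\<tau> (\<phi> u) ?D + s' 0 (\<tau> ?D)) (at 0)"
  proof (intro tendsto_add Y.tendsto_scale)
    have c: "isCont (d\<tau> (\<phi> u)) ?D" "isCont \<tau> ?D"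
      using continuous_d\<tau>[of UNIV "\<phi> u"] continuous_\<tau>[of UNIV] by (simp_all add: continuous_on_eq_continuous_at)
    have l: "(?g \<longlongrightarrow> ?D) (at 0)" using lim(1) by (simp add: D)
    show "((\<lambda>t. d\<tau> (\<phi> u) (?g t)) \<longlongrightarrow> d\<tau> (\<phi> u) ?D) (at 0)" by (rule isCont_tendsto_compose[OF c(1) l])
    show "((\<lambda>t. \<tau> (?g t)) \<longlongrightarrow> \<tau> ?D) (at 0)" by (rule isCont_tendsto_compose[OF c(2) l])
  qed (rule tendsto_ident_at)
  ultimately have "d\<tau> (\<phi> u) ?D + s' 0 (\<tau> ?D) = 0" by (intro tendsto_unique[of "at (0::'f)"]) auto
  then show ?thesis by simp
qed

text \<open>A chart \<open>\<phi>\<close> of the fibre is thickened to \<open>z \<mapsto> \<phi> z' + N z''\<close>, an isometric chart of the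
  ambient space in which the tube around the fibre is a box.\<close>

lemma fibre_chart_measure:
  assumes lp: "local_parametrization s XT (n - m) U \<phi>" and u: "u \<in> U"
    and M: "\<And>A c. compact A \<Longrightarrow> open A \<Longrightarrow> tube_density A c \<Longrightarrow> emeasure M (A \<inter> XT) = ennreal c"
  shows "\<exists>\<rho>>0. bx (n - m) u \<rho> \<subseteq> U \<and> (\<forall>x r. x \<in> bx (n - m) u \<rho> \<longrightarrow> 0 < r \<longrightarrow> bx (n - m) x r \<subseteq> bx (n - m) u \<rho> \<longrightarrow>
        emeasure M (\<phi> ` bx (n - m) x r) = ennreal (modulus (rel (\<phi> u) (partial_deriv s \<phi> u))) * emeasure (pm (n - m)) (bx (n - m) x r))"
proof -
  note lD = local_parametrizationD[OF lp]
  let ?r = "n - m" and ?x = "\<phi> u" and ?D = "partial_deriv s \<phi> u"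
  have UA: "U \<subseteq> affine_space ?r" using lD(1) openin_imp_subset by blast
  have \<phi>T: "\<phi> ` U \<subseteq> XT" using lD(2) openin_imp_subset by blast
  then have xT: "\<tau> ?x = T" using u by blast
  obtain b0 y where ad0: "adapted ?x b0 y" using adapted_exists[of ?x] regular[OF xT] by blast
  have mn: "m \<le> n" and y: "Y.is_basis y" using ad0 by (auto simp: adapted_def)
  have rm: "?r + m = n" using mn by simp
  define N where "N j = b0 (?r + j)" for j
  have N: "\<And>j. j < m \<Longrightarrow> d\<tau> ?x (N j) = y j" using ad0 unfolding adapted_def N_def by blast
  have Dt: "\<And>i. i < ?r \<Longrightarrow> d\<tau> ?x (?D i) = 0" by (rule partial_deriv_tangent[OF lD(4,1) \<phi>T u])
  have Di: "X.indep ?r ?D" unfolding X.indep_def lin_def using lD(5)[OF u] by blast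
  define b where "b = (\<lambda>i. if i < ?r then ?D i else N (i - ?r))"
  have ad: "adapted ?x b y" and rel: "rel ?x ?D = \<omega>X b / \<omega>Y y"
    using rel_eq[OF mn Di Dt y N] unfolding b_def by auto
  have b: "X.is_basis b" using ad by (simp add: adapted_def)
  obtain K where K: "K > 0" "\<And>a w. nm m (Y.co m y (B a w)) \<le> K * nm n (X.co n b a) * nm n (X.co n b w)"
    using B_bound[OF b y] by blast
  have half: "0 < (1/2::real)" by simp
  from X.C1_strict[OF lD(4,1) subset_UNIV u b half] obtain \<rho>1 where \<rho>1: "\<rho>1 > 0" "bx ?r u \<rho>1 \<subseteq> U"
    "\<And>a c. a \<in> bx ?r u \<rho>1 \<Longrightarrow> c \<in> bx ?r u \<rho>1 \<Longrightarrow>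
      nm n (X.co n b (\<phi> a - \<phi> c - lin s ?r ?D (\<lambda>i. a i - c i))) \<le> 1/2 * nm ?r (\<lambda>i. a i - c i)" by blast
  define \<rho> where "\<rho> = min \<rho>1 (1 / (2 * K))"
  have \<rho>: "\<rho> > 0" "\<rho> \<le> \<rho>1" "K * \<rho> \<le> 1/2" using \<rho>1(1) K(1) by (auto simp: \<rho>_def min_def field_simps)
  have ua: "u \<in> affine_space ?r" using UA u by blast
  let ?e = "\<lambda>v. emb v (\<lambda>_. 0 :: 'f)"
  let ?B = "bx n (?e u) \<rho>"
  let ?z1 = "\<lambda>z. restrict z {..<?r}" and ?z2 = "\<lambda>z j. z (?r + j)"
  define \<Phi> where "\<Phi> z = \<phi> (?z1 z) + lin s m N (?z2 z)" for z
  have z1: "?z1 z \<in> bx ?r u \<rho>" if "z \<in> ?B" for z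
    using that bx_emb_iff[OF mn, of z u "\<lambda>_. 0" \<rho>] bx_subset_affine by blast
  have z1': "?z1 z \<in> bx ?r u \<rho>1" if "z \<in> ?B" for z using z1[OF that] bx_mono[OF \<rho>(2), of ?r u] by blast
  have Lb: "X.L b c = lin s ?r ?D c + lin s m N (?z2 c)" for c
  proof -
    have "lin s ?r b c = lin s ?r ?D c" by (rule lin_cong) (auto simp: b_def)
    moreover have "lin s m (\<lambda>j. b (?r + j)) (?z2 c) = lin s m N (?z2 c)" by (rule lin_cong) (auto simp: b_def)
    ultimately show ?thesis using lin_split[OF mn, of b c] by simp
  qed
  have coL: "nm n (X.co n b (X.L b z)) = nm n z" for z
    using X.co_lin_nth[OF X.is_basis_indep[OF b]] by (intro nm_cong) simp
  have iso: "X.isometric b ?B \<Phi>"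
    unfolding X.isometric_def
  proof (intro conjI ballI)
    fix z w assume zw: "z \<in> ?B" "w \<in> ?B"
    let ?d = "\<lambda>i. z i - w i"
    define e where "e = \<phi> (?z1 z) - \<phi> (?z1 w) - lin s ?r ?D (\<lambda>i. ?z1 z i - ?z1 w i)"
    have "lin s ?r ?D (\<lambda>i. ?z1 z i - ?z1 w i) = lin s ?r ?D ?d" by (rule lin_cong) auto
    then have eq: "\<Phi> z - \<Phi> w = X.L b ?d + e"
      unfolding Lb e_def \<Phi>_def by (simp add: X.lin_diff)
    show "nm n (X.co n b (\<Phi> z - \<Phi> w)) = nm n ?d"
    proof (rule nm_near[where e="1/2"])
      have "nm n (\<lambda>i. X.co n b (\<Phi> z - \<Phi> w) i - ?d i) = nm n (X.co n b e)"
        by (rule nm_cong) (simp add: eq X.co_add[OF b] X.co_lin_nth[OF X.is_basis_indep[OF b]])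
      also have "\<dots> \<le> 1/2 * nm ?r (\<lambda>i. ?z1 z i - ?z1 w i)" unfolding e_def by (rule \<rho>1(3)[OF z1'[OF zw(1)] z1'[OF zw(2)]])
      also have "nm ?r (\<lambda>i. ?z1 z i - ?z1 w i) = nm ?r ?d" by (rule nm_cong) simp
      also have "1/2 * nm ?r ?d \<le> 1/2 * nm n ?d" using nm_split[OF mn, of ?d] by simp
      finally show "nm n (\<lambda>i. X.co n b (\<Phi> z - \<Phi> w) i - ?d i) \<le> 1/2 * nm n ?d" .
    qed simp
  qed simp
  have \<Phi>e: "\<Phi> (?e v) = \<phi> v" if "v \<in> affine_space ?r" for v
  proof -
    have "?z1 (?e v) = v" by (rule affine_eqI[of _ ?r]) (use that in \<open>auto simp: emb_nth1\<close>)
    moreover have "lin s m N (?z2 (?e v)) = lin s m N (\<lambda>_. 0)" by (rule lin_cong) (simp_all only: emb_nth2[OF mn])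
    ultimately show ?thesis by (simp add: \<Phi>_def)
  qed
  have eB: "?e v \<in> ?B" if "v \<in> bx ?r u \<rho>" for v
  proof -
    have "v \<in> affine_space ?r" using that bx_subset_affine by blast
    moreover have "nm ?r (\<lambda>i. v i - u i) \<le> \<rho>" using that \<rho>(1) by (simp add: bx_iff_nm)
    ultimately show ?thesis using \<rho>(1) nm_emb_diff[OF mn, of v "\<lambda>_. 0" u "\<lambda>_. 0"] by (simp add: bx_iff_nm)
  qed
  have uB: "?e u \<in> ?B" using \<rho>(1) by (intro bx_center) auto
  have tau: "nm m (Y.co m y (\<tau> (\<Phi> z) - T)) = nm m (?z2 z)" if z: "z \<in> ?B" for z
  proof (rule nm_near[where e="1/2"])
    let ?p = "\<phi> (?z1 z)" and ?w = "lin s m N (?z2 z)"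
    have "\<tau> ?p = T" using z1'[OF z] \<rho>1(2) \<phi>T by blast
    \<comment> \<open>Since \<open>?p\<close> lies on the fibre, every term of the error contains
      the transversal vector \<open>?w\<close>. The error is therefore small relative to the last
      \<open>m\<close> coordinates alone, and these control the distance of \<open>\<tau>\<close>
      from \<open>T\<close> exactly.\<close>
    define e where "e = B (?p - ?x) ?w + (B ?w (?p - ?x) + B ?w ?w)"
    have eW: "e \<in> W'" by (simp add: e_def B_in Y.subspace_add[OF Y.subspace_W])
    have "\<tau> (\<Phi> z) - T = d\<tau> ?x ?w + e"
      unfolding \<Phi>_def \<tau>_add \<open>\<tau> ?p = T\<close> by (simp add: e_def d\<tau>_def \<tau>_def B_diff_left B_diff_right)
    also have "d\<tau> ?x ?w = Y.L y (?z2 z)" unfolding d\<tau>_lin using N by (intro lin_cong) auto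
    finally have eq: "\<tau> (\<Phi> z) - T = Y.L y (?z2 z) + e" .
    have w: "?w = X.L b (emb (\<lambda>_. 0) (?z2 z))"
    proof -
      have "lin s ?r ?D (emb (\<lambda>_. 0) (?z2 z)) = lin s ?r ?D (\<lambda>_. 0)" by (rule lin_cong) (simp_all add: emb_nth1)
      moreover have "lin s m N (?z2 (emb (\<lambda>_. 0) (?z2 z))) = ?w" by (rule lin_cong) (simp_all only: emb_nth2[OF mn])
      ultimately show ?thesis unfolding Lb by simp
    qed
    have nw: "nm n (X.co n b ?w) = nm m (?z2 z)"
      unfolding w coL nm_emb[OF mn] by simp
    have nz: "nm n (\<lambda>i. z i - ?e u i) \<le> \<rho>" using z \<rho>(1) by (simp add: bx_iff_nm)
    have w\<rho>: "nm n (X.co n b ?w) \<le> \<rho>"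
    proof -
      have "nm m (?z2 z) = nm m (\<lambda>j. z (?r + j) - ?e u (?r + j))" by (rule nm_cong) (simp only: emb_nth2[OF mn] diff_0_right)
      also have "\<dots> \<le> \<rho>" using nz nm_split[OF mn, of "\<lambda>i. z i - ?e u i"] by simp
      finally show ?thesis using nw by simp
    qed
    have p\<rho>: "nm n (X.co n b (?p - ?x)) \<le> \<rho>"
    proof -
      have m1: "?e (?z1 z) \<in> ?B" by (rule eB[OF z1[OF z]])
      have "?p - ?x = \<Phi> (?e (?z1 z)) - \<Phi> (?e u)" using \<Phi>e[OF restrict_affine] \<Phi>e[OF ua] by simp
      then have "nm n (X.co n b (?p - ?x)) = nm n (\<lambda>i. ?e (?z1 z) i - ?e u i)" using iso m1 uB by (simp add: X.isometric_def)
      also have "\<dots> \<le> \<rho>" using m1 \<rho>(1) by (simp add: bx_iff_nm)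
      finally show ?thesis .
    qed
    have bd: "K * t * nm m (?z2 z) \<le> 1/2 * nm m (?z2 z)" "K * nm m (?z2 z) * t \<le> 1/2 * nm m (?z2 z)" if "t \<le> \<rho>" for t
    proof -
      have "K * t \<le> K * \<rho>" by (rule mult_left_mono[OF that less_imp_le[OF K(1)]])
      then have "K * t \<le> 1/2" using \<rho>(3) by linarith
      then have "K * t * nm m (?z2 z) \<le> 1/2 * nm m (?z2 z)" by (rule mult_right_mono) simp
      then show "K * t * nm m (?z2 z) \<le> 1/2 * nm m (?z2 z)" "K * nm m (?z2 z) * t \<le> 1/2 * nm m (?z2 z)"
        by (simp_all add: mult.commute mult.left_commute)
    qed
    let ?E = "1/2 * nm m (?z2 z)"
    have b1: "nm m (Y.co m y (B (?p - ?x) ?w)) \<le> ?E" using K(2)[of "?p - ?x" ?w] bd(1)[OF p\<rho>] nw by simp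
    have b2: "nm m (Y.co m y (B ?w (?p - ?x))) \<le> ?E" using K(2)[of ?w "?p - ?x"] bd(2)[OF p\<rho>] nw by simp
    have b3: "nm m (Y.co m y (B ?w ?w)) \<le> ?E" using K(2)[of ?w ?w] bd(1)[OF w\<rho>] nw by simp
    have co_le: "nm m (Y.co m y (p + q)) \<le> max (nm m (Y.co m y p)) (nm m (Y.co m y q))" if "p \<in> W'" "q \<in> W'" for p q
    proof -
      have "nm m (Y.co m y (p + q)) = nm m (\<lambda>j. Y.co m y p j + Y.co m y q j)"
        by (rule nm_cong) (simp add: Y.co_add[OF y that])
      then show ?thesis using nm_add_le by simp
    qed
    have "nm m (Y.co m y e) \<le> ?E"
      unfolding e_def
      using co_le[OF B_in[of "?p - ?x" ?w] Y.subspace_add[OF Y.subspace_W B_in[of ?w "?p - ?x"] B_in[of ?w ?w]]]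
        co_le[OF B_in[of ?w "?p - ?x"] B_in[of ?w ?w]] b1 b2 b3 by linarith
    moreover have "nm m (\<lambda>j. Y.co m y (\<tau> (\<Phi> z) - T) j - ?z2 z j) = nm m (Y.co m y e)"
      by (rule nm_cong) (simp add: eq Y.co_add[OF y Y.L_in_W[OF y] eW] Y.co_lin_nth[OF Y.is_basis_indep[OF y]])
    ultimately show "nm m (\<lambda>j. Y.co m y (\<tau> (\<Phi> z) - T) j - ?z2 z j) \<le> ?E" by simp
  qed simp
  note mX = modulus_pos[OF X.top_form_nonzero[OF \<omega>X b]]
  note mY = modulus_pos[OF Y.top_form_nonzero[OF \<omega>Y y]]
  have "emeasure M (\<phi> ` bx ?r x0 t0) = ennreal (modulus (rel ?x ?D)) * emeasure (pm ?r) (bx ?r x0 t0)"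
    if x0: "x0 \<in> bx ?r u \<rho>" and t0: "0 < t0" "bx ?r x0 t0 \<subseteq> bx ?r u \<rho>" for x0 t0
  proof -
    \<comment> \<open>A radius beyond \<open>\<rho>\<close> describes the same box, since the box
      lies in one of radius \<open>\<rho>\<close>.\<close>
    define t where "t = min t0 \<rho>"
    have t: "t > 0" "t \<le> \<rho>" using t0 \<rho>(1) by (auto simp: t_def)
    have bt: "bx ?r x0 t0 = bx ?r x0 t"
    proof
      show "bx ?r x0 t0 \<subseteq> bx ?r x0 t" using t0(2) unfolding bx_eq[OF x0, symmetric] by (auto simp: bx_iff t_def)
      show "bx ?r x0 t \<subseteq> bx ?r x0 t0" by (rule bx_mono) (simp add: t_def)
    qed
    have x0a: "x0 \<in> affine_space ?r" using x0 bx_subset_affine by blast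
    let ?B' = "bx n (?e x0) t"
    have B'B: "?B' \<subseteq> ?B" by (rule bx_subset[OF eB[OF x0] t(2)])
    define A where "A = \<Phi> ` ?B'"
    have A: "A = X.lball b (\<Phi> (?e x0)) t"
      unfolding A_def by (rule X.isometric_image_bx[OF b X.isometric_subset[OF iso B'B] emb_affine t(1)])
    have cA: "compact A" unfolding A by (rule X.compact_lball)
    have oA: "open A" unfolding A using X.openin_lball[OF b _ t(1), of "\<Phi> (?e x0)"] by simp
    obtain c where c: "tube_density A c" using tube_density_exists[OF cA oA] by blast
    have AXT: "A \<inter> XT = \<phi> ` bx ?r x0 t"
    proof (intro set_eqI iffI)
      fix p assume "p \<in> A \<inter> XT"
      then obtain z where z: "z \<in> ?B'" "p = \<Phi> z" "\<tau> (\<Phi> z) = T" by (auto simp: A_def)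
      have za: "z \<in> affine_space n" using z(1) bx_subset_affine by blast
      have "nm m (Y.co m y 0) = 0" using Y.co_eqI[OF y, of 0 "\<lambda>_. 0"] by (simp add: nm_eq_0_iff)
      then have "nm m (?z2 z) = 0" using tau[of z] z B'B by auto
      then have "lin s m N (?z2 z) = lin s m N (\<lambda>_. 0)" by (intro lin_cong) (simp_all add: nm_eq_0_iff)
      then have "p = \<phi> (?z1 z)" using z(2) by (simp add: \<Phi>_def)
      moreover have "?z1 z \<in> bx ?r x0 t" using bx_emb_iff[OF mn za] z(1) by blast
      ultimately show "p \<in> \<phi> ` bx ?r x0 t" by blast
    next
      fix p assume "p \<in> \<phi> ` bx ?r x0 t"
      then obtain v where v: "v \<in> bx ?r x0 t" "p = \<phi> v" by blast
      have va: "v \<in> affine_space ?r" using v(1) bx_subset_affine by blast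
      have "nm ?r (\<lambda>i. v i - x0 i) \<le> t" using v(1) t(1) by (simp add: bx_iff_nm)
      then have "?e v \<in> ?B'" using t(1) nm_emb_diff[OF mn, of v "\<lambda>_. 0" x0 "\<lambda>_. 0"] by (simp add: bx_iff_nm)
      then have "p \<in> A" unfolding A_def using \<Phi>e[OF va] v(2) by (metis imageI)
      moreover have "v \<in> U" using v(1) t0(2) bt \<rho>1(2) bx_mono[OF \<rho>(2), of ?r u] by blast
      then have "p \<in> XT" using \<phi>T v(2) by blast
      ultimately show "p \<in> A \<inter> XT" by blast
    qed
    obtain V where V: "0 \<le> c" "openin (top_of_set W') V" "T \<in> V"
      "\<And>U. U \<subseteq> V \<Longrightarrow> compact U \<Longrightarrow> openin (top_of_set W') U \<Longrightarrow> emeasure \<mu>X (A \<inter> \<tau> -` U) = ennreal c * emeasure \<mu>Y U"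
      using tube_densityE[OF c] by blast
    obtain \<delta>0 where \<delta>0: "\<delta>0 > 0" "Y.lball y T \<delta>0 \<subseteq> V" using Y.openin_contains_lball[OF y V(2,3)] by blast
    \<comment> \<open>\<open>\<delta> \<le> t\<close> makes the tube over the ball of radius
      \<open>\<delta>\<close> a product box inside \<open>?B'\<close>, thin in the last
      \<open>m\<close> directions.\<close>
    define \<delta> where "\<delta> = min \<delta>0 t"
    have \<delta>: "\<delta> > 0" "\<delta> \<le> t" "Y.lball y T \<delta> \<subseteq> V"
      using \<delta>0 t(1) Y.lball_mono[of \<delta> \<delta>0 y T] by (auto simp: \<delta>_def)
    let ?R = "\<lambda>i. if i < ?r then t else \<delta>"
    let ?Box = "\<Pi>\<^sub>E i\<in>{..<n}. cball (?e x0 i) (?R i)"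
    have Box: "z \<in> ?Box \<longleftrightarrow> z \<in> ?B' \<and> nm m (?z2 z) \<le> \<delta>" for z
    proof -
      have "z \<in> ?B' \<and> nm m (?z2 z) \<le> \<delta> \<longleftrightarrow> z \<in> affine_space n \<and> (\<forall>i<n. dist (?e x0 i) (z i) \<le> t) \<and> (\<forall>j<m. av (z (?r + j)) \<le> \<delta>)"
        using \<delta>(1) by (simp add: bx_iff nm_le_iff)
      also have "\<dots> \<longleftrightarrow> z \<in> affine_space n \<and> (\<forall>i<n. dist (?e x0 i) (z i) \<le> ?R i)"
      proof (intro iffI conjI allI impI; (elim conjE)?)
        fix i assume a: "\<forall>i<n. dist (?e x0 i) (z i) \<le> t" "\<forall>j<m. av (z (?r + j)) \<le> \<delta>" and i: "i < n"
        show "dist (?e x0 i) (z i) \<le> ?R i"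
        proof (cases "i < ?r")
          case False
          then have j: "i - ?r < m" "?r + (i - ?r) = i" using i mn by auto
          have "?e x0 i = 0" using False i by (simp add: emb_def)
          then show ?thesis using False a(2)[rule_format, OF j(1)] j(2) by simp
        qed (use a i in auto)
      next
        fix i assume a: "\<forall>i<n. dist (?e x0 i) (z i) \<le> ?R i" and i: "i < n"
        have "dist (?e x0 i) (z i) \<le> ?R i" using a i by blast
        also have "?R i \<le> t" using \<delta>(2) by simp
        finally show "dist (?e x0 i) (z i) \<le> t" .
      next
        fix j assume a: "\<forall>i<n. dist (?e x0 i) (z i) \<le> ?R i" and j: "j < m"
        have "?r + j < n" using j rm by simp
        from a[rule_format, OF this] show "av (z (?r + j)) \<le> \<delta>" unfolding emb_nth2[OF mn j] by simp
      qed auto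
      finally show ?thesis by (auto simp: PiE_iff affine_space_def)
    qed
    have BoxS: "?Box \<in> sets (pm n)" by (intro sets_PiM_I_finite) (auto simp: sets_hF)
    have BoxB: "?Box \<subseteq> ?B" using Box B'B by blast
    have BoxA: "A \<inter> \<tau> -` Y.lball y T \<delta> = \<Phi> ` ?Box"
    proof -
      have "\<tau> (\<Phi> z) \<in> Y.lball y T \<delta> \<longleftrightarrow> nm m (?z2 z) \<le> \<delta>" if "z \<in> ?B'" for z
        using Y.lball_eq[OF y T_in, of \<delta>] \<delta>(1) \<tau>_in tau[of z] that B'B by auto
      then show ?thesis unfolding A_def using Box by blast
    qed
    let ?vt = "ball_volume TYPE('f) t" and ?vd = "ball_volume TYPE('f) \<delta>"
    have vt: "?vt > 0" and vd: "?vd > 0" using ball_volume_pos t(1) \<delta>(1) by auto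
    have "(\<Prod>i<n. ball_volume TYPE('f) (?R i)) = (\<Prod>i<?r + m. if i < ?r then ?vt else ?vd)"
      unfolding rm by (rule prod.cong) auto
    then have pBox: "emeasure (pm n) ?Box = ennreal (?vt ^ ?r * ?vd ^ m)"
      using emeasure_pm_PiE[of n ?R "?e x0"] t(1) \<delta>(1) by (simp add: prod_if_lessThan)
    \<comment> \<open>The volume of this tube, once by the density \<open>c\<close> and once in the
      isometric chart \<open>\<Phi>\<close>; the common factor \<open>?vd ^ m\<close>
      cancels.\<close>
    have "ennreal c * ennreal (modulus (\<omega>Y y) * ?vd ^ m) = ennreal c * emeasure \<mu>Y (Y.lball y T \<delta>)"
      by (simp only: Y.vol_lball[OF \<omega>Y y T_in \<delta>(1)])
    also have "\<dots> = emeasure \<mu>X (A \<inter> \<tau> -` Y.lball y T \<delta>)"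
      using V(4)[OF \<delta>(3) Y.compact_lball Y.openin_lball[OF y T_in \<delta>(1)]] by simp
    also have "\<dots> = ennreal (modulus (\<omega>X b)) * emeasure (pm n) ?Box"
      unfolding BoxA by (rule X.isometric_measure(2)[OF \<omega>X b iso emb_affine \<rho>(1) BoxS BoxB])
    also have "\<dots> = ennreal (modulus (\<omega>X b) * (?vt ^ ?r * ?vd ^ m))"
      unfolding pBox using mX vt vd by (simp add: ennreal_mult)
    finally have "ennreal (c * (modulus (\<omega>Y y) * ?vd ^ m)) = ennreal (modulus (\<omega>X b) * (?vt ^ ?r * ?vd ^ m))"
      using V(1) mY vd by (simp add: ennreal_mult)
    then have "c * (modulus (\<omega>Y y) * ?vd ^ m) = modulus (\<omega>X b) * (?vt ^ ?r * ?vd ^ m)"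
      using V(1) mX mY vt vd by (subst (asm) ennreal_inj) auto
    then have "c * modulus (\<omega>Y y) = modulus (\<omega>X b) * ?vt ^ ?r" using vd by simp
    then have cc: "c = modulus (\<omega>X b) / modulus (\<omega>Y y) * ?vt ^ ?r" using mY by (simp add: field_simps)
    have "modulus (rel ?x ?D) = modulus (\<omega>X b) / modulus (\<omega>Y y)"
      unfolding rel by (rule modulus_divide[OF X.top_form_nonzero[OF \<omega>X b] Y.top_form_nonzero[OF \<omega>Y y]])
    then have "ennreal (modulus (rel ?x ?D)) * emeasure (pm ?r) (bx ?r x0 t) = ennreal c"
      unfolding emeasure_pm_bx[OF t(1)] cc using mX mY vt by (simp add: ennreal_mult[symmetric])
    moreover have "emeasure M (\<phi> ` bx ?r x0 t) = ennreal c" using M[OF cA oA c] unfolding AXT .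
    ultimately show ?thesis unfolding bt by simp
  qed
  moreover have "bx ?r u \<rho> \<subseteq> U" using \<rho>1(2) bx_mono[OF \<rho>(2), of ?r u] by blast
  ultimately show ?thesis using \<rho>(1) by blast
qed

end


section \<open>Charts of the fibre\<close>

context quad_fibre
begin

text \<open>By \<open>\<tau>_diff\<close>, the increment of \<open>\<tau>\<close> is given by linear maps that depend continuously on both
  end points. So the difference quotients of the inverse of the straightening map solve linear equations
  that make sense, and are uniquely solvable, on the diagonal as well.\<close>

lemma chart_exists:
  assumes x: "\<tau> x = T"
  shows "\<exists>U \<phi>. local_parametrization s XT (n - m) U \<phi> \<and> x \<in> \<phi> ` U"
proof -
  let ?r = "n - m"
  obtain b y where ad: "adapted x b y" using adapted_exists[of x] regular[OF x] by blast
  have mn: "m \<le> n" and b: "X.is_basis b" and y: "Y.is_basis y" using ad by (auto simp: adapted_def)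
  from straighten[OF ad] obtain \<rho>0 f where \<rho>0: "\<rho>0 > 0" and f0: "X.isometric b (bx n (\<lambda>_. 0) \<rho>0) f"
    "f (restrict (\<lambda>_. 0) {..<n}) = x"
    "\<And>z. z \<in> bx n (\<lambda>_. 0) \<rho>0 \<Longrightarrow> \<tau> (f z) = \<tau> x + Y.L y (\<lambda>j. z (?r + j)) \<and> (\<forall>i<?r. X.co n b (f z - x) i = z i)" by blast
  obtain K where K: "K > 0" "\<And>a w. nm m (Y.co m y (B a w)) \<le> K * nm n (X.co n b a) * nm n (X.co n b w)"
    using B_bound[OF b y] by blast
  define \<rho> where "\<rho> = min \<rho>0 (1 / (2 * K))"
  have \<rho>: "\<rho> > 0" "\<rho> \<le> \<rho>0" "K * \<rho> \<le> 1/2" using \<rho>0 K(1) by (auto simp: \<rho>_def min_def field_simps)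
  let ?B = "bx n (\<lambda>_. 0 :: 'f) \<rho>"
  have sub: "?B \<subseteq> bx n (\<lambda>_. 0) \<rho>0" by (rule bx_mono[OF \<rho>(2)])
  have f: "X.isometric b ?B f" by (rule X.isometric_subset[OF f0(1) sub])
  have f\<tau>: "\<tau> (f z) = T + Y.L y (\<lambda>j. z (?r + j))" and f1: "\<And>i. i < ?r \<Longrightarrow> X.co n b (f z - x) i = z i" if "z \<in> ?B" for z
    using f0(3)[of z] that sub x by auto
  let ?z = "restrict (\<lambda>_. 0) {..<n} :: nat \<Rightarrow> 'f"
  have bz: "bx n ?z t = bx n (\<lambda>_. 0) t" for t by (rule bx_cong) simp
  note fz = f[folded bz]
  have za: "?z \<in> affine_space n" by simp
  have imgB: "f ` ?B = X.lball b x \<rho>" using X.isometric_image_bx[OF b fz za \<rho>(1)] f0(2) by (simp add: bz)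
  have openB: "open (f ` ?B)" unfolding imgB using X.openin_lball[OF b _ \<rho>(1), of x] by simp
  have fcont: "continuous_on ?B f"
    using X.isometric_homeomorphism[OF b fz za \<rho>(1)] by (auto simp: bz homeomorphism_def)

  \<comment> \<open>The chart: the straightening map on the slice with last coordinates 0\<close>
  let ?e = "\<lambda>v. emb v (\<lambda>_. 0 :: 'f)"
  define U where "U = bx ?r (\<lambda>_. 0 :: 'f) \<rho>"
  have UA: "U \<subseteq> affine_space ?r" unfolding U_def by (rule bx_subset_affine)
  have oU: "openin (top_of_set (affine_space ?r)) U" unfolding U_def by (rule openin_bx[OF \<rho>(1)])
  have eB: "?e v \<in> ?B" if "v \<in> U" for v
  proof -
    have "nm ?r v \<le> \<rho>" using that \<rho>(1) by (simp add: U_def bx_iff_nm)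
    then show ?thesis using \<rho>(1) nm_emb[OF mn, of v "\<lambda>_. 0"] by (simp add: bx_iff_nm)
  qed
  define \<phi> where "\<phi> v = f (?e v)" for v
  have z2: "(\<lambda>j. ?e v (?r + j)) j = 0" if "j < m" for v j by (rule emb_nth2[OF mn that])
  have \<phi>T: "\<tau> (\<phi> v) = T" if "v \<in> U" for v
  proof -
    have "Y.L y (\<lambda>j. ?e v (?r + j)) = Y.L y (\<lambda>_. 0)" using z2 by (intro lin_cong) auto
    then show ?thesis using f\<tau>[OF eB[OF that]] by (simp add: \<phi>_def)
  qed
  have \<phi>1: "X.co n b (\<phi> v - x) i = v i" if "v \<in> U" "i < ?r" for v i
    using f1[OF eB[OF that(1)] that(2)] that(2) by (simp add: \<phi>_def emb_nth1)
  have \<phi>B: "nm n (X.co n b (\<phi> v - x)) \<le> \<rho>" if "v \<in> U" for v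
  proof -
    have "\<phi> v \<in> X.lball b x \<rho>" unfolding imgB[symmetric] \<phi>_def using eB[OF that] by (rule imageI)
    then show ?thesis using X.lball_eq[OF b _ less_imp_le[OF \<rho>(1)], of x] by simp
  qed
  have img: "\<phi> ` U = XT \<inter> f ` ?B"
  proof (intro set_eqI iffI)
    fix p assume "p \<in> \<phi> ` U"
    then obtain v where v: "v \<in> U" "p = \<phi> v" by blast
    have "f (?e v) \<in> f ` ?B" using eB[OF v(1)] by (rule imageI)
    then show "p \<in> XT \<inter> f ` ?B" using \<phi>T[OF v(1)] v(2) by (simp add: \<phi>_def)
  next
    fix p assume "p \<in> XT \<inter> f ` ?B"
    then obtain z where z: "z \<in> ?B" "p = f z" "\<tau> (f z) = T" by auto
    then have "Y.L y (\<lambda>j. z (?r + j)) = 0" using f\<tau>[OF z(1)] by simp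
    then have z0: "\<forall>j<m. z (?r + j) = 0" using Y.is_basis_indep[OF y] unfolding Y.indep_def by blast
    have zA: "z \<in> affine_space n" using z(1) bx_subset_affine by blast
    have "?e (restrict z {..<?r}) = emb (restrict z {..<?r}) (\<lambda>j. z (?r + j))"
      unfolding emb_def
    proof (rule restrict_ext)
      fix i assume i: "i \<in> {..<n}"
      show "(if i < ?r then restrict z {..<?r} i else 0) = (if i < ?r then restrict z {..<?r} i else z (?r + (i - ?r)))"
      proof (cases "i < ?r")
        case False
        then have "i - ?r < m" using i mn by auto
        then have "z (?r + (i - ?r)) = 0" using z0 by blast
        then show ?thesis using False by simp
      qed simp
    qed
    then have ez: "?e (restrict z {..<?r}) = z" using emb_split[OF zA] by simp
    have "nm ?r (restrict z {..<?r}) \<le> nm n z"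
    proof -
      have "nm ?r (restrict z {..<?r}) = nm ?r z" by (rule nm_cong) simp
      then show ?thesis using nm_split[OF mn, of z] by simp
    qed
    also have "\<dots> \<le> \<rho>" using z(1) \<rho>(1) by (simp add: bx_iff_nm)
    finally have "restrict z {..<?r} \<in> U"
      using \<rho>(1) unfolding U_def by (simp add: bx_iff_nm del: restrict_apply)
    then have "\<phi> (restrict z {..<?r}) \<in> \<phi> ` U" by (rule imageI)
    then show "p \<in> \<phi> ` U" using ez z(2) by (simp add: \<phi>_def)
  qed
  have \<phi>cont: "continuous_on U \<phi>"
    unfolding \<phi>_def by (rule continuous_on_compose2[OF fcont continuous_emb]) (use eB in auto)
  define \<psi> where "\<psi> p = restrict (X.co n b (p - x)) {..<?r}" for p
  have hom: "homeomorphism U (\<phi> ` U) \<phi> \<psi>"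
  proof (rule homeomorphismI[OF \<phi>cont])
    show "continuous_on (\<phi> ` U) \<psi>"
    proof (rule continuous_on_coordinatewise_then_product)
      fix i
      show "continuous_on (\<phi> ` U) (\<lambda>p. \<psi> p i)"
        using continuous_on_product_then_coordinatewise[OF X.co_diff_continuous[OF b, of x "\<phi> ` U"], of i]
        by (cases "i < ?r") (simp_all add: \<psi>_def)
    qed
    have \<psi>\<phi>: "\<psi> (\<phi> v) = v" if "v \<in> U" for v
      by (rule affine_eqI[of _ ?r]) (use that UA \<phi>1 in \<open>auto simp: \<psi>_def\<close>)
    then show "\<And>v. v \<in> U \<Longrightarrow> \<psi> (\<phi> v) = v" .
    show "\<psi> ` \<phi> ` U \<subseteq> U" using \<psi>\<phi> by auto
    show "\<And>p. p \<in> \<phi> ` U \<Longrightarrow> \<phi> (\<psi> p) = p" using \<psi>\<phi> by auto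
  qed simp

  \<comment> \<open>The linear increment maps and their inverses\<close>
  have coL: "X.co n b (X.L b q) i = q i" if "i < n" for q i by (rule X.co_lin_nth[OF X.is_basis_indep[OF b] that])
  have nL: "nm n (X.co n b (X.L b q)) = nm n q" for q using coL by (intro nm_cong) simp
  define h where "h a a' q = B (X.L b q) a + B a' (X.L b q)" for a a' q
  have hW: "h a a' q \<in> W'" for a a' q by (simp add: h_def B_in Y.subspace_add[OF Y.subspace_W])
  have hdiff: "h a a' q - h a a' q' = h a a' (\<lambda>i. q i - q' i)" for a a' q q'
    by (simp add: h_def X.lin_diff B_diff_left B_diff_right)
  \<comment> \<open>Linear in \<open>q\<close>: the first coordinates of \<open>q\<close>, followed
    by the increment that \<open>\<tau>\<close> would have between \<open>a'\<close> and
    \<open>a\<close> if their difference had coordinates \<open>q\<close>. For \<open>a = a'\<close>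
    this is the derivative of the inverse of the straightening map.\<close>
  define \<Lambda> where "\<Lambda> a a' q = emb q (Y.co m y (h a a' q))" for a a' q
  have \<Lambda>diff: "nm n (\<lambda>i. \<Lambda> a a' q i - \<Lambda> a a' q' i) = nm n (\<Lambda> a a' (\<lambda>i. q i - q' i))" for a a' q q'
  proof -
    have "nm n (\<lambda>i. \<Lambda> a a' q i - \<Lambda> a a' q' i) = max (nm ?r (\<lambda>i. q i - q' i)) (nm m (\<lambda>j. Y.co m y (h a a' q) j - Y.co m y (h a a' q') j))"
      unfolding \<Lambda>_def by (rule nm_emb_diff[OF mn])
    also have "nm m (\<lambda>j. Y.co m y (h a a' q) j - Y.co m y (h a a' q') j) = nm m (Y.co m y (h a a' (\<lambda>i. q i - q' i)))"
      by (rule nm_cong) (simp add: hdiff[symmetric] Y.co_diff[OF y hW hW])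
    also have "max (nm ?r (\<lambda>i. q i - q' i)) \<dots> = nm n (\<Lambda> a a' (\<lambda>i. q i - q' i))"
      unfolding \<Lambda>_def nm_emb[OF mn] ..
    finally show ?thesis .
  qed
  define near where "near a \<longleftrightarrow> nm n (X.co n b (a - x)) \<le> \<rho>" for a
  \<comment> \<open>At \<open>a = a' = x\<close> the map is the identity in adapted coordinates; for
    end points near \<open>x\<close> it differs from it by a relative error of at most 1/2.\<close>
  have \<Lambda>n: "nm n (\<Lambda> a a' q) = nm n q" if a: "near a" "near a'" for a a' q
  proof (rule nm_near[where e="1/2"])
    define e where "e = B (X.L b q) (a - x) + B (a' - x) (X.L b q)"
    have eW: "e \<in> W'" by (simp add: e_def B_in Y.subspace_add[OF Y.subspace_W])
    have "h a a' q = d\<tau> x (X.L b q) + e"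
      by (simp add: h_def e_def d\<tau>_def B_diff_left B_diff_right)
    then have eq: "h a a' q = Y.L y (\<lambda>j. q (?r + j)) + e" by (simp add: adapted_d\<tau>[OF ad])
    have bd: "K * nm n q * t \<le> 1/2 * nm n q" "K * t * nm n q \<le> 1/2 * nm n q" if "t \<le> \<rho>" for t
    proof -
      have "K * t \<le> K * \<rho>" by (rule mult_left_mono[OF that less_imp_le[OF K(1)]])
      then have "K * t \<le> 1/2" using \<rho>(3) by linarith
      then have "K * t * nm n q \<le> 1/2 * nm n q" by (rule mult_right_mono) simp
      then show "K * nm n q * t \<le> 1/2 * nm n q" "K * t * nm n q \<le> 1/2 * nm n q" by (simp_all add: mult.commute mult.left_commute)
    qed
    have "nm m (Y.co m y e) = nm m (\<lambda>j. Y.co m y (B (X.L b q) (a - x)) j + Y.co m y (B (a' - x) (X.L b q)) j)"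
      by (rule nm_cong) (simp add: e_def Y.co_add[OF y B_in B_in])
    also have "\<dots> \<le> max (nm m (Y.co m y (B (X.L b q) (a - x)))) (nm m (Y.co m y (B (a' - x) (X.L b q))))" by (rule nm_add_le)
    also have "\<dots> \<le> 1/2 * nm n q"
      using K(2)[of "X.L b q" "a - x"] K(2)[of "a' - x" "X.L b q"] bd(1)[OF a(1)[unfolded near_def]] bd(2)[OF a(2)[unfolded near_def]]
      by (simp add: nL)
    finally have en: "nm m (Y.co m y e) \<le> 1/2 * nm n q" .
    let ?E = "\<lambda>i. \<Lambda> a a' q i - q i"
    have "nm n ?E = max (nm ?r ?E) (nm m (\<lambda>j. ?E (?r + j)))" by (rule nm_split[OF mn])
    also have "nm ?r ?E = 0" by (simp add: nm_eq_0_iff \<Lambda>_def emb_nth1)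
    also have "nm m (\<lambda>j. ?E (?r + j)) = nm m (Y.co m y e)"
    proof (rule nm_cong)
      fix j assume j: "j < m"
      have "\<Lambda> a a' q (?r + j) = Y.co m y (h a a' q) j" unfolding \<Lambda>_def by (rule emb_nth2[OF mn j])
      also have "\<dots> = q (?r + j) + Y.co m y e j"
        unfolding eq using Y.co_add[OF y Y.L_in_W[OF y] eW j] Y.co_lin_nth[OF Y.is_basis_indep[OF y] j] by simp
      finally show "av (?E (?r + j)) = av (Y.co m y e j)" by simp
    qed
    finally show "nm n ?E \<le> 1/2 * nm n q" using en by simp
  qed simp
  have \<Lambda>iso: "nm n (\<lambda>i. \<Lambda> a a' q i - \<Lambda> a a' q' i) = nm n (\<lambda>i. q i - q' i)" if "near a" "near a'" for a a' q q'
    using \<Lambda>diff \<Lambda>n[OF that] by simp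
  \<comment> \<open>A linear isometry maps a box around 0 onto itself by
    \<open>isometry_image_bx\<close>. The box is taken large enough to contain the right-hand side,
    and the added 1 makes its radius positive.\<close>
  have solve: "\<exists>q. q \<in> affine_space n \<and> \<Lambda> a a' q = ?e v" if a: "near a" "near a'" for a a' v
  proof -
    define R where "R = nm n (?e v) + 1"
    have R: "R > 0" "nm n (?e v) \<le> R" by (auto simp: R_def add_nonneg_pos)
    have "X.L b ?z = 0" by simp
    then have h0: "h a a' ?z = 0" by (simp add: h_def)
    have co0: "Y.co m y 0 j = 0" if "j < m" for j using Y.co_eqI[OF y, of 0 "\<lambda>_. 0" j] that by simp
    have "\<Lambda> a a' ?z = ?z"
    proof (rule affine_eqI[of _ n])
      fix i assume i: "i < n"
      show "\<Lambda> a a' ?z i = ?z i" using i mn co0[of "i - ?r"] by (simp add: \<Lambda>_def emb_def h0)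
    qed (simp_all add: \<Lambda>_def)
    moreover have "\<Lambda> a a' ` bx n ?z R = bx n (\<Lambda> a a' ?z) R"
      by (rule isometry_image_bx[OF _ \<Lambda>iso[OF a] _ R(1)]) (simp_all add: \<Lambda>_def)
    moreover have "?e v \<in> bx n ?z R" using R by (simp add: bz bx_iff_nm)
    ultimately have "?e v \<in> \<Lambda> a a' ` bx n ?z R" by simp
    then obtain q where "q \<in> bx n ?z R" "?e v = \<Lambda> a a' q" by blast
    then show ?thesis using bx_subset_affine[of n ?z R] by auto
  qed
  \<comment> \<open>Coordinates of the vector with first coordinates \<open>v\<close> along which
    \<open>\<tau>\<close> has no increment between the two end points; a tangent vector of the fibre
    when they coincide in a point of it.\<close>
  define Q where "Q a a' v = (SOME q. q \<in> affine_space n \<and> \<Lambda> a a' q = ?e v)" for a a' v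
  have Q: "Q a a' v \<in> affine_space n" "\<Lambda> a a' (Q a a' v) = ?e v" if "near a" "near a'" for a a' v
    using someI_ex[OF solve[OF that, of v]] unfolding Q_def by blast+
  have Qnm: "nm n (Q a a' v) = nm ?r v" if "near a" "near a'" for a a' v
    using \<Lambda>n[OF that, of "Q a a' v"] Q(2)[OF that, of v] nm_emb[OF mn, of v "\<lambda>_. 0"] by simp
  have Q1: "Q a a' v i = v i" if "near a" "near a'" "i < ?r" for a a' v i
  proof -
    have "\<Lambda> a a' (Q a a' v) i = Q a a' v i" unfolding \<Lambda>_def by (rule emb_nth1[OF that(3)])
    then show ?thesis using Q(2)[OF that(1,2), of v] emb_nth1[OF that(3), of v "\<lambda>_. 0"] by simp
  qed
  have near\<phi>: "near (\<phi> v)" if "v \<in> U" for v using \<phi>B[OF that] by (simp add: near_def)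

  \<comment> \<open>The difference quotient and its continuity\<close>
  define g where "g u v t = X.L b (Q (\<phi> (translate_along ?r u v t)) (\<phi> u) v)" for u v t
  let ?G = "{(u, v, t). u \<in> U \<and> v \<in> affine_space ?r \<and> translate_along ?r u v t \<in> U}"
  have geq: "\<phi> (translate_along ?r u v t) - \<phi> u = s t (g u v t)"
    if u: "u \<in> U" and v: "v \<in> affine_space ?r" and tU: "translate_along ?r u v t \<in> U" for u v t
  proof -
    let ?a = "\<phi> (translate_along ?r u v t)" and ?a' = "\<phi> u"
    define q where "q = Q ?a ?a' v"
    define p where "p = X.co n b (?a - ?a')"
    have pL: "?a - ?a' = X.L b p" using X.L_co[OF b] by (simp add: p_def)
    have "h ?a ?a' p = \<tau> ?a - \<tau> ?a'" unfolding \<tau>_diff h_def pL[symmetric] ..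
    then have hp: "h ?a ?a' p = 0" using \<phi>T[OF u] \<phi>T[OF tU] by simp
    have co0: "Y.co m y 0 j = 0" if "j < m" for j using Y.co_eqI[OF y, of 0 "\<lambda>_. 0" j] that by simp
    have q2: "Y.co m y (h ?a ?a' q) j = 0" if j: "j < m" for j
    proof -
      have "\<Lambda> ?a ?a' q (?r + j) = Y.co m y (h ?a ?a' q) j" unfolding \<Lambda>_def by (rule emb_nth2[OF mn j])
      moreover have "?e v (?r + j) = 0" by (rule emb_nth2[OF mn j])
      ultimately show ?thesis using Q(2)[OF near\<phi>[OF tU] near\<phi>[OF u], of v] by (simp add: q_def)
    qed
    \<comment> \<open>Under \<open>\<Lambda>\<close> the vectors \<open>p\<close> and
      \<open>t * q\<close> have the same first coordinates and vanishing last ones. As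
      \<open>\<Lambda>\<close> preserves distances, they agree.\<close>
    have "nm n (\<lambda>i. p i - t * q i) = nm n (\<lambda>i. \<Lambda> ?a ?a' p i - \<Lambda> ?a ?a' (\<lambda>i. t * q i) i)"
      by (rule \<Lambda>iso[OF near\<phi>[OF tU] near\<phi>[OF u], symmetric])
    also have "\<dots> = max (nm ?r (\<lambda>i. p i - t * q i)) (nm m (\<lambda>j. Y.co m y (h ?a ?a' p) j - Y.co m y (h ?a ?a' (\<lambda>i. t * q i)) j))"
      unfolding \<Lambda>_def by (rule nm_emb_diff[OF mn])
    also have "nm ?r (\<lambda>i. p i - t * q i) = 0"
    proof -
      have "p i = t * q i" if i: "i < ?r" for i
      proof -
        have "?a - ?a' = (?a - x) - (?a' - x)" by simp
        then have "p i = X.co n b (?a - x) i - X.co n b (?a' - x) i"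
          unfolding p_def using X.co_diff[OF b, of "?a - x" "?a' - x" i] i by simp
        also have "\<dots> = translate_along ?r u v t i - u i" using \<phi>1[OF tU i] \<phi>1[OF u i] by simp
        also have "\<dots> = t * v i" using i by (simp add: translate_along_def)
        finally show ?thesis using Q1[OF near\<phi>[OF tU] near\<phi>[OF u] i, of v] by (simp add: q_def)
      qed
      then show ?thesis by (simp add: nm_eq_0_iff)
    qed
    also have "nm m (\<lambda>j. Y.co m y (h ?a ?a' p) j - Y.co m y (h ?a ?a' (\<lambda>i. t * q i)) j) = 0"
    proof -
      have "h ?a ?a' (\<lambda>i. t * q i) = s' t (h ?a ?a' q)"
        by (simp add: h_def X.lin_scale B_scale_left B_scale_right Y.scale_right_distrib)
      then show ?thesis by (simp add: nm_eq_0_iff hp co0 Y.co_scale[OF y hW] q2)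
    qed
    finally have "nm n (\<lambda>i. p i - t * q i) = 0" by simp
    then have "X.L b p = X.L b (\<lambda>i. t * q i)" by (intro lin_cong) (simp_all add: nm_eq_0_iff)
    then show ?thesis unfolding pL by (simp add: X.lin_scale g_def q_def)
  qed
  have gcont: "continuous_on ?G (\<lambda>(u, v, t). g u v t)"
  proof -
    define a where "a P = \<phi> (translate_along ?r (fst P) (fst (snd P)) (snd (snd P)))" for P :: "(nat \<Rightarrow> 'f) \<times> (nat \<Rightarrow> 'f) \<times> 'f"
    define a' where "a' P = \<phi> (fst P)" for P :: "(nat \<Rightarrow> 'f) \<times> (nat \<Rightarrow> 'f) \<times> 'f"
    define q where "q P = Q (a P) (a' P) (fst (snd P))" for P :: "(nat \<Rightarrow> 'f) \<times> (nat \<Rightarrow> 'f) \<times> 'f"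
    have uc: "continuous_on ?G (\<lambda>P. fst P)" and vc: "continuous_on ?G (\<lambda>P. fst (snd P))"
      and tc: "continuous_on ?G (\<lambda>P. snd (snd P))"
      by (intro continuous_on_fst continuous_on_snd continuous_on_id)+
    have ac: "continuous_on ?G a"
      unfolding a_def
      by (rule continuous_on_compose2[OF \<phi>cont continuous_on_translate_along[OF uc vc tc]]) auto
    have a'c: "continuous_on ?G a'"
      unfolding a'_def by (rule continuous_on_compose2[OF \<phi>cont uc]) auto
    have coa: "continuous_on ?G (\<lambda>P. X.co n b (a P))" "continuous_on ?G (\<lambda>P. X.co n b (a' P))"
      by (rule continuous_on_compose2[OF X.co_continuous[OF b subset_UNIV] ac subset_UNIV],
          rule continuous_on_compose2[OF X.co_continuous[OF b subset_UNIV] a'c subset_UNIV])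
    have nr: "near (a P)" "near (a' P)" if "P \<in> ?G" for P using that near\<phi> by (auto simp: a_def a'_def)
    have "continuous_on ?G (\<lambda>P. q P i)" if i: "i < n" for i
      unfolding continuous_on_def
    proof
      fix P0 assume P0: "P0 \<in> ?G"
      show "((\<lambda>P. q P i) \<longlongrightarrow> q P0 i) (at P0 within ?G)"
      proof (rule tendstoI)
        fix \<epsilon> :: real assume \<epsilon>: "\<epsilon> > 0"
        define k where "k = K * nm n (q P0) + 1"
        have k: "k > 0" unfolding k_def using K(1) by (intro add_nonneg_pos mult_nonneg_nonneg) auto
        have ek: "\<epsilon> / k > 0" using \<epsilon> k by simp
        have small: "K * nm n (q P0) * t < \<epsilon>" if "t < \<epsilon> / k" "0 \<le> t" for t
        proof -
          have "K * nm n (q P0) * t \<le> k * t" using that(2) by (intro mult_right_mono) (auto simp: k_def)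
          also have "\<dots> < \<epsilon>" using that(1) k by (simp add: pos_less_divide_eq mult.commute)
          finally show ?thesis .
        qed
        have "eventually (\<lambda>P. P \<in> ?G) (at P0 within ?G)" by (simp add: eventually_at_filter)
        then show "eventually (\<lambda>P. dist (q P i) (q P0 i) < \<epsilon>) (at P0 within ?G)"
          using nm_eventually[OF vc P0 \<epsilon>, of ?r] nm_eventually[OF coa(1) P0 ek, of n] nm_eventually[OF coa(2) P0 ek, of n]
        proof eventually_elim
          case (elim P)
          let ?da = "a P - a P0" and ?da' = "a' P - a' P0"
          have da: "nm n (X.co n b ?da) < \<epsilon> / k" "nm n (X.co n b ?da') < \<epsilon> / k"
          proof -
            have "nm n (X.co n b ?da) = nm n (\<lambda>i. X.co n b (a P) i - X.co n b (a P0) i)"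
              "nm n (X.co n b ?da') = nm n (\<lambda>i. X.co n b (a' P) i - X.co n b (a' P0) i)"
              by (rule nm_cong, simp add: X.co_diff[OF b])+
            then show "nm n (X.co n b ?da) < \<epsilon> / k" "nm n (X.co n b ?da') < \<epsilon> / k" using elim(3,4) by simp_all
          qed
          \<comment> \<open>The solutions at \<open>P\<close> and \<open>P0\<close> are compared by
            applying the isometry at \<open>P\<close> to both; the discrepancy is the change of
            \<open>v\<close> together with the change of the equation at the fixed vector
            \<open>q P0\<close>.\<close>
          have hh: "h (a P) (a' P) (q P0) = h (a P0) (a' P0) (q P0) + (B (X.L b (q P0)) ?da + B ?da' (X.L b (q P0)))"
            by (simp add: h_def B_diff_left B_diff_right)
          let ?w = "B (X.L b (q P0)) ?da + B ?da' (X.L b (q P0))"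
          have wW: "?w \<in> W'" by (simp add: B_in Y.subspace_add[OF Y.subspace_W])
          have nw: "nm m (Y.co m y ?w) < \<epsilon>"
          proof -
            have "nm m (Y.co m y ?w) = nm m (\<lambda>j. Y.co m y (B (X.L b (q P0)) ?da) j + Y.co m y (B ?da' (X.L b (q P0))) j)"
              by (rule nm_cong) (simp add: Y.co_add[OF y B_in B_in])
            also have "\<dots> \<le> max (nm m (Y.co m y (B (X.L b (q P0)) ?da))) (nm m (Y.co m y (B ?da' (X.L b (q P0)))))" by (rule nm_add_le)
            also have "\<dots> < \<epsilon>"
            proof -
              have "nm m (Y.co m y (B (X.L b (q P0)) ?da)) < \<epsilon>"
                using K(2)[of "X.L b (q P0)" ?da] small[OF da(1)] by (simp add: nL)
              moreover have "nm m (Y.co m y (B ?da' (X.L b (q P0)))) < \<epsilon>"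
                using K(2)[of ?da' "X.L b (q P0)"] small[OF da(2)] by (simp add: nL mult.commute mult.left_commute)
              ultimately show ?thesis by simp
            qed
            finally show ?thesis .
          qed
          have e1: "\<Lambda> (a P) (a' P) (q P) = ?e (fst (snd P))" unfolding q_def by (rule Q(2)[OF nr[OF elim(1)]])
          have e0: "\<Lambda> (a P0) (a' P0) (q P0) = ?e (fst (snd P0))" unfolding q_def by (rule Q(2)[OF nr[OF P0]])
          have h0: "Y.co m y (h (a P0) (a' P0) (q P0)) j = 0" if j: "j < m" for j
          proof -
            have "\<Lambda> (a P0) (a' P0) (q P0) (?r + j) = Y.co m y (h (a P0) (a' P0) (q P0)) j" unfolding \<Lambda>_def by (rule emb_nth2[OF mn j])
            then show ?thesis unfolding e0 emb_nth2[OF mn j] by simp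
          qed
          have q0: "q P0 i = fst (snd P0) i" if "i < ?r" for i
            unfolding q_def by (rule Q1[OF nr[OF P0] that])
          have "nm n (\<lambda>i. q P i - q P0 i) = nm n (\<lambda>i. ?e (fst (snd P)) i - \<Lambda> (a P) (a' P) (q P0) i)"
            using \<Lambda>iso[OF nr[OF elim(1)], of "q P" "q P0"] unfolding e1 by simp
          also have "\<dots> = max (nm ?r (\<lambda>i. fst (snd P) i - q P0 i)) (nm m (\<lambda>j. 0 - Y.co m y (h (a P) (a' P) (q P0)) j))"
            unfolding \<Lambda>_def by (rule nm_emb_diff[OF mn])
          also have "nm ?r (\<lambda>i. fst (snd P) i - q P0 i) = nm ?r (\<lambda>i. fst (snd P) i - fst (snd P0) i)"
            by (rule nm_cong) (simp add: q0)
          also have "nm m (\<lambda>j. 0 - Y.co m y (h (a P) (a' P) (q P0)) j) = nm m (Y.co m y ?w)"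
            by (rule nm_cong) (simp add: hh Y.co_add[OF y hW wW] h0)
          finally have "nm n (\<lambda>i. q P i - q P0 i) < \<epsilon>" using elim(2) nw by simp
          then have "av (q P i - q P0 i) < \<epsilon>" using av_le_nm[OF i, of "\<lambda>i. q P i - q P0 i"] by simp
          then show "dist (q P i) (q P0 i) < \<epsilon>" by (simp add: dist_eq_av[of "q P i"] av_minus_commute)
        qed
      qed
    qed
    then have "continuous_on ?G (\<lambda>P. X.L b (q P))" by (rule X.continuous_on_lin)
    moreover have "(\<lambda>(u, v, t). g u v t) = (\<lambda>P. X.L b (q P))" by (auto simp: g_def q_def a_def a'_def)
    ultimately show ?thesis by simp
  qed
  have gq: "C1_quotient s ?r U \<phi> g" unfolding C1_quotient_def using gcont geq by blast
  have "local_parametrization s XT ?r U \<phi>"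
    unfolding local_parametrization_def
  proof (intro conjI ballI allI impI)
    show "openin (top_of_set (affine_space ?r)) U" by (rule oU)
    show "openin (top_of_set XT) (\<phi> ` U)" unfolding img by (rule openin_open_Int[OF openB])
    show "\<exists>\<psi>. homeomorphism U (\<phi> ` U) \<phi> \<psi>" using hom by blast
    show "C1_map s ?r U \<phi>" using gq C1_map_iff by blast
    fix u c i assume u: "u \<in> U" and c: "(\<Sum>i<?r. s (c i) (partial_deriv s \<phi> u i)) = 0" and i: "i < ?r"
    have ua: "u \<in> affine_space ?r" using u UA by blast
    \<comment> \<open>The first coordinates of \<open>q l\<close> are those of the
      \<open>l\<close>-th unit vector, so a relation among the partial derivatives has zero
      coefficients.\<close>
    define q where "q l = Q (\<phi> u) (\<phi> u) (unit_vec ?r l)" for l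
    have pd: "partial_deriv s \<phi> u l = X.L b (q l)" if "l < ?r" for l
      using X.partial_deriv_eq[OF gq oU u that] by (simp add: g_def q_def translate_along_zero[OF ua])
    have "(\<Sum>l<k. s (c l) (X.L b (q l))) = X.L b (\<lambda>i. \<Sum>l<k. c l * q l i)" for k
      by (induction k) (simp_all add: X.lin_add X.lin_scale)
    then have "X.L b (\<lambda>i. \<Sum>l<?r. c l * q l i) = 0" using c pd by simp
    then have "(\<Sum>l<?r. c l * q l i) = 0" using X.is_basis_indep[OF b] i unfolding X.indep_def by (meson diff_le_self less_le_trans)
    moreover have "(\<Sum>l<?r. c l * q l i) = (\<Sum>l<?r. if l = i then c i else 0)"
    proof (rule sum.cong)
      fix l assume "l \<in> {..<?r}"
      have "q l i = unit_vec ?r l i" unfolding q_def by (rule Q1[OF near\<phi>[OF u] near\<phi>[OF u] i])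
      then show "c l * q l i = (if l = i then c i else 0)" using i by (simp add: unit_vec_def)
    qed simp
    ultimately show "c i = 0" using i by simp
  qed
  moreover have "x \<in> \<phi> ` U"
  proof -
    have zU: "restrict (\<lambda>_. 0) {..<?r} \<in> U" using \<rho>(1) by (simp add: U_def bx_iff)
    have "?e (restrict (\<lambda>_. 0) {..<?r}) = ?z" unfolding emb_def by (intro restrict_ext) simp
    then have "\<phi> (restrict (\<lambda>_. 0) {..<?r}) = x" using f0(2) by (simp add: \<phi>_def)
    then show ?thesis using imageI[OF zU, of \<phi>] by simp
  qed
  ultimately show ?thesis by blast
qed

text \<open>The measure built from tube densities satisfies the chart formula, and charts cover the
  fibre, so it is the measure of the relative form. Its value on the trace of \<open>C\<close> is
  the density of \<open>C\<close>.\<close>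

theorem fibre_formula:
  assumes C: "compact C" "open C"
  shows "\<exists>c V. 0 \<le> c \<and> emeasure (form_measure s XT (n - m) rel) (C \<inter> XT) = ennreal c \<and>
    openin (top_of_set W') V \<and> T \<in> V \<and>
    (\<forall>U. U \<subseteq> V \<and> compact U \<and> openin (top_of_set W') U \<longrightarrow>
      emeasure \<mu>X (C \<inter> \<tau> -` U) = ennreal c * emeasure \<mu>Y U)"
proof -
  from fibre_measure_exists obtain M where
    "sets M = sets (restrict_space borel XT) \<and>
      (\<forall>A c. compact A \<and> open A \<and> tube_density A c \<longrightarrow> emeasure M (A \<inter> XT) = ennreal c)" ..
  then have M: "sets M = sets (restrict_space borel XT)"
    "\<And>A c. compact A \<Longrightarrow> open A \<Longrightarrow> tube_density A c \<Longrightarrow> emeasure M (A \<inter> XT) = ennreal c" by simp_all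
  have "is_form_measure s XT (n - m) rel M"
    by (rule X.is_form_measureI[OF M(1)]) (rule fibre_chart_measure[OF _ _ M(2)])
  then have FM: "form_measure s XT (n - m) rel = M"
    by (rule X.form_measure_eqI[OF subset_UNIV]) (rule chart_exists, simp)
  from tube_density_exists[OF C] obtain c where c: "tube_density C c" ..
  have "0 \<le> c \<and> (\<exists>V. openin (top_of_set W') V \<and> T \<in> V \<and>
    (\<forall>U. U \<subseteq> V \<and> compact U \<and> openin (top_of_set W') U \<longrightarrow>
      emeasure \<mu>X (C \<inter> \<tau> -` U) = ennreal c * emeasure \<mu>Y U))"
    using c unfolding tube_density_def .
  then show ?thesis
    unfolding FM using M(2)[OF C c] by (elim conjE exE) (intro exI conjI)
qed

end


section \<open>Quadratic extensions\<close>

lemma quadratic_mult: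
  fixes x :: "'a::comm_ring_1"
  assumes "x * x = B + A * x"
  shows "(U + V * x) * (U' + V' * x) = (U * U' + V * V' * B) + (U * V' + V * U' + V * V' * A) * x"
proof -
  have "(U + V * x) * (U' + V' * x) = U * U' + (U * V' + V * U') * x + V * V' * (x * x)"
    by (simp add: algebra_simps)
  also have "V * V' * (x * x) = V * V' * B + V * V' * A * x"
    unfolding assms by (simp add: algebra_simps)
  finally show ?thesis by (simp add: algebra_simps)
qed

locale field_hom =
  fixes \<iota> :: "'f::field \<Rightarrow> 'k::field"
  assumes emb: "field_embedding \<iota>"
begin

lemma one [simp]: "\<iota> 1 = 1" and add: "\<iota> (a + b) = \<iota> a + \<iota> b" and mult: "\<iota> (a * b) = \<iota> a * \<iota> b"
  using emb by (auto simp: field_embedding_def)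

lemma zero [simp]: "\<iota> 0 = 0"
proof -
  have "\<iota> 0 + 0 = \<iota> 0 + \<iota> 0" using add[of 0 0] by (simp only: add_0_right)
  then have "0 = \<iota> 0" by (simp only: add_left_cancel)
  then show ?thesis by (rule sym)
qed

lemma minus: "\<iota> (- a) = - \<iota> a"
  using add[of a "- a"] by (simp add: eq_neg_iff_add_eq_0 add.commute)

lemma diff: "\<iota> (a - b) = \<iota> a - \<iota> b"
  using add[of a "- b"] by (simp add: minus)

lemma eq_0_iff [simp]: "\<iota> a = 0 \<longleftrightarrow> a = 0"
proof
  assume "\<iota> a = 0"
  then show "a = 0" using mult[of a "inverse a"] by (cases "a = 0") auto
qed simp

lemma vector_space_mult: "vector_space (\<lambda>a x. \<iota> a * x)"
  by unfold_locales (simp_all add: add mult algebra_simps)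

end

lemma field_homI: "field_embedding \<iota> \<Longrightarrow> field_hom \<iota>" by unfold_locales

locale quadratic_extension = field_hom \<iota>
  for \<iota> :: "'f::field \<Rightarrow> 'k::field" +
  assumes dim_2: "vector_space.dim (\<lambda>a x. \<iota> a * x) (UNIV :: 'k set) = 2"
begin

sublocale V: vector_space "\<lambda>a x. \<iota> a * x" by (rule vector_space_mult)

lemma basis_obtain: obtains B where "finite B" "card B = 2" "V.independent B" "V.span B = UNIV"
proof -
  obtain B where B: "B \<subseteq> (UNIV :: 'k set)" "V.independent B" "UNIV \<subseteq> V.span B" "card B = V.dim (UNIV :: 'k set)"
    by (rule V.basis_exists)
  then have "card B = 2" using dim_2 by simp
  \<comment> \<open>An infinite basis would have cardinality 0.\<close>
  moreover from this have "finite B" by (intro card_ge_0_finite) simp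
  ultimately show thesis using that[of B] B by blast
qed

lemma span_one: "V.span {1} = range \<iota>"
  by (simp add: V.span_singleton)

lemma exists_not_in_range: "\<exists>x. x \<notin> range \<iota>"
proof (rule ccontr)
  assume "\<not> ?thesis"
  then have "V.span {1} = UNIV" by (simp add: span_one surj_def) blast
  moreover obtain B where "finite B" "card B = 2" "V.independent B" by (rule basis_obtain)
  ultimately show False using V.independent_span_bound[of "{1}" B] by simp
qed

lemma decomposition:
  assumes x: "x \<notin> range \<iota>"
  shows "\<exists>u v. z = \<iota> u + \<iota> v * x"
proof (rule ccontr)
  assume no: "\<not> ?thesis"
  have "z \<notin> V.span {x, 1}"
  proof
    assume "z \<in> V.span {x, 1}"
    then obtain v where "z - \<iota> v * x \<in> V.span {1}" by (auto simp: V.span_breakdown_eq)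
    then obtain u where "z - \<iota> v * x = \<iota> u" unfolding span_one by blast
    then have "z = \<iota> u + \<iota> v * x" by (simp add: algebra_simps)
    then show False using no by blast
  qed
  moreover have "V.independent {x, 1}"
    using x by (simp add: V.independent_insert span_one V.dependent_single)
  ultimately have ind: "V.independent {z, x, 1}" by (rule V.independent_insertI)
  have zx: "z \<noteq> x" "z \<noteq> 1" "x \<noteq> 1"
  proof -
    show "z \<noteq> x" "z \<noteq> 1" using \<open>z \<notin> V.span {x, 1}\<close> V.span_base[of _ "{x, 1}"] by auto
    show "x \<noteq> 1" using x one by (metis rangeI)
  qed
  obtain B where B: "finite B" "card B = 2" "V.span B = UNIV" by (rule basis_obtain)
  have "card {z, x, 1} \<le> card B"
    using V.independent_span_bound[OF B(1) ind] B(3) by simp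
  then show False using zx B(2) by simp
qed

lemma decomposition_unique:
  assumes x: "x \<notin> range \<iota>" and eq: "\<iota> u + \<iota> v * x = \<iota> u' + \<iota> v' * x"
  shows "u = u' \<and> v = v'"
proof -
  have *: "\<iota> (v - v') * x = \<iota> (u' - u)" using eq by (simp add: diff algebra_simps)
  have "v = v'"
  proof (rule ccontr)
    assume ne: "v \<noteq> v'"
    have "x = \<iota> (inverse (v - v')) * (\<iota> (v - v') * x)"
      using ne by (simp add: mult.assoc[symmetric] mult[symmetric])
    then have "x = \<iota> (inverse (v - v') * (u' - u))" unfolding * by (simp add: mult)
    then show False using x by blast
  qed
  moreover have "\<iota> (u' - u) = 0" using * calculation by simp
  ultimately show ?thesis by simp
qed

text \<open>\<open>\<sigma> x\<close> is a root of the quadratic equation of \<open>x\<close>, hence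
  equals \<open>x\<close> or \<open>\<iota> a - x\<close>.\<close>

lemma galois_involution:
  assumes \<sigma>: "\<sigma> \<in> galois_group \<iota>"
  shows "\<sigma> (\<sigma> x) = x"
proof (cases "x \<in> range \<iota>")
  case True
  then show ?thesis using \<sigma> by (auto simp: galois_group_def)
next
  case False
  interpret \<sigma>: field_hom \<sigma> using \<sigma> by unfold_locales (simp add: galois_group_def)
  have fix_base: "\<sigma> (\<iota> a) = \<iota> a" for a using \<sigma> by (simp add: galois_group_def)
  obtain b a where q: "x * x = \<iota> b + \<iota> a * x" using decomposition[OF False] by blast
  have q': "\<sigma> x * \<sigma> x = \<iota> b + \<iota> a * \<sigma> x"
    using arg_cong[OF q, of \<sigma>] by (simp add: \<sigma>.mult \<sigma>.add fix_base)
  have "(\<sigma> x - x) * (\<sigma> x - (\<iota> a - x)) = (\<sigma> x * \<sigma> x - \<iota> a * \<sigma> x) - (x * x - \<iota> a * x)"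
    by (simp add: algebra_simps)
  also have "\<dots> = 0" unfolding q q' by simp
  finally have "\<sigma> x = x \<or> \<sigma> x = \<iota> a - x" by auto
  then show ?thesis by (elim disjE) (simp_all add: \<sigma>.diff fix_base)
qed

text \<open>The automorphism sending \<open>x\<close> to the other root of its equation. In
  characteristic 2 with \<open>a \<noteq> 0\<close> it moves \<open>x\<close>, which will show that
  the generator \<open>\<sigma>\<close> is not the identity.\<close>

lemma conjugation_in_galois_group:
  assumes x: "x \<notin> range \<iota>" and q: "x * x = \<iota> b + \<iota> a * x"
  shows "\<exists>\<rho> \<in> galois_group \<iota>. \<rho> x = \<iota> a - x"
proof -
  define P where "P z w \<longleftrightarrow> (\<exists>u v. z = \<iota> u + \<iota> v * x \<and> w = \<iota> u + \<iota> v * (\<iota> a - x))" for z w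
  define \<rho> where "\<rho> z = (THE w. P z w)" for z
  have \<rho>: "\<rho> (\<iota> u + \<iota> v * x) = \<iota> u + \<iota> v * (\<iota> a - x)" for u v
    unfolding \<rho>_def P_def using decomposition_unique[OF x] by (intro the_equality) blast+
  have base: "\<rho> (\<iota> u) = \<iota> u" for u using \<rho>[of u 0] by simp
  have add\<rho>: "\<rho> (z + z') = \<rho> z + \<rho> z'" and mult\<rho>: "\<rho> (z * z') = \<rho> z * \<rho> z'" for z z'
  proof -
    obtain u v where z: "z = \<iota> u + \<iota> v * x" using decomposition[OF x] by blast
    obtain u' v' where z': "z' = \<iota> u' + \<iota> v' * x" using decomposition[OF x] by blast
    have "z + z' = \<iota> (u + u') + \<iota> (v + v') * x" by (simp add: z z' add algebra_simps)
    then show "\<rho> (z + z') = \<rho> z + \<rho> z'" unfolding z z' by (simp only: \<rho>) (simp add: add algebra_simps)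
    have zz: "z * z' = \<iota> (u * u' + v * v' * b) + \<iota> (u * v' + v * u' + v * v' * a) * x"
      unfolding z z' quadratic_mult[OF q] by (simp add: add mult)
    have "(\<iota> a - x) * (\<iota> a - x) = \<iota> a * (\<iota> a - x) - (\<iota> a * x - x * x)" by (simp add: algebra_simps)
    then have y: "(\<iota> a - x) * (\<iota> a - x) = \<iota> b + \<iota> a * (\<iota> a - x)" unfolding q by simp
    show "\<rho> (z * z') = \<rho> z * \<rho> z'"
      unfolding zz \<rho> unfolding z z' \<rho> quadratic_mult[OF y] by (simp add: add mult)
  qed
  have \<rho>x: "\<rho> x = \<iota> a - x" using \<rho>[of 0 1] by simp
  have fe: "field_embedding \<rho>" unfolding field_embedding_def using add\<rho> mult\<rho> base[of 1] by simp
  interpret \<rho>: field_hom \<rho> by (rule field_homI[OF fe])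
  have inv: "\<rho> (\<rho> z) = z" for z
  proof -
    obtain u v where z: "z = \<iota> u + \<iota> v * x" using decomposition[OF x] by blast
    show ?thesis unfolding z by (simp add: \<rho>.add \<rho>.mult \<rho>.diff base \<rho>x)
  qed
  have "bij \<rho>" by (rule involuntory_imp_bij[OF inv])
  then have "\<rho> \<in> galois_group \<iota>" using fe base by (simp add: galois_group_def)
  then show ?thesis using \<rho>x by blast
qed

text \<open>Division with remainder by X^2 - b, by induction on the coefficients and together with
  the value at \<open>x\<close>, where X^2 - b vanishes.\<close>

lemma divide_quadratic:
  assumes q: "x * x = \<iota> b"
  shows "\<exists>s r0 r1. p = [:- b, 0, 1:] * s + [:r0, r1:] \<and> poly (map_poly \<iota> p) x = \<iota> r0 + \<iota> r1 * x"
proof (induction p)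
  case 0
  show ?case by (rule exI[of _ 0], rule exI[of _ 0], rule exI[of _ 0]) simp
next
  case (pCons a p)
  then obtain s r0 r1 where p: "p = [:- b, 0, 1:] * s + [:r0, r1:]" and ev: "poly (map_poly \<iota> p) x = \<iota> r0 + \<iota> r1 * x"
    by blast
  have "pCons a p = [:- b, 0, 1:] * pCons r1 s + [:a + b * r1, r0:]"
    unfolding p by (simp add: mult.commute)
  moreover have "poly (map_poly \<iota> (pCons a p)) x = \<iota> (a + b * r1) + \<iota> r0 * x"
  proof -
    have "poly (map_poly \<iota> (pCons a p)) x = \<iota> a + (\<iota> r0 * x + \<iota> r1 * (x * x))"
      by (simp add: map_poly_pCons ev algebra_simps)
    then show ?thesis unfolding q by (simp add: add mult algebra_simps)
  qed
  ultimately show ?case by blast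
qed

text \<open>In characteristic 2 this is where separability enters: it gives an element that is not fixed
  by \<open>\<sigma>\<close>, whose trace is therefore nonzero.\<close>

lemma trace_one_exists:
  assumes sep: "\<And>x. \<exists>p. coprime p (pderiv p) \<and> poly (map_poly \<iota> p) x = 0"
    and gal: "galois_group \<iota> = range (\<lambda>n::nat. \<sigma> ^^ n)"
  shows "\<exists>c. c + \<sigma> c = 1"
proof -
  have \<sigma>: "\<sigma> \<in> galois_group \<iota>" unfolding gal by (rule range_eqI[of _ _ 1]) simp
  interpret \<sigma>: field_hom \<sigma> using \<sigma> by unfold_locales (simp add: galois_group_def)
  show ?thesis
  proof (cases "(1::'k) + 1 = 0")
    case False
    let ?c = "inverse (1 + 1 :: 'k)"
    have "\<sigma> ?c * (1 + 1) = \<sigma> (?c * (1 + 1))" by (simp only: \<sigma>.mult \<sigma>.add \<sigma>.one)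
    also have "\<dots> = ?c * (1 + 1)" using False by simp
    finally have "\<sigma> ?c = ?c" using False mult_right_cancel by blast
    then have "?c + \<sigma> ?c = ?c * (1 + 1)" by (simp only: distrib_left mult_1_right)
    then show ?thesis using False by auto
  next
    case True
    have m: "- z = z" for z :: 'k
    proof -
      have "z + z = (1 + 1) * z" by (simp only: distrib_right mult_1_left)
      then show ?thesis using True by (simp add: neg_eq_iff_add_eq_0)
    qed
    obtain x where x: "x \<notin> range \<iota>" using exists_not_in_range by blast
    obtain b a where q: "x * x = \<iota> b + \<iota> a * x" using decomposition[OF x] by blast
    have a: "a \<noteq> 0"
    proof
      assume "a = 0"
      \<comment> \<open>X^2 - b then divides the separable polynomial \<open>p\<close> that vanishes
        at \<open>x\<close>. In characteristic 2 its derivative is 0, so it divides the derivative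
        of \<open>p\<close> as well, contrary to coprimality.\<close>
      then have q0: "x * x = \<iota> b" using q by simp
      obtain p where p: "coprime p (pderiv p)" "poly (map_poly \<iota> p) x = 0" using sep by blast
      obtain s r0 r1 where s: "p = [:- b, 0, 1:] * s + [:r0, r1:]" "poly (map_poly \<iota> p) x = \<iota> r0 + \<iota> r1 * x"
        using divide_quadratic[OF q0] by blast
      have "r0 = 0 \<and> r1 = 0" using decomposition_unique[OF x, of r0 r1 0 0] s(2) p(2) by simp
      then have ps: "p = [:- b, 0, 1:] * s" using s(1) by simp
      have "\<iota> (1 + 1) = 0" using True by (simp only: add one)
      then have "(2::'f) = 0" by simp
      then have "pderiv [:- b, 0, 1:] = 0" by (simp add: pderiv_pCons)
      then have "pderiv p = [:- b, 0, 1:] * pderiv s" unfolding ps pderiv_mult by simp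
      then have "[:- b, 0, 1:] dvd p" "[:- b, 0, 1:] dvd pderiv p" using ps by (metis dvd_triv_left)+
      then have "is_unit [:- b, 0, 1:]" using p(1) coprime_common_divisor by blast
      then show False by (simp add: is_unit_iff_degree)
    qed
    obtain \<rho> where \<rho>: "\<rho> \<in> galois_group \<iota>" "\<rho> x = \<iota> a - x" using conjugation_in_galois_group[OF x q] by blast
    have "\<rho> x \<noteq> x"
    proof
      assume "\<rho> x = x"
      then have "\<iota> a = x + x" using \<rho>(2) by (simp add: algebra_simps)
      also have "\<dots> = 0" using m[of x] by (metis add.right_inverse)
      finally show False using a by simp
    qed
    moreover obtain n where "\<rho> = \<sigma> ^^ n" using \<rho>(1) unfolding gal by blast
    ultimately have "(\<sigma> ^^ n) x \<noteq> x" by simp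
    then have "\<exists>z. \<sigma> z \<noteq> z"
    proof (rule contrapos_np)
      assume "\<not> (\<exists>z. \<sigma> z \<noteq> z)"
      then have "\<sigma> = id" by auto
      then show "(\<sigma> ^^ n) x = x" by simp
    qed
    then obtain z where z: "\<sigma> z \<noteq> z" by blast
    \<comment> \<open>The trace of an element moved by \<open>\<sigma>\<close>; it is nonzero
      because \<open>- z = z\<close>, and dividing by it normalises the trace to 1.\<close>
    define t where "t = z + \<sigma> z"
    have t: "t \<noteq> 0"
    proof
      assume "t = 0"
      then have "\<sigma> z = - z" by (simp add: t_def eq_neg_iff_add_eq_0 add.commute)
      then show False using z m by simp
    qed
    have \<sigma>t: "\<sigma> t = t" by (simp add: t_def \<sigma>.add galois_involution[OF \<sigma>] add.commute)
    have "\<sigma> (z / t) * t = \<sigma> (z / t * t)" unfolding \<sigma>.mult \<sigma>t ..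
    also have "\<dots> = \<sigma> z" using t by simp
    finally have "(z / t + \<sigma> (z / t)) * t = t" using t by (simp add: distrib_right t_def)
    then have "z / t + \<sigma> (z / t) = 1" using t by simp
    then show ?thesis by blast
  qed
qed

end

section \<open>Finite dimensional spaces and their powers\<close>

locale findim_tvs = tvs s
  for s :: "'f::nonarch_local_field \<Rightarrow> 'w::{topological_ab_group_add,t2_space} \<Rightarrow> 'w" +
  assumes finite_span: "\<exists>T. finite T \<and> span T = UNIV"
begin

lemma ftvs_subspace:
  assumes W: "subspace W"
  shows "ftvs s W (dim W)"
proof unfold_locales
  obtain T where T: "finite T" "span T = UNIV" using finite_span by blast
  obtain B where B: "B \<subseteq> W" "independent B" "W \<subseteq> span B" "card B = dim W" by (rule basis_exists)
  have "finite B" using independent_span_bound[OF T(1) B(2)] T(2) by simp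
  moreover have "span B = W" using B(1,3) W by (simp add: span_minimal subset_antisym)
  ultimately show "\<exists>B. finite B \<and> independent B \<and> span B = W \<and> card B = dim W" using B by blast
qed (rule W)

lemma findim_tvs_vec: "findim_tvs (\<lambda>a (x :: 'w ^ 'd::finite). \<chi> i. s a (x $ i))"
proof -
  let ?s = "\<lambda>a (x :: 'w ^ 'd). \<chi> i. s a (x $ i)"
  interpret V: vector_space ?s
    by unfold_locales (simp_all add: vec_eq_iff scale_right_distrib scale_left_distrib)
  show ?thesis
  proof unfold_locales
    have "continuous_on UNIV (\<lambda>p :: 'f \<times> ('w ^ 'd). s (fst p) (snd p $ i))" for i
    proof -
      have "continuous_on UNIV (\<lambda>p :: 'f \<times> ('w ^ 'd). (fst p, snd p $ i))"
        by (intro continuous_on_Pair continuous_on_fst continuous_on_component continuous_on_snd continuous_on_id)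
      from continuous_on_compose2[OF cont_scale this] show ?thesis by simp
    qed
    then have "continuous_on UNIV (\<lambda>p. ?s (fst p) (snd p))" by (rule continuous_on_vec_lambda)
    then show "continuous_on UNIV (\<lambda>(a, x). ?s a x)" by (simp add: case_prod_beta)
    obtain T where T: "finite T" "span T = UNIV" using finite_span by blast
    define T' where "T' = (\<lambda>(i, w). axis i w :: 'w ^ 'd) ` (UNIV \<times> T)"
    have ax: "axis i w \<in> V.span T'" for i w
    proof -
      have "w \<in> span T" using T(2) by simp
      then show ?thesis
      proof (induction rule: span_induct)
        case base
        have a0: "axis i 0 = (0 :: 'w ^ 'd)"
          and a1: "axis i (a + b) = axis i a + (axis i b :: 'w ^ 'd)"
          and a2: "axis i (s c a) = ?s c (axis i a)" for a b c
          by (simp_all add: vec_eq_iff axis_def)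
        show ?case
        proof (rule subspaceI)
          show "0 \<in> {w. axis i w \<in> V.span T'}" unfolding mem_Collect_eq a0 by (rule V.span_zero)
        next
          fix a b assume "a \<in> {w. axis i w \<in> V.span T'}" "b \<in> {w. axis i w \<in> V.span T'}"
          then show "a + b \<in> {w. axis i w \<in> V.span T'}" unfolding mem_Collect_eq a1 by (rule V.span_add)
        next
          fix c a assume "a \<in> {w. axis i w \<in> V.span T'}"
          then show "s c a \<in> {w. axis i w \<in> V.span T'}" unfolding mem_Collect_eq a2 by (rule V.span_scale)
        qed
      next
        case (step w)
        then show ?case by (intro V.span_base) (auto simp: T'_def)
      qed
    qed
    have "x \<in> V.span T'" for x
    proof -
      have "x = (\<Sum>i\<in>UNIV. axis i (x $ i))"
        by (simp add: vec_eq_iff axis_def sum.delta)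
      moreover have "(\<Sum>i\<in>UNIV. axis i (x $ i)) \<in> V.span T'" by (intro V.span_sum ax)
      ultimately show ?thesis by simp
    qed
    moreover have "finite T'" using T(1) by (simp add: T'_def)
    ultimately show "\<exists>T. finite T \<and> V.span T = UNIV" by (intro exI[of _ T']) auto
  qed
qed

end


section \<open>The moment map\<close>

lemma openin_Collect_neq:
  fixes f :: "'a::topological_space \<Rightarrow> 'b::t1_space"
  assumes "continuous_on UNIV f"
  shows "openin (top_of_set W) {x \<in> W. f x \<noteq> c}"
proof -
  have "open (f -` (- {c}))" by (rule open_vimage[OF _ assms]) (rule open_Compl[OF closed_singleton])
  then have "openin (top_of_set W) (W \<inter> f -` (- {c}))" by (rule openin_open_Int)
  moreover have "W \<inter> f -` (- {c}) = {x \<in> W. f x \<noteq> c}" by auto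
  ultimately show ?thesis by simp
qed

lemma continuous_on_det:
  "continuous_on S (det :: 'k::{comm_ring_1,topological_comm_monoid_mult,topological_comm_monoid_add} ^ 'd ^ 'd \<Rightarrow> 'k)"
  unfolding det_def
  by (intro continuous_on_sum continuous_on_mult' continuous_on_prod' continuous_on_const
      continuous_on_component continuous_on_id)

text \<open>For \<open>t \<noteq> 0\<close> the quotient equals
  \<open>d\<tau> x v + s' t (\<tau> v)\<close>. This identifies \<open>deriv_moment\<close> with the
  algebraic differential.\<close>

lemma (in quad) deriv_\<tau>: "Lim (at 0) (\<lambda>t. s' (inverse t) (\<tau> (x + s t v) - \<tau> x)) = d\<tau> x v"
proof (rule tendsto_Lim)
  have "((\<lambda>t. d\<tau> x v + s' t (\<tau> v)) \<longlongrightarrow> d\<tau> x v + s' 0 (\<tau> v)) (at 0)"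
    by (intro tendsto_add tendsto_const Y.tendsto_scale tendsto_ident_at)
  then have lim: "((\<lambda>t. d\<tau> x v + s' t (\<tau> v)) \<longlongrightarrow> d\<tau> x v) (at 0)" by simp
  have "s' (inverse t) (\<tau> (x + s t v) - \<tau> x) = d\<tau> x v + s' t (\<tau> v)" if "t \<noteq> 0" for t
  proof -
    have "\<tau> (s t v) = s' (t * t) (\<tau> v)" by (simp add: \<tau>_def B_scale_left B_scale_right)
    then show ?thesis
      using that by (simp add: \<tau>_add d\<tau>_scale Y.scale_right_distrib mult.assoc[symmetric])
  qed
  then have "eventually (\<lambda>t. d\<tau> x v + s' t (\<tau> v) = s' (inverse t) (\<tau> (x + s t v) - \<tau> x)) (at 0)"
    unfolding eventually_at_filter by (intro always_eventually) simp
  then show "((\<lambda>t. s' (inverse t) (\<tau> (x + s t v) - \<tau> x)) \<longlongrightarrow> d\<tau> x v) (at 0)"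
    by (rule Lim_transform_eventually[OF lim])
qed simp

locale hermitian_setting =
  fixes \<iota> :: "'f::nonarch_local_field \<Rightarrow> 'k::nonarch_local_field"
    and \<sigma> :: "'k \<Rightarrow> 'k"
    and sV :: "'k \<Rightarrow> 'v::{topological_ab_group_add,t2_space} \<Rightarrow> 'v"
    and h :: "'v \<Rightarrow> 'v \<Rightarrow> 'k"
  assumes extension: "separable_quadratic_extension \<iota>"
    and galois: "galois_group \<iota> = range (\<lambda>n::nat. \<sigma> ^^ n)"
    and findim: "findim_topological_vector_space sV"
    and hermitian: "hermitian_form sV \<sigma> h"
begin

sublocale quadratic_extension \<iota>
  using extension unfolding separable_quadratic_extension_def
  by (auto intro!: quadratic_extension.intro quadratic_extension_axioms.intro field_hom.intro)

lemma \<sigma>_galois: "\<sigma> \<in> galois_group \<iota>" unfolding galois by (rule range_eqI[of _ _ 1]) simp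

sublocale \<sigma>: field_hom \<sigma>
  using \<sigma>_galois by unfold_locales (simp add: galois_group_def)

lemma \<sigma>_\<iota> [simp]: "\<sigma> (\<iota> a) = \<iota> a" using \<sigma>_galois by (simp add: galois_group_def)

lemma \<sigma>_\<sigma> [simp]: "\<sigma> (\<sigma> z) = z" by (rule galois_involution[OF \<sigma>_galois])

definition half :: 'k where "half = (SOME c. c + \<sigma> c = 1)"

lemma half: "half + \<sigma> half = 1"
proof -
  have "\<exists>p. coprime p (pderiv p) \<and> poly (map_poly \<iota> p) x = 0" for x
    using extension unfolding separable_quadratic_extension_def by blast
  then show ?thesis unfolding half_def by (rule someI_ex[OF trace_one_exists[OF _ galois]])
qed

lemma continuous_\<iota>: "continuous_on S \<iota>"
  using extension continuous_on_subset[of UNIV \<iota> S] by (auto simp: separable_quadratic_extension_def)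

lemma hermD:
  "h (x + x') y = h x y + h x' y" "h (sV a x) y = a * h x y"
  "h x (y + y') = h x y + h x y'" "h x (sV a y) = \<sigma> a * h x y" "\<sigma> (h x y) = h y x"
proof -
  note * = hermitian[unfolded hermitian_form_def]
  show "h (x + x') y = h x y + h x' y" using * by blast
  show "h (sV a x) y = a * h x y" using * by blast
  show "h x (y + y') = h x y + h x y'" using * by blast
  show "h x (sV a y) = \<sigma> a * h x y" using * by blast
  have "h y x = \<sigma> (h x y)" using * by blast
  then show "\<sigma> (h x y) = h y x" by (rule sym)
qed

lemma h_zero_left: "h 0 y = 0"
proof -
  have "h 0 y + 0 = h 0 y + h 0 y" using hermD(1)[of 0 0 y] by (simp only: add_0_right)
  then have "0 = h 0 y" by (simp only: add_left_cancel)
  then show ?thesis by (rule sym)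
qed

lemma mem_Herm: "t \<in> Herm \<sigma> \<longleftrightarrow> (\<forall>i j. \<sigma> (t $ i $ j) = t $ j $ i)"
  unfolding Herm_def mem_Collect_eq by metis

lemma h_sum_left: "h (sum f A) y = (\<Sum>a\<in>A. h (f a) y)"
  by (induction A rule: infinite_finite_induct) (simp_all add: h_zero_left hermD)

lemma findim_tvs_field: "findim_tvs (\<lambda>a x. \<iota> a * x)"
proof unfold_locales
  have "continuous_on UNIV (\<lambda>p :: 'f \<times> 'k. \<iota> (fst p) * snd p)"
    by (intro continuous_on_mult' continuous_on_compose2[OF continuous_\<iota>[of UNIV]] continuous_on_fst
        continuous_on_snd continuous_on_id subset_UNIV)
  then show "continuous_on UNIV (\<lambda>(a, x). \<iota> a * x)" by (simp add: case_prod_beta)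
  obtain B where "finite B" "card B = 2" "V.independent B" "V.span B = UNIV" by (rule basis_obtain)
  then show "\<exists>T. finite T \<and> V.span T = UNIV" by blast
qed

text \<open>Restriction of scalars: products of a basis of the larger field over \<open>F\<close>
  with a basis of the space form a finite spanning set, and scaling stays continuous because
  \<open>\<iota>\<close> is.\<close>

lemma findim_tvs_space: "findim_tvs (\<lambda>a v. sV (\<iota> a) v)"
proof -
  obtain B where B: "finite_dimensional_vector_space sV B"
    using findim by (auto simp: findim_topological_vector_space_def)
  interpret K: finite_dimensional_vector_space sV B by (rule B)
  interpret F: vector_space "\<lambda>a v. sV (\<iota> a) v"
    by unfold_locales (simp_all add: K.scale_right_distrib K.scale_left_distrib add mult)
  have cont: "continuous_on UNIV (\<lambda>(a, v). sV a v)"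
    using findim by (simp add: findim_topological_vector_space_def)
  obtain E where E: "finite E" "V.span E = (UNIV :: 'k set)" by (rule basis_obtain)
  define T where "T = (\<lambda>(e, b). sV e b) ` (E \<times> B)"
  have Eb: "sV k b \<in> F.span T" if b: "b \<in> B" for k b
  proof -
    have "k \<in> V.span E" using E(2) by simp
    then show ?thesis
    proof (induction rule: V.span_induct)
      case base
      show ?case
        by (rule V.subspaceI)
          (simp_all add: K.scale_left_distrib F.span_zero F.span_add F.span_scale flip: K.scale_scale)
    next
      case (step e)
      then show ?case using b by (intro F.span_base) (auto simp: T_def)
    qed
  qed
  have KB: "\<forall>k. sV k v \<in> F.span T" for v
  proof -
    have "v \<in> K.span B" using K.span_Basis by simp
    then show ?thesis
    proof (induction rule: K.span_induct)
      case base
      show ?case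
        by (rule K.subspaceI) (auto simp: K.scale_right_distrib intro: F.span_zero F.span_add)
    next
      case (step b)
      then show ?case using Eb by blast
    qed
  qed
  show ?thesis
  proof unfold_locales
    have "continuous_on UNIV (\<lambda>p :: 'f \<times> 'v. (\<iota> (fst p), snd p))"
      by (intro continuous_on_Pair continuous_on_compose2[OF continuous_\<iota>[of UNIV]] continuous_on_fst
          continuous_on_snd continuous_on_id subset_UNIV)
    from continuous_on_compose2[OF cont this]
    show "continuous_on UNIV (\<lambda>(a, v). sV (\<iota> a) v)" by (simp add: case_prod_beta)
    have "v \<in> F.span T" for v using KB[of v] K.scale_one[of v] by metis
    moreover have "finite T" using E(1) K.finite_Basis by (simp add: T_def)
    ultimately show "\<exists>T. finite T \<and> F.span T = UNIV" by (intro exI[of _ T]) auto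
  qed
qed

lemma findim_tvs_tuple: "findim_tvs (scale_tuple \<iota> sV :: 'f \<Rightarrow> 'v ^ 'd::finite \<Rightarrow> _)"
proof -
  have "(\<lambda>a (x :: 'v ^ 'd). \<chi> i. sV (\<iota> a) (x $ i)) = scale_tuple \<iota> sV"
    by (intro ext) (simp add: scale_tuple_def)
  then show ?thesis using findim_tvs.findim_tvs_vec[OF findim_tvs_space, where 'd='d] by simp
qed

lemma findim_tvs_matrix: "findim_tvs (scale_matrix \<iota> :: 'f \<Rightarrow> 'k ^ 'd::finite ^ 'd \<Rightarrow> _)"
proof -
  have "(\<lambda>a (x :: 'k ^ 'd ^ 'd). \<chi> i. (\<chi> j. \<iota> a * (x $ i) $ j)) = scale_matrix \<iota>"
    by (intro ext) (simp add: scale_matrix_def)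
  then show ?thesis
    using findim_tvs.findim_tvs_vec[OF findim_tvs.findim_tvs_vec[OF findim_tvs_field, where 'd='d], where 'd='d] by simp
qed

lemma ftvs_tuple: "ftvs (scale_tuple \<iota> sV) (UNIV :: ('v ^ 'd::finite) set) (dim_X \<iota> sV TYPE('d))"
proof -
  interpret X: findim_tvs "scale_tuple \<iota> sV :: 'f \<Rightarrow> 'v ^ 'd \<Rightarrow> _" by (rule findim_tvs_tuple)
  show ?thesis unfolding dim_X_def by (rule X.ftvs_subspace[OF X.subspace_UNIV])
qed

lemma ftvs_Herm: "ftvs (scale_matrix \<iota>) (Herm \<sigma> :: ('k ^ 'd::finite ^ 'd) set) (dim_Y \<iota> \<sigma> TYPE('d))"
proof -
  interpret Y: findim_tvs "scale_matrix \<iota> :: 'f \<Rightarrow> 'k ^ 'd ^ 'd \<Rightarrow> _" by (rule findim_tvs_matrix)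
  have "Y.subspace (Herm \<sigma>)"
    by (rule Y.subspaceI) (simp_all add: mem_Herm scale_matrix_def \<sigma>.add \<sigma>.mult)
  then show ?thesis unfolding dim_Y_def by (rule Y.ftvs_subspace)
qed

text \<open>\<open>half\<close> replaces \<open>1/2\<close>, which need not exist.\<close>

definition polar :: "'v ^ 'd \<Rightarrow> 'v ^ 'd \<Rightarrow> 'k ^ 'd ^ 'd" where
  "polar x y = (\<chi> i j. half * h (x $ i) (y $ j) + \<sigma> (half * h (x $ j) (y $ i)))"

lemma quad_polar:
  "quad (scale_tuple \<iota> sV) (dim_X \<iota> sV TYPE('d)) (scale_matrix \<iota>) (Herm \<sigma>) (dim_Y \<iota> \<sigma> TYPE('d))
    (polar :: 'v ^ 'd::finite \<Rightarrow> _)"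
  by (intro quad.intro ftvs_tuple ftvs_Herm quad_axioms.intro)
    (simp_all add: polar_def scale_tuple_def scale_matrix_def mem_Herm vec_eq_iff hermD \<sigma>.add \<sigma>.mult algebra_simps)

lemma polar_diagonal: "polar x x = moment_matrix h x"
proof -
  have "half * z + \<sigma> half * z = z" for z using half by (simp flip: distrib_right)
  then show ?thesis by (simp add: polar_def moment_matrix_def vec_eq_iff \<sigma>.mult hermD)
qed

text \<open>The choice of \<open>half\<close> drops out on symmetrising, as it must, since the
  moment map determines its differential.\<close>

lemma polar_sym: "polar x v + polar v x = (\<chi> i j. h (x $ i) (v $ j) + h (v $ i) (x $ j))"
proof -
  have "half * a + \<sigma> half * b + (half * b + \<sigma> half * a) = (half + \<sigma> half) * (a + b)" for a b
    by (simp add: algebra_simps)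
  then show ?thesis by (simp add: polar_def vec_eq_iff \<sigma>.mult hermD half)
qed

text \<open>Solve \<open>h (v\<^sub>i, x\<^sub>j) = half * y\<^sub>i\<^sub>j\<close>.\<close>

lemma moment_submersion:
  fixes x :: "'v ^ 'd::finite"
  assumes x: "det (moment_matrix h x) \<noteq> 0" and y: "y \<in> Herm \<sigma>"
  shows "\<exists>v. polar x v + polar v x = y"
proof -
  let ?T = "moment_matrix h x"
  obtain T' where T': "T' ** ?T = mat 1"
    using x unfolding invertible_det_nz[symmetric] invertible_def by blast
  \<comment> \<open>If \<open>v\<close> consists of combinations of the entries of \<open>x\<close>
    with coefficient matrix \<open>M\<close>, then the matrix of the
    \<open>h (v $ i) (x $ j)\<close> is \<open>M ** ?T\<close>, so the inverse \<open>T'\<close>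
    gives \<open>M\<close>.\<close>
  define M where "M = (\<chi> i j. half * y $ i $ j) ** T'"
  define v where "v = (\<chi> i. \<Sum>k\<in>UNIV. sV (M $ i $ k) (x $ k))"
  have "h (v $ i) (x $ j) = half * y $ i $ j" for i j
  proof -
    have "h (v $ i) (x $ j) = (M ** ?T) $ i $ j"
      by (simp add: v_def h_sum_left hermD matrix_matrix_mult_def moment_matrix_def)
    also have "M ** ?T = (\<chi> i j. half * y $ i $ j)"
      unfolding M_def matrix_mul_assoc[symmetric] T' by (rule matrix_mul_rid)
    finally show ?thesis by simp
  qed
  note hv = this
  have "h (x $ i) (v $ j) = \<sigma> half * y $ i $ j" for i j
  proof -
    have "h (x $ i) (v $ j) = \<sigma> (h (v $ j) (x $ i))" by (simp add: hermD)
    also have "\<dots> = \<sigma> half * \<sigma> (y $ j $ i)" unfolding hv \<sigma>.mult ..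
    also have "\<sigma> (y $ j $ i) = y $ i $ j" using y by (simp add: mem_Herm)
    finally show ?thesis .
  qed
  moreover have "half * z + \<sigma> half * z = z" for z using half by (simp flip: distrib_right)
  ultimately have "polar x v + polar v x = y"
    unfolding polar_sym by (simp add: hv vec_eq_iff add.commute)
  then show ?thesis by blast
qed

lemma openin_Herm_ns: "openin (top_of_set (Herm \<sigma>)) (Herm_ns \<sigma> :: ('k ^ 'd::finite ^ 'd) set)"
  unfolding Herm_ns_def by (rule openin_Collect_neq[OF continuous_on_det])

end


section \<open>Representation densities\<close>

lemma top_form_iff:
  assumes "ftvs s W (vector_space.dim s W)"
  shows "nonzero_invariant_top_form s W \<omega> \<longleftrightarrow> ftvs.top_form s W (vector_space.dim s W) \<omega>"
  unfolding nonzero_invariant_top_form_def ftvs.top_form_def[OF assms] ..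

lemma (in ftvs) small_compact_open:
  assumes \<omega>: "top_form \<omega>" and V: "openin (top_of_set W) V" "w \<in> V"
  shows "\<exists>U q. U \<subseteq> V \<and> compact U \<and> openin (top_of_set W) U \<and> 0 < q \<and> emeasure (vol \<omega>) U = ennreal q"
proof -
  have w: "w \<in> W" using V openin_imp_subset by blast
  obtain b where b: "is_basis b" using is_basis_exists by blast
  obtain r where r: "r > 0" "lball b w r \<subseteq> V" using openin_contains_lball[OF b V] by blast
  have "modulus (\<omega> b) * ball_volume TYPE('f) r ^ n > 0"
    using modulus_pos[OF top_form_nonzero[OF \<omega> b]] ball_volume_pos[OF r(1), where 'f='f] by simp
  then show ?thesis
    using r(2) compact_lball openin_lball[OF b w r(1)] vol_lball[OF \<omega> b w r(1)] by blast
qed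

context hermitian_setting
begin

abbreviation MX :: "((nat \<Rightarrow> 'v ^ 'd::finite) \<Rightarrow> 'f) \<Rightarrow> ('v ^ 'd) measure" where
  "MX \<omega> \<equiv> form_measure (scale_tuple \<iota> sV) UNIV (dim_X \<iota> sV TYPE('d)) (\<lambda>_. \<omega>)"

abbreviation MY :: "((nat \<Rightarrow> 'k ^ 'd::finite ^ 'd) \<Rightarrow> 'f) \<Rightarrow> ('k ^ 'd ^ 'd) measure" where
  "MY \<omega> \<equiv> form_measure (scale_matrix \<iota>) (Herm \<sigma>) (dim_Y \<iota> \<sigma> TYPE('d)) (\<lambda>_. \<omega>)"

context
  fixes \<omega>X :: "(nat \<Rightarrow> 'v ^ 'd::finite) \<Rightarrow> 'f" and \<omega>Y :: "(nat \<Rightarrow> 'k ^ 'd ^ 'd) \<Rightarrow> 'f"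
  assumes \<omega>X: "nonzero_invariant_top_form (scale_tuple \<iota> sV) UNIV \<omega>X"
    and \<omega>Y: "nonzero_invariant_top_form (scale_matrix \<iota>) (Herm \<sigma>) \<omega>Y"
begin

interpretation Q: quad "scale_tuple \<iota> sV" "dim_X \<iota> sV TYPE('d)" "scale_matrix \<iota>" "Herm \<sigma>"
  "dim_Y \<iota> \<sigma> TYPE('d)" "polar :: 'v ^ 'd \<Rightarrow> _"
  by (rule quad_polar)

lemma top_forms: "Q.X.top_form \<omega>X" "Q.Y.top_form \<omega>Y"
  using \<omega>X \<omega>Y top_form_iff[of "scale_tuple \<iota> sV" "UNIV :: ('v ^ 'd) set"]
    top_form_iff[of "scale_matrix \<iota>" "Herm \<sigma> :: ('k ^ 'd ^ 'd) set"]
    ftvs_tuple[where 'd='d] ftvs_Herm[where 'd='d]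
  by (simp_all add: dim_X_def dim_Y_def)

lemma MX_eq: "MX \<omega>X = Q.X.vol \<omega>X" by (rule Q.X.form_measure_vol[OF top_forms(1)])

lemma MY_eq: "MY \<omega>Y = Q.Y.vol \<omega>Y" by (rule Q.Y.form_measure_vol[OF top_forms(2)])

lemma haar_MX: "haar_measure_on (UNIV :: ('v ^ 'd) set) \<mu> \<Longrightarrow> \<exists>\<kappa>>0. \<mu> = scale_measure (ennreal \<kappa>) (MX \<omega>X)"
  unfolding MX_eq by (rule Q.X.haar_eq_scale_vol[OF _ top_forms(1)])

lemma haar_MY: "haar_measure_on (Herm \<sigma> :: ('k ^ 'd ^ 'd) set) \<nu> \<Longrightarrow> \<exists>\<kappa>>0. \<nu> = scale_measure (ennreal \<kappa>) (MY \<omega>Y)"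
  unfolding MY_eq by (rule Q.Y.haar_eq_scale_vol[OF _ top_forms(2)])

text \<open>The abstract fibre formula for \<open>polar\<close>, whose diagonal is the moment map.
  Nonsingularity of \<open>T\<close> makes the differential surjective at every point of the fibre,
  as the moment matrix there is \<open>T\<close>.\<close>

lemma fibre_density:
  fixes T :: "'k ^ 'd ^ 'd" and C :: "('v ^ 'd) set"
  assumes T: "T \<in> Herm_ns \<sigma>" and C: "compact C" "open C"
  shows "\<exists>c V. 0 \<le> c \<and> emeasure (fibre_measure \<iota> \<sigma> sV h \<omega>X \<omega>Y T) (C \<inter> fibre h T) = ennreal c \<and>
    openin (top_of_set (Herm \<sigma>)) V \<and> T \<in> V \<and>
    (\<forall>U. U \<subseteq> V \<and> compact U \<and> openin (top_of_set (Herm \<sigma>)) U \<longrightarrow>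
      emeasure (MX \<omega>X) {x \<in> C. moment_matrix h x \<in> U} = ennreal c * emeasure (MY \<omega>Y) U)"
proof -
  have \<tau>: "Q.\<tau> = moment_matrix h" by (rule ext) (simp add: Q.\<tau>_def polar_diagonal)
  have d\<tau>: "Q.d\<tau> x v = deriv_moment \<iota> sV h x v" for x v
    unfolding deriv_moment_def Q.deriv_\<tau>[symmetric] \<tau> ..
  interpret F: quad_fibre "scale_tuple \<iota> sV" "dim_X \<iota> sV TYPE('d)" "scale_matrix \<iota>" "Herm \<sigma>"
    "dim_Y \<iota> \<sigma> TYPE('d)" "polar :: 'v ^ 'd \<Rightarrow> _" T \<omega>X \<omega>Y
  proof unfold_locales
    show "T \<in> Herm \<sigma>" using T by (simp add: Herm_ns_def)
    show "\<exists>v. Q.d\<tau> x v = y" if "Q.\<tau> x = T" "y \<in> Herm \<sigma>" for x y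
      using moment_submersion[of x y] that T unfolding Q.d\<tau>_def \<tau> by (simp add: Herm_ns_def)
  qed (rule top_forms)+
  have rel: "F.rel = relative_form \<iota> \<sigma> sV h \<omega>X \<omega>Y"
    by (intro ext) (simp add: F.rel_def relative_form_def Let_def d\<tau>)
  have XT: "{x. Q.\<tau> x = T} = fibre h T" by (simp add: fibre_def \<tau>)
  have pre: "C \<inter> Q.\<tau> -` U = {x \<in> C. moment_matrix h x \<in> U}" for U by (auto simp: \<tau>)
  show ?thesis
    using F.fibre_formula[OF C] unfolding rel XT pre fibre_measure_def MX_eq MY_eq .
qed

lemma MY_small_compact_open:
  "openin (top_of_set (Herm \<sigma>)) V \<Longrightarrow> T \<in> V \<Longrightarrow>
    \<exists>U q. U \<subseteq> V \<and> compact U \<and> openin (top_of_set (Herm \<sigma>)) U \<and> 0 < q \<and> emeasure (MY \<omega>Y) U = ennreal q"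
  unfolding MY_eq by (rule Q.Y.small_compact_open[OF top_forms(2)])

text \<open>The constant belonging to \<open>T\<close> describes the tubes over every compact open
  subset of \<open>V\<close>. A small one around \<open>T'\<close> lies in the neighbourhoods
  attached to both matrices and has positive volume, so the two constants agree.\<close>

lemma Den_locally_constant:
  fixes C :: "('v ^ 'd) set"
  assumes C: "compact C" "open C" and T: "T \<in> Herm_ns \<sigma>"
  shows "\<exists>U. openin (top_of_set (Herm_ns \<sigma>)) U \<and> T \<in> U \<and>
    (\<forall>T' \<in> U. Den \<iota> \<sigma> sV h \<omega>X \<omega>Y T' C = Den \<iota> \<sigma> sV h \<omega>X \<omega>Y T C)"
proof -
  obtain c V where V: "0 \<le> c" "emeasure (fibre_measure \<iota> \<sigma> sV h \<omega>X \<omega>Y T) (C \<inter> fibre h T) = ennreal c"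
    "openin (top_of_set (Herm \<sigma>)) V" "T \<in> V"
    "\<forall>U. U \<subseteq> V \<and> compact U \<and> openin (top_of_set (Herm \<sigma>)) U \<longrightarrow>
      emeasure (MX \<omega>X) {x \<in> C. moment_matrix h x \<in> U} = ennreal c * emeasure (MY \<omega>Y) U"
    using fibre_density[OF T C] by (elim exE conjE)
  show ?thesis
  proof (intro exI conjI ballI)
    show "openin (top_of_set (Herm_ns \<sigma>)) (V \<inter> Herm_ns \<sigma>)"
      using V(3) openin_Herm_ns openin_subset_trans[OF openin_Int[OF V(3) openin_Herm_ns]]
      by (simp add: Herm_ns_def Collect_mono_iff subset_iff)
    show "T \<in> V \<inter> Herm_ns \<sigma>" using V(4) T by simp
    fix T' assume "T' \<in> V \<inter> Herm_ns \<sigma>"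
    then have T': "T' \<in> V" "T' \<in> Herm_ns \<sigma>" by auto
    obtain c' V' where V': "0 \<le> c'" "emeasure (fibre_measure \<iota> \<sigma> sV h \<omega>X \<omega>Y T') (C \<inter> fibre h T') = ennreal c'"
      "openin (top_of_set (Herm \<sigma>)) V'" "T' \<in> V'"
      "\<forall>U. U \<subseteq> V' \<and> compact U \<and> openin (top_of_set (Herm \<sigma>)) U \<longrightarrow>
        emeasure (MX \<omega>X) {x \<in> C. moment_matrix h x \<in> U} = ennreal c' * emeasure (MY \<omega>Y) U"
      using fibre_density[OF T'(2) C] by (elim exE conjE)
    obtain U q where U: "U \<subseteq> V \<inter> V'" "compact U" "openin (top_of_set (Herm \<sigma>)) U" "0 < q" "emeasure (MY \<omega>Y) U = ennreal q"
      using MY_small_compact_open[OF openin_Int[OF V(3) V'(3)] IntI[OF T'(1) V'(4)]] by (elim exE conjE)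
    have "ennreal c * ennreal q = ennreal c' * ennreal q"
      using V(5)[rule_format, of U] V'(5)[rule_format, of U] U by simp
    then have "c * q = c' * q" using V(1) V'(1) U(4) by (simp flip: ennreal_mult)
    then have "c = c'" using U(4) by simp
    then show "Den \<iota> \<sigma> sV h \<omega>X \<omega>Y T' C = Den \<iota> \<sigma> sV h \<omega>X \<omega>Y T C"
      using V(2) V'(2) by (simp add: Den_def measure_def)
  qed
qed

text \<open>Each Haar measure is a constant multiple of the measure of the corresponding form, and
  it occurs once in a numerator and once in a denominator.\<close>

lemma Den_formula:
  fixes C :: "('v ^ 'd) set"
  assumes C: "compact C" "open C" and T: "T \<in> Herm_ns \<sigma>"
  shows "\<exists>U\<^sub>0. openin (top_of_set (Herm_ns \<sigma>)) U\<^sub>0 \<and> T \<in> U\<^sub>0 \<and>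
    (\<forall>U. U \<subseteq> U\<^sub>0 \<and> T \<in> U \<and> compact U \<and> openin (top_of_set (Herm_ns \<sigma>)) U \<longrightarrow>
      (\<forall>\<mu> \<nu>. haar_measure_on (UNIV :: ('v ^ 'd) set) \<mu> \<and> haar_measure_on (Herm \<sigma> :: ('k ^ 'd ^ 'd) set) \<nu> \<longrightarrow>
        Den \<iota> \<sigma> sV h \<omega>X \<omega>Y T C =
          measure \<mu> {x \<in> C. moment_matrix h x \<in> U} / measure \<mu> C *
          (measure \<nu> (Herm_dual \<iota> \<sigma>) / measure \<nu> U)))"
proof -
  obtain c V where V: "0 \<le> c" "emeasure (fibre_measure \<iota> \<sigma> sV h \<omega>X \<omega>Y T) (C \<inter> fibre h T) = ennreal c"
    "openin (top_of_set (Herm \<sigma>)) V" "T \<in> V"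
    "\<forall>U. U \<subseteq> V \<and> compact U \<and> openin (top_of_set (Herm \<sigma>)) U \<longrightarrow>
      emeasure (MX \<omega>X) {x \<in> C. moment_matrix h x \<in> U} = ennreal c * emeasure (MY \<omega>Y) U"
    using fibre_density[OF T C] by (elim exE conjE)
  show ?thesis
  proof (intro exI conjI allI impI)
    show "openin (top_of_set (Herm_ns \<sigma>)) (V \<inter> Herm_ns \<sigma>)"
      using V(3) openin_Herm_ns openin_subset_trans[OF openin_Int[OF V(3) openin_Herm_ns]]
      by (simp add: Herm_ns_def Collect_mono_iff subset_iff)
    show "T \<in> V \<inter> Herm_ns \<sigma>" using V(4) T by simp
    fix U \<mu> \<nu>
    assume "U \<subseteq> V \<inter> Herm_ns \<sigma> \<and> T \<in> U \<and> compact U \<and> openin (top_of_set (Herm_ns \<sigma>)) U"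
    then have U: "U \<subseteq> V" "T \<in> U" "compact U" "openin (top_of_set (Herm \<sigma>)) U"
      using openin_trans[OF _ openin_Herm_ns, of U] by auto
    assume "haar_measure_on (UNIV :: ('v ^ 'd) set) \<mu> \<and> haar_measure_on (Herm \<sigma> :: ('k ^ 'd ^ 'd) set) \<nu>"
    then have \<mu>: "haar_measure_on (UNIV :: ('v ^ 'd) set) \<mu>"
      and \<nu>: "haar_measure_on (Herm \<sigma> :: ('k ^ 'd ^ 'd) set) \<nu>" by auto
    obtain \<kappa> where \<kappa>: "\<kappa> > 0" "\<mu> = scale_measure (ennreal \<kappa>) (MX \<omega>X)" using haar_MX[OF \<mu>] by (elim exE conjE)
    obtain \<eta> where \<eta>: "\<eta> > 0" "\<nu> = scale_measure (ennreal \<eta>) (MY \<omega>Y)" using haar_MY[OF \<nu>] by (elim exE conjE)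
    have m\<mu>: "measure \<mu> A = \<kappa> * measure (MX \<omega>X) A" for A unfolding \<kappa>(2) using \<kappa>(1) by simp
    have m\<nu>: "measure \<nu> A = \<eta> * measure (MY \<omega>Y) A" for A unfolding \<eta>(2) using \<eta>(1) by simp
    have "0 < emeasure \<nu> U" "emeasure \<nu> U < \<infinity>"
      using \<nu> U openin_imp_subset[OF U(4)] unfolding haar_measure_on_def by auto
    \<comment> \<open>\<open>measure\<close> is 0 also on sets of infinite measure, so finiteness
      and positivity both enter.\<close>
    then have "measure \<nu> U \<noteq> 0" by (auto simp: measure_def enn2real_eq_0_iff)
    then have Y0: "measure (MY \<omega>Y) U \<noteq> 0" using m\<nu>[of U] by simp
    have "emeasure (MX \<omega>X) {x \<in> C. moment_matrix h x \<in> U} = ennreal c * emeasure (MY \<omega>Y) U"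
      using V(5) U by blast
    then have q: "measure (MX \<omega>X) {x \<in> C. moment_matrix h x \<in> U} = c * measure (MY \<omega>Y) U"
      using V(1) by (simp add: measure_def enn2real_mult)
    have "measure (fibre_measure \<iota> \<sigma> sV h \<omega>X \<omega>Y T) (C \<inter> fibre h T) = c"
      using V(1,2) by (simp add: measure_def)
    then have "Den \<iota> \<sigma> sV h \<omega>X \<omega>Y T C = c * (measure (MY \<omega>Y) (Herm_dual \<iota> \<sigma>) / measure (MX \<omega>X) C)"
      by (simp add: Den_def)
    also have "\<dots> = measure \<mu> {x \<in> C. moment_matrix h x \<in> U} / measure \<mu> C *
          (measure \<nu> (Herm_dual \<iota> \<sigma>) / measure \<nu> U)"
      unfolding m\<mu> m\<nu> q using \<kappa>(1) \<eta>(1) Y0 by simp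
    finally show "Den \<iota> \<sigma> sV h \<omega>X \<omega>Y T C = measure \<mu> {x \<in> C. moment_matrix h x \<in> U} / measure \<mu> C *
          (measure \<nu> (Herm_dual \<iota> \<sigma>) / measure \<nu> U)" .
  qed
qed

end

end

theorem proposition2p2p5:
  fixes \<iota> :: "'f::nonarch_local_field \<Rightarrow> 'k::nonarch_local_field"
    and \<sigma> :: "'k \<Rightarrow> 'k"
    and sV :: "'k \<Rightarrow> 'v::{topological_ab_group_add,t2_space} \<Rightarrow> 'v"
    and h :: "'v \<Rightarrow> 'v \<Rightarrow> 'k"
    and C :: "('v^'d::finite) set"
    and \<mu>X :: "(nat \<Rightarrow> 'v^'d) \<Rightarrow> 'f"
    and \<mu>Y :: "(nat \<Rightarrow> 'k^'d^'d) \<Rightarrow> 'f"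
  assumes "separable_quadratic_extension \<iota>"
    and "galois_group \<iota> = range (\<lambda>n::nat. \<sigma> ^^ n)"
    and "findim_topological_vector_space sV"
    and "hermitian_form sV \<sigma> h"
    and "nondegenerate_form h"
    and "C \<noteq> {}" and "compact C" and "open C"
    and "nonzero_invariant_top_form (scale_tuple \<iota> sV) UNIV \<mu>X"
    and "nonzero_invariant_top_form (scale_matrix \<iota>) (Herm \<sigma>) \<mu>Y"
  shows "(\<forall>T \<in> Herm_ns \<sigma>. \<exists>U. openin (top_of_set (Herm_ns \<sigma>)) U \<and> T \<in> U \<and>
            (\<forall>T' \<in> U. Den \<iota> \<sigma> sV h \<mu>X \<mu>Y T' C = Den \<iota> \<sigma> sV h \<mu>X \<mu>Y T C)) \<and>
         (\<forall>T \<in> Herm_ns \<sigma>. \<exists>U\<^sub>0. openin (top_of_set (Herm_ns \<sigma>)) U\<^sub>0 \<and> T \<in> U\<^sub>0 \<and>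
            (\<forall>U. U \<subseteq> U\<^sub>0 \<and> T \<in> U \<and> compact U \<and> openin (top_of_set (Herm_ns \<sigma>)) U \<longrightarrow>
              (\<forall>\<mu> \<nu>. haar_measure_on (UNIV :: ('v^'d) set) \<mu> \<and>
                     haar_measure_on (Herm \<sigma> :: ('k^'d^'d) set) \<nu> \<longrightarrow>
                Den \<iota> \<sigma> sV h \<mu>X \<mu>Y T C =
                  measure \<mu> {x \<in> C. moment_matrix h x \<in> U} / measure \<mu> C *
                  (measure \<nu> (Herm_dual \<iota> \<sigma>) / measure \<nu> U))))"
proof -
  interpret hermitian_setting \<iota> \<sigma> sV h using assms(1-4) by unfold_locales
  show ?thesis
    using Den_locally_constant[OF assms(9,10,7,8)] Den_formula[OF assms(9,10,7,8)] by (intro conjI ballI)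
qed

end
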